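(* Let $A=(a_{ij})_{1\le i,j\le n}$ satisfy $a_{ij}=a_{ji}\ge 0$ for $1\le i,j\le n$, and suppose that there exists a positive vector solution $\vec u=(c_1,\dots,c_n)U=\vec c\,U\in\mathbb{R}^nU$ of the system $-\Delta u_i+\lambda u_i=\sum_{j=1}^n a_{ij}u_iu_j^2$ in $\Omega$, $u_i\in H$, $1\le i\le n$. Then the following hold. (i) The Morse index of $\vec u$ equals the number of positive eigenvalues $\lambda_1\ge\cdots\ge\lambda_k>0$ of $A$, counted with multiplicity. Moreover, a maximal negative space $W$ of $I''(\vec u)$, i.e. one satisfying $I''(\vec u)(\vec\phi,\vec\phi)<0$ for $\vec\phi\in W\setminus\{0\}$, is given by the linear span of $\{(\vec\gamma\oslash\vec c)U \mid A\vec\gamma=\lambda_i\vec\gamma,\ i=1,\dots,k\}$. (ii) If $U$ is nondegenerate in $H$ and $\det(A)=0$, the linearized kernel of the system at $\vec u$ is $\{(\vec\gamma\oslash\vec c)U\mid A\vec\gamma=0\}$. In this case, for $K=\{\vec\gamma=(\gamma_1,\dots,\gamma_n)\in\mathbb{R}^n\mid A\vec\gamma=0\}$, the set $$L=\{(d_1,\dots,d_n)\mid (d_1,\dots,d_n)U\in\mathbb{R}^nU \text{ is a positive vector solution of the system}\}$$ satisfies $$L=\big\{\big((c_1^2+\gamma_1)^{1/2},\dots,(c_n^2+\gamma_n)^{1/2}\big)\ \big|\ \vec\gamma\in K,\ c_i^2+\gamma_i>0,\ i=1,\dots,n\big\},$$ and $L$ is a connected smooth $\dim(K)$-dimensional manifold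 in $S^+_{c_1^2+\cdots+c_n^2}$ with $I(\vec u)=I((d_1,\dots,d_n)U)$ for all $(d_1,\dots,d_n)\in L$, and $\partial L\subset\partial S^+_{c_1^2+\cdots+c_n^2}$. (iii) If $U$ is degenerate in $H$ and $\det(A)\ne0$, the linearized kernel of the system at $\vec u$ contains $\{(c_1,\dots,c_n)\psi\mid \Delta\psi-\lambda\psi+3U^2\psi=0,\ \psi\in H\}$. Moreover, if $U$ is degenerate in $H$, $\det(A)\neq0$ and $a_{ij}>0$ for all $1\le i,j\le n$, the linearized kernel of the system at $\vec u$ is spanned by $\{(c_1,\dots,c_n)\psi\mid \Delta\psi-\lambda\psi+3U^2\psi=0,\ \psi\in H\}$. (iv) The vector solution $\vec u$ is nondegenerate in $\mathbf{H}$ if and only if $U$ is nondegenerate in $H$ and $\det(A)\neq0$.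
   Context: $\Omega\subset\mathbb{R}^N$ is a domain, $N\le 3$, $\lambda>0$. $H=H^1_0(\Omega)$, except that if $\Omega=\mathbb{R}^N$ then $H$ is the subspace of radially symmetric functions in $H^1(\mathbb{R}^N)$; $\mathbf{H}=H^n$. $U\in H$ is a least energy positive solution of the scalar equation $\Delta u-\lambda u+u^3=0$ in $\Omega$, $u=0$ on $\partial\Omega$ (so $U$ has Morse index $1$). $U$ is nondegenerate in $H$ if $\psi=0$ is the only $\psi\in H$ with $\Delta\psi-\lambda\psi+3U^2\psi=0$; otherwise it is degenerate. $\mathbb{R}^nU=\{\vec cU\mid \vec c\in\mathbb{R}^n\}\subset\mathbf{H}$. The energy functional is $I(\vec u)=\frac12\sum_{i=1}^n\int_\Omega(|\nabla u_i|^2+\lambda u_i^2)\,dx-\frac14\int_\Omega\sum_{i,j=1}^na_{ij}u_i^2u_j^2\,dx$ on $\mathbf{H}$. A positive vector solution is a solution with $u_i>0$ in $\Omega$ for every $i$. The Morse index of a solution $\vec u$ is the maximal dimension of a subspace $W\subset\mathbf{H}$ with $I''(\vec u)(\vec\phi,\vec\phi)<0$ for all $\vec\phi\in W\setminus\{0\}$. The linearized kernel of the system at $\vec u$ is $\{\vec\varphi\in\mathbf{H}\mid I''(\vec u)(\vec\varphi,\vec\psi)=0\ \forall\vec\psi\in\mathbf{H}\}$; $\vec u$ is nondegenerate in $\mathbf{H}$ if this kernel is $\{0\}$. $\vec a\oslash\vec b=(a_1/b_1,\dots,a_n/b_n)$ is the Hadamard division. For $r>0$, $S_r^+=\{(c_1,\dots,c_n)\in\mathbb{R}^n\mid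 c_1^2+\cdots+c_n^2=r,\ c_i>0,\ i=1,\dots,n\}$. For $X=L$ or $X=S_r^+$, $\partial X$ denotes the closure of $X$ in $\mathbb{R}^n$ minus $X$. *)

theory Defs
  imports "HOL-Analysis.Analysis" "HOL-Library.Extended_Nat"
begin

section \<open>Real functions modulo equality almost everywhere\<close>

definition ae_equal :: "('a::euclidean_space \<Rightarrow> real) \<Rightarrow> ('a \<Rightarrow> real) \<Rightarrow> bool" where
  "ae_equal f g \<longleftrightarrow> f \<in> borel_measurable lebesgue \<and> g \<in> borel_measurable lebesgue
     \<and> (AE x in lebesgue. f x = g x)"

lemma part_equivp_ae_equal: "part_equivp ae_equal"
proof (rule part_equivpI)
  show "\<exists>f. ae_equal f f"
    by (rule exI[of _ "\<lambda>_. 0"]) (simp add: ae_equal_def)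
  show "symp ae_equal"
    by (auto simp: symp_def ae_equal_def)
  show "transp ae_equal"
    unfolding transp_def ae_equal_def by (auto elim: AE_mp)
qed

quotient_type (overloaded) 'a ae_fun = "'a::euclidean_space \<Rightarrow> real" / partial: ae_equal
  by (rule part_equivp_ae_equal)

instantiation ae_fun :: (euclidean_space) real_vector
begin

lift_definition zero_ae_fun :: "'a ae_fun" is "\<lambda>_. 0"
  by (simp add: ae_equal_def)

lift_definition plus_ae_fun :: "'a ae_fun \<Rightarrow> 'a ae_fun \<Rightarrow> 'a ae_fun" is "\<lambda>f g x. f x + g x"
  unfolding ae_equal_def by (auto elim: AE_mp)

lift_definition minus_ae_fun :: "'a ae_fun \<Rightarrow> 'a ae_fun \<Rightarrow> 'a ae_fun" is "\<lambda>f g x. f x - g x"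
  unfolding ae_equal_def by (auto elim: AE_mp)

lift_definition uminus_ae_fun :: "'a ae_fun \<Rightarrow> 'a ae_fun" is "\<lambda>f x. - f x"
  unfolding ae_equal_def by (auto elim: AE_mp)

lift_definition scaleR_ae_fun :: "real \<Rightarrow> 'a ae_fun \<Rightarrow> 'a ae_fun" is "\<lambda>r f x. r * f x"
  unfolding ae_equal_def by (auto elim: AE_mp)

instance
  by standard (transfer; auto simp: ae_equal_def algebra_simps)+

end


section \<open>Smooth functions and embedded submanifolds\<close>

text \<open>Intended for open \<open>S\<close>.\<close>

primrec k_smooth_on ::
    "nat \<Rightarrow> 'a::real_normed_vector set \<Rightarrow> ('a \<Rightarrow> 'b::real_normed_vector) \<Rightarrow> bool" where
  "k_smooth_on 0 S f \<longleftrightarrow> continuous_on S f"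
| "k_smooth_on (Suc k) S f \<longleftrightarrow>
     (\<forall>x\<in>S. f differentiable (at x)) \<and>
     (\<forall>v. k_smooth_on k S (\<lambda>x. frechet_derivative f (at x) v))"

definition smooth_on ::
    "'a::real_normed_vector set \<Rightarrow> ('a \<Rightarrow> 'b::real_normed_vector) \<Rightarrow> bool" where
  "smooth_on S f \<longleftrightarrow> (\<forall>k. k_smooth_on k S f)"

text \<open>Near each of its points, \<open>M\<close> is straightened by an ambient diffeomorphism to an open
  piece of an \<open>m\<close>-dimensional linear subspace.\<close>

definition smooth_submanifold :: "nat \<Rightarrow> 'a::euclidean_space set \<Rightarrow> bool" where
  "smooth_submanifold m M \<longleftrightarrow>
     (\<forall>p\<in>M. \<exists>V W \<Phi> \<Psi> E. p \<in> V \<and> open V \<and> open (W :: 'a set) \<and> homeomorphism V W \<Phi> \<Psi>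
        \<and> smooth_on V \<Phi> \<and> smooth_on W \<Psi>
        \<and> subspace E \<and> dim E = m \<and> \<Phi> ` (M \<inter> V) = E \<inter> W)"


section \<open>Sobolev spaces\<close>

definition domain :: "'a::euclidean_space set \<Rightarrow> bool" where
  "domain \<Omega> \<longleftrightarrow> open \<Omega> \<and> connected \<Omega> \<and> \<Omega> \<noteq> {}"

definition gradient :: "('a::euclidean_space \<Rightarrow> real) \<Rightarrow> 'a \<Rightarrow> 'a" where
  "gradient f x = (THE D. GDERIV f x :> D)"

definition test_function :: "'a::euclidean_space set \<Rightarrow> ('a \<Rightarrow> real) \<Rightarrow> bool" where
  "test_function \<Omega> \<eta> \<longleftrightarrow>
     smooth_on UNIV \<eta> \<and> (\<exists>C. compact C \<and> C \<subseteq> \<Omega> \<and> (\<forall>x. x \<notin> C \<longrightarrow> \<eta> x = 0))"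

definition L2_on :: "'a::euclidean_space set \<Rightarrow> ('a \<Rightarrow> 'b::euclidean_space) \<Rightarrow> bool" where
  "L2_on \<Omega> f \<longleftrightarrow>
     f \<in> borel_measurable (lebesgue_on \<Omega>) \<and> integrable (lebesgue_on \<Omega>) (\<lambda>x. (norm (f x))\<^sup>2)"

definition is_weak_gradient :: "'a::euclidean_space set \<Rightarrow> 'a ae_fun \<Rightarrow> ('a \<Rightarrow> 'a) \<Rightarrow> bool" where
  "is_weak_gradient \<Omega> u g \<longleftrightarrow> L2_on \<Omega> g \<and>
     (\<forall>\<eta>. test_function \<Omega> \<eta> \<longrightarrow>
        (LINT x|lebesgue_on \<Omega>. rep_ae_fun u x *\<^sub>R gradient \<eta> x)
          = - (LINT x|lebesgue_on \<Omega>. \<eta> x *\<^sub>R g x))"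

text \<open>Determined up to a null set of \<open>\<Omega>\<close>; only used under integrals over \<open>\<Omega>\<close>.\<close>

definition weak_gradient :: "'a::euclidean_space set \<Rightarrow> 'a ae_fun \<Rightarrow> 'a \<Rightarrow> 'a" where
  "weak_gradient \<Omega> u = (SOME g. is_weak_gradient \<Omega> u g)"

text \<open>A class of functions on \<open>\<Omega>\<close> is represented by its extension by zero outside \<open>\<Omega>\<close>, so
  that equality in the type \<open>ae_fun\<close> is equality almost everywhere on \<open>\<Omega>\<close>. The gradient is
  nevertheless the weak gradient in \<open>\<Omega>\<close>.\<close>

definition H1 :: "'a::euclidean_space set \<Rightarrow> 'a ae_fun set" where
  "H1 \<Omega> = {u. (AE x in lebesgue. x \<notin> \<Omega> \<longrightarrow> rep_ae_fun u x = 0)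
               \<and> L2_on \<Omega> (rep_ae_fun u) \<and> (\<exists>g. is_weak_gradient \<Omega> u g)}"

definition H10 :: "'a::euclidean_space set \<Rightarrow> 'a ae_fun set" where
  "H10 \<Omega> = {u \<in> H1 \<Omega>. \<exists>\<eta> :: nat \<Rightarrow> 'a \<Rightarrow> real. (\<forall>k. test_function \<Omega> (\<eta> k)) \<and>
     (\<lambda>k. LINT x|lebesgue_on \<Omega>. (rep_ae_fun u x - \<eta> k x)\<^sup>2
             + (norm (weak_gradient \<Omega> u x - gradient (\<eta> k) x))\<^sup>2) \<longlonglongrightarrow> 0}"

definition radially_symmetric :: "'a::euclidean_space ae_fun \<Rightarrow> bool" where
  "radially_symmetric u \<longleftrightarrow>
     (\<forall>T. orthogonal_transformation T \<longrightarrow>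
        (AE x in lebesgue. rep_ae_fun u (T x) = rep_ae_fun u x))"

definition H_space :: "'a::euclidean_space set \<Rightarrow> 'a ae_fun set" where
  "H_space \<Omega> = (if \<Omega> = UNIV then {u \<in> H1 UNIV. radially_symmetric u} else H10 \<Omega>)"

definition H_vec :: "'a::euclidean_space set \<Rightarrow> ('a ae_fun ^ 'n) set" where
  "H_vec \<Omega> = {u. \<forall>i. u $ i \<in> H_space \<Omega>}"


section \<open>Second variation, Morse index, nondegeneracy\<close>

text \<open>\<open>F''(u)(\<phi>,\<psi>)\<close> as the iterated directional derivative.\<close>

definition second_variation :: "('v::real_vector \<Rightarrow> real) \<Rightarrow> 'v \<Rightarrow> 'v \<Rightarrow> 'v \<Rightarrow> real" where
  "second_variation F u \<phi> \<psi> = deriv (\<lambda>s. deriv (\<lambda>t. F (u + s *\<^sub>R \<phi> + t *\<^sub>R \<psi>)) 0) 0"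

definition negative_space :: "('v::real_vector \<Rightarrow> real) \<Rightarrow> 'v set \<Rightarrow> 'v \<Rightarrow> 'v set \<Rightarrow> bool" where
  "negative_space F H u W \<longleftrightarrow>
     subspace W \<and> W \<subseteq> H \<and> (\<forall>\<phi>\<in>W - {0}. second_variation F u \<phi> \<phi> < 0)"

text \<open>Maximal dimension of a negative space, \<open>\<infinity>\<close> if unbounded. Subspaces are given by bases
  because \<open>dim\<close> is \<open>0\<close> on infinite-dimensional ones; restricting to finite-dimensional ones
  does not affect the supremum.\<close>

definition morse_index :: "('v::real_vector \<Rightarrow> real) \<Rightarrow> 'v set \<Rightarrow> 'v \<Rightarrow> enat" where
  "morse_index F H u =
     Sup {enat (card B) | B. finite B \<and> independent B \<and> negative_space F H u (span B)}"

definition maximal_negative_space ::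
    "('v::real_vector \<Rightarrow> real) \<Rightarrow> 'v set \<Rightarrow> 'v \<Rightarrow> 'v set \<Rightarrow> bool" where
  "maximal_negative_space F H u W \<longleftrightarrow>
     negative_space F H u W \<and> (\<forall>W'. negative_space F H u W' \<and> W \<subseteq> W' \<longrightarrow> W' = W)"

definition linearized_kernel :: "('v::real_vector \<Rightarrow> real) \<Rightarrow> 'v set \<Rightarrow> 'v \<Rightarrow> 'v set" where
  "linearized_kernel F H u = {\<phi> \<in> H. \<forall>\<psi>\<in>H. second_variation F u \<phi> \<psi> = 0}"


section \<open>The scalar equation\<close>

text \<open>\<open>- \<Delta>u + lam u = f\<close> in \<open>\<Omega>\<close>, in the sense of distributions.\<close>

definition weakly_solves ::
    "'a::euclidean_space set \<Rightarrow> real \<Rightarrow> 'a ae_fun \<Rightarrow> ('a \<Rightarrow> real) \<Rightarrow> bool" where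
  "weakly_solves \<Omega> lam u f \<longleftrightarrow>
     (\<forall>\<eta>. test_function \<Omega> \<eta> \<longrightarrow>
        (LINT x|lebesgue_on \<Omega>. weak_gradient \<Omega> u x \<bullet> gradient \<eta> x + lam * rep_ae_fun u x * \<eta> x)
          = (LINT x|lebesgue_on \<Omega>. f x * \<eta> x))"

definition positive_on :: "'a::euclidean_space set \<Rightarrow> 'a ae_fun \<Rightarrow> bool" where
  "positive_on \<Omega> u \<longleftrightarrow> (AE x in lebesgue_on \<Omega>. rep_ae_fun u x > 0)"

definition scalar_energy :: "'a::euclidean_space set \<Rightarrow> real \<Rightarrow> 'a ae_fun \<Rightarrow> real" where
  "scalar_energy \<Omega> lam u =
     1/2 * (LINT x|lebesgue_on \<Omega>. (norm (weak_gradient \<Omega> u x))\<^sup>2 + lam * (rep_ae_fun u x)\<^sup>2)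
     - 1/4 * (LINT x|lebesgue_on \<Omega>. (rep_ae_fun u x)^4)"

definition positive_scalar_solution ::
    "'a::euclidean_space set \<Rightarrow> real \<Rightarrow> 'a ae_fun \<Rightarrow> bool" where
  "positive_scalar_solution \<Omega> lam u \<longleftrightarrow>
     u \<in> H_space \<Omega> \<and> weakly_solves \<Omega> lam u (\<lambda>x. (rep_ae_fun u x)^3) \<and> positive_on \<Omega> u"

definition least_energy_positive_solution ::
    "'a::euclidean_space set \<Rightarrow> real \<Rightarrow> 'a ae_fun \<Rightarrow> bool" where
  "least_energy_positive_solution \<Omega> lam U \<longleftrightarrow>
     positive_scalar_solution \<Omega> lam U \<and>
     (\<forall>V. positive_scalar_solution \<Omega> lam V \<longrightarrow> scalar_energy \<Omega> lam U \<le> scalar_energy \<Omega> lam V)"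

text \<open>The solutions \<open>\<psi> \<in> H\<close> of \<open>\<Delta>\<psi> - lam \<psi> + 3 U\<^sup>2 \<psi> = 0\<close>.\<close>

definition scalar_linearized_solutions ::
    "'a::euclidean_space set \<Rightarrow> real \<Rightarrow> 'a ae_fun \<Rightarrow> 'a ae_fun set" where
  "scalar_linearized_solutions \<Omega> lam U =
     {\<psi> \<in> H_space \<Omega>. weakly_solves \<Omega> lam \<psi> (\<lambda>x. 3 * (rep_ae_fun U x)\<^sup>2 * rep_ae_fun \<psi> x)}"

definition scalar_nondegenerate ::
    "'a::euclidean_space set \<Rightarrow> real \<Rightarrow> 'a ae_fun \<Rightarrow> bool" where
  "scalar_nondegenerate \<Omega> lam U \<longleftrightarrow> (\<forall>\<psi>\<in>scalar_linearized_solutions \<Omega> lam U. \<psi> = 0)"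


section \<open>The system\<close>

definition energy ::
    "'a::euclidean_space set \<Rightarrow> real \<Rightarrow> real^'n^'n \<Rightarrow> 'a ae_fun ^ 'n \<Rightarrow> real" where
  "energy \<Omega> lam A u =
     1/2 * (\<Sum>i\<in>UNIV. LINT x|lebesgue_on \<Omega>.
              (norm (weak_gradient \<Omega> (u $ i) x))\<^sup>2 + lam * (rep_ae_fun (u $ i) x)\<^sup>2)
     - 1/4 * (LINT x|lebesgue_on \<Omega>. (\<Sum>i\<in>UNIV. \<Sum>j\<in>UNIV.
              A $ i $ j * (rep_ae_fun (u $ i) x)\<^sup>2 * (rep_ae_fun (u $ j) x)\<^sup>2))"

definition vector_solution ::
    "'a::euclidean_space set \<Rightarrow> real \<Rightarrow> real^'n^'n \<Rightarrow> 'a ae_fun ^ 'n \<Rightarrow> bool" where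
  "vector_solution \<Omega> lam A u \<longleftrightarrow> u \<in> H_vec \<Omega> \<and>
     (\<forall>i. weakly_solves \<Omega> lam (u $ i)
            (\<lambda>x. \<Sum>j\<in>UNIV. A $ i $ j * rep_ae_fun (u $ i) x * (rep_ae_fun (u $ j) x)\<^sup>2))"

definition positive_vector_solution ::
    "'a::euclidean_space set \<Rightarrow> real \<Rightarrow> real^'n^'n \<Rightarrow> 'a ae_fun ^ 'n \<Rightarrow> bool" where
  "positive_vector_solution \<Omega> lam A u \<longleftrightarrow>
     vector_solution \<Omega> lam A u \<and> (\<forall>i. positive_on \<Omega> (u $ i))"

definition nondegenerate ::
    "'a::euclidean_space set \<Rightarrow> real \<Rightarrow> real^'n^'n \<Rightarrow> 'a ae_fun ^ 'n \<Rightarrow> bool" where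
  "nondegenerate \<Omega> lam A u \<longleftrightarrow> linearized_kernel (energy \<Omega> lam A) (H_vec \<Omega>) u = {0}"


section \<open>Vectors and matrices\<close>

text \<open>\<open>c \<odot> U = (c\<^sub>1 U, \<dots>, c\<^sub>n U)\<close> for \<open>c \<in> \<real>\<^sup>n\<close>.\<close>

definition times_fun :: "real^'n \<Rightarrow> 'v::real_vector \<Rightarrow> 'v^'n" (infixr "\<odot>" 75) where
  "c \<odot> U = (\<chi> i. (c $ i) *\<^sub>R U)"

definition hadamard_div :: "real^'n \<Rightarrow> real^'n \<Rightarrow> real^'n" (infixl "\<oslash>" 80) where
  "a \<oslash> b = (\<chi> i. a $ i / b $ i)"

text \<open>For symmetric matrices only: there the multiplicity of an eigenvalue is the dimension of
  its eigenspace.\<close>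

definition num_pos_eigenvalues :: "real^'n^'n \<Rightarrow> nat" where
  "num_pos_eigenvalues A =
     (\<Sum>\<mu> | \<mu> > 0 \<and> (\<exists>v. v \<noteq> 0 \<and> A *v v = \<mu> *\<^sub>R v). dim {v. A *v v = \<mu> *\<^sub>R v})"

definition S_plus :: "real \<Rightarrow> (real^'n) set" where
  "S_plus r = {c. (\<Sum>i\<in>UNIV. (c $ i)\<^sup>2) = r \<and> (\<forall>i. c $ i > 0)}"

text \<open>Not the topological frontier: \<open>S\<close> need not have interior points.\<close>

definition bdry :: "'a::topological_space set \<Rightarrow> 'a set" where
  "bdry S = closure S - S"

definition solution_amplitudes ::
    "'a::euclidean_space set \<Rightarrow> real \<Rightarrow> real^'n^'n \<Rightarrow> 'a ae_fun \<Rightarrow> (real^'n) set" where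
  "solution_amplitudes \<Omega> lam A U = {d. positive_vector_solution \<Omega> lam A (d \<odot> U)}"

end

theory Submission
  imports Defs
begin

text \<open>Write \<open>R\<close> for multiplication by \<open>U\<^sup>2\<close> and \<open>Q\<^sub>s\<close> for the form of \<open>- \<Delta> + lam - s U\<^sup>2\<close> on \<open>H\<close>. Since \<open>U\<close>
  solves the equation, \<open>Q\<^sub>1 U = 0\<close>, and since \<open>Q\<^sub>3\<close> has index one, no plane containing \<open>U\<close> is
  \<open>Q\<^sub>3\<close>-negative; hence \<open>Q\<^sub>1 \<ge> 0\<close>, \<open>Q\<^sub>1 f f = 0\<close> only for multiples \<open>f\<close> of \<open>U\<close>, and \<open>Q\<^sub>s\<close> has trivial
  kernel for \<open>s < 3\<close>, \<open>s \<noteq> 1\<close>. That \<open>c U\<close> solves the system means that the squares of the \<open>c\<^sub>i\<close> are mapped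
  by \<open>A\<close> to the vector of ones, so the symmetric nonnegative matrix \<open>Mat\<close> with entries \<open>a\<^sub>i\<^sub>j c\<^sub>i c\<^sub>j\<close> has the
  positive eigenvector \<open>c\<close> with eigenvalue \<open>1\<close>, and by Perron--Frobenius all its eigenvalues are at
  most \<open>1\<close>. In an orthonormal eigenbasis of \<open>Mat\<close> with eigenvalues \<open>\<mu>\<^sub>k\<close> the second variation at
  \<open>c U\<close> is the direct sum of the scalar forms with \<open>s = 1 + 2 \<mu>\<^sub>k\<close>, from which index and kernels are read
  off; by Sylvester's law \<open>Mat\<close> and \<open>A\<close> have equally many positive eigenvalues. Componentwise squaring
  turns the set of amplitudes into an open piece of an affine space.

  The forms are finite on \<open>H\<close> by the Sobolev embedding into \<open>L\<^sup>4\<close>. For the whole space one needs in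
  addition that test functions are dense in \<open>H\<^sup>1\<close> and, as radial functions are tested against radial
  functions only, the principle of symmetric criticality.\<close>

section \<open>Smooth functions and test functions\<close>

text \<open>Index one always enters through the same plane. On the span of \<open>U\<close> and
  \<open>f\<close> the form \<open>Q\<^sub>3\<close> is \<open>Q\<^sub>1 - 2 R\<close>; there
  \<open>Q\<^sub>1\<close> ignores the \<open>U\<close> coordinate, and \<open>R\<close> is positive
  definite because \<open>U > 0\<close> almost everywhere. If \<open>f\<close> is not a multiple of
  \<open>U\<close> and \<open>Q\<^sub>1 f f \<le> 0\<close>, the whole plane is
  \<open>Q\<^sub>3\<close>-negative, which is one dimension too many. The bound
  \<open>\<mu>\<^sub>k \<le> 1\<close> matters because \<open>Q\<^sub>s\<close> is nonnegative on
  the \<open>R\<close>-complement of \<open>U\<close> for \<open>s \<le> 3\<close>. Hence a positive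
  \<open>\<mu>\<^sub>k\<close> contributes a single negative direction, along \<open>U\<close>, and
  the others contribute none. The main obstacle is the gap between the definitions, which test with
  smooth compactly supported functions, and the forms, which live on \<open>H\<close>. On the whole
  space it is closed by projection: what is orthogonal to all test functions satisfies
  \<open>\<Delta>w = lam w\<close> weakly, its convolutions vanish at infinity, and the maximum
  principle makes them zero. The embedding into \<open>L\<^sup>4\<close> is Ladyzhenskaya's
  inequality, obtained from one-dimensional estimates along coordinate lines.\<close>

lemma k_smooth_on_imp_continuous_on: "k_smooth_on k S f \<Longrightarrow> continuous_on S f"
  by (cases k) (auto simp: continuous_at_imp_continuous_on differentiable_imp_continuous_within)

lemma k_smooth_on_SucD: "k_smooth_on (Suc k) S f \<Longrightarrow> k_smooth_on k S f"
proof (induction k arbitrary: f)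
  case 0
  then show ?case using k_smooth_on_imp_continuous_on[of "Suc 0" S f] by simp
next
  case (Suc k)
  then show ?case by (meson k_smooth_on.simps(2))
qed

text \<open>As \<open>S\<close> is open, functions that agree on \<open>S\<close> agree near each of
  its points and have the same Frechet derivative there, so the induction can pass to the
  derivatives.\<close>

lemma k_smooth_on_cong:
  assumes "open S" "\<And>x. x \<in> S \<Longrightarrow> f x = g x" "k_smooth_on k S f"
  shows "k_smooth_on k S g"
  using assms(2,3)
proof (induction k arbitrary: f g)
  case 0
  then show ?case by (simp cong: continuous_on_cong)
next
  case (Suc k)
  have d: "(g has_derivative frechet_derivative f (at x)) (at x)" if "x \<in> S" for x
    using Suc.prems that \<open>open S\<close>
    by (intro has_derivative_transform_within_open[of f _ x UNIV S g])
       (auto simp: frechet_derivative_works)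
  have eq: "frechet_derivative f (at x) = frechet_derivative g (at x)" if "x \<in> S" for x
    using frechet_derivative_at[OF d[OF that]] by simp
  have "k_smooth_on k S (\<lambda>x. frechet_derivative g (at x) v)" for v
  proof (rule Suc.IH)
    show "frechet_derivative f (at x) v = frechet_derivative g (at x) v" if "x \<in> S" for x
      using eq[OF that] by simp
    show "k_smooth_on k S (\<lambda>x. frechet_derivative f (at x) v)"
      using Suc.prems(2) by simp
  qed
  moreover have "\<forall>x\<in>S. g differentiable (at x)"
    using d by (auto simp: differentiable_def)
  ultimately show ?case
    by simp
qed

text \<open>Lets a proof supply any formula \<open>D\<close> for the derivative instead of the
  choice term \<open>frechet_derivative\<close>.\<close>

lemma k_smooth_on_SucI:
  assumes "open S" "\<And>x. x \<in> S \<Longrightarrow> (f has_derivative D x) (at x)"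
    and "\<And>v. k_smooth_on k S (\<lambda>x. D x v)"
  shows "k_smooth_on (Suc k) S f"
proof -
  have "k_smooth_on k S (\<lambda>x. frechet_derivative f (at x) v)" for v
    using frechet_derivative_at[OF assms(2)]
    by (intro k_smooth_on_cong[OF assms(1) _ assms(3)[of v]]) auto
  then show ?thesis
    using assms(2) by (auto simp: differentiable_def)
qed

lemma k_smooth_on_SucE:
  assumes "k_smooth_on (Suc k) S f" "x \<in> S"
  shows "(f has_derivative frechet_derivative f (at x)) (at x)"
  using assms by (simp add: frechet_derivative_works)

lemma k_smooth_on_const: "k_smooth_on k S (\<lambda>x. c)"
  by (induction k arbitrary: c) (auto simp: frechet_derivative_const)

lemma k_smooth_on_add:
  "open S \<Longrightarrow> k_smooth_on k S f \<Longrightarrow> k_smooth_on k S g \<Longrightarrow> k_smooth_on k S (\<lambda>x. f x + g x)"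
proof (induction k arbitrary: f g)
  case 0
  then show ?case by (auto intro: continuous_intros)
next
  case (Suc k)
  show ?case
    by (rule k_smooth_on_SucI[OF \<open>open S\<close> has_derivative_add[OF
          k_smooth_on_SucE[OF Suc.prems(2)] k_smooth_on_SucE[OF Suc.prems(3)]]])
       (use Suc in auto)
qed

lemma k_smooth_on_bounded_linear:
  assumes "bounded_linear T" "open S"
  shows "k_smooth_on k S f \<Longrightarrow> k_smooth_on k S (\<lambda>x. T (f x))"
proof (induction k arbitrary: f)
  case 0
  then show ?case
    by (auto intro: bounded_linear.continuous_on[OF assms(1)])
next
  case (Suc k)
  show ?case
    by (rule k_smooth_on_SucI[OF \<open>open S\<close> bounded_linear.has_derivative[OF assms(1)
          k_smooth_on_SucE[OF Suc.prems]]])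
       (use Suc in auto)
qed

lemma k_smooth_on_mult:
  fixes f g :: "'a::real_normed_vector \<Rightarrow> real"
  shows "open S \<Longrightarrow> k_smooth_on k S f \<Longrightarrow> k_smooth_on k S g \<Longrightarrow> k_smooth_on k S (\<lambda>x. f x * g x)"
proof (induction k arbitrary: f g)
  case 0
  then show ?case by (auto intro: continuous_intros)
next
  case (Suc k)
  show ?case
    \<comment> \<open>The product rule leaves one factor undifferentiated, so its smoothness of
      order \<open>Suc k\<close> has to be lowered to \<open>k\<close> before the induction
      hypothesis applies.\<close>
    by (rule k_smooth_on_SucI[OF \<open>open S\<close> has_derivative_mult[OF
          k_smooth_on_SucE[OF Suc.prems(2)] k_smooth_on_SucE[OF Suc.prems(3)]]])
       (use Suc k_smooth_on_SucD[OF Suc.prems(2)] k_smooth_on_SucD[OF Suc.prems(3)]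
         in \<open>auto intro!: k_smooth_on_add Suc.IH\<close>)
qed

lemma k_smooth_on_sum:
  "finite I \<Longrightarrow> open S \<Longrightarrow> (\<And>i. i \<in> I \<Longrightarrow> k_smooth_on k S (f i)) \<Longrightarrow>
    k_smooth_on k S (\<lambda>x. \<Sum>i\<in>I. f i x)"
  by (induction I rule: finite_induct) (auto intro: k_smooth_on_add k_smooth_on_const)

lemma k_smooth_on_prod:
  fixes f :: "'i \<Rightarrow> 'a::real_normed_vector \<Rightarrow> real"
  shows "finite I \<Longrightarrow> open S \<Longrightarrow> (\<And>i. i \<in> I \<Longrightarrow> k_smooth_on k S (f i)) \<Longrightarrow>
    k_smooth_on k S (\<lambda>x. \<Prod>i\<in>I. f i x)"
  by (induction I rule: finite_induct) (auto intro: k_smooth_on_mult k_smooth_on_const)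

lemma k_smooth_on_affine:
  assumes "bounded_linear L"
  shows "k_smooth_on k UNIV f \<Longrightarrow> k_smooth_on k UNIV (\<lambda>x. f (a + L x))"
proof (induction k arbitrary: f)
  case 0
  then show ?case
    by (auto intro!: continuous_on_compose2[of UNIV f UNIV "\<lambda>x. a + L x"]
        continuous_on_add continuous_on_const continuous_on_id bounded_linear.continuous_on[OF assms(1)])
next
  case (Suc k)
  have "((\<lambda>x. f (a + L x)) has_derivative (\<lambda>v. frechet_derivative f (at (a + L x)) (L v))) (at x)" for x
    by (rule has_derivative_compose[of "\<lambda>x. a + L x" "\<lambda>v. L v" x UNIV f])
       (use k_smooth_on_SucE[OF Suc.prems] in
          \<open>auto intro!: derivative_eq_intros bounded_linear.has_derivative[OF assms(1)]\<close>)
  then show ?case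
    by (rule k_smooth_on_SucI[OF open_UNIV]) (use Suc in auto)
qed

text \<open>The full sequence of derivatives is given in advance, so the induction on
  \<open>m\<close> runs over all \<open>k\<close> at once; differentiating just moves one step along
  \<open>D\<close>.\<close>

lemma k_smooth_on_inner_comp:
  fixes D :: "nat \<Rightarrow> real \<Rightarrow> real"
  assumes "open T" "\<And>x. x \<in> T \<Longrightarrow> x \<bullet> b \<in> I"
    and D: "\<And>k t. t \<in> I \<Longrightarrow> (D k has_field_derivative D (Suc k) t) (at t)"
  shows "k_smooth_on m T (\<lambda>x. D k (x \<bullet> b))"
proof (induction m arbitrary: k)
  case 0
  have "isCont (D k) (x \<bullet> b)" if "x \<in> T" for x
    using D[of "x \<bullet> b" k] assms(2)[OF that] by (auto intro: DERIV_isCont)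
  then have "isCont (\<lambda>x. D k (x \<bullet> b)) x" if "x \<in> T" for x
    using that by (intro isCont_o2[of _ "\<lambda>x. x \<bullet> b" "D k"]) (auto intro: continuous_intros)
  then show ?case
    by (auto intro: continuous_at_imp_continuous_on)
next
  case (Suc m)
  have "((\<lambda>x. D k (x \<bullet> b)) has_derivative (\<lambda>v. (v \<bullet> b) * D (Suc k) (x \<bullet> b))) (at x)"
    if "x \<in> T" for x
    using D[of "x \<bullet> b" k] assms(2)[OF that]
    by (auto intro!: DERIV_compose_FDERIV[where g="\<lambda>x. x \<bullet> b"] derivative_eq_intros)
  then show ?case
    by (rule k_smooth_on_SucI[OF assms(1)])
       (auto intro!: k_smooth_on_mult assms(1) k_smooth_on_const Suc)
qed

section \<open>A flat function and smooth approximations of boxes\<close>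

lemma tendsto_poly_exp_neg_at_top:
  fixes p :: "real poly"
  shows "((\<lambda>x. poly p x * exp (- x)) \<longlongrightarrow> 0) at_top"
proof -
  have "((\<lambda>x. (\<Sum>i\<le>degree p. coeff p i * (x ^ i / exp x))) \<longlongrightarrow> (\<Sum>i\<le>degree p. coeff p i * 0)) at_top"
    by (intro tendsto_sum tendsto_mult tendsto_const tendsto_power_div_exp_0)
  moreover have "(\<Sum>i\<le>degree p. coeff p i * (x ^ i / exp x)) = poly p x * exp (- x)" for x
    by (simp add: poly_altdef sum_distrib_right sum_divide_distrib exp_minus field_simps)
  ultimately show ?thesis by simp
qed

text \<open>The derivatives of \<open>exp (- 1 / t)\<close> are polynomials in \<open>1 / t\<close> times \<open>exp (- 1 / t)\<close>.\<close>

definition exp_flat :: "real poly \<Rightarrow> real \<Rightarrow> real" where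
  "exp_flat p t = (if t > 0 then poly p (1 / t) * exp (- (1 / t)) else 0)"

text \<open>With \<open>s = 1 / t\<close> one has \<open>d/dt = - s\<^sup>2 d/ds\<close>, so
  \<open>p(s) exp (- s)\<close> becomes \<open>s\<^sup>2 (p(s) - p'(s)) exp (- s)\<close>; the
  polynomial \<open>[:0,0,1:]\<close> is \<open>s\<^sup>2\<close>.\<close>

lemma exp_flat_deriv:
  "(exp_flat p has_field_derivative exp_flat ([:0,0,1:] * (p - pderiv p)) t) (at t)"
proof (cases t "0::real" rule: linorder_cases)
  case less
  have "((\<lambda>x. 0) has_field_derivative 0) (at t)" by simp
  then have "(exp_flat p has_field_derivative 0) (at t)"
    by (rule has_field_derivative_transform_within_open[of _ _ _ "{..<0}"])
       (use less in \<open>auto simp: exp_flat_def\<close>)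
  then show ?thesis using less by (simp add: exp_flat_def)
next
  case greater
  have "((\<lambda>t. poly p (1 / t) * exp (- (1 / t))) has_field_derivative
      exp_flat ([:0,0,1:] * (p - pderiv p)) t) (at t)"
    using greater
    by (auto intro!: derivative_eq_intros DERIV_chain2[where f="poly p"] poly_DERIV
        simp: exp_flat_def field_simps power2_eq_square)
  then show ?thesis
    by (rule has_field_derivative_transform_within_open[of _ _ _ "{0<..}"])
       (use greater in \<open>auto simp: exp_flat_def\<close>)
next
  case equal
  \<comment> \<open>From the right, the difference quotient at 0 is \<open>s p(s) exp (- s)\<close>
    with \<open>s = 1 / h\<close>, which explains the extra factor \<open>[:0,1:]\<close>.\<close>
  have "((\<lambda>h. (poly ([:0,1:] * p) (1 / h)) * exp (- (1 / h))) \<longlongrightarrow> 0) (at_right 0)"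
    using filterlim_compose[OF tendsto_poly_exp_neg_at_top filterlim_inverse_at_top_right, of "[:0,1:] * p"]
    by (simp add: inverse_eq_divide)
  then have r: "((\<lambda>h. (exp_flat p (0 + h) - exp_flat p 0) / h) \<longlongrightarrow> 0) (at_right 0)"
    by (rule Lim_transform_eventually)
       (auto simp: exp_flat_def eventually_at_filter)
  have l: "((\<lambda>h. (exp_flat p (0 + h) - exp_flat p 0) / h) \<longlongrightarrow> 0) (at_left 0)"
    by (rule tendsto_eventually) (auto simp: exp_flat_def eventually_at_filter)
  have "(exp_flat p has_field_derivative 0) (at 0)"
    unfolding DERIV_def using filterlim_split_at[OF l r] by simp
  then show ?thesis using equal by (simp add: exp_flat_def)
qed

primrec exp_flat_poly :: "nat \<Rightarrow> real poly" where
  "exp_flat_poly 0 = 1"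
| "exp_flat_poly (Suc k) = [:0,0,1:] * (exp_flat_poly k - pderiv (exp_flat_poly k))"

definition flat :: "real \<Rightarrow> real" where
  "flat t = (if t > 0 then exp (- (1 / t)) else 0)"

lemma flat_eq: "flat = exp_flat (exp_flat_poly 0)"
  by (auto simp: fun_eq_iff flat_def exp_flat_def)

lemma k_smooth_on_flat_inner: "k_smooth_on m UNIV (\<lambda>x. flat (x \<bullet> b))"
  unfolding flat_eq
proof (rule k_smooth_on_inner_comp[where I=UNIV])
  fix k t show "(exp_flat (exp_flat_poly k) has_field_derivative exp_flat (exp_flat_poly (Suc k)) t) (at t)"
    unfolding exp_flat_poly.simps by (rule exp_flat_deriv)
qed auto

lemma flat_nonneg: "0 \<le> flat t" and flat_le_1: "flat t \<le> 1"
  by (auto simp: flat_def)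

lemma flat_seq_tendsto: "(\<lambda>n. flat (real n * t)) \<longlonglongrightarrow> (if t > 0 then 1 else 0)"
proof (cases "t > 0")
  case True
  have "((\<lambda>n. 1 / (real n * t)) \<longlonglongrightarrow> 0)"
    using tendsto_mult[OF lim_1_over_n tendsto_const[of "1/t"]] by simp
  then have "((\<lambda>n. exp (- (1 / (real n * t)))) \<longlonglongrightarrow> exp (- 0))"
    by (intro tendsto_intros)
  then have "((\<lambda>n. flat (real n * t)) \<longlonglongrightarrow> exp (- 0))"
    by (rule Lim_transform_eventually)
       (use True in \<open>auto simp: flat_def intro!: eventually_sequentiallyI[of 1]\<close>)
  then show ?thesis using True by simp
next
  case False
  then have "flat (real n * t) = 0" for n
    by (auto simp: flat_def zero_less_mult_iff)
  then show ?thesis using False by simp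
qed

text \<open>Smooth cutoffs between 0 and 1 that vanish outside the open box and tend pointwise to
  its indicator as \<open>n\<close> grows; they carry the fundamental lemma from test functions to
  boxes.\<close>

definition box_bump :: "'a::euclidean_space \<Rightarrow> 'a \<Rightarrow> real \<Rightarrow> 'a \<Rightarrow> real" where
  "box_bump a b n x = (\<Prod>i\<in>Basis. flat (n * ((x - a) \<bullet> i)) * flat (n * ((b - x) \<bullet> i)))"

lemma box_bump_outside: "n \<ge> 0 \<Longrightarrow> x \<notin> box a b \<Longrightarrow> box_bump a b n x = 0"
proof -
  assume "n \<ge> 0" "x \<notin> box a b"
  then obtain i where i: "i \<in> Basis" "(x - a) \<bullet> i \<le> 0 \<or> (b - x) \<bullet> i \<le> 0"
    by (auto simp: mem_box inner_diff_left not_less)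
  then have "flat (n * ((x - a) \<bullet> i)) * flat (n * ((b - x) \<bullet> i)) = 0"
    using \<open>n \<ge> 0\<close> by (auto simp: flat_def zero_less_mult_iff)
  then show ?thesis
    unfolding box_bump_def using i(1) by (intro prod_zero) auto
qed

lemma box_bump_nonneg: "0 \<le> box_bump a b n x"
  and box_bump_le_1: "box_bump a b n x \<le> 1"
  unfolding box_bump_def
  by (auto intro!: prod_nonneg prod_le_1 mult_nonneg_nonneg mult_le_one flat_nonneg flat_le_1)

lemma box_bump_tendsto: "(\<lambda>n. box_bump a b (real n) x) \<longlonglongrightarrow> indicator (box a b) x"
proof (cases "x \<in> box a b")
  case True
  have "(\<lambda>n. box_bump a b (real n) x) \<longlonglongrightarrow> (\<Prod>i\<in>(Basis::'a set). (if (x - a) \<bullet> i > 0 then 1 else 0)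
      * (if (b - x) \<bullet> i > 0 then 1 else 0))"
    unfolding box_bump_def by (intro tendsto_prod tendsto_mult flat_seq_tendsto)
  then show ?thesis
    using True by (auto simp: mem_box inner_diff_left cong: prod.cong)
next
  case False
  then show ?thesis by (simp add: box_bump_outside)
qed

lemma k_smooth_on_box_bump: "k_smooth_on m UNIV (box_bump a b n)"
proof -
  have 1: "k_smooth_on m UNIV (\<lambda>x. flat (n * ((x - a) \<bullet> i)))" for i
    using k_smooth_on_affine[OF bounded_linear_scaleR_right[of n] k_smooth_on_flat_inner[of m i], of "- n *\<^sub>R a"]
    by (simp add: algebra_simps inner_diff_left)
  have 2: "k_smooth_on m UNIV (\<lambda>x. flat (n * ((b - x) \<bullet> i)))" for i
    using k_smooth_on_affine[OF bounded_linear_scaleR_right[of "-n"] k_smooth_on_flat_inner[of m i], of "n *\<^sub>R b"]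
    by (simp add: algebra_simps inner_diff_left)
  show ?thesis
    unfolding box_bump_def by (intro k_smooth_on_prod k_smooth_on_mult 1 2 finite_Basis open_UNIV)
qed

lemma test_function_box_bump:
  assumes "cbox a b \<subseteq> \<Omega>" "n \<ge> 0"
  shows "test_function \<Omega> (box_bump a b n)"
  unfolding test_function_def smooth_on_def
  using assms box_bump_outside[OF assms(2), of _ a b] box_subset_cbox[of a b]
  by (intro conjI allI k_smooth_on_box_bump exI[of _ "cbox a b"] compact_cbox) blast+

section \<open>Algebra of test functions\<close>

lemma test_function_smooth: "test_function \<Omega> \<eta> \<Longrightarrow> k_smooth_on k UNIV \<eta>"
  by (simp add: test_function_def smooth_on_def)

lemma test_functionE:
  assumes "test_function \<Omega> \<eta>"
  obtains C where "compact C" "C \<subseteq> \<Omega>" "\<And>x. x \<notin> C \<Longrightarrow> \<eta> x = 0"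
  using assms by (auto simp: test_function_def)

lemma test_functionI:
  assumes "\<And>k. k_smooth_on k UNIV \<eta>" "compact C" "C \<subseteq> \<Omega>" "\<And>x. x \<notin> C \<Longrightarrow> \<eta> x = 0"
  shows "test_function \<Omega> \<eta>"
  using assms by (auto simp: test_function_def smooth_on_def)

lemma test_function_mono: "test_function \<Omega> \<eta> \<Longrightarrow> \<Omega> \<subseteq> \<Omega>' \<Longrightarrow> test_function \<Omega>' \<eta>"
  by (auto simp: test_function_def)

lemma test_function_zero: "test_function \<Omega> (\<lambda>x. 0)"
  by (rule test_functionI[of _ "{}"]) (auto simp: k_smooth_on_const)

lemma test_function_add:
  assumes "test_function \<Omega> \<eta>" "test_function \<Omega> \<zeta>"
  shows "test_function \<Omega> (\<lambda>x. \<eta> x + \<zeta> x)"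
proof -
  obtain C D where *: "compact C" "C \<subseteq> \<Omega>" "\<And>x. x \<notin> C \<Longrightarrow> \<eta> x = 0"
    "compact D" "D \<subseteq> \<Omega>" "\<And>x. x \<notin> D \<Longrightarrow> \<zeta> x = 0"
    using assms by (metis test_functionE)
  show ?thesis
    by (rule test_functionI[of _ "C \<union> D"])
       (use * assms in \<open>auto intro: k_smooth_on_add test_function_smooth\<close>)
qed

lemma test_function_mult_smooth:
  assumes "test_function \<Omega> \<eta>" "\<And>k. k_smooth_on k UNIV g"
  shows "test_function \<Omega> (\<lambda>x. g x * \<eta> x)"
proof -
  obtain C where *: "compact C" "C \<subseteq> \<Omega>" "\<And>x. x \<notin> C \<Longrightarrow> \<eta> x = 0"
    using assms by (metis test_functionE)
  show ?thesis
    by (rule test_functionI[of _ "C"])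
       (use * assms in \<open>auto intro: k_smooth_on_mult test_function_smooth\<close>)
qed

lemma test_function_cmult: "test_function \<Omega> \<eta> \<Longrightarrow> test_function \<Omega> (\<lambda>x. r * \<eta> x)"
  by (rule test_function_mult_smooth) (auto intro: k_smooth_on_const)

lemma test_function_mult:
  "test_function \<Omega> \<eta> \<Longrightarrow> test_function \<Omega> \<zeta> \<Longrightarrow> test_function \<Omega> (\<lambda>x. \<eta> x * \<zeta> x)"
  by (rule test_function_mult_smooth) (auto intro: test_function_smooth)

lemma test_function_has_derivative:
  "test_function \<Omega> \<eta> \<Longrightarrow> (\<eta> has_derivative frechet_derivative \<eta> (at x)) (at x)"
  using k_smooth_on_SucE[OF test_function_smooth[of \<Omega> \<eta> "Suc 0"]] by simp

lemma test_function_support_deriv: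
  assumes "test_function \<Omega> \<eta>" "compact C" "\<And>x. x \<notin> C \<Longrightarrow> \<eta> x = 0" "x \<notin> C"
  shows "frechet_derivative \<eta> (at x) v = 0"
proof -
  have "(\<eta> has_derivative (\<lambda>_. 0)) (at x)"
    by (rule has_derivative_transform_within_open[of "\<lambda>_. 0" _ x UNIV "- C"])
       (use assms compact_imp_closed in auto)
  then show ?thesis
    using frechet_derivative_at by metis
qed

lemma test_function_deriv:
  assumes "test_function \<Omega> \<eta>"
  shows "test_function \<Omega> (\<lambda>x. frechet_derivative \<eta> (at x) v)"
proof -
  obtain C where *: "compact C" "C \<subseteq> \<Omega>" "\<And>x. x \<notin> C \<Longrightarrow> \<eta> x = 0"
    using assms by (metis test_functionE)
  show ?thesis
    by (rule test_functionI[of _ "C"])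
       (use * test_function_support_deriv[OF assms *(1,3)] test_function_smooth[OF assms, of "Suc _"]
         in auto)
qed

section \<open>Gradients of test functions\<close>

lemma gradient_eqI:
  assumes "(f has_derivative (\<lambda>h. h \<bullet> D)) (at x)"
  shows "gradient f x = D"
  unfolding gradient_def
proof (rule the_equality)
  show "GDERIV f x :> D"
    using assms by (simp add: gderiv_def)
  fix E assume "GDERIV f x :> E"
  then have "(\<lambda>h. h \<bullet> E) = (\<lambda>h. h \<bullet> D)"
    using has_derivative_unique[OF assms] by (simp add: gderiv_def)
  then show "E = D"
    by (metis inner_commute vector_eq_ldot)
qed

lemma test_function_gradient:
  assumes "test_function \<Omega> \<eta>"
  shows "gradient \<eta> x = (\<Sum>i\<in>Basis. frechet_derivative \<eta> (at x) i *\<^sub>R i)" (is "_ = ?g")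
    and "frechet_derivative \<eta> (at x) v = gradient \<eta> x \<bullet> v"
proof -
  note d = test_function_has_derivative[OF assms, of x]
  interpret bounded_linear "frechet_derivative \<eta> (at x)"
    using d by (rule has_derivative_bounded_linear)
  have eq: "frechet_derivative \<eta> (at x) h = h \<bullet> ?g" for h
  proof -
    have "frechet_derivative \<eta> (at x) h = frechet_derivative \<eta> (at x) (\<Sum>i\<in>Basis. (h \<bullet> i) *\<^sub>R i)"
      by (simp add: euclidean_representation)
    also have "\<dots> = (\<Sum>i\<in>Basis. (h \<bullet> i) * frechet_derivative \<eta> (at x) i)"
      by (simp add: sum scale)
    finally show ?thesis
      by (simp add: inner_sum_right mult.commute)
  qed
  have "frechet_derivative \<eta> (at x) = (\<lambda>h. h \<bullet> ?g)"
    using eq by (rule ext)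
  then show g: "gradient \<eta> x = ?g"
    using d by (intro gradient_eqI) simp
  show "frechet_derivative \<eta> (at x) v = gradient \<eta> x \<bullet> v"
    by (metis eq g inner_commute)
qed

lemma test_function_has_gradient:
  "test_function \<Omega> \<eta> \<Longrightarrow> (\<eta> has_derivative (\<lambda>v. gradient \<eta> x \<bullet> v)) (at x)"
  using test_function_has_derivative[of \<Omega> \<eta> x] test_function_gradient(2)[of \<Omega> \<eta> x]
  by (metis (no_types, lifting) ext)

lemma test_function_inner_gradient:
  assumes "test_function \<Omega> \<eta>" shows "test_function \<Omega> (\<lambda>x. gradient \<eta> x \<bullet> v)"
  using test_function_deriv[OF assms, of v] by (simp add: test_function_gradient(2)[OF assms])

lemma gradient_eqI':
  assumes "(f has_derivative (\<lambda>v. D \<bullet> v)) (at x)"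
  shows "gradient f x = D"
  using assms by (intro gradient_eqI) (simp add: inner_commute)

lemma gradient_mult:
  assumes "test_function \<Omega> \<eta>" "test_function \<Omega> \<zeta>"
  shows "gradient (\<lambda>x. \<eta> x * \<zeta> x) x = \<eta> x *\<^sub>R gradient \<zeta> x + \<zeta> x *\<^sub>R gradient \<eta> x"
  by (rule gradient_eqI')
     (use has_derivative_mult[OF assms[THEN test_function_has_gradient, of x]]
       in \<open>simp add: inner_add_left mult.commute\<close>)

lemma continuous_on_test_function: "test_function \<Omega> \<eta> \<Longrightarrow> continuous_on S \<eta>"
  using k_smooth_on_imp_continuous_on[OF test_function_smooth] continuous_on_subset by blast

lemma continuous_on_gradient:
  assumes "test_function \<Omega> \<eta>" shows "continuous_on S (gradient \<eta>)"
proof -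
  have "continuous_on S (\<lambda>x. \<Sum>i\<in>Basis. frechet_derivative \<eta> (at x) i *\<^sub>R i)"
    by (intro continuous_intros continuous_on_test_function[OF test_function_deriv[OF assms]])
  then show ?thesis
    using test_function_gradient(1)[OF assms] by (metis (no_types, lifting) ext)
qed

lemma gradient_support:
  assumes "test_function \<Omega> \<eta>" "compact C" "\<And>x. x \<notin> C \<Longrightarrow> \<eta> x = 0" "x \<notin> C"
  shows "gradient \<eta> x = 0"
  using test_function_support_deriv[OF assms] by (simp add: test_function_gradient(1)[OF assms(1)])

lemma test_function_affine:
  fixes L :: "'a::euclidean_space \<Rightarrow> 'a"
  assumes "test_function UNIV \<eta>" "linear L" "inj L"
  shows "test_function UNIV (\<lambda>x. \<eta> (a + L x))"
    and "(gradient (\<lambda>x. \<eta> (a + L x)) x) \<bullet> v = gradient \<eta> (a + L x) \<bullet> L v"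
proof -
  obtain C where *: "compact C" "\<And>x. x \<notin> C \<Longrightarrow> \<eta> x = 0"
    using assms by (metis test_functionE)
  obtain M where M: "linear M" "M \<circ> L = id"
    using assms(2,3) linear_injective_left_inverse by blast
  \<comment> \<open>A left inverse of \<open>L\<close> carries the translated support to a compact
    set that contains the support of the composition.\<close>
  have "compact (M ` ((\<lambda>y. y - a) ` C))"
    using * M by (intro compact_continuous_image linear_continuous_on continuous_intros)
                 (auto simp: linear_linear)
  moreover have "\<eta> (a + L x) = 0" if "x \<notin> M ` ((\<lambda>y. y - a) ` C)" for x
  proof (rule *)
    show "a + L x \<notin> C"
    proof
      assume "a + L x \<in> C"
      then have "M (a + L x - a) \<in> M ` ((\<lambda>y. y - a) ` C)" by blast
      moreover have "M (a + L x - a) = x" using M(2) by (auto simp: fun_eq_iff)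
      ultimately show False using that by simp
    qed
  qed
  ultimately show t: "test_function UNIV (\<lambda>x. \<eta> (a + L x))"
    by (intro test_functionI k_smooth_on_affine test_function_smooth[OF assms(1)])
       (auto simp: linear_linear assms(2))
  have "((\<lambda>x. \<eta> (a + L x)) has_derivative (\<lambda>v. gradient \<eta> (a + L x) \<bullet> L v)) (at x)"
    by (rule has_derivative_compose[of "\<lambda>x. a + L x" "\<lambda>v. L v" x UNIV \<eta>])
       (use test_function_has_gradient[OF assms(1)] assms(2) in
          \<open>auto intro!: derivative_eq_intros linear_imp_has_derivative\<close>)
  then show "(gradient (\<lambda>x. \<eta> (a + L x)) x) \<bullet> v = gradient \<eta> (a + L x) \<bullet> L v"
    using has_derivative_unique test_function_has_gradient[OF t, of x]
    by (metis (mono_tags, lifting))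
qed

section \<open>Bounds from compact support\<close>

lemma compact_support_bounded:
  fixes f :: "'a::euclidean_space \<Rightarrow> 'b::real_normed_vector"
  assumes "continuous_on UNIV f" "compact C" "\<And>x. x \<notin> C \<Longrightarrow> f x = 0"
  obtains B where "B > 0" "\<And>x. norm (f x) \<le> B * indicator C x"
proof -
  have "bounded (f ` C)"
    using assms continuous_on_subset by (blast intro: compact_imp_bounded compact_continuous_image)
  then obtain B where "B > 0" "\<And>x. x \<in> C \<Longrightarrow> norm (f x) \<le> B"
    by (auto simp: bounded_pos)
  then show thesis
    using assms(3) by (intro that[of B]) (auto simp: indicator_def)
qed

lemma test_function_bounded:
  assumes "test_function \<Omega> \<eta>"
  obtains B C where "B > 0" "compact C" "C \<subseteq> \<Omega>" "\<And>x. \<bar>\<eta> x\<bar> \<le> B * indicator C x"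
    "\<And>x. norm (gradient \<eta> x) \<le> B * indicator C x"
proof -
  obtain C where *: "compact C" "C \<subseteq> \<Omega>" "\<And>x. x \<notin> C \<Longrightarrow> \<eta> x = 0"
    using assms by (metis test_functionE)
  obtain B1 where 1: "B1 > 0" "\<And>x. norm (\<eta> x) \<le> B1 * indicator C x"
    using compact_support_bounded[OF continuous_on_test_function[OF assms] *(1,3)] by blast
  obtain B2 where 2: "B2 > 0" "\<And>x. norm (gradient \<eta> x) \<le> B2 * indicator C x"
    using compact_support_bounded[OF continuous_on_gradient[OF assms] *(1)]
      gradient_support[OF assms *(1,3)] by metis
  show thesis
  proof (rule that[of "max B1 B2" C])
    fix x
    show "\<bar>\<eta> x\<bar> \<le> max B1 B2 * indicator C x"
      using 1(2)[of x] by (auto simp: indicator_def split: if_splits)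
    show "norm (gradient \<eta> x) \<le> max B1 B2 * indicator C x"
      using 2(2)[of x] by (auto simp: indicator_def split: if_splits)
  qed (use * 1(1) in auto)
qed

lemma test_function_line_deriv:
  assumes "test_function \<Omega> \<eta>"
  shows "((\<lambda>t. \<eta> (x + t *\<^sub>R v)) has_field_derivative gradient \<eta> (x + t *\<^sub>R v) \<bullet> v) (at t)"
proof -
  have "((\<lambda>t. \<eta> (x + t *\<^sub>R v)) has_derivative (\<lambda>s. gradient \<eta> (x + t *\<^sub>R v) \<bullet> (s *\<^sub>R v))) (at t)"
    by (rule has_derivative_compose[of "\<lambda>t. x + t *\<^sub>R v" "\<lambda>s. s *\<^sub>R v" t UNIV \<eta>])
       (use test_function_has_gradient[OF assms] in \<open>auto intro!: derivative_eq_intros\<close>)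
  then show ?thesis
    by (simp add: has_field_derivative_def mult_commute_abs)
qed

text \<open>One compact set serves all \<open>h\<close> with absolute value at most 1, so the
  difference quotients have a common locally supported majorant for dominated convergence.\<close>

lemma test_function_diff_bound:
  assumes "test_function \<Omega> \<eta>"
  obtains B C where "B > 0" "compact C"
    "\<And>x h. \<bar>h\<bar> \<le> 1 \<Longrightarrow> \<bar>\<eta> (x + h *\<^sub>R v) - \<eta> x\<bar> \<le> \<bar>h\<bar> * (B * indicator C x)"
proof -
  obtain B C where BC: "B > 0" "compact C" "C \<subseteq> \<Omega>" "\<And>x. \<bar>\<eta> x\<bar> \<le> B * indicator C x"
    "\<And>x. norm (gradient \<eta> x) \<le> B * indicator C x"
    using test_function_bounded[OF assms] by metis
  \<comment> \<open>The support fattened by the length of \<open>v\<close>: outside it neither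
    \<open>x\<close> nor \<open>x + h *\<^sub>R v\<close> meets \<open>C\<close>.\<close>
  define D where "D = {x + y | x y. x \<in> C \<and> y \<in> cball 0 (norm v)}"
  have D: "compact D"
    unfolding D_def by (intro compact_sums BC compact_cball)
  have CD: "x \<in> D" if "x + h *\<^sub>R v \<in> C" "\<bar>h\<bar> \<le> 1" for x h
  proof -
    have "x = (x + h *\<^sub>R v) + (- h *\<^sub>R v)" by simp
    moreover have "- h *\<^sub>R v \<in> cball 0 (norm v)" using that(2) by (simp add: mult_left_le_one_le)
    ultimately show ?thesis using that(1) unfolding D_def by blast
  qed
  show thesis
  \<comment> \<open>The mean value theorem gives \<open>B * norm v\<close>; adding 1 keeps the
    constant positive when \<open>v = 0\<close>.\<close>
  proof (rule that[of "B * (norm v + 1)" D])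
    fix x and h :: real assume h: "\<bar>h\<bar> \<le> 1"
    show "\<bar>\<eta> (x + h *\<^sub>R v) - \<eta> x\<bar> \<le> \<bar>h\<bar> * (B * (norm v + 1) * indicator D x)"
    proof (cases "x \<in> D")
      case False
      then have "x + h *\<^sub>R v \<notin> C" "x \<notin> C"
        using CD[of x h] CD[of x 0] h by auto
      then show ?thesis
        using BC(4)[of x] BC(4)[of "x + h *\<^sub>R v"] False by simp
    next
      case True
      have "norm (\<eta> (x + h *\<^sub>R v) - \<eta> (x + 0 *\<^sub>R v)) \<le> (B * norm v) * norm (h - 0)"
      proof (rule field_differentiable_bound[where S=UNIV])
        fix t :: real
        show "((\<lambda>t. \<eta> (x + t *\<^sub>R v)) has_field_derivative gradient \<eta> (x + t *\<^sub>R v) \<bullet> v) (at t within UNIV)"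
          using test_function_line_deriv[OF assms] by simp
        have "\<bar>gradient \<eta> (x + t *\<^sub>R v) \<bullet> v\<bar> \<le> norm (gradient \<eta> (x + t *\<^sub>R v)) * norm v"
          by (rule Cauchy_Schwarz_ineq2)
        also have "\<dots> \<le> B * norm v"
          using order_trans[OF BC(5)[of "x + t *\<^sub>R v"] mult_left_mono[OF indicator_le_1]] BC(1)
          by (intro mult_right_mono) auto
        finally show "norm (gradient \<eta> (x + t *\<^sub>R v) \<bullet> v) \<le> B * norm v" by simp
      qed auto
      also have "(B * norm v) * norm (h - 0) \<le> \<bar>h\<bar> * (B * (norm v + 1) * indicator D x)"
        using True BC(1) by (simp add: mult.commute mult_left_mono)
      finally show ?thesis by simp
    qed
  qed (use D BC(1) in \<open>auto intro!: mult_pos_pos add_nonneg_pos\<close>)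
qed

section \<open>Square-integrable functions\<close>

text \<open>Over an arbitrary measure and with Euclidean values: it is used on
  \<open>lebesgue_on \<Omega>\<close>, on \<open>lebesgue\<close> for rotations, and for the pairs
  formed by a function and its gradient.\<close>

definition square_integrable :: "'x measure \<Rightarrow> ('x \<Rightarrow> 'b::euclidean_space) \<Rightarrow> bool" where
  "square_integrable M f \<longleftrightarrow> f \<in> borel_measurable M \<and> integrable M (\<lambda>x. (norm (f x))\<^sup>2)"

lemma L2_on_eq: "L2_on \<Omega> = square_integrable (lebesgue_on \<Omega>)"
  by (simp add: fun_eq_iff L2_on_def square_integrable_def)

lemma square_integrable_measurable[measurable_dest]:
  "square_integrable M f \<Longrightarrow> f \<in> borel_measurable M"
  by (simp add: square_integrable_def)

lemma square_integrable_cong_AE: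
  assumes "square_integrable M f" "g \<in> borel_measurable M" "AE x in M. f x = g x"
  shows "square_integrable M g"
proof -
  have [measurable]: "f \<in> borel_measurable M" using assms by (simp add: square_integrable_def)
  note [measurable] = assms(2)
  have "integrable M (\<lambda>x. (norm (g x))\<^sup>2)"
    by (rule integrable_cong_AE_imp[of M "\<lambda>x. (norm (f x))\<^sup>2"])
       (use assms in \<open>auto simp: square_integrable_def\<close>)
  then show ?thesis using assms(2) by (simp add: square_integrable_def)
qed

lemma norm_add_square_le: "(norm (x + y))\<^sup>2 \<le> 2 * (norm x)\<^sup>2 + 2 * (norm (y::'b::real_inner))\<^sup>2"
proof -
  have "0 \<le> (norm (x - y))\<^sup>2" by simp
  then show ?thesis
    by (simp add: power2_norm_eq_inner inner_add_left inner_add_right inner_diff_left inner_diff_right inner_commute)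
qed

lemma two_abs_inner_le: "2 * \<bar>x \<bullet> y\<bar> \<le> (norm x)\<^sup>2 + (norm (y::'b::real_inner))\<^sup>2"
proof -
  have "\<bar>x \<bullet> y\<bar> \<le> norm x * norm y" by (rule Cauchy_Schwarz_ineq2)
  moreover have "2 * (norm x * norm y) \<le> (norm x)\<^sup>2 + (norm y)\<^sup>2"
    using sum_squares_bound[of "norm x" "norm y"] by simp
  ultimately show ?thesis by linarith
qed

lemma square_integrable_add:
  assumes "square_integrable M f" "square_integrable M g"
  shows "square_integrable M (\<lambda>x. f x + g x)"
proof -
  note [measurable] = assms[THEN square_integrable_measurable]
  have "integrable M (\<lambda>x. 2 * (norm (f x))\<^sup>2 + 2 * (norm (g x))\<^sup>2)"
    using assms by (auto simp: square_integrable_def)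
  then have "integrable M (\<lambda>x. (norm (f x + g x))\<^sup>2)"
    by (rule Bochner_Integration.integrable_bound) (auto intro!: AE_I2 norm_add_square_le)
  then show ?thesis by (simp add: square_integrable_def)
qed

lemma square_integrable_scaleR:
  assumes "square_integrable M f" shows "square_integrable M (\<lambda>x. r *\<^sub>R f x)"
  using assms by (auto simp: square_integrable_def power_mult_distrib)

lemma square_integrable_diff:
  assumes "square_integrable M f" "square_integrable M g"
  shows "square_integrable M (\<lambda>x. f x - g x)"
  using square_integrable_add[OF assms(1) square_integrable_scaleR[OF assms(2), of "-1"]] by simp

lemma square_integrable_inner:
  assumes "square_integrable M f" "square_integrable M g"
  shows "integrable M (\<lambda>x. f x \<bullet> g x)"
proof -
  note [measurable] = assms[THEN square_integrable_measurable]
  have "integrable M (\<lambda>x. (norm (f x))\<^sup>2 + (norm (g x))\<^sup>2)"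
    using assms by (auto simp: square_integrable_def)
  then show ?thesis
  proof (rule Bochner_Integration.integrable_bound)
    show "AE x in M. norm (f x \<bullet> g x) \<le> norm ((norm (f x))\<^sup>2 + (norm (g x))\<^sup>2)"
    proof (rule AE_I2)
      fix x show "norm (f x \<bullet> g x) \<le> norm ((norm (f x))\<^sup>2 + (norm (g x))\<^sup>2)"
        using two_abs_inner_le[of "f x" "g x"] by simp
    qed
  qed simp
qed

lemma square_integrable_mult_scaleR:
  fixes f :: "'x \<Rightarrow> real"
  assumes "square_integrable M f" "square_integrable M g"
  shows "integrable M (\<lambda>x. f x *\<^sub>R g x)"
proof -
  note [measurable] = assms[THEN square_integrable_measurable]
  have "integrable M (\<lambda>x. (f x)\<^sup>2 + (norm (g x))\<^sup>2)"
    using assms by (auto simp: square_integrable_def)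
  then show ?thesis
  proof (rule Bochner_Integration.integrable_bound)
    show "AE x in M. norm (f x *\<^sub>R g x) \<le> norm ((f x)\<^sup>2 + (norm (g x))\<^sup>2)"
    proof (rule AE_I2)
      fix x show "norm (f x *\<^sub>R g x) \<le> norm ((f x)\<^sup>2 + (norm (g x))\<^sup>2)"
        using sum_squares_bound[of "\<bar>f x\<bar>" "norm (g x)"] mult_nonneg_nonneg[OF abs_ge_zero norm_ge_zero, of "f x" "g x"]
          power2_abs[of "f x"] abs_ge_self[of "(f x)\<^sup>2 + (norm (g x))\<^sup>2"]
        unfolding norm_scaleR real_norm_def by linarith
    qed
  qed simp
qed

text \<open>Yields the Cauchy-Schwarz inequality for semidefinite forms and, with
  \<open>a = 0\<close>, the vanishing of the first variation at an extremum.\<close>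

lemma quadratic_nonneg_discriminant:
  fixes a b c :: real
  assumes "\<And>t. 0 \<le> a + 2 * t * b + t\<^sup>2 * c" "0 \<le> c"
  shows "b\<^sup>2 \<le> a * c"
proof (cases "c = 0")
  case True
  have "b = 0"
  proof (rule ccontr)
    assume "b \<noteq> 0"
    \<comment> \<open>This \<open>t\<close> makes the affine function \<open>a + 2 * t * b\<close>
      equal to -1.\<close>
    then show False using assms(1)[of "- (a + 1) / (2 * b)"] True by (simp add: field_simps)
  qed
  then show ?thesis using True by simp
next
  case False
  then have "c > 0" using assms(2) by simp
  have "0 \<le> a + 2 * (- b / c) * b + (- b / c)\<^sup>2 * c" by (rule assms(1))
  also have "\<dots> = a - b\<^sup>2 / c" using \<open>c > 0\<close> by (simp add: field_simps power2_eq_square)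
  finally show ?thesis using \<open>c > 0\<close> by (simp add: field_simps)
qed

lemma integral_norm_add_scaleR:
  assumes "square_integrable M f" "square_integrable M g"
  shows "(LINT x|M. (norm (f x + t *\<^sub>R g x))\<^sup>2) =
    (LINT x|M. (norm (f x))\<^sup>2) + 2 * t * (LINT x|M. f x \<bullet> g x) + t\<^sup>2 * (LINT x|M. (norm (g x))\<^sup>2)"
proof -
  have "(LINT x|M. (norm (f x + t *\<^sub>R g x))\<^sup>2) =
     (LINT x|M. (norm (f x))\<^sup>2 + 2 * t * (f x \<bullet> g x) + t\<^sup>2 * (norm (g x))\<^sup>2)"
    unfolding power2_norm_eq_inner
    by (intro Bochner_Integration.integral_cong refl)
       (simp add: inner_add_left inner_add_right inner_commute algebra_simps power2_eq_square)
  also have "\<dots> = (LINT x|M. (norm (f x))\<^sup>2) + 2 * t * (LINT x|M. f x \<bullet> g x) + t\<^sup>2 * (LINT x|M. (norm (g x))\<^sup>2)"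
    using assms square_integrable_inner[OF assms] by (simp add: square_integrable_def)
  finally show ?thesis .
qed

lemma Cauchy_Schwarz_integral:
  assumes "square_integrable M f" "square_integrable M g"
  shows "(LINT x|M. f x \<bullet> g x)\<^sup>2 \<le> (LINT x|M. (norm (f x))\<^sup>2) * (LINT x|M. (norm (g x))\<^sup>2)"
proof (rule quadratic_nonneg_discriminant)
  fix t :: real
  have "0 \<le> (LINT x|M. (norm (f x + t *\<^sub>R g x))\<^sup>2)" by simp
  then show "0 \<le> (LINT x|M. (norm (f x))\<^sup>2) + 2 * t * (LINT x|M. f x \<bullet> g x) + t\<^sup>2 * (LINT x|M. (norm (g x))\<^sup>2)"
    by (simp add: integral_norm_add_scaleR[OF assms])
qed simp

lemma square_integrable_Pair:
  assumes "square_integrable M f" "square_integrable M g"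
  shows "square_integrable M (\<lambda>x. (f x, g x))"
proof -
  note [measurable] = assms[THEN square_integrable_measurable]
  have "integrable M (\<lambda>x. (norm (f x))\<^sup>2 + (norm (g x))\<^sup>2)"
    using assms by (auto simp: square_integrable_def)
  then show ?thesis
    by (simp add: square_integrable_def norm_Pair)
qed

lemma square_integrable_fst_snd:
  fixes f :: "'x \<Rightarrow> 'b::euclidean_space \<times> 'c::euclidean_space"
  assumes "square_integrable M f"
  shows "square_integrable M (\<lambda>x. fst (f x))" "square_integrable M (\<lambda>x. snd (f x))"
proof -
  note [measurable] = assms[THEN square_integrable_measurable]
  have i: "integrable M (\<lambda>x. (norm (f x))\<^sup>2)" using assms by (simp add: square_integrable_def)
  have m: "(\<lambda>x. fst (f x)) \<in> borel_measurable M" "(\<lambda>x. snd (f x)) \<in> borel_measurable M"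
    by (rule borel_measurable_continuous_onI[THEN measurable_compose[rotated], rotated];
        auto intro!: continuous_intros)+
  note [measurable] = m
  have "norm (fst z) \<le> norm z" "norm (snd z) \<le> norm z" for z :: "'b \<times> 'c"
    by (metis norm_fst_le prod.collapse, metis norm_snd_le prod.collapse)
  note le = this
  have "integrable M (\<lambda>x. (norm (fst (f x)))\<^sup>2)" "integrable M (\<lambda>x. (norm (snd (f x)))\<^sup>2)"
    by (rule Bochner_Integration.integrable_bound[OF i]; use le in \<open>simp add: power_mono\<close>)+
  then show "square_integrable M (\<lambda>x. fst (f x))" "square_integrable M (\<lambda>x. snd (f x))"
    using m by (simp_all add: square_integrable_def)
qed

lemma tendsto_integral_inner:
  assumes "\<And>n. square_integrable M (f n)" "square_integrable M F" "square_integrable M g"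
    and lim: "(\<lambda>n. LINT x|M. (norm (f n x - F x))\<^sup>2) \<longlonglongrightarrow> 0"
  shows "(\<lambda>n. LINT x|M. f n x \<bullet> g x) \<longlonglongrightarrow> (LINT x|M. F x \<bullet> g x)"
proof -
  have "(\<lambda>n. (LINT x|M. (f n x - F x) \<bullet> g x)) \<longlonglongrightarrow> 0"
  proof (rule tendsto_0_le[where K=1])
    show "(\<lambda>n. sqrt ((LINT x|M. (norm (f n x - F x))\<^sup>2) * (LINT x|M. (norm (g x))\<^sup>2))) \<longlonglongrightarrow> 0"
      using tendsto_real_sqrt[OF tendsto_mult_left_zero[OF lim]] by simp
    show "\<forall>\<^sub>F n in sequentially. norm (LINT x|M. (f n x - F x) \<bullet> g x)
      \<le> norm (sqrt ((LINT x|M. (norm (f n x - F x))\<^sup>2) * (LINT x|M. (norm (g x))\<^sup>2))) * 1"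
    proof (rule always_eventually, rule allI)
      fix n
      have "\<bar>LINT x|M. (f n x - F x) \<bullet> g x\<bar> \<le> sqrt ((LINT x|M. (norm (f n x - F x))\<^sup>2) * (LINT x|M. (norm (g x))\<^sup>2))"
        by (rule real_le_rsqrt) (use Cauchy_Schwarz_integral[OF square_integrable_diff[OF assms(1)[of n] assms(2)] assms(3)] in simp)
      then show "norm (LINT x|M. (f n x - F x) \<bullet> g x)
        \<le> norm (sqrt ((LINT x|M. (norm (f n x - F x))\<^sup>2) * (LINT x|M. (norm (g x))\<^sup>2))) * 1"
        by simp
    qed
  qed
  then have "(\<lambda>n. (LINT x|M. (f n x - F x) \<bullet> g x) + (LINT x|M. F x \<bullet> g x)) \<longlonglongrightarrow> 0 + (LINT x|M. F x \<bullet> g x)"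
    by (intro tendsto_intros)
  moreover have "(LINT x|M. (f n x - F x) \<bullet> g x) = (LINT x|M. f n x \<bullet> g x) - (LINT x|M. F x \<bullet> g x)" for n
    by (simp add: inner_diff_left square_integrable_inner[OF assms(1,3)] square_integrable_inner[OF assms(2,3)])
  ultimately show ?thesis by simp
qed

text \<open>Along a rapidly Cauchy subsequence the increments are almost everywhere eventually below
  \<open>2 ^ -k\<close>, because \<open>\<Sum>k. 4 ^ k * |increment k|\<^sup>2\<close> is integrable.\<close>

lemma square_integrable_rapidly_Cauchy_AE:
  fixes f :: "nat \<Rightarrow> 'x \<Rightarrow> 'b::euclidean_space"
  assumes sq: "\<And>n. square_integrable M (f n)"
    and fast: "\<And>k. (LINT x|M. (norm (f (Suc k) x - f k x))\<^sup>2) \<le> (1/8) ^ k"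
  shows "AE x in M. convergent (\<lambda>k. f k x)"
proof -
  define g where "g = (\<lambda>k x. 4 ^ k * (norm (f (Suc k) x - f k x))\<^sup>2)"
  note [measurable] = sq[THEN square_integrable_measurable]
  have [measurable]: "g k \<in> borel_measurable M" for k unfolding g_def by measurable
  have g_int: "integrable M (g k)" for k
    using square_integrable_diff[OF sq[of "Suc k"] sq[of k]] by (auto simp: g_def square_integrable_def)
  have "(\<integral>\<^sup>+x. (\<Sum>k. ennreal (g k x)) \<partial>M) = (\<Sum>k. (\<integral>\<^sup>+x. ennreal (g k x) \<partial>M))"
    by (rule nn_integral_suminf) measurable
  also have "\<dots> \<le> (\<Sum>k. ennreal ((1/2) ^ k))"
  proof (rule suminf_le)
    fix k
    have "(\<integral>\<^sup>+x. ennreal (g k x) \<partial>M) = ennreal (LINT x|M. g k x)"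
      by (rule nn_integral_eq_integral[OF g_int]) (auto simp: g_def)
    also have "(LINT x|M. g k x) \<le> 4 ^ k * (1/8) ^ k"
      unfolding g_def using fast[of k] by simp
    \<comment> \<open>The rate 1/8 beats the weight 4, leaving a convergent geometric
      series.\<close>
    also have "(4::real) ^ k * (1/8) ^ k = (1/2) ^ k"
      by (simp flip: power_mult_distrib)
    finally show "(\<integral>\<^sup>+x. ennreal (g k x) \<partial>M) \<le> ennreal ((1/2) ^ k)" by (simp add: ennreal_leI)
  qed auto
  also have "\<dots> < \<infinity>"
    using summable_geometric[of "1/2::real"] by (subst suminf_ennreal2) auto
  finally have "AE x in M. (\<Sum>k. ennreal (g k x)) \<noteq> \<infinity>"
    by (intro nn_integral_PInf_AE) (auto simp: less_top)
  then show ?thesis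
  proof (rule AE_mp, intro AE_I2 impI)
    fix x assume "(\<Sum>k. ennreal (g k x)) \<noteq> \<infinity>"
    then have "summable (\<lambda>k. g k x)"
      by (subst summable_iff_suminf_neq_top[symmetric] summable_suminf_not_top)
         (auto simp: g_def intro!: summable_suminf_not_top)
    then have "(\<lambda>k. g k x) \<longlonglongrightarrow> 0" by (rule summable_LIMSEQ_zero)
    then have "eventually (\<lambda>k. g k x < 1) sequentially"
      by (rule order_tendstoD) simp
    then have "eventually (\<lambda>k. norm (norm (f (Suc k) x - f k x)) \<le> (1/2) ^ k) sequentially"
    proof eventually_elim
      case (elim k)
      have "(2 ^ k * norm (f (Suc k) x - f k x))\<^sup>2 = g k x"
        using power_mult_distrib[of "2::real" 2 k, symmetric]
        by (simp add: g_def power_mult_distrib power2_eq_square)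
      then have "(2 ^ k * norm (f (Suc k) x - f k x))\<^sup>2 \<le> 1\<^sup>2" using elim by simp
      then have "2 ^ k * norm (f (Suc k) x - f k x) \<le> 1" by (rule power2_le_imp_le) simp
      then show ?case by (simp add: field_simps)
    qed
    then have "summable (\<lambda>k. norm (f (Suc k) x - f k x))"
      by (rule summable_comparison_test_ev) (simp add: summable_geometric)
    then have "summable (\<lambda>k. f (Suc k) x - f k x)" by (rule summable_norm_cancel)
    then have "convergent (\<lambda>n. f 0 x + (\<Sum>k<n. f (Suc k) x - f k x))"
      by (intro convergent_add convergent_const) (simp add: summable_iff_convergent)
    moreover have "f 0 x + (\<Sum>k<n. f (Suc k) x - f k x) = f n x" for n
      using sum_lessThan_telescope[of "\<lambda>k. f k x" n] by simp
    ultimately show "convergent (\<lambda>k. f k x)"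
      by (simp only:)
  qed
qed

text \<open>Fatou's lemma for the squared norms.\<close>

lemma square_integrable_limit:
  fixes f :: "nat \<Rightarrow> 'x \<Rightarrow> 'b::euclidean_space"
  assumes sq: "\<And>n. square_integrable M (f n)" and [measurable]: "F \<in> borel_measurable M"
    and lim: "AE x in M. (\<lambda>k. f k x) \<longlonglongrightarrow> F x"
    and bd: "\<And>k. (LINT x|M. (norm (f k x))\<^sup>2) \<le> e"
  shows "square_integrable M F" "(LINT x|M. (norm (F x))\<^sup>2) \<le> e"
proof -
  note [measurable] = sq[THEN square_integrable_measurable]
  have e: "0 \<le> e" using bd[of 0] order_trans[OF _ bd[of 0]] by simp
  have "(\<integral>\<^sup>+x. ennreal ((norm (F x))\<^sup>2) \<partial>M) = (\<integral>\<^sup>+x. liminf (\<lambda>k. ennreal ((norm (f k x))\<^sup>2)) \<partial>M)"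
  proof (rule nn_integral_cong_AE, rule AE_mp[OF lim], intro AE_I2 impI)
    fix x assume "(\<lambda>k. f k x) \<longlonglongrightarrow> F x"
    then have "(\<lambda>k. ennreal ((norm (f k x))\<^sup>2)) \<longlonglongrightarrow> ennreal ((norm (F x))\<^sup>2)"
      by (intro tendsto_ennrealI tendsto_intros)
    then show "ennreal ((norm (F x))\<^sup>2) = liminf (\<lambda>k. ennreal ((norm (f k x))\<^sup>2))"
      by (rule lim_imp_Liminf[OF trivial_limit_sequentially, symmetric])
  qed
  also have "\<dots> \<le> liminf (\<lambda>k. \<integral>\<^sup>+x. ennreal ((norm (f k x))\<^sup>2) \<partial>M)"
    by (rule nn_integral_liminf) measurable
  also have "\<dots> \<le> ennreal e"
  proof (rule Liminf_le, simp, rule always_eventually, rule allI)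
    fix k
    have "(\<integral>\<^sup>+x. ennreal ((norm (f k x))\<^sup>2) \<partial>M) = ennreal (LINT x|M. (norm (f k x))\<^sup>2)"
      by (rule nn_integral_eq_integral) (use sq in \<open>auto simp: square_integrable_def\<close>)
    then show "(\<integral>\<^sup>+x. ennreal ((norm (f k x))\<^sup>2) \<partial>M) \<le> ennreal e"
      using bd[of k] by (simp add: ennreal_leI)
  qed
  finally have le: "(\<integral>\<^sup>+x. ennreal ((norm (F x))\<^sup>2) \<partial>M) \<le> ennreal e" .
  have "integrable M (\<lambda>x. (norm (F x))\<^sup>2)"
    by (rule integrableI_bounded) (use le in \<open>auto intro: le_less_trans\<close>)
  then show "square_integrable M F" by (simp add: square_integrable_def)
  show "(LINT x|M. (norm (F x))\<^sup>2) \<le> e"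
    using le nn_integral_eq_integral[OF \<open>integrable M (\<lambda>x. (norm (F x))\<^sup>2)\<close>] e
    by (simp add: ennreal_le_iff)
qed

text \<open>The Riesz-Fischer theorem: a rapidly Cauchy subsequence converges almost everywhere, and
  Fatou's lemma turns its limit into a limit in \<open>L\<^sup>2\<close>.\<close>

lemma square_integrable_complete:
  fixes f :: "nat \<Rightarrow> 'x \<Rightarrow> 'b::euclidean_space"
  assumes sq: "\<And>n. square_integrable M (f n)"
    and cauchy: "\<And>e. e > 0 \<Longrightarrow> \<exists>N. \<forall>m\<ge>N. \<forall>n\<ge>N. (LINT x|M. (norm (f m x - f n x))\<^sup>2) \<le> e"
  obtains F where "square_integrable M F" "(\<lambda>n. LINT x|M. (norm (f n x - F x))\<^sup>2) \<longlonglongrightarrow> 0"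
proof -
  have "\<forall>k. \<exists>N. \<forall>m\<ge>N. \<forall>n\<ge>N. (LINT x|M. (norm (f m x - f n x))\<^sup>2) \<le> (1/8) ^ k"
    using cauchy by simp
  then obtain N where N: "\<And>k m n. m \<ge> N k \<Longrightarrow> n \<ge> N k \<Longrightarrow> (LINT x|M. (norm (f m x - f n x))\<^sup>2) \<le> (1/8) ^ k"
    by metis
  \<comment> \<open>Summing the thresholds puts both \<open>r k\<close> and \<open>r (Suc k)\<close>
    above \<open>N k\<close>; the summand \<open>k\<close> makes \<open>r\<close> unbounded.\<close>
  define r where "r k = (\<Sum>i\<le>k. N i) + k" for k
  have rN: "r k \<ge> N k" "r (Suc k) \<ge> N k" "r k \<ge> k" for k
  proof -
    have "N k \<le> (\<Sum>i\<le>k. N i)" by (rule member_le_sum) auto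
    then show "r k \<ge> N k" "r (Suc k) \<ge> N k" "r k \<ge> k" unfolding r_def by simp_all
  qed
  note [measurable] = sq[THEN square_integrable_measurable]
  have conv: "AE x in M. convergent (\<lambda>k. f (r k) x)"
  proof (rule square_integrable_rapidly_Cauchy_AE)
    show "square_integrable M (f (r n))" for n by (rule sq)
    show "(LINT x|M. (norm (f (r (Suc k)) x - f (r k) x))\<^sup>2) \<le> (1/8) ^ k" for k
      by (rule N) (rule rN)+
  qed
  define F where "F x = lim (\<lambda>k. f (r k) x)" for x
  have [measurable]: "F \<in> borel_measurable M" unfolding F_def by measurable
  have lim: "AE x in M. (\<lambda>k. f (r k) x) \<longlonglongrightarrow> F x"
    using conv by eventually_elim (simp add: F_def convergent_LIMSEQ_iff)
  \<comment> \<open>Fatou's lemma along \<open>f (r (k + K)) - f m\<close>; the shift by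
    \<open>K\<close> keeps all indices in the range where the Cauchy bound holds.\<close>
  have tail: "square_integrable M (\<lambda>x. F x - f m x) \<and> (LINT x|M. (norm (F x - f m x))\<^sup>2) \<le> e"
    if K: "\<forall>m\<ge>K. \<forall>n\<ge>K. (LINT x|M. (norm (f m x - f n x))\<^sup>2) \<le> e" and m: "m \<ge> K" for K m e
  proof -
    have 1: "square_integrable M (\<lambda>x. f (r (k + K)) x - f m x)" for k
      by (intro square_integrable_diff sq)
    have 2: "AE x in M. (\<lambda>k. f (r (k + K)) x - f m x) \<longlonglongrightarrow> F x - f m x"
      using lim
    proof eventually_elim
      case (elim x)
      show ?case using LIMSEQ_ignore_initial_segment[OF elim, of K] by (intro tendsto_intros)
    qed
    have "r (k + K) \<ge> K" for k using rN(3)[of "k + K"] by simp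
    then have 3: "(LINT x|M. (norm (f (r (k + K)) x - f m x))\<^sup>2) \<le> e" for k
      using K m by blast
    show ?thesis using square_integrable_limit[OF 1 _ 2 3] by simp
  qed
  obtain K where K: "\<forall>m\<ge>K. \<forall>n\<ge>K. (LINT x|M. (norm (f m x - f n x))\<^sup>2) \<le> 1"
    using cauchy[of 1] by auto
  have F: "square_integrable M F"
    using square_integrable_add[OF tail[OF K order_refl, THEN conjunct1] sq[of K]] by simp
  have "(\<lambda>n. LINT x|M. (norm (f n x - F x))\<^sup>2) \<longlonglongrightarrow> 0"
  proof (rule LIMSEQ_I)
    fix e :: real assume "e > 0"
    then obtain K where K: "\<forall>m\<ge>K. \<forall>n\<ge>K. (LINT x|M. (norm (f m x - f n x))\<^sup>2) \<le> e / 2"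
      using cauchy[of "e/2"] by auto
    have "norm ((LINT x|M. (norm (f n x - F x))\<^sup>2) - 0) < e" if "n \<ge> K" for n
      using tail[OF K that] \<open>e > 0\<close> by (simp add: norm_minus_commute)
    then show "\<exists>no. \<forall>n\<ge>no. norm ((LINT x|M. (norm (f n x - F x))\<^sup>2) - 0) < e" by blast
  qed
  with F show thesis by (rule that)
qed

section \<open>Riesz representation\<close>

text \<open>The form is attached to a subset of a type, because the Sobolev form is bilinear only on
  the function space and not on all of \<open>ae_fun\<close>.\<close>

locale semi_inner =
  fixes V :: "'v::real_vector set" and ip :: "'v \<Rightarrow> 'v \<Rightarrow> real"
  assumes subspace_V: "subspace V"
    and ip_sym: "u \<in> V \<Longrightarrow> v \<in> V \<Longrightarrow> ip u v = ip v u"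
    and ip_add: "u \<in> V \<Longrightarrow> v \<in> V \<Longrightarrow> w \<in> V \<Longrightarrow> ip (u + v) w = ip u w + ip v w"
    and ip_scale: "u \<in> V \<Longrightarrow> w \<in> V \<Longrightarrow> ip (r *\<^sub>R u) w = r * ip u w"
    and ip_nonneg: "u \<in> V \<Longrightarrow> 0 \<le> ip u u"
begin

lemma V_closed: "u \<in> V \<Longrightarrow> v \<in> V \<Longrightarrow> u + v \<in> V" "u \<in> V \<Longrightarrow> r *\<^sub>R u \<in> V"
  "u \<in> V \<Longrightarrow> v \<in> V \<Longrightarrow> u - v \<in> V" "0 \<in> V"
  using subspace_V by (auto simp: subspace_add subspace_scale subspace_diff subspace_0)

lemma ip_add_right: "u \<in> V \<Longrightarrow> v \<in> V \<Longrightarrow> w \<in> V \<Longrightarrow> ip w (u + v) = ip w u + ip w v"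
  using ip_sym[of w "u + v"] ip_add[of u v w] ip_sym[of u w] ip_sym[of v w] by (simp add: V_closed)

lemma ip_scale_right: "u \<in> V \<Longrightarrow> w \<in> V \<Longrightarrow> ip w (r *\<^sub>R u) = r * ip w u"
  using ip_sym[of w "r *\<^sub>R u"] ip_scale[of u w r] ip_sym[of u w] by (simp add: V_closed)

lemma ip_add_scale_sq: "u \<in> V \<Longrightarrow> v \<in> V \<Longrightarrow> ip (u + t *\<^sub>R v) (u + t *\<^sub>R v) = ip u u + 2 * t * ip u v + t\<^sup>2 * ip v v"
  by (simp add: ip_add ip_add_right ip_scale ip_scale_right V_closed ip_sym[of v u] power2_eq_square algebra_simps)

text \<open>Direct method: minimize \<open>J v = ip v v - 2 * F v\<close>. The parallelogram
  identity makes a minimizing sequence Cauchy, and the first variation at the limit is the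
  representation.\<close>

lemma Riesz:
  assumes complete: "\<And>f :: nat \<Rightarrow> 'v. (\<And>n. f n \<in> V) \<Longrightarrow>
      (\<And>e. e > 0 \<Longrightarrow> \<exists>N. \<forall>m\<ge>N. \<forall>n\<ge>N. ip (f m - f n) (f m - f n) \<le> e) \<Longrightarrow>
      \<exists>w\<in>V. (\<lambda>n. ip (f n - w) (f n - w)) \<longlonglongrightarrow> 0"
    and F_add: "\<And>u v. u \<in> V \<Longrightarrow> v \<in> V \<Longrightarrow> F (u + v) = F u + F v"
    and F_scale: "\<And>u r. u \<in> V \<Longrightarrow> F (r *\<^sub>R u) = r * F u"
    and F_bounded: "\<And>u. u \<in> V \<Longrightarrow> (F u)\<^sup>2 \<le> C * ip u u"
  obtains w where "w \<in> V" "\<And>v. v \<in> V \<Longrightarrow> ip w v = F v"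
proof -
  define J where "J v = ip v v - 2 * F v" for v
  have C: "0 \<le> \<bar>C\<bar>" by simp
  have J_bd: "- \<bar>C\<bar> \<le> J v" if "v \<in> V" for v
  proof -
    have "(F v)\<^sup>2 \<le> \<bar>C\<bar> * ip v v"
      using F_bounded[OF that] ip_nonneg[OF that] by (meson abs_ge_self mult_right_mono order_trans)
    moreover have "0 \<le> (\<bar>C\<bar> - ip v v)\<^sup>2" by simp
    \<comment> \<open>Chain: \<open>(2 * F v)\<^sup>2 \<le> 4 * \<bar>C\<bar> * ip v v \<le>
      (\<bar>C\<bar> + ip v v)\<^sup>2\<close>, the last step being the displayed square.\<close>
    ultimately have "(2 * F v)\<^sup>2 \<le> (\<bar>C\<bar> + ip v v)\<^sup>2"
      by (simp add: power2_eq_square algebra_simps)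
    then have "2 * F v \<le> \<bar>C\<bar> + ip v v"
      by (rule power2_le_imp_le) (use ip_nonneg[OF that] in simp)
    then show ?thesis by (simp add: J_def)
  qed
  define m where "m = (INF v\<in>V. J v)"
  have bdd: "bdd_below (J ` V)" using J_bd by (auto intro!: bdd_belowI2)
  have m_le: "m \<le> J v" if "v \<in> V" for v
    unfolding m_def by (rule cINF_lower[OF bdd that])
  have "\<exists>v\<in>V. J v < m + 1 / real (Suc n)" for n
    using cINF_less_iff[of V J "m + 1 / real (Suc n)"] bdd V_closed(4)
    unfolding m_def[symmetric] by auto
  then obtain f where f: "\<And>n. f n \<in> V" "\<And>n. J (f n) < m + 1 / real (Suc n)"
    by metis
  \<comment> \<open>The value of \<open>J\<close> at the midpoint is at least the infimum
    \<open>m\<close>, so two almost minimizers must be close.\<close>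
  have par: "ip (u - v) (u - v) \<le> 2 * (J u - m) + 2 * (J v - m)" if "u \<in> V" "v \<in> V" for u v
  proof -
    have "m \<le> J ((1/2) *\<^sub>R (u + v))" using that by (intro m_le V_closed)
    also have "J ((1/2) *\<^sub>R (u + v)) = (ip u u + 2 * ip u v + ip v v) / 4 - (F u + F v)"
      using that by (simp add: J_def ip_scale ip_scale_right V_closed ip_add ip_add_right F_scale F_add ip_sym[of v u] field_simps)
    finally have "m \<le> (ip u u + 2 * ip u v + ip v v) / 4 - (F u + F v)" .
    moreover have "ip (u - v) (u - v) = ip u u - 2 * ip u v + ip v v"
      using ip_add_scale_sq[OF that, of "-1"] by simp
    ultimately show ?thesis by (simp add: J_def field_simps)
  qed
  have "\<exists>w\<in>V. (\<lambda>n. ip (f n - w) (f n - w)) \<longlonglongrightarrow> 0"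
  proof (rule complete[OF f(1)])
    fix e :: real assume "e > 0"
    then obtain N where N: "1 / real (Suc N) < e / 4"
      by (metis nat_approx_posE divide_pos_pos zero_less_numeral)
    have J_small: "J (f n) - m \<le> e / 4" if "n \<ge> N" for n
    proof -
      have "1 / real (Suc n) \<le> 1 / real (Suc N)" using that by (intro divide_left_mono) auto
      then show ?thesis using f(2)[of n] N by linarith
    qed
    have "ip (f k - f n) (f k - f n) \<le> e" if "k \<ge> N" "n \<ge> N" for k n
    proof -
      have "ip (f k - f n) (f k - f n) \<le> 2 * (J (f k) - m) + 2 * (J (f n) - m)"
        by (rule par[OF f(1) f(1)])
      also have "\<dots> \<le> 2 * (e / 4) + 2 * (e / 4)"
        by (intro add_mono mult_left_mono J_small that) auto
      finally show ?thesis by simp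
    qed
    then show "\<exists>N. \<forall>m\<ge>N. \<forall>n\<ge>N. ip (f m - f n) (f m - f n) \<le> e" by blast
  qed
  then obtain w where w: "w \<in> V" "(\<lambda>n. ip (f n - w) (f n - w)) \<longlonglongrightarrow> 0" by blast
  have cs: "(ip u v)\<^sup>2 \<le> ip u u * ip v v" if "u \<in> V" "v \<in> V" for u v
    by (rule quadratic_nonneg_discriminant)
       (use ip_add_scale_sq[OF that] ip_nonneg that V_closed in metis)+
  have sq_to_0: "(\<lambda>n. G (f n - w)) \<longlonglongrightarrow> 0" if "\<And>u. u \<in> V \<Longrightarrow> (G u)\<^sup>2 \<le> B * ip u u" for G B
  proof -
    have "(\<lambda>n. (G (f n - w))\<^sup>2) \<longlonglongrightarrow> 0"
      by (rule tendsto_sandwich[OF _ _ tendsto_const tendsto_mult_right_zero[OF w(2), of B]])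
         (use that f(1) w(1) V_closed in auto)
    then show ?thesis
      using tendsto_real_sqrt[of "\<lambda>n. (G (f n - w))\<^sup>2" 0] by (simp add: tendsto_rabs_zero_iff)
  qed
  have F0: "(\<lambda>n. F (f n - w)) \<longlonglongrightarrow> 0" by (rule sq_to_0[OF F_bounded])
  have ip0: "(\<lambda>n. ip w (f n - w)) \<longlonglongrightarrow> 0"
    by (rule sq_to_0[of _ "ip w w"]) (use cs w(1) in auto)
  have J_eq: "J (f n) = J w + 2 * ip w (f n - w) + ip (f n - w) (f n - w) - 2 * F (f n - w)" for n
  proof -
    have "f n - w \<in> V" using f(1) w(1) V_closed by auto
    then show ?thesis
      using F_add[of w "f n - w"] ip_add_scale_sq[of w "f n - w" 1] w(1) by (simp add: J_def)
  qed
  have "(\<lambda>n. J (f n)) \<longlonglongrightarrow> J w + 2 * 0 + 0 - 2 * 0"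
    unfolding J_eq by (intro tendsto_intros F0 ip0 w(2))
  moreover have "(\<lambda>n. m + 1 / real (Suc n)) \<longlonglongrightarrow> m + 0"
    by (intro tendsto_intros LIMSEQ_Suc lim_1_over_n)
  ultimately have "J w + 2 * 0 + 0 - 2 * 0 \<le> m + 0"
    by (rule LIMSEQ_le) (use f(2) less_imp_le in blast)
  then have Jw: "J w \<le> m" by simp
  have "ip w v = F v" if "v \<in> V" for v
  proof -
    \<comment> \<open>Minimality of \<open>w\<close> along the line \<open>w + t *\<^sub>R v\<close>
      is a nonnegative quadratic in \<open>t\<close> with constant term 0, hence its linear
      coefficient vanishes.\<close>
    have "(ip w v - F v)\<^sup>2 \<le> 0 * ip v v"
    proof (rule quadratic_nonneg_discriminant)
      fix t :: real
      have "J (w + t *\<^sub>R v) = J w + 2 * t * (ip w v - F v) + t\<^sup>2 * ip v v"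
        using that w(1) by (simp add: J_def ip_add_scale_sq F_add F_scale V_closed algebra_simps)
      moreover have "m \<le> J (w + t *\<^sub>R v)" using that w(1) by (intro m_le V_closed)
      ultimately show "0 \<le> 0 + 2 * t * (ip w v - F v) + t\<^sup>2 * ip v v" using Jw by linarith
    qed (use ip_nonneg that in auto)
    then show ?thesis by simp
  qed
  with w(1) show thesis by (rule that)
qed

end

section \<open>Integrals of test functions\<close>

lemma integrable_compact_support:
  fixes f :: "'a::euclidean_space \<Rightarrow> 'b::euclidean_space"
  assumes "continuous_on UNIV f" "compact C" "\<And>x. x \<notin> C \<Longrightarrow> f x = 0"
  shows "integrable lborel f"
proof -
  have "integrable lborel (\<lambda>x. indicator C x *\<^sub>R f x)"
    using assms continuous_on_subset by (blast intro: borel_integrable_compact)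
  moreover have "indicator C x *\<^sub>R f x = f x" for x
    using assms(3) by (auto simp: indicator_def)
  ultimately show ?thesis by simp
qed

lemma integrable_lebesgue_on_of_lborel:
  fixes f :: "'a::euclidean_space \<Rightarrow> 'b::euclidean_space"
  assumes "integrable lborel f" "\<Omega> \<in> sets lebesgue"
  shows "integrable (lebesgue_on \<Omega>) f"
proof -
  have "integrable lebesgue f"
    using assms(1) by (subst integrable_completion) auto
  then have "integrable lebesgue (\<lambda>x. indicator \<Omega> x *\<^sub>R f x)"
    by (rule integrable_mult_indicator[OF assms(2)])
  then show ?thesis
    using assms(2) by (subst integrable_restrict_space) auto
qed

lemma integral_lebesgue_on_eq_lborel:
  fixes f :: "'a::euclidean_space \<Rightarrow> 'b::euclidean_space"
  assumes "f \<in> borel_measurable borel" "\<Omega> \<in> sets lebesgue" "\<And>x. x \<notin> \<Omega> \<Longrightarrow> f x = 0"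
  shows "(LINT x|lebesgue_on \<Omega>. f x) = (LINT x|lborel. f x)"
proof -
  have "(LINT x|lebesgue_on \<Omega>. f x) = (LINT x|lebesgue. indicator \<Omega> x *\<^sub>R f x)"
    using assms(2) by (subst integral_restrict_space) auto
  also have "\<dots> = (LINT x|lebesgue. f x)"
    by (rule Bochner_Integration.integral_cong) (use assms(3) in \<open>auto simp: indicator_def\<close>)
  also have "\<dots> = (LINT x|lborel. f x)"
    using assms(1) by (intro integral_completion) auto
  finally show ?thesis .
qed

lemma borel_measurable_continuous_lebesgue_on:
  "continuous_on UNIV f \<Longrightarrow> f \<in> borel_measurable (lebesgue_on \<Omega>)"
  by (intro measurable_restrict_space1 measurable_completion) (auto intro: borel_measurable_continuous_onI)

lemma square_integrable_compact_support:
  fixes f :: "'a::euclidean_space \<Rightarrow> 'b::euclidean_space"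
  assumes "continuous_on UNIV f" "compact C" "\<And>x. x \<notin> C \<Longrightarrow> f x = 0" "\<Omega> \<in> sets lebesgue"
  shows "square_integrable (lebesgue_on \<Omega>) f"
proof -
  have "integrable lborel (\<lambda>x. (norm (f x))\<^sup>2)"
    by (rule integrable_compact_support[OF _ assms(2)])
       (use assms in \<open>auto intro!: continuous_intros\<close>)
  then show ?thesis
    unfolding square_integrable_def
    using integrable_lebesgue_on_of_lborel[OF _ assms(4)] borel_measurable_continuous_lebesgue_on[OF assms(1)]
    by blast
qed

lemma test_function_square_integrable:
  assumes "test_function \<Omega>' \<eta>" "\<Omega> \<in> sets lebesgue"
  shows "square_integrable (lebesgue_on \<Omega>) \<eta>" "square_integrable (lebesgue_on \<Omega>) (gradient \<eta>)"
proof -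
  obtain C where *: "compact C" "\<And>x. x \<notin> C \<Longrightarrow> \<eta> x = 0"
    using assms by (metis test_functionE)
  show "square_integrable (lebesgue_on \<Omega>) \<eta>"
    by (rule square_integrable_compact_support[OF continuous_on_test_function[OF assms(1)] * assms(2)])
  show "square_integrable (lebesgue_on \<Omega>) (gradient \<eta>)"
    by (rule square_integrable_compact_support[OF continuous_on_gradient[OF assms(1)] *(1)
          gradient_support[OF assms(1) *] assms(2)])
qed

lemma test_function_integrable:
  assumes "test_function \<Omega> \<eta>"
  shows "integrable lborel \<eta>"
proof -
  obtain C where *: "compact C" "\<And>x. x \<notin> C \<Longrightarrow> \<eta> x = 0"
    using assms by (metis test_functionE)
  show ?thesis
    by (rule integrable_compact_support[OF continuous_on_test_function[OF assms(1)] *])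
qed

lemma lborel_integral_translate:
  fixes f :: "'a::euclidean_space \<Rightarrow> 'b::euclidean_space"
  assumes "f \<in> borel_measurable borel"
  shows "(LINT x|lborel. f (x + v)) = (LINT x|lborel. f x)"
proof -
  have "(LINT x|lborel. f x) = (LINT x|distr lborel borel ((+) v). f x)"
    by (simp add: lborel_distr_plus)
  also have "\<dots> = (LINT x|lborel. f (v + x))"
    using assms by (intro integral_distr) auto
  finally show ?thesis by (simp add: add.commute)
qed

lemma difference_quotient_integral_tendsto:
  assumes \<rho>: "test_function UNIV \<rho>" and w: "w \<in> borel_measurable M" and M: "sets M = sets lebesgue \<or> sets M = sets borel"
    and loc: "\<And>C::'a::euclidean_space set. compact C \<Longrightarrow> integrable M (\<lambda>y. indicator C y * w y)"
    and h: "h \<longlonglongrightarrow> (0::real)" "\<And>n. h n \<noteq> 0"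
  shows "(\<lambda>n. LINT y|M. (\<rho> (y + h n *\<^sub>R v) - \<rho> y) / h n * w y) \<longlonglongrightarrow> (LINT y|M. (gradient \<rho> y \<bullet> v) * w y)"
proof -
  obtain B C where BC: "B > 0" "compact C"
    "\<And>x h. \<bar>h\<bar> \<le> 1 \<Longrightarrow> \<bar>\<rho> (x + h *\<^sub>R v) - \<rho> x\<bar> \<le> \<bar>h\<bar> * (B * indicator C x)"
    using test_function_diff_bound[OF \<rho>] by metis
  note [measurable] = w
  have mborel: "f \<in> borel_measurable M" if "continuous_on UNIV f" for f :: "'a \<Rightarrow> real"
  proof -
    have 1: "f \<in> borel_measurable borel" by (rule borel_measurable_continuous_onI[OF that])
    then have 2: "f \<in> borel_measurable lebesgue" by (intro measurable_completion) simp
    show ?thesis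
      using M
    proof
      assume "sets M = sets lebesgue"
      then show ?thesis using 2 measurable_cong_sets[OF _ refl, of M lebesgue borel] by blast
    next
      assume "sets M = sets borel"
      then show ?thesis using 1 measurable_cong_sets[OF _ refl, of M borel borel] by blast
    qed
  qed
  have [measurable]: "(\<lambda>y. (\<rho> (y + h n *\<^sub>R v) - \<rho> y) / h n) \<in> borel_measurable M" for n
    by (intro mborel continuous_intros continuous_on_compose2[OF continuous_on_test_function[OF \<rho>, of UNIV]])
       (auto simp: h(2))
  have [measurable]: "(\<lambda>y. gradient \<rho> y \<bullet> v) \<in> borel_measurable M"
    by (intro mborel continuous_intros continuous_on_gradient[OF \<rho>])
  obtain N where N: "\<And>n. n \<ge> N \<Longrightarrow> \<bar>h n\<bar> < 1"
    using h(1) unfolding LIMSEQ_def by (force simp: dist_real_def)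
  \<comment> \<open>Dropping the first \<open>N\<close> terms brings \<open>h\<close> into the range
    where the majorant is valid.\<close>
  have "(\<lambda>n. LINT y|M. (\<rho> (y + h (n + N) *\<^sub>R v) - \<rho> y) / h (n + N) * w y) \<longlonglongrightarrow> (LINT y|M. (gradient \<rho> y \<bullet> v) * w y)"
  proof (rule integral_dominated_convergence[where w="\<lambda>y. B * \<bar>indicator C y * w y\<bar>"])
    show "integrable M (\<lambda>y. B * \<bar>indicator C y * w y\<bar>)"
      using loc[OF BC(2)] by auto
    show "AE y in M. (\<lambda>n. (\<rho> (y + h (n + N) *\<^sub>R v) - \<rho> y) / h (n + N) * w y) \<longlonglongrightarrow> (gradient \<rho> y \<bullet> v) * w y"
    proof (rule AE_I2)
      fix y
      have "((\<lambda>t. (\<rho> (y + (0 + t) *\<^sub>R v) - \<rho> (y + 0 *\<^sub>R v)) / t) \<longlongrightarrow> gradient \<rho> y \<bullet> v) (at 0)"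
        using test_function_line_deriv[OF \<rho>, of y v 0] by (simp add: DERIV_def)
      then have "(\<lambda>n. (\<rho> (y + (0 + h (n + N)) *\<^sub>R v) - \<rho> (y + 0 *\<^sub>R v)) / h (n + N)) \<longlonglongrightarrow> gradient \<rho> y \<bullet> v"
        by (rule filterlim_compose)
           (use LIMSEQ_ignore_initial_segment[OF h(1), of N] h(2) in \<open>auto simp: filterlim_at\<close>)
      then show "(\<lambda>n. (\<rho> (y + h (n + N) *\<^sub>R v) - \<rho> y) / h (n + N) * w y) \<longlonglongrightarrow> (gradient \<rho> y \<bullet> v) * w y"
        by (intro tendsto_mult tendsto_const) simp
    qed
    show "AE y in M. norm ((\<rho> (y + h (n + N) *\<^sub>R v) - \<rho> y) / h (n + N) * w y) \<le> B * \<bar>indicator C y * w y\<bar>" for n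
    proof (rule AE_I2)
      fix y
      have "\<bar>\<rho> (y + h (n + N) *\<^sub>R v) - \<rho> y\<bar> / \<bar>h (n + N)\<bar> \<le> B * indicator C y"
        using BC(3)[of "h (n + N)" y] N[of "n + N"] h(2)[of "n + N"]
        by (simp add: pos_divide_le_eq mult.commute)
      from mult_right_mono[OF this abs_ge_zero[of "w y"]]
      show "norm ((\<rho> (y + h (n + N) *\<^sub>R v) - \<rho> y) / h (n + N) * w y) \<le> B * \<bar>indicator C y * w y\<bar>"
        by (simp add: abs_mult mult.assoc)
    qed
  qed measurable
  then show ?thesis by (rule LIMSEQ_offset)
qed

text \<open>By translation invariance every difference quotient of \<open>\<rho>\<close> has
  integral 0; the derivative inherits this in the limit.\<close>

lemma integral_gradient_eq_0:
  assumes "test_function UNIV \<rho>"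
  shows "(LINT x|lborel. gradient \<rho> x \<bullet> v) = 0"
proof -
  let ?h = "\<lambda>n. 1 / real (Suc n)"
  have \<rho>: "\<rho> \<in> borel_measurable borel"
    using assms continuous_on_test_function borel_measurable_continuous_onI by blast
  have "(\<lambda>n. LINT y|lborel. (\<rho> (y + ?h n *\<^sub>R v) - \<rho> y) / ?h n * 1) \<longlonglongrightarrow> (LINT y|lborel. (gradient \<rho> y \<bullet> v) * 1)"
  proof (rule difference_quotient_integral_tendsto[OF assms])
    show "integrable lborel (\<lambda>y. indicator C y * (1::real))" if "compact C" for C :: "'a set"
      using borel_integrable_compact[OF that, of "\<lambda>_. 1::real"] by simp
    show "?h \<longlonglongrightarrow> 0" by (intro LIMSEQ_Suc lim_1_over_n)
  qed auto
  moreover have "(LINT y|lborel. (\<rho> (y + ?h n *\<^sub>R v) - \<rho> y) / ?h n * 1) = 0" for n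
  proof -
    have "test_function UNIV (\<lambda>y. \<rho> (?h n *\<^sub>R v + id y))"
      by (intro test_function_affine assms) (auto simp: linear_id linear_iff)
    then have "integrable lborel (\<lambda>y. \<rho> (y + ?h n *\<^sub>R v))"
      using test_function_integrable by (fastforce simp: add.commute)
    then show ?thesis
      using test_function_integrable[OF assms] lborel_integral_translate[OF \<rho>, of "?h n *\<^sub>R v"]
      by (simp del: of_nat_Suc)
  qed
  ultimately show ?thesis
    by (simp add: LIMSEQ_const_iff)
qed

text \<open>The gradient of the product \<open>\<eta> * \<zeta>\<close> integrates to zero in each
  direction \<open>v\<close>.\<close>

lemma test_function_integration_by_parts:
  fixes \<Omega> :: "'a::euclidean_space set"
  assumes "test_function \<Omega> \<eta>" "test_function \<Omega> \<zeta>" "\<Omega> \<in> sets lebesgue"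
  shows "(LINT x|lebesgue_on \<Omega>. \<eta> x *\<^sub>R gradient \<zeta> x) = - (LINT x|lebesgue_on \<Omega>. \<zeta> x *\<^sub>R gradient \<eta> x)"
proof (rule vector_eq_ldot[THEN iffD1], rule allI)
  fix v :: 'a
  let ?M = "lebesgue_on \<Omega>"
  note sq = test_function_square_integrable[OF assms(1,3)] test_function_square_integrable[OF assms(2,3)]
  have i1: "integrable ?M (\<lambda>x. \<eta> x *\<^sub>R gradient \<zeta> x)" and i2: "integrable ?M (\<lambda>x. \<zeta> x *\<^sub>R gradient \<eta> x)"
    using sq by (auto intro: square_integrable_mult_scaleR)
  have p: "test_function \<Omega> (\<lambda>x. \<eta> x * \<zeta> x)" by (intro test_function_mult assms)
  obtain C where C: "compact C" "C \<subseteq> \<Omega>" "\<And>x. x \<notin> C \<Longrightarrow> \<eta> x * \<zeta> x = 0"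
    by (rule test_functionE[OF p]) blast
  have "(LINT x|?M. v \<bullet> (\<eta> x *\<^sub>R gradient \<zeta> x)) + (LINT x|?M. v \<bullet> (\<zeta> x *\<^sub>R gradient \<eta> x))
     = (LINT x|?M. gradient (\<lambda>x. \<eta> x * \<zeta> x) x \<bullet> v)"
    using integrable_inner_right[OF i1, of v] integrable_inner_right[OF i2, of v]
    by (subst Bochner_Integration.integral_add[symmetric])
       (auto simp: gradient_mult[OF assms(1,2)] inner_commute[of _ v] inner_add_right simp del: integral_inner_right)
  also have "\<dots> = (LINT x|lborel. gradient (\<lambda>x. \<eta> x * \<zeta> x) x \<bullet> v)"
  proof (rule integral_lebesgue_on_eq_lborel[OF _ assms(3)])
    show "(\<lambda>x. gradient (\<lambda>x. \<eta> x * \<zeta> x) x \<bullet> v) \<in> borel_measurable borel"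
      by (intro borel_measurable_continuous_onI continuous_intros continuous_on_gradient[OF p])
    show "gradient (\<lambda>x. \<eta> x * \<zeta> x) x \<bullet> v = 0" if "x \<notin> \<Omega>" for x
      using gradient_support[OF p C(1,3)] C(2) that by force
  qed
  also have "\<dots> = 0"
    by (rule integral_gradient_eq_0[OF test_function_mono[OF p]]) simp
  finally show "v \<bullet> (LINT x|?M. \<eta> x *\<^sub>R gradient \<zeta> x) = v \<bullet> - (LINT x|?M. \<zeta> x *\<^sub>R gradient \<eta> x)"
    using i1 i2 by (simp add: integral_inner_right[symmetric] del: integral_inner_right)
qed

section \<open>The fundamental lemma of the calculus of variations\<close>

text \<open>Boxes are stable under intersection and generate the Borel sets, so a Dynkin argument
  extends the hypothesis to all Borel sets; the integral over the whole space is what the complement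
  step consumes.\<close>

lemma AE_eq_0_if_box_integrals_eq_0:
  fixes g :: "'a::euclidean_space \<Rightarrow> real"
  assumes g: "integrable lborel g"
    and box: "\<And>a b. (LINT x|lborel. indicator (box a b) x * g x) = 0"
    and all: "(LINT x|lborel. g x) = 0"
  shows "AE x in lborel. g x = 0"
proof -
  have "(LINT x|lborel. indicator A x * g x) = 0" if "A \<in> sets borel" for A
  proof -
    have mem: "A \<in> sigma_sets UNIV (range (\<lambda>(a, b). box a b :: 'a set))"
      using that by (simp add: borel_eq_box)
    have stable: "Int_stable (range (\<lambda>(a, b). box a b :: 'a set))"
      by (auto simp: Int_stable_def box_Int_box intro!: rev_image_eqI)
    show ?thesis
      using stable subset_UNIV[of "range (\<lambda>(a, b). box a b :: 'a set)", folded Pow_UNIV] mem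
    proof (induction A rule: sigma_sets_induct_disjoint)
      case (basic A)
      then show ?case using box by auto
    next
      case empty
      then show ?case by simp
    next
      case (compl A)
      then have A: "A \<in> sets lborel" by (simp add: borel_eq_box)
      have "(LINT x|lborel. indicator (UNIV - A) x * g x) = (LINT x|lborel. g x - indicator A x *\<^sub>R g x)"
        by (rule Bochner_Integration.integral_cong) (auto simp: indicator_def)
      also have "\<dots> = 0"
        using compl all integrable_mult_indicator[OF A g] g by simp
      finally show ?case .
    next
      case (union A)
      then have A: "A i \<in> sets lborel" for i by (auto simp: borel_eq_box)
      have "set_integrable lborel (\<Union>i. A i) g"
        unfolding set_integrable_def using A by (intro integrable_mult_indicator g) auto
      then have "(LINT x:(\<Union>i. A i)|lborel. g x) = (\<Sum>i. (LINT x:(A i)|lborel. g x))"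
        using union(1) A by (intro lebesgue_integral_countable_add) (auto simp: disjoint_family_on_def)
      then show ?case
        using union(3) by (simp add: set_lebesgue_integral_def)
    qed
  qed
  then have "AE x in lborel. g x = 0"
    using g by (intro density_unique_real) (auto simp: set_lebesgue_integral_def)
  then show ?thesis .
qed

text \<open>Smooth bumps approximate indicators of boxes boundedly, so \<open>f\<close> integrates
  to zero over every closed box's interior inside \<open>\<Omega>\<close>. Localizing to one box at
  a time and covering \<open>\<Omega>\<close> by countably many of them finishes the
  argument.\<close>

lemma fundamental_lemma:
  fixes f :: "'a::euclidean_space \<Rightarrow> real"
  assumes \<Omega>: "open \<Omega>" and f: "square_integrable (lebesgue_on \<Omega>) f"
    and orth: "\<And>\<eta>. test_function \<Omega> \<eta> \<Longrightarrow> (LINT x|lebesgue_on \<Omega>. \<eta> x * f x) = 0"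
  shows "AE x in lebesgue_on \<Omega>. f x = 0"
proof -
  have \<Omega>': "\<Omega> \<in> sets lebesgue" using \<Omega> by simp
  have fm: "f \<in> borel_measurable (lebesgue_on \<Omega>)" using f by (rule square_integrable_measurable)
  then have fi: "(\<lambda>x. indicator \<Omega> x * f x) \<in> borel_measurable lebesgue"
    using \<Omega>' by (subst (asm) borel_measurable_restrict_space_iff) auto
  \<comment> \<open>Closed boxes, because a bump on a box is a test function only if the closed box
    lies in \<open>\<Omega>\<close>.\<close>
  have cb: "AE x in lebesgue. x \<in> cbox a b \<longrightarrow> f x = 0" if ab: "cbox a b \<subseteq> \<Omega>" for a b
  proof -
    define F where "F x = indicator (box a b) x * f x" for x
    have F_eq: "F x = indicator (box a b) x * (indicator \<Omega> x * f x)" for x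
      using ab box_subset_cbox[of a b] by (auto simp: F_def indicator_def)
    have Fm: "F \<in> borel_measurable lebesgue"
      unfolding F_eq by (intro borel_measurable_times fi borel_measurable_indicator) auto
    have ind: "square_integrable (lebesgue_on \<Omega>) (\<lambda>x. indicator (box c d) x :: real)" for c d
      unfolding square_integrable_def
    proof
      show "(\<lambda>x. indicator (box c d) x :: real) \<in> borel_measurable (lebesgue_on \<Omega>)"
        by (intro measurable_restrict_space1 measurable_completion) auto
      have "integrable lborel (\<lambda>x. indicator (box c d) x :: real)"
        by (rule integrable_real_indicator[OF _ emeasure_lborel_box_finite]) simp
      then have "integrable (lebesgue_on \<Omega>) (\<lambda>x. indicator (box c d) x :: real)"
        by (rule integrable_lebesgue_on_of_lborel[OF _ \<Omega>'])
      moreover have "(\<lambda>x. (norm (indicator (box c d) x :: real))\<^sup>2) = indicator (box c d)"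
        by (auto simp: indicator_def)
      ultimately show "integrable (lebesgue_on \<Omega>) (\<lambda>x. (norm (indicator (box c d) x :: real))\<^sup>2)"
        by simp
    qed
    have indf: "integrable (lebesgue_on \<Omega>) (\<lambda>x. indicator (box c d) x * f x)" for c d
      using square_integrable_inner[OF ind f] by simp
    have to_F: "(LINT x|lebesgue_on \<Omega>. indicator (box c d) x * f x) = (LINT x|lebesgue. indicator (box c d) x * f x)"
      if "box c d \<subseteq> \<Omega>" for c d
      using that \<Omega>' by (subst integral_restrict_space)
        (auto intro!: Bochner_Integration.integral_cong simp: indicator_def)
    have box0: "(LINT x|lebesgue_on \<Omega>. indicator (box c d) x * f x) = 0" if "cbox c d \<subseteq> \<Omega>" for c d
    proof -
      have t: "test_function \<Omega> (box_bump c d (real n))" for n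
        by (rule test_function_box_bump[OF that]) simp
      have "(\<lambda>n. LINT x|lebesgue_on \<Omega>. box_bump c d (real n) x * f x) \<longlonglongrightarrow>
        (LINT x|lebesgue_on \<Omega>. indicator (box c d) x * f x)"
      proof (rule integral_dominated_convergence[where w="\<lambda>x. \<bar>indicator (box c d) x * f x\<bar>"])
        show "integrable (lebesgue_on \<Omega>) (\<lambda>x. \<bar>indicator (box c d) x * f x\<bar>)"
          using indf by simp
        show "(\<lambda>x. indicator (box c d) x * f x) \<in> borel_measurable (lebesgue_on \<Omega>)"
          using indf by (rule borel_measurable_integrable)
        show "(\<lambda>x. box_bump c d (real n) x * f x) \<in> borel_measurable (lebesgue_on \<Omega>)" for n
          by (intro borel_measurable_times fm borel_measurable_continuous_lebesgue_on continuous_on_test_function[OF t])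
        show "AE x in lebesgue_on \<Omega>. (\<lambda>n. box_bump c d (real n) x * f x) \<longlonglongrightarrow> indicator (box c d) x * f x"
          by (intro AE_I2 tendsto_mult box_bump_tendsto tendsto_const)
        show "AE x in lebesgue_on \<Omega>. norm (box_bump c d (real n) x * f x) \<le> \<bar>indicator (box c d) x * f x\<bar>" for n
          using box_bump_le_1[of c d "real n"] box_bump_nonneg[of c d "real n"] box_bump_outside[of "real n" _ c d]
          by (intro AE_I2) (auto simp: abs_mult indicator_def mult_left_le_one_le)
      qed
      then show ?thesis
        using orth[OF t] by (simp add: LIMSEQ_const_iff)
    qed
    \<comment> \<open>A Borel representative is required: \<open>F\<close> is only Lebesgue
      measurable, while the Dynkin argument speaks of \<open>lborel\<close>.\<close>
    obtain g where g: "g \<in> borel_measurable lborel" "AE x in lborel. F x = g x"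
      using completion_ex_borel_measurable_real[OF Fm] by auto
    have g': "AE x in lebesgue. F x = g x" using g(2) by (rule AE_completion)
    note [measurable] = g(1) Fm
    have gm: "g \<in> borel_measurable lebesgue" using g(1) by (rule measurable_completion)
    have "integrable lebesgue F"
    proof -
      have "integrable lebesgue (\<lambda>x. indicator \<Omega> x *\<^sub>R (indicator (box a b) x * f x))"
        using indf \<Omega>' by (subst integrable_restrict_space[symmetric]) auto
      moreover have "F = (\<lambda>x. indicator \<Omega> x *\<^sub>R (indicator (box a b) x * f x))"
        by (auto simp: F_eq)
      ultimately show ?thesis by simp
    qed
    then have "integrable lebesgue g"
      using gm g' by (rule integrable_cong_AE_imp)
    then have gi: "integrable lborel g"
      using g(1) by (subst (asm) integrable_completion) auto
    have gbox: "(LINT x|lborel. indicator (box c d) x * g x) = 0" for c d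
    proof -
      have "(LINT x|lborel. indicator (box c d) x * g x) = (LINT x|lebesgue. indicator (box c d) x * g x)"
        by (rule integral_completion[symmetric]) measurable
      also have "\<dots> = (LINT x|lebesgue. indicator (box c d) x * F x)"
        by (intro integral_cong_AE borel_measurable_times borel_measurable_indicator gm Fm) (use g' in auto)
      also have "\<dots> = (LINT x|lebesgue. indicator (box c d \<inter> box a b) x * f x)"
        by (rule Bochner_Integration.integral_cong) (auto simp: F_def indicator_def)
      also have "\<dots> = 0"
      proof -
        obtain p q where pq: "box c d \<inter> box a b = box p q" by (auto simp: box_Int_box)
        show ?thesis
        proof (cases "box p q = {}")
          case False
          then have "cbox p q = closure (box p q)" by simp
          also have "\<dots> \<subseteq> cbox a b"
            using pq box_subset_cbox[of a b] by (intro closure_minimal) auto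
          finally have *: "cbox p q \<subseteq> \<Omega>" using ab by simp
          then have "box p q \<subseteq> \<Omega>" using box_subset_cbox by blast
          then show ?thesis using box0[OF *] to_F pq by simp
        qed (simp add: pq)
      qed
      finally show ?thesis .
    qed
    have "(LINT x|lborel. g x) = (LINT x|lborel. indicator (box a b) x * g x)"
    proof (rule integral_cong_AE)
      show "AE x in lborel. g x = indicator (box a b) x * g x"
        using g(2) by eventually_elim (auto simp: F_def indicator_def split: if_splits)
    qed (use g(1) in auto)
    then have "AE x in lborel. g x = 0"
      by (intro AE_eq_0_if_box_integrals_eq_0 gi gbox) (simp add: gbox)
    then have "AE x in lebesgue. g x = 0" by (rule AE_completion)
    \<comment> \<open>\<open>F\<close> is cut off to the open box, so the null boundary must be
      discarded to reach the closed one.\<close>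
    moreover have "AE x in lebesgue. x \<notin> cbox a b - box a b"
      using null_sets_cbox_Diff_box[of a b] by (intro AE_completion AE_not_in)
    ultimately show ?thesis
      using g' by eventually_elim (auto simp: F_def indicator_def split: if_splits)
  qed
  obtain \<D> where D: "countable \<D>" "\<D> \<subseteq> Pow \<Omega>" "\<And>X. X \<in> \<D> \<Longrightarrow> \<exists>a b. X = cbox a b" "\<Union>\<D> = \<Omega>"
    using open_countable_Union_open_cbox[OF \<Omega>] by metis
  have "AE x in lebesgue. \<forall>X\<in>\<D>. x \<in> X \<longrightarrow> f x = 0"
  proof (rule AE_ball_countable[THEN iffD2, OF D(1)], rule ballI)
    fix X assume "X \<in> \<D>"
    moreover from this obtain a b where "X = cbox a b" using D(3) by blast
    ultimately show "AE x in lebesgue. x \<in> X \<longrightarrow> f x = 0" using D(2) cb by auto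
  qed
  then have "AE x in lebesgue. x \<in> \<Omega> \<longrightarrow> f x = 0"
    by eventually_elim (use D(4) in blast)
  then show ?thesis
    using \<Omega>' by (subst AE_restrict_space_iff) auto
qed

section \<open>Representatives\<close>

lemma ae_equal_refl: "ae_equal f f \<longleftrightarrow> f \<in> borel_measurable lebesgue"
  by (auto simp: ae_equal_def)

lemma rep_ae_fun_measurable[measurable]: "rep_ae_fun u \<in> borel_measurable lebesgue"
  using Quotient3_rep_reflp[OF Quotient3_ae_fun, of u] by (simp add: ae_equal_def)

lemma rep_abs_ae_fun: "f \<in> borel_measurable lebesgue \<Longrightarrow> AE x in lebesgue. rep_ae_fun (abs_ae_fun f) x = f x"
  using rep_abs_rsp_left[OF Quotient3_ae_fun, of f f] by (simp add: ae_equal_def)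

lemma abs_rep_ae_fun: "abs_ae_fun (rep_ae_fun u) = u"
  by (rule Quotient3_abs_rep[OF Quotient3_ae_fun])

lemma ae_fun_eqI: "AE x in lebesgue. rep_ae_fun u x = rep_ae_fun v x \<Longrightarrow> u = v"
  using Quotient3_rel_rep[OF Quotient3_ae_fun, of u v] by (simp add: ae_equal_def)

lemma rep_ae_fun_add: "AE x in lebesgue. rep_ae_fun (u + v) x = rep_ae_fun u x + rep_ae_fun v x"
proof -
  have "u + v = abs_ae_fun (\<lambda>x. rep_ae_fun u x + rep_ae_fun v x)"
    using plus_ae_fun.abs_eq[of "rep_ae_fun u" "rep_ae_fun v"] by (simp add: ae_equal_refl abs_rep_ae_fun)
  then show ?thesis using rep_abs_ae_fun[of "\<lambda>x. rep_ae_fun u x + rep_ae_fun v x"] by simp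
qed

lemma rep_ae_fun_scaleR: "AE x in lebesgue. rep_ae_fun (r *\<^sub>R u) x = r * rep_ae_fun u x"
proof -
  have "r *\<^sub>R u = abs_ae_fun (\<lambda>x. r * rep_ae_fun u x)"
    using scaleR_ae_fun.abs_eq[of "rep_ae_fun u" r] by (simp add: ae_equal_refl abs_rep_ae_fun)
  then show ?thesis using rep_abs_ae_fun[of "\<lambda>x. r * rep_ae_fun u x"] by simp
qed

lemma rep_ae_fun_zero: "AE x in lebesgue. rep_ae_fun 0 x = 0"
  using rep_abs_ae_fun[of "\<lambda>_. 0"] by (simp add: zero_ae_fun_def)

lemma AE_lebesgue_on:
  "\<Omega> \<in> sets lebesgue \<Longrightarrow> (AE x in lebesgue_on \<Omega>. P x) \<longleftrightarrow> (AE x in lebesgue. x \<in> \<Omega> \<longrightarrow> P x)"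
  by (rule AE_restrict_space_iff) simp

lemma AE_lebesgue_onI: "AE x in lebesgue. P x \<Longrightarrow> \<Omega> \<in> sets lebesgue \<Longrightarrow> AE x in lebesgue_on \<Omega>. P x"
  by (subst AE_lebesgue_on) auto

section \<open>The weak gradient\<close>

text \<open>The pairing of \<open>(u, \<nabla>u)\<close> with \<open>(\<nabla>\<eta> \<bullet> v, \<eta> v)\<close> vanishes: a formulation that
  is visibly stable under limits in \<open>L\<^sup>2\<close>.\<close>

lemma is_weak_gradient_iff:
  assumes \<Omega>: "\<Omega> \<in> sets lebesgue"
    and u: "square_integrable (lebesgue_on \<Omega>) (rep_ae_fun u)" and g: "square_integrable (lebesgue_on \<Omega>) g"
  shows "is_weak_gradient \<Omega> u g \<longleftrightarrow> (\<forall>\<eta> v. test_function \<Omega> \<eta> \<longrightarrow>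
    (LINT x|lebesgue_on \<Omega>. (rep_ae_fun u x, g x) \<bullet> (gradient \<eta> x \<bullet> v, \<eta> x *\<^sub>R v)) = 0)"
proof -
  let ?M = "lebesgue_on \<Omega>"
  have "((LINT x|?M. rep_ae_fun u x *\<^sub>R gradient \<eta> x) = - (LINT x|?M. \<eta> x *\<^sub>R g x)) \<longleftrightarrow>
    (\<forall>v. (LINT x|?M. (rep_ae_fun u x, g x) \<bullet> (gradient \<eta> x \<bullet> v, \<eta> x *\<^sub>R v)) = 0)"
    if \<eta>: "test_function \<Omega> \<eta>" for \<eta>
  proof -
    note sq = test_function_square_integrable[OF \<eta> \<Omega>]
    have i1: "integrable ?M (\<lambda>x. rep_ae_fun u x *\<^sub>R gradient \<eta> x)"
      and i2: "integrable ?M (\<lambda>x. \<eta> x *\<^sub>R g x)"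
      using u g sq by (auto intro: square_integrable_mult_scaleR)
    have "(LINT x|?M. (rep_ae_fun u x, g x) \<bullet> (gradient \<eta> x \<bullet> v, \<eta> x *\<^sub>R v)) =
       ((LINT x|?M. rep_ae_fun u x *\<^sub>R gradient \<eta> x) + (LINT x|?M. \<eta> x *\<^sub>R g x)) \<bullet> v" for v
    proof -
      have "(LINT x|?M. (rep_ae_fun u x, g x) \<bullet> (gradient \<eta> x \<bullet> v, \<eta> x *\<^sub>R v)) =
        (LINT x|?M. (rep_ae_fun u x *\<^sub>R gradient \<eta> x) \<bullet> v + (\<eta> x *\<^sub>R g x) \<bullet> v)"
        by (intro Bochner_Integration.integral_cong refl) simp
      also have "\<dots> = (LINT x|?M. (rep_ae_fun u x *\<^sub>R gradient \<eta> x) \<bullet> v) + (LINT x|?M. (\<eta> x *\<^sub>R g x) \<bullet> v)"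
        using i1 i2 by (intro Bochner_Integration.integral_add integrable_inner_left) auto
      also have "\<dots> = ((LINT x|?M. rep_ae_fun u x *\<^sub>R gradient \<eta> x) + (LINT x|?M. \<eta> x *\<^sub>R g x)) \<bullet> v"
        using i1 i2 by (simp add: inner_add_left integral_inner_left[symmetric] del: integral_inner_left)
      finally show ?thesis .
    qed
    moreover have "(\<forall>v. (a + b) \<bullet> v = 0) \<longleftrightarrow> a = - b" for a b :: 'a
      using inner_eq_zero_iff[of "a + b"] by (auto simp: eq_neg_iff_add_eq_0)
    ultimately show ?thesis by simp
  qed
  then show ?thesis
    using g unfolding is_weak_gradient_def L2_on_eq by blast
qed

text \<open>Each component of the difference is orthogonal to all test functions, so the fundamental
  lemma applies to it.\<close>

lemma weak_gradient_unique:
  assumes \<Omega>: "open \<Omega>" and g: "is_weak_gradient \<Omega> u g" and h: "is_weak_gradient \<Omega> u h"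
  shows "AE x in lebesgue_on \<Omega>. g x = h x"
proof -
  have \<Omega>': "\<Omega> \<in> sets lebesgue" using \<Omega> by simp
  have sq: "square_integrable (lebesgue_on \<Omega>) g" "square_integrable (lebesgue_on \<Omega>) h"
    using g h by (auto simp: is_weak_gradient_def L2_on_eq)
  note d = square_integrable_diff[OF sq]
  have "AE x in lebesgue_on \<Omega>. (g x - h x) \<bullet> b = 0" for b
  proof (rule fundamental_lemma[OF \<Omega>])
    show "square_integrable (lebesgue_on \<Omega>) (\<lambda>x. (g x - h x) \<bullet> b)"
    proof -
      note [measurable] = square_integrable_measurable[OF d]
      have i: "integrable (lebesgue_on \<Omega>) (\<lambda>x. (norm b)\<^sup>2 * (norm (g x - h x))\<^sup>2)"
        using d by (auto simp: square_integrable_def)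
      have "integrable (lebesgue_on \<Omega>) (\<lambda>x. (norm ((g x - h x) \<bullet> b))\<^sup>2)"
      proof (rule Bochner_Integration.integrable_bound[OF i])
        show "AE x in lebesgue_on \<Omega>. norm ((norm ((g x - h x) \<bullet> b))\<^sup>2) \<le> norm ((norm b)\<^sup>2 * (norm (g x - h x))\<^sup>2)"
        proof (rule AE_I2)
          fix x
          have "((g x - h x) \<bullet> b)\<^sup>2 \<le> (norm (g x - h x) * norm b)\<^sup>2"
            using Cauchy_Schwarz_ineq2[of "g x - h x" b] by (intro abs_le_square_iff[THEN iffD1]) simp
          then show "norm ((norm ((g x - h x) \<bullet> b))\<^sup>2) \<le> norm ((norm b)\<^sup>2 * (norm (g x - h x))\<^sup>2)"
            by (simp add: power_mult_distrib mult.commute)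
        qed
      qed measurable
      then show ?thesis by (simp add: square_integrable_def)
    qed
    fix \<eta> assume \<eta>: "test_function \<Omega> \<eta>"
    note sqe = test_function_square_integrable[OF \<eta> \<Omega>']
    have i: "integrable (lebesgue_on \<Omega>) (\<lambda>x. \<eta> x *\<^sub>R g x)" "integrable (lebesgue_on \<Omega>) (\<lambda>x. \<eta> x *\<^sub>R h x)"
      using sq sqe by (auto intro: square_integrable_mult_scaleR)
    have "(LINT x|lebesgue_on \<Omega>. \<eta> x * ((g x - h x) \<bullet> b))
       = (LINT x|lebesgue_on \<Omega>. (\<eta> x *\<^sub>R g x - \<eta> x *\<^sub>R h x) \<bullet> b)"
      by (simp add: inner_diff_left right_diff_distrib)
    also have "\<dots> = (LINT x|lebesgue_on \<Omega>. (\<eta> x *\<^sub>R g x - \<eta> x *\<^sub>R h x)) \<bullet> b"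
      using i by (intro integral_inner_left) auto
    also have "(LINT x|lebesgue_on \<Omega>. (\<eta> x *\<^sub>R g x - \<eta> x *\<^sub>R h x)) = 0"
      using i g h \<eta> by (simp add: is_weak_gradient_def)
    finally show "(LINT x|lebesgue_on \<Omega>. \<eta> x * ((g x - h x) \<bullet> b)) = 0" by simp
  qed
  then have "AE x in lebesgue_on \<Omega>. \<forall>b\<in>Basis. (g x - h x) \<bullet> b = 0"
    by (intro AE_finite_allI) auto
  then show ?thesis
    by eventually_elim (auto simp: euclidean_eq_iff[of "g _"] inner_diff_left)
qed

lemma weak_gradient_is_weak_gradient: "u \<in> H1 \<Omega> \<Longrightarrow> is_weak_gradient \<Omega> u (weak_gradient \<Omega> u)"
  unfolding H1_def weak_gradient_def mem_Collect_eq by (elim conjE) (erule someI_ex)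

lemma H1_I:
  assumes "AE x in lebesgue. x \<notin> \<Omega> \<longrightarrow> rep_ae_fun u x = 0"
    "square_integrable (lebesgue_on \<Omega>) (rep_ae_fun u)" "is_weak_gradient \<Omega> u g"
  shows "u \<in> H1 \<Omega>"
  using assms by (auto simp: H1_def L2_on_eq)

lemma H1_D:
  assumes "u \<in> H1 \<Omega>"
  shows "AE x in lebesgue. x \<notin> \<Omega> \<longrightarrow> rep_ae_fun u x = 0"
    "square_integrable (lebesgue_on \<Omega>) (rep_ae_fun u)" "square_integrable (lebesgue_on \<Omega>) (weak_gradient \<Omega> u)"
  using assms weak_gradient_is_weak_gradient[OF assms] by (auto simp: H1_def L2_on_eq is_weak_gradient_def)

lemma H1_weak_gradient_AE:
  "open \<Omega> \<Longrightarrow> u \<in> H1 \<Omega> \<Longrightarrow> is_weak_gradient \<Omega> u g \<Longrightarrow> AE x in lebesgue_on \<Omega>. weak_gradient \<Omega> u x = g x"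
  by (rule weak_gradient_unique[OF _ weak_gradient_is_weak_gradient])

text \<open>\<open>weak_gradient\<close> is a Hilbert choice made separately for each class. It is
  therefore linear only almost everywhere, and uniqueness is what proves it.\<close>

lemma H1_lincomb:
  assumes \<Omega>: "open \<Omega>" and u: "u \<in> H1 \<Omega>" and v: "v \<in> H1 \<Omega>"
  shows "u + r *\<^sub>R v \<in> H1 \<Omega>"
    and "AE x in lebesgue_on \<Omega>. weak_gradient \<Omega> (u + r *\<^sub>R v) x = weak_gradient \<Omega> u x + r *\<^sub>R weak_gradient \<Omega> v x"
proof -
  have \<Omega>': "\<Omega> \<in> sets lebesgue" using \<Omega> by simp
  let ?M = "lebesgue_on \<Omega>" and ?g = "\<lambda>x. weak_gradient \<Omega> u x + r *\<^sub>R weak_gradient \<Omega> v x"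
  have rep: "AE x in lebesgue. rep_ae_fun (u + r *\<^sub>R v) x = rep_ae_fun u x + r * rep_ae_fun v x"
    using rep_ae_fun_add[of u "r *\<^sub>R v"] rep_ae_fun_scaleR[of r v] by eventually_elim simp
  have [measurable]: "rep_ae_fun w \<in> borel_measurable ?M" for w
    by (intro measurable_restrict_space1) simp
  have sq: "square_integrable ?M (rep_ae_fun (u + r *\<^sub>R v))"
    by (rule square_integrable_cong_AE[OF square_integrable_add[OF H1_D(2)[OF u]
          square_integrable_scaleR[OF H1_D(2)[OF v], of r]]])
       (use AE_lebesgue_onI[OF rep \<Omega>'] in \<open>auto elim: AE_mp\<close>)
  have g: "square_integrable ?M ?g"
    by (intro square_integrable_add square_integrable_scaleR H1_D u v)
  have wg: "is_weak_gradient \<Omega> (u + r *\<^sub>R v) ?g"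
    unfolding is_weak_gradient_iff[OF \<Omega>' sq g]
  proof (intro allI impI)
    fix \<eta> w assume \<eta>: "test_function \<Omega> \<eta>"
    let ?t = "\<lambda>x. (gradient \<eta> x \<bullet> w, \<eta> x *\<^sub>R w)"
    have t: "square_integrable ?M ?t"
      using test_function_square_integrable(1)[OF test_function_inner_gradient[OF \<eta>, of w] \<Omega>']
        test_function_square_integrable(1)[OF \<eta> \<Omega>']
      by (intro square_integrable_Pair)
         (auto simp: square_integrable_def power_mult_distrib)
    have z: "(LINT x|?M. (rep_ae_fun z x, weak_gradient \<Omega> z x) \<bullet> ?t x) = 0" and
      i: "integrable ?M (\<lambda>x. (rep_ae_fun z x, weak_gradient \<Omega> z x) \<bullet> ?t x)" if "z \<in> H1 \<Omega>" for z
      using weak_gradient_is_weak_gradient[OF that] is_weak_gradient_iff[OF \<Omega>' H1_D(2,3)[OF that]] \<eta>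
        square_integrable_inner[OF square_integrable_Pair[OF H1_D(2,3)[OF that]] t] by auto
    have "(LINT x|?M. (rep_ae_fun (u + r *\<^sub>R v) x, ?g x) \<bullet> ?t x) =
      (LINT x|?M. (rep_ae_fun u x, weak_gradient \<Omega> u x) \<bullet> ?t x + r * ((rep_ae_fun v x, weak_gradient \<Omega> v x) \<bullet> ?t x))"
    proof (rule integral_cong_AE)
      show "AE x in ?M. (rep_ae_fun (u + r *\<^sub>R v) x, ?g x) \<bullet> ?t x =
        (rep_ae_fun u x, weak_gradient \<Omega> u x) \<bullet> ?t x + r * ((rep_ae_fun v x, weak_gradient \<Omega> v x) \<bullet> ?t x)"
        using AE_lebesgue_onI[OF rep \<Omega>']
        by eventually_elim (simp add: algebra_simps inner_add_left)
      show "(\<lambda>x. (rep_ae_fun (u + r *\<^sub>R v) x, ?g x) \<bullet> ?t x) \<in> borel_measurable ?M"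
        using square_integrable_inner[OF square_integrable_Pair[OF sq g] t] by (rule borel_measurable_integrable)
      show "(\<lambda>x. (rep_ae_fun u x, weak_gradient \<Omega> u x) \<bullet> ?t x + r * ((rep_ae_fun v x, weak_gradient \<Omega> v x) \<bullet> ?t x)) \<in> borel_measurable ?M"
        by (intro borel_measurable_add borel_measurable_times borel_measurable_const borel_measurable_integrable i u v)
    qed
    also have "\<dots> = 0"
      using i[OF u] i[OF v] z[OF u] z[OF v] by simp
    finally show "(LINT x|?M. (rep_ae_fun (u + r *\<^sub>R v) x, ?g x) \<bullet> ?t x) = 0" .
  qed
  have "AE x in lebesgue. x \<notin> \<Omega> \<longrightarrow> rep_ae_fun (u + r *\<^sub>R v) x = 0"
    using rep H1_D(1)[OF u] H1_D(1)[OF v] by eventually_elim auto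
  then show 1: "u + r *\<^sub>R v \<in> H1 \<Omega>" by (rule H1_I[OF _ sq wg])
  show "AE x in ?M. weak_gradient \<Omega> (u + r *\<^sub>R v) x = ?g x"
    by (rule H1_weak_gradient_AE[OF \<Omega> 1 wg])
qed

lemma test_function_measurable: "test_function \<Omega> \<eta> \<Longrightarrow> \<eta> \<in> borel_measurable lebesgue"
  using borel_measurable_continuous_onI[OF continuous_on_test_function[of \<Omega> \<eta> UNIV]]
  by (intro measurable_completion) simp

lemma rep_abs_test_function:
  "test_function \<Omega> \<eta> \<Longrightarrow> AE x in lebesgue. rep_ae_fun (abs_ae_fun \<eta>) x = \<eta> x"
  by (rule rep_abs_ae_fun[OF test_function_measurable])

text \<open>By integration by parts the classical gradient is a weak one; uniqueness then identifies
  it with the chosen one.\<close>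

lemma test_function_H1:
  assumes \<Omega>: "open \<Omega>" and \<eta>: "test_function \<Omega> \<eta>"
  shows "abs_ae_fun \<eta> \<in> H1 \<Omega>" "AE x in lebesgue_on \<Omega>. weak_gradient \<Omega> (abs_ae_fun \<eta>) x = gradient \<eta> x"
proof -
  have \<Omega>': "\<Omega> \<in> sets lebesgue" using \<Omega> by simp
  let ?M = "lebesgue_on \<Omega>"
  note sq = test_function_square_integrable[OF \<eta> \<Omega>']
  have [measurable]: "rep_ae_fun w \<in> borel_measurable ?M" for w
    by (intro measurable_restrict_space1) simp
  have rep: "AE x in ?M. rep_ae_fun (abs_ae_fun \<eta>) x = \<eta> x"
    by (rule AE_lebesgue_onI[OF rep_abs_test_function[OF \<eta>] \<Omega>'])
  have rsq: "square_integrable ?M (rep_ae_fun (abs_ae_fun \<eta>))"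
    by (rule square_integrable_cong_AE[OF sq(1)]) (use rep in \<open>auto elim: AE_mp\<close>)
  have wg: "is_weak_gradient \<Omega> (abs_ae_fun \<eta>) (gradient \<eta>)"
    unfolding is_weak_gradient_def L2_on_eq
  proof (intro conjI allI impI sq)
    fix \<zeta> assume \<zeta>: "test_function \<Omega> \<zeta>"
    note [measurable] = square_integrable_measurable[OF sq(1)]
      square_integrable_measurable[OF test_function_square_integrable(2)[OF \<zeta> \<Omega>']]
    have "(LINT x|?M. rep_ae_fun (abs_ae_fun \<eta>) x *\<^sub>R gradient \<zeta> x) = (LINT x|?M. \<eta> x *\<^sub>R gradient \<zeta> x)"
      by (rule integral_cong_AE; measurable?) (use rep in \<open>auto elim: AE_mp\<close>)
    then show "(LINT x|?M. rep_ae_fun (abs_ae_fun \<eta>) x *\<^sub>R gradient \<zeta> x) = - (LINT x|?M. \<zeta> x *\<^sub>R gradient \<eta> x)"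
      using test_function_integration_by_parts[OF \<eta> \<zeta> \<Omega>'] by simp
  qed
  obtain C where C: "C \<subseteq> \<Omega>" "\<And>x. x \<notin> C \<Longrightarrow> \<eta> x = 0"
    using \<eta> by (metis test_functionE)
  have "AE x in lebesgue. x \<notin> \<Omega> \<longrightarrow> rep_ae_fun (abs_ae_fun \<eta>) x = 0"
    using rep_abs_test_function[OF \<eta>] by eventually_elim (use C in auto)
  then show 1: "abs_ae_fun \<eta> \<in> H1 \<Omega>" by (rule H1_I[OF _ rsq wg])
  show "AE x in ?M. weak_gradient \<Omega> (abs_ae_fun \<eta>) x = gradient \<eta> x"
    by (rule H1_weak_gradient_AE[OF \<Omega> 1 wg])
qed

section \<open>The Hilbert space structure\<close>

locale sobolev =
  fixes \<Omega> :: "'a::euclidean_space set" and lam :: real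
  assumes open_domain: "open \<Omega>" and lam_pos: "0 < lam"
begin

abbreviation M where "M \<equiv> lebesgue_on \<Omega>"

lemma \<Omega>_sets: "\<Omega> \<in> sets lebesgue"
  using open_domain by simp

lemma rep_measurable[measurable]: "rep_ae_fun u \<in> borel_measurable M"
  by (intro measurable_restrict_space1) simp

text \<open>An isometric embedding of \<open>H1 \<Omega>\<close> with the form \<open>P\<close> into
  \<open>L\<^sup>2\<close> with values in \<open>real \<times> 'a\<close>, from which Cauchy-Schwarz
  and completeness are inherited.\<close>

definition J :: "'a ae_fun \<Rightarrow> 'a \<Rightarrow> real \<times> 'a" where
  "J u x = (sqrt lam * rep_ae_fun u x, weak_gradient \<Omega> u x)"

text \<open>The analogue of \<open>J\<close> for a function with pointwise values and a classical
  gradient, since \<open>J (abs_ae_fun \<eta>)\<close> is known only almost everywhere.\<close>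

definition Jt :: "('a \<Rightarrow> real) \<Rightarrow> 'a \<Rightarrow> real \<times> 'a" where
  "Jt \<eta> x = (sqrt lam * \<eta> x, gradient \<eta> x)"

definition P :: "'a ae_fun \<Rightarrow> 'a ae_fun \<Rightarrow> real" where
  "P u v = (LINT x|M. J u x \<bullet> J v x)"

lemma J_square_integrable: "u \<in> H1 \<Omega> \<Longrightarrow> square_integrable M (J u)"
  unfolding J_def[abs_def]
  using square_integrable_scaleR[OF H1_D(2), of u \<Omega> "sqrt lam"]
  by (intro square_integrable_Pair H1_D) auto

lemma J_lincomb:
  assumes "u \<in> H1 \<Omega>" "v \<in> H1 \<Omega>"
  shows "AE x in M. J (u + r *\<^sub>R v) x = J u x + r *\<^sub>R J v x"
  using H1_lincomb(2)[OF open_domain assms, of r]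
    AE_lebesgue_onI[OF rep_ae_fun_add[of u "r *\<^sub>R v"] \<Omega>_sets] AE_lebesgue_onI[OF rep_ae_fun_scaleR[of r v] \<Omega>_sets]
  by eventually_elim (simp add: J_def algebra_simps)

lemma H1_zero: "0 \<in> H1 \<Omega>"
proof -
  have "abs_ae_fun (\<lambda>x. 0) \<in> H1 \<Omega>"
    by (rule test_function_H1[OF open_domain test_function_zero])
  then show ?thesis by (simp add: zero_ae_fun_def)
qed

lemma H1_subspace: "subspace (H1 \<Omega>)"
  unfolding subspace_def
proof (intro conjI ballI allI)
  show "0 \<in> H1 \<Omega>" by (rule H1_zero)
  show "x + y \<in> H1 \<Omega>" if "x \<in> H1 \<Omega>" "y \<in> H1 \<Omega>" for x y
    using H1_lincomb(1)[OF open_domain that, of 1] by simp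
  show "c *\<^sub>R x \<in> H1 \<Omega>" if "x \<in> H1 \<Omega>" for c x
    using H1_lincomb(1)[OF open_domain H1_zero that, of c] by simp
qed

lemma P_eqI:
  assumes "AE x in M. J u x = f x" "u \<in> H1 \<Omega>" "v \<in> H1 \<Omega>" "f \<in> borel_measurable M"
  shows "P u v = (LINT x|M. f x \<bullet> J v x)"
  unfolding P_def
proof (rule integral_cong_AE)
  note [measurable] = square_integrable_measurable[OF J_square_integrable[OF assms(2)]]
    square_integrable_measurable[OF J_square_integrable[OF assms(3)]] assms(4)
  show "(\<lambda>x. J u x \<bullet> J v x) \<in> borel_measurable M" "(\<lambda>x. f x \<bullet> J v x) \<in> borel_measurable M"
    by measurable
  show "AE x in M. J u x \<bullet> J v x = f x \<bullet> J v x"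
    using assms(1) by eventually_elim simp
qed

lemma P_commute: "P u v = P v u"
  by (simp add: P_def inner_commute)

lemma P_lincomb:
  assumes "u \<in> H1 \<Omega>" "v \<in> H1 \<Omega>" "w \<in> H1 \<Omega>"
  shows "P (u + r *\<^sub>R v) w = P u w + r * P v w"
proof -
  note sq = assms[THEN J_square_integrable]
  have "P (u + r *\<^sub>R v) w = (LINT x|M. (J u x + r *\<^sub>R J v x) \<bullet> J w x)"
    by (rule P_eqI[OF J_lincomb[OF assms(1,2)]])
       (use assms H1_lincomb(1)[OF open_domain] sq in
         \<open>auto intro!: square_integrable_measurable square_integrable_add square_integrable_scaleR\<close>)
  also have "\<dots> = (LINT x|M. J u x \<bullet> J w x + r * (J v x \<bullet> J w x))"
    by (simp add: inner_add_left)
  also have "\<dots> = P u w + r * P v w"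
    unfolding P_def using sq by (simp add: square_integrable_inner)
  finally show ?thesis .
qed

sublocale H1: semi_inner "H1 \<Omega>" P
proof
  fix u v w and r :: real
  assume u: "u \<in> H1 \<Omega>"
  show "P u v = P v u" by (rule P_commute)
  show "P u u \<ge> 0" by (simp add: P_def)
  show "P (u + v) w = P u w + P v w" if "v \<in> H1 \<Omega>" "w \<in> H1 \<Omega>"
    using P_lincomb[OF u that, of 1] by simp
  show "P (r *\<^sub>R u) w = r * P u w" if "w \<in> H1 \<Omega>"
    using P_lincomb[OF H1_zero u that, of r] P_lincomb[OF H1_zero H1_zero that, of 1] by simp
qed (rule H1_subspace)

lemma P_diff_eq:
  assumes "u \<in> H1 \<Omega>" "v \<in> H1 \<Omega>"
  shows "P (u - v) (u - v) = (LINT x|M. (norm (J u x - J v x))\<^sup>2)"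
proof -
  have uv: "u - v \<in> H1 \<Omega>" using assms by (rule H1.V_closed)
  have ae: "AE x in M. J (u - v) x = J u x - J v x"
    using J_lincomb[OF assms, of "-1"] by simp
  note [measurable] = assms[THEN J_square_integrable, THEN square_integrable_measurable]
    square_integrable_measurable[OF J_square_integrable[OF uv]]
  show ?thesis unfolding P_def
    by (rule integral_cong_AE) (use ae in \<open>auto simp: power2_norm_eq_inner elim: AE_mp\<close>)
qed

text \<open>\<open>P\<close> controls \<open>u\<close> only on \<open>\<Omega>\<close>; the zero
  extension built into \<open>H1\<close> supplies the complement.\<close>

lemma P_eq_0:
  assumes "u \<in> H1 \<Omega>" "P u u = 0"
  shows "u = 0"
proof -
  have i: "integrable M (\<lambda>x. (norm (J u x))\<^sup>2)"
    using J_square_integrable[OF assms(1)] by (simp add: square_integrable_def)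
  have "(LINT x|M. (norm (J u x))\<^sup>2) = 0"
    using assms(2) by (simp add: P_def power2_norm_eq_inner)
  then have "AE x in M. (norm (J u x))\<^sup>2 = 0"
    using integral_nonneg_eq_0_iff_AE[OF i] by simp
  then have "AE x in M. rep_ae_fun u x = 0"
    by eventually_elim (use lam_pos in \<open>auto simp: J_def zero_prod_def\<close>)
  then have "AE x in lebesgue. x \<in> \<Omega> \<longrightarrow> rep_ae_fun u x = 0"
    by (subst (asm) AE_lebesgue_on[OF \<Omega>_sets])
  then have "AE x in lebesgue. rep_ae_fun u x = rep_ae_fun 0 x"
    using H1_D(1)[OF assms(1)] rep_ae_fun_zero by eventually_elim auto
  then show ?thesis by (rule ae_fun_eqI)
qed

lemma J_test_function:
  assumes "test_function \<Omega> \<eta>" shows "AE x in M. J (abs_ae_fun \<eta>) x = Jt \<eta> x"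
  using test_function_H1(2)[OF open_domain assms] AE_lebesgue_onI[OF rep_abs_test_function[OF assms] \<Omega>_sets]
  by eventually_elim (simp add: J_def Jt_def)

lemma Jt_square_integrable: "test_function \<Omega> \<eta> \<Longrightarrow> square_integrable M (Jt \<eta>)"
  unfolding Jt_def[abs_def]
  using square_integrable_scaleR[OF test_function_square_integrable(1)[OF _ \<Omega>_sets], of \<Omega> \<eta> "sqrt lam"]
  by (intro square_integrable_Pair test_function_square_integrable(2)[OF _ \<Omega>_sets]) auto

lemma P_diff_test_function:
  assumes u: "u \<in> H1 \<Omega>" and \<eta>: "test_function \<Omega> \<eta>"
  shows "P (u - abs_ae_fun \<eta>) (u - abs_ae_fun \<eta>) =
    (LINT x|M. lam * (rep_ae_fun u x - \<eta> x)\<^sup>2 + (norm (weak_gradient \<Omega> u x - gradient \<eta> x))\<^sup>2)"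
proof -
  note t = test_function_H1(1)[OF open_domain \<eta>]
  note [measurable] = square_integrable_measurable[OF J_square_integrable[OF u]]
    square_integrable_measurable[OF J_square_integrable[OF t]]
    square_integrable_measurable[OF Jt_square_integrable[OF \<eta>]]
  have "P (u - abs_ae_fun \<eta>) (u - abs_ae_fun \<eta>) = (LINT x|M. (norm (J u x - J (abs_ae_fun \<eta>) x))\<^sup>2)"
    by (rule P_diff_eq[OF u t])
  also have "\<dots> = (LINT x|M. (norm (J u x - Jt \<eta> x))\<^sup>2)"
    by (rule integral_cong_AE) (use J_test_function[OF \<eta>] in \<open>auto elim: AE_mp\<close>)
  also have "\<dots> = (LINT x|M. lam * (rep_ae_fun u x - \<eta> x)\<^sup>2 + (norm (weak_gradient \<Omega> u x - gradient \<eta> x))\<^sup>2)"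
    using lam_pos
    by (intro Bochner_Integration.integral_cong refl)
       (simp add: J_def Jt_def norm_Pair right_diff_distrib[symmetric] power_mult_distrib)
  finally show ?thesis .
qed

text \<open>The definition weights the function by 1, \<open>P\<close> weights it by
  \<open>lam\<close>. All terms are nonnegative, so either sum tends to zero exactly when both
  summands do.\<close>

lemma H10_iff:
  "u \<in> H10 \<Omega> \<longleftrightarrow> u \<in> H1 \<Omega> \<and> (\<exists>\<eta>. (\<forall>k. test_function \<Omega> (\<eta> k)) \<and>
     (\<lambda>k::nat. P (u - abs_ae_fun (\<eta> k)) (u - abs_ae_fun (\<eta> k))) \<longlonglongrightarrow> 0)"
proof -
  have "(\<lambda>k. LINT x|M. (rep_ae_fun u x - \<eta> k x)\<^sup>2 + (norm (weak_gradient \<Omega> u x - gradient (\<eta> k) x))\<^sup>2) \<longlonglongrightarrow> 0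
    \<longleftrightarrow> (\<lambda>k::nat. P (u - abs_ae_fun (\<eta> k)) (u - abs_ae_fun (\<eta> k))) \<longlonglongrightarrow> 0"
    if u: "u \<in> H1 \<Omega>" and \<eta>: "\<forall>k. test_function \<Omega> (\<eta> k)" for \<eta>
  proof -
    let ?a = "\<lambda>k x. (rep_ae_fun u x - \<eta> k x)\<^sup>2" and ?b = "\<lambda>k x. (norm (weak_gradient \<Omega> u x - gradient (\<eta> k) x))\<^sup>2"
    have "square_integrable M (\<lambda>x. rep_ae_fun u x - \<eta> k x)"
      "square_integrable M (\<lambda>x. weak_gradient \<Omega> u x - gradient (\<eta> k) x)" for k
      using \<eta> by (intro square_integrable_diff H1_D u test_function_square_integrable[OF _ \<Omega>_sets]; blast)+
    then have i: "integrable M (?a k)" "integrable M (?b k)" for k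
      by (auto simp: square_integrable_def)
    define A where "A k = (LINT x|M. ?a k x)" for k
    define B where "B k = (LINT x|M. ?b k x)" for k
    have AB: "0 \<le> A k" "0 \<le> B k" for k by (auto simp: A_def B_def)
    have 1: "(LINT x|M. ?a k x + ?b k x) = A k + B k" for k using i by (simp add: A_def B_def)
    have 2: "P (u - abs_ae_fun (\<eta> k)) (u - abs_ae_fun (\<eta> k)) = lam * A k + B k" for k
      using P_diff_test_function[OF u, of "\<eta> k"] \<eta> i by (simp add: A_def B_def)
    have A0: "A \<longlonglongrightarrow> 0 \<and> B \<longlonglongrightarrow> 0" if c: "0 < c" and "(\<lambda>k. c * A k + B k) \<longlonglongrightarrow> 0" for c
    proof
      have *: "(\<lambda>k. (c * A k + B k) / c) \<longlonglongrightarrow> 0 / c" using that by (intro tendsto_intros) auto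
      show "A \<longlonglongrightarrow> 0"
        by (rule tendsto_sandwich[OF _ _ tendsto_const *[simplified]])
           (use AB c in \<open>auto simp: field_simps\<close>)
      show "B \<longlonglongrightarrow> 0"
        by (rule tendsto_sandwich[OF _ _ tendsto_const that(2)]) (use AB c in auto)
    qed
    have conv: "(\<lambda>k. c * A k + B k) \<longlonglongrightarrow> 0" if "A \<longlonglongrightarrow> 0" "B \<longlonglongrightarrow> 0" for c
      using tendsto_add[OF tendsto_mult[OF tendsto_const that(1), of c] that(2)] by simp
    show ?thesis
      unfolding 1 2 using A0[OF zero_less_one] A0[OF lam_pos] conv[of 1] conv[of lam]
      unfolding mult_1 by blast
  qed
  then show ?thesis unfolding H10_def by blast
qed

lemma H10_H1: "u \<in> H10 \<Omega> \<Longrightarrow> u \<in> H1 \<Omega>"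
  by (simp add: H10_def)

lemma H10_approx_iff:
  "u \<in> H10 \<Omega> \<longleftrightarrow> u \<in> H1 \<Omega> \<and> (\<forall>e>0. \<exists>\<eta>. test_function \<Omega> \<eta> \<and> P (u - abs_ae_fun \<eta>) (u - abs_ae_fun \<eta>) < e)"
proof
  assume "u \<in> H10 \<Omega>"
  then obtain \<eta> where u: "u \<in> H1 \<Omega>" and \<eta>: "\<And>k. test_function \<Omega> (\<eta> k)"
    "(\<lambda>k::nat. P (u - abs_ae_fun (\<eta> k)) (u - abs_ae_fun (\<eta> k))) \<longlonglongrightarrow> 0"
    by (auto simp: H10_iff)
  have "\<exists>\<eta>. test_function \<Omega> \<eta> \<and> P (u - abs_ae_fun \<eta>) (u - abs_ae_fun \<eta>) < e" if "e > 0" for e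
    using order_tendstoD(2)[OF \<eta>(2) that] \<eta>(1) unfolding eventually_sequentially by blast
  with u show "u \<in> H1 \<Omega> \<and> (\<forall>e>0. \<exists>\<eta>. test_function \<Omega> \<eta> \<and> P (u - abs_ae_fun \<eta>) (u - abs_ae_fun \<eta>) < e)" by blast
next
  assume u: "u \<in> H1 \<Omega> \<and> (\<forall>e>0. \<exists>\<eta>. test_function \<Omega> \<eta> \<and> P (u - abs_ae_fun \<eta>) (u - abs_ae_fun \<eta>) < e)"
  then have "\<forall>k. \<exists>\<eta>. test_function \<Omega> \<eta> \<and> P (u - abs_ae_fun \<eta>) (u - abs_ae_fun \<eta>) < 1 / real (Suc k)"
    by simp
  then obtain \<eta> where \<eta>: "\<And>k. test_function \<Omega> (\<eta> k)"
    "\<And>k. P (u - abs_ae_fun (\<eta> k)) (u - abs_ae_fun (\<eta> k)) < 1 / real (Suc k)"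
    by metis
  have "(\<lambda>k. P (u - abs_ae_fun (\<eta> k)) (u - abs_ae_fun (\<eta> k))) \<longlonglongrightarrow> 0"
  proof (rule tendsto_sandwich[OF _ _ tendsto_const LIMSEQ_Suc[OF lim_1_over_n]])
    have "u - abs_ae_fun (\<eta> k) \<in> H1 \<Omega>" for k
      using u test_function_H1(1)[OF open_domain \<eta>(1)[of k]] H1.V_closed by blast
    then show "\<forall>\<^sub>F k in sequentially. 0 \<le> P (u - abs_ae_fun (\<eta> k)) (u - abs_ae_fun (\<eta> k))"
      using H1.ip_nonneg by simp
    show "\<forall>\<^sub>F k in sequentially. P (u - abs_ae_fun (\<eta> k)) (u - abs_ae_fun (\<eta> k)) \<le> 1 / real (Suc k)"
      using \<eta>(2) less_imp_le by (intro always_eventually allI) blast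
  qed
  then show "u \<in> H10 \<Omega>" using u \<eta>(1) H10_iff by blast
qed

lemma P_add_le:
  assumes "u \<in> H1 \<Omega>" "v \<in> H1 \<Omega>"
  shows "P (u + v) (u + v) \<le> 2 * P u u + 2 * P v v"
proof -
  have "0 \<le> P (u + (-1) *\<^sub>R v) (u + (-1) *\<^sub>R v)"
    by (intro H1.ip_nonneg H1.V_closed assms)
  then show ?thesis
    using H1.ip_add_scale_sq[OF assms, of "-1"] H1.ip_add_scale_sq[OF assms, of 1] by simp
qed

lemma H10_closed:
  assumes u: "u \<in> H1 \<Omega>" and f: "\<And>e. e > 0 \<Longrightarrow> \<exists>v\<in>H10 \<Omega>. P (u - v) (u - v) < e"
  shows "u \<in> H10 \<Omega>"
  unfolding H10_approx_iff
proof (intro conjI allI impI u)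
  fix e :: real assume "e > 0"
  then obtain v where v: "v \<in> H10 \<Omega>" "P (u - v) (u - v) < e / 4" using f[of "e/4"] by auto
  then obtain \<eta> where \<eta>: "test_function \<Omega> \<eta>" "P (v - abs_ae_fun \<eta>) (v - abs_ae_fun \<eta>) < e / 4"
    using \<open>e > 0\<close> unfolding H10_approx_iff by (meson divide_pos_pos zero_less_numeral)
  note t = test_function_H1(1)[OF open_domain \<eta>(1)]
  have "P ((u - v) + (v - abs_ae_fun \<eta>)) ((u - v) + (v - abs_ae_fun \<eta>)) < e"
    using P_add_le[of "u - v" "v - abs_ae_fun \<eta>"] v \<eta>(2) u t H10_H1[OF v(1)] H1.V_closed by fastforce
  then show "\<exists>\<eta>. test_function \<Omega> \<eta> \<and> P (u - abs_ae_fun \<eta>) (u - abs_ae_fun \<eta>) < e"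
    using \<eta>(1) by auto
qed

lemma test_function_H10: "test_function \<Omega> \<eta> \<Longrightarrow> abs_ae_fun \<eta> \<in> H10 \<Omega>"
  unfolding H10_approx_iff using test_function_H1(1)[OF open_domain] H1.ip_scale[OF H1_zero H1_zero, of 0]
  by auto

lemma abs_test_function_lincomb:
  assumes "test_function \<Omega> \<eta>" "test_function \<Omega> \<zeta>"
  shows "abs_ae_fun (\<lambda>x. \<eta> x + r * \<zeta> x) = abs_ae_fun \<eta> + r *\<^sub>R abs_ae_fun \<zeta>"
proof (rule ae_fun_eqI)
  have "test_function \<Omega> (\<lambda>x. \<eta> x + r * \<zeta> x)"
    by (intro test_function_add test_function_cmult assms)
  from rep_abs_test_function[OF this] rep_abs_test_function[OF assms(1)] rep_abs_test_function[OF assms(2)]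
    rep_ae_fun_add[of "abs_ae_fun \<eta>" "r *\<^sub>R abs_ae_fun \<zeta>"] rep_ae_fun_scaleR[of r "abs_ae_fun \<zeta>"]
  show "AE x in lebesgue. rep_ae_fun (abs_ae_fun (\<lambda>x. \<eta> x + r * \<zeta> x)) x =
      rep_ae_fun (abs_ae_fun \<eta> + r *\<^sub>R abs_ae_fun \<zeta>) x"
    by eventually_elim simp
qed

lemma H10_lincomb:
  assumes "u \<in> H10 \<Omega>" "v \<in> H10 \<Omega>" shows "u + r *\<^sub>R v \<in> H10 \<Omega>"
proof -
  note h = assms[THEN H10_H1]
  show ?thesis
  proof (rule H10_closed)
    show "u + r *\<^sub>R v \<in> H1 \<Omega>" by (intro H1.V_closed h)
    fix e :: real assume "e > 0"
    \<comment> \<open>Chosen so that \<open>2 * d + 2 * (r\<^sup>2 * d)\<close> is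
      \<open>e / 2\<close>.\<close>
    define d where "d = e / (4 * (1 + r\<^sup>2))"
    have r: "0 < 1 + r\<^sup>2" by (simp add: add_pos_nonneg)
    have d: "d > 0" using \<open>e > 0\<close> r by (simp add: d_def)
    obtain \<eta> \<zeta> where t: "test_function \<Omega> \<eta>" "test_function \<Omega> \<zeta>"
      and l: "P (u - abs_ae_fun \<eta>) (u - abs_ae_fun \<eta>) < d" "P (v - abs_ae_fun \<zeta>) (v - abs_ae_fun \<zeta>) < d"
      using assms d unfolding H10_approx_iff by meson
    let ?w = "abs_ae_fun (\<lambda>x. \<eta> x + r * \<zeta> x)"
    note th = test_function_H1(1)[OF open_domain t(1)] test_function_H1(1)[OF open_domain t(2)]
    have w: "?w \<in> H10 \<Omega>" by (intro test_function_H10 test_function_add test_function_cmult t)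
    have eq: "u + r *\<^sub>R v - ?w = (u - abs_ae_fun \<eta>) + r *\<^sub>R (v - abs_ae_fun \<zeta>)"
      by (simp add: abs_test_function_lincomb[OF t] algebra_simps)
    have "P (u + r *\<^sub>R v - ?w) (u + r *\<^sub>R v - ?w) \<le>
      2 * P (u - abs_ae_fun \<eta>) (u - abs_ae_fun \<eta>) + 2 * P (r *\<^sub>R (v - abs_ae_fun \<zeta>)) (r *\<^sub>R (v - abs_ae_fun \<zeta>))"
      unfolding eq by (intro P_add_le H1.V_closed h th)
    also have "P (r *\<^sub>R (v - abs_ae_fun \<zeta>)) (r *\<^sub>R (v - abs_ae_fun \<zeta>)) = r\<^sup>2 * P (v - abs_ae_fun \<zeta>) (v - abs_ae_fun \<zeta>)"
      using h th by (simp add: H1.ip_scale H1.ip_scale_right H1.V_closed power2_eq_square)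
    also have "2 * P (u - abs_ae_fun \<eta>) (u - abs_ae_fun \<eta>) + 2 * (r\<^sup>2 * P (v - abs_ae_fun \<zeta>) (v - abs_ae_fun \<zeta>))
      \<le> 2 * d + 2 * (r\<^sup>2 * d)"
      using l by (intro add_mono mult_left_mono) auto
    also have "\<dots> = 2 * (d * (1 + r\<^sup>2))" by (simp add: algebra_simps)
    also have "d * (1 + r\<^sup>2) = e / 4"
      using r unfolding d_def by (metis less_irrefl nonzero_mult_divide_mult_cancel_right times_divide_eq_left)
    also have "2 * (e / 4) = e / 2" by simp
    also have "\<dots> < e" using \<open>e > 0\<close> by simp
    finally show "\<exists>w\<in>H10 \<Omega>. P (u + r *\<^sub>R v - w) (u + r *\<^sub>R v - w) < e" using w by blast
  qed
qed

lemma H10_zero: "0 \<in> H10 \<Omega>"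
  using test_function_H10[OF test_function_zero] by (simp add: zero_ae_fun_def)

lemma H10_subspace: "subspace (H10 \<Omega>)"
  unfolding subspace_def
  using H10_zero H10_lincomb[of _ _ 1] H10_lincomb[OF H10_zero] by simp

sublocale H10: semi_inner "H10 \<Omega>" P
  by standard (auto simp: H10_subspace H1.ip_add H1.ip_scale H1.ip_nonneg H10_H1 intro: P_commute)

text \<open>Being a weak gradient means that the pair is orthogonal to certain fixed elements of
  \<open>L\<^sup>2\<close>, a condition that survives the limit.\<close>

lemma H1_complete:
  assumes f: "\<And>n. f n \<in> H1 \<Omega>"
    and cauchy: "\<And>e. e > 0 \<Longrightarrow> \<exists>N. \<forall>m\<ge>N. \<forall>n\<ge>N. P (f m - f n) (f m - f n) \<le> e"
  shows "\<exists>w\<in>H1 \<Omega>. (\<lambda>n. P (f n - w) (f n - w)) \<longlonglongrightarrow> 0"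
proof -
  note sq = J_square_integrable[OF f]
  have "\<exists>N. \<forall>m\<ge>N. \<forall>n\<ge>N. (LINT x|M. (norm (J (f m) x - J (f n) x))\<^sup>2) \<le> e" if "e > 0" for e
    using cauchy[OF that] by (simp add: P_diff_eq f)
  then obtain F where F: "square_integrable M F" "(\<lambda>n. LINT x|M. (norm (J (f n) x - F x))\<^sup>2) \<longlonglongrightarrow> 0"
    by (rule square_integrable_complete[of M "\<lambda>n. J (f n)", OF sq])
  note F12 = square_integrable_fst_snd[OF F(1)]
  note [measurable] = square_integrable_measurable[OF F12(1)] square_integrable_measurable[OF F12(2)]
    square_integrable_measurable[OF F(1)]
  have sl: "sqrt lam > 0" using lam_pos by simp
  \<comment> \<open>The first component of the limit carries the factor \<open>sqrt lam\<close>;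
    extending by zero outside \<open>\<Omega>\<close> is what membership in \<open>H1\<close>
    demands.\<close>
  define h where "h x = (if x \<in> \<Omega> then fst (F x) / sqrt lam else 0)" for x
  have "(\<lambda>x. indicator \<Omega> x *\<^sub>R (fst (F x) / sqrt lam)) \<in> borel_measurable lebesgue"
    using \<Omega>_sets by (subst borel_measurable_restrict_space_iff[symmetric]) auto
  moreover have "h = (\<lambda>x. indicator \<Omega> x *\<^sub>R (fst (F x) / sqrt lam))"
    by (auto simp: h_def)
  ultimately have hm: "h \<in> borel_measurable lebesgue" by simp
  define w where "w = abs_ae_fun h"
  have rw: "AE x in lebesgue. rep_ae_fun w x = h x" unfolding w_def by (rule rep_abs_ae_fun[OF hm])
  have rwM: "AE x in M. rep_ae_fun w x = fst (F x) / sqrt lam"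
    using rw \<Omega>_sets by (subst AE_lebesgue_on) (auto simp: h_def elim: AE_mp)
  have w_sq: "square_integrable M (rep_ae_fun w)"
    by (rule square_integrable_cong_AE[OF square_integrable_scaleR[OF F12(1), of "1 / sqrt lam"]])
       (use rwM in \<open>auto elim: AE_mp\<close>)
  have wg: "is_weak_gradient \<Omega> w (\<lambda>x. snd (F x))"
    unfolding is_weak_gradient_iff[OF \<Omega>_sets w_sq F12(2)]
  proof (intro allI impI)
    fix \<eta> v assume \<eta>: "test_function \<Omega> \<eta>"
    \<comment> \<open>The division cancels the factor \<open>sqrt lam\<close> in
      \<open>J\<close>.\<close>
    let ?t = "\<lambda>x. ((gradient \<eta> x \<bullet> v) / sqrt lam, \<eta> x *\<^sub>R v)"
    have t: "square_integrable M ?t"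
      using square_integrable_scaleR[OF test_function_square_integrable(1)[OF test_function_inner_gradient[OF \<eta>, of v] \<Omega>_sets], of "1 / sqrt lam"]
        test_function_square_integrable(1)[OF \<eta> \<Omega>_sets]
      by (intro square_integrable_Pair) (auto simp: square_integrable_def power_mult_distrib)
    note [measurable] = square_integrable_measurable[OF t]
      square_integrable_measurable[OF test_function_square_integrable(1)[OF test_function_inner_gradient[OF \<eta>, of v] \<Omega>_sets]]
      square_integrable_measurable[OF test_function_square_integrable(1)[OF \<eta> \<Omega>_sets]]
    have 0: "(LINT x|M. J (f n) x \<bullet> ?t x) = 0" for n
    proof -
      have "(LINT x|M. J (f n) x \<bullet> ?t x)
        = (LINT x|M. (rep_ae_fun (f n) x, weak_gradient \<Omega> (f n) x) \<bullet> (gradient \<eta> x \<bullet> v, \<eta> x *\<^sub>R v))"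
        using sl by (intro Bochner_Integration.integral_cong refl) (simp add: J_def)
      also have "\<dots> = 0"
        using weak_gradient_is_weak_gradient[OF f[of n]] \<eta>
          is_weak_gradient_iff[OF \<Omega>_sets H1_D(2,3)[OF f[of n]]] by blast
      finally show ?thesis .
    qed
    have "(\<lambda>n. LINT x|M. J (f n) x \<bullet> ?t x) \<longlonglongrightarrow> (LINT x|M. F x \<bullet> ?t x)"
      by (rule tendsto_integral_inner[OF sq F(1) t F(2)])
    then have F0: "(LINT x|M. F x \<bullet> ?t x) = 0"
      unfolding 0 by (simp add: LIMSEQ_const_iff)
    have "(LINT x|M. (rep_ae_fun w x, snd (F x)) \<bullet> (gradient \<eta> x \<bullet> v, \<eta> x *\<^sub>R v)) = (LINT x|M. F x \<bullet> ?t x)"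
    proof (rule integral_cong_AE)
      show "AE x in M. (rep_ae_fun w x, snd (F x)) \<bullet> (gradient \<eta> x \<bullet> v, \<eta> x *\<^sub>R v) = F x \<bullet> ?t x"
        using rwM by eventually_elim (auto simp: inner_prod_def)
      show "(\<lambda>x. F x \<bullet> ?t x) \<in> borel_measurable M" by measurable
      show "(\<lambda>x. (rep_ae_fun w x, snd (F x)) \<bullet> (gradient \<eta> x \<bullet> v, \<eta> x *\<^sub>R v)) \<in> borel_measurable M"
        unfolding inner_prod_def fst_conv snd_conv by measurable
    qed
    with F0 show "(LINT x|M. (rep_ae_fun w x, snd (F x)) \<bullet> (gradient \<eta> x \<bullet> v, \<eta> x *\<^sub>R v)) = 0" by simp
  qed
  have w: "w \<in> H1 \<Omega>"
    by (rule H1_I[OF _ w_sq wg]) (use rw in \<open>auto simp: h_def elim: AE_mp\<close>)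
  have Jw: "AE x in M. J w x = F x"
    using rwM H1_weak_gradient_AE[OF open_domain w wg]
    by eventually_elim (use sl in \<open>auto simp: J_def prod_eq_iff\<close>)
  have "P (f n - w) (f n - w) = (LINT x|M. (norm (J (f n) x - F x))\<^sup>2)" for n
  proof -
    note [measurable] = square_integrable_measurable[OF sq[of n]] square_integrable_measurable[OF J_square_integrable[OF w]]
    show ?thesis
      unfolding P_diff_eq[OF f w]
      by (rule integral_cong_AE) (use Jw in \<open>auto elim: AE_mp\<close>)
  qed
  then have "(\<lambda>n. P (f n - w) (f n - w)) \<longlonglongrightarrow> 0" using F(2) by simp
  then show ?thesis using w by blast
qed

lemma H10_complete:
  assumes f: "\<And>n. f n \<in> H10 \<Omega>"
    and cauchy: "\<And>e. e > 0 \<Longrightarrow> \<exists>N. \<forall>m\<ge>N. \<forall>n\<ge>N. P (f m - f n) (f m - f n) \<le> e"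
  shows "\<exists>w\<in>H10 \<Omega>. (\<lambda>n. P (f n - w) (f n - w)) \<longlonglongrightarrow> 0"
proof -
  obtain w where w: "w \<in> H1 \<Omega>" "(\<lambda>n. P (f n - w) (f n - w)) \<longlonglongrightarrow> 0"
    using H1_complete[OF H10_H1[OF f] cauchy] by blast
  have "w \<in> H10 \<Omega>"
  proof (rule H10_closed[OF w(1)])
    fix e :: real assume "e > 0"
    then obtain n where "P (f n - w) (f n - w) < e"
      using order_tendstoD(2)[OF w(2)] unfolding eventually_sequentially by blast
    moreover have "P (w - f n) (w - f n) = P (f n - w) (f n - w)"
      using H1.ip_scale[of "f n - w" "(-1) *\<^sub>R (f n - w)" "-1"] H1.ip_scale_right[of "f n - w" "f n - w" "-1"]
        H1.V_closed(3)[OF H10_H1[OF f[of n]] w(1)] H1.V_closed(2) by (metis minus_diff_eq mult_minus1 scaleR_minus1_left minus_minus)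
    ultimately show "\<exists>v\<in>H10 \<Omega>. P (w - v) (w - v) < e" using f[of n] by (intro bexI[of _ "f n"]) simp_all
  qed
  with w(2) show ?thesis by blast
qed

lemma H10_Riesz:
  assumes "\<And>u v. u \<in> H10 \<Omega> \<Longrightarrow> v \<in> H10 \<Omega> \<Longrightarrow> F (u + v) = F u + F v"
    "\<And>u r. u \<in> H10 \<Omega> \<Longrightarrow> F (r *\<^sub>R u) = r * F u"
    "\<And>u. u \<in> H10 \<Omega> \<Longrightarrow> (F u)\<^sup>2 \<le> C * P u u"
  obtains w where "w \<in> H10 \<Omega>" "\<And>v. v \<in> H10 \<Omega> \<Longrightarrow> P w v = F v"
  using H10.Riesz[OF H10_complete assms] by metis

end

section \<open>The Sobolev embedding into \<open>L\<^sup>4\<close> in dimension at most three\<close>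

text \<open>Regarded as a function of the base point \<open>x\<close>, so that it is constant along
  \<open>i\<close> and can be integrated again in another direction without splitting
  coordinates.\<close>

definition line_integral :: "'a::euclidean_space \<Rightarrow> ('a \<Rightarrow> ennreal) \<Rightarrow> 'a \<Rightarrow> ennreal" where
  "line_integral i g x = (\<integral>\<^sup>+t. g (x + t *\<^sub>R i) \<partial>lborel)"

lemma line_integral_measurable[measurable]:
  assumes [measurable]: "g \<in> borel_measurable borel"
  shows "line_integral i g \<in> borel_measurable borel"
  unfolding line_integral_def[abs_def] by measurable

lemma line_integral_mono: "(\<And>x. f x \<le> g x) \<Longrightarrow> line_integral i f x \<le> line_integral i g x"
  unfolding line_integral_def by (intro nn_integral_mono) simp

lemma line_integral_translate:
  assumes [measurable]: "g \<in> borel_measurable borel"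
  shows "line_integral i g (x + s *\<^sub>R i) = line_integral i g x"
proof -
  have "line_integral i g x = (\<integral>\<^sup>+t. g (x + t *\<^sub>R i) \<partial>distr lborel borel ((+) s))"
    by (simp add: line_integral_def lborel_distr_plus)
  also have "\<dots> = (\<integral>\<^sup>+t. g (x + (s + t) *\<^sub>R i) \<partial>lborel)"
    by (subst nn_integral_distr) auto
  finally show ?thesis
    by (simp add: line_integral_def scaleR_add_left add.assoc)
qed

text \<open>Tonelli's theorem for the two line parameters.\<close>

lemma line_integral_commute:
  assumes [measurable]: "g \<in> borel_measurable borel"
  shows "line_integral i (line_integral j g) x = line_integral j (line_integral i g) x"
proof -
  have "line_integral i (line_integral j g) x = (\<integral>\<^sup>+t. (\<integral>\<^sup>+s. g (x + t *\<^sub>R i + s *\<^sub>R j) \<partial>lborel) \<partial>lborel)"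
    by (simp add: line_integral_def)
  also have "\<dots> = (\<integral>\<^sup>+s. (\<integral>\<^sup>+t. g (x + t *\<^sub>R i + s *\<^sub>R j) \<partial>lborel) \<partial>lborel)"
    by (rule lborel_pair.Fubini') measurable
  also have "\<dots> = line_integral j (line_integral i g) x"
    by (simp add: line_integral_def add_ac)
  finally show ?thesis .
qed

lemma line_integral_mult_const:
  assumes [measurable]: "g \<in> borel_measurable borel" and h: "\<And>s. h (x + s *\<^sub>R i) = h x"
  shows "line_integral i (\<lambda>y. h y * g y) x = h x * line_integral i g x"
  unfolding line_integral_def h by (rule nn_integral_cmult) measurable

text \<open>Peels one coordinate off the product integral; the free base point \<open>a\<close> is
  what allows the step to be repeated.\<close>

lemma nn_integral_PiM_line:
  fixes g :: "'a::euclidean_space \<Rightarrow> ennreal"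
  assumes [measurable]: "g \<in> borel_measurable borel" and I: "finite I" "i \<notin> I"
  shows "(\<integral>\<^sup>+f. g (a + (\<Sum>b\<in>insert i I. f b *\<^sub>R b)) \<partial>(\<Pi>\<^sub>M b\<in>insert i I. lborel)) =
    line_integral i (\<lambda>a. \<integral>\<^sup>+f. g (a + (\<Sum>b\<in>I. f b *\<^sub>R b)) \<partial>(\<Pi>\<^sub>M b\<in>I. lborel)) a"
proof -
  interpret product_sigma_finite "\<lambda>_. lborel :: real measure"
    by (rule product_sigma_finite.intro) (rule lborel.sigma_finite_measure_axioms)
  have [measurable]: "(\<lambda>f. g (a + (\<Sum>b\<in>insert i I. f b *\<^sub>R b))) \<in> borel_measurable (\<Pi>\<^sub>M b\<in>insert i I. (lborel :: real measure))"
  proof (rule measurable_compose[OF _ assms(1)])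
    show "(\<lambda>f. a + (\<Sum>b\<in>insert i I. f b *\<^sub>R b)) \<in> (\<Pi>\<^sub>M b\<in>insert i I. (lborel :: real measure)) \<rightarrow>\<^sub>M borel"
      by (intro borel_measurable_add borel_measurable_const borel_measurable_sum borel_measurable_scaleR)
         (use measurable_component_singleton in fastforce)+
  qed
  have s: "(\<Sum>b\<in>I. (if b = i then t else f b) *\<^sub>R b) = (\<Sum>b\<in>I. f b *\<^sub>R b)" for t and f :: "'a \<Rightarrow> real"
    using I by (intro sum.cong) auto
  show ?thesis
    unfolding line_integral_def
    by (subst product_nn_integral_insert_rev[OF I])
       (use I in \<open>auto simp: s add.assoc fun_upd_def intro!: nn_integral_cong\<close>)
qed

lemma nn_integral_lborel_PiM:
  fixes g :: "'a::euclidean_space \<Rightarrow> ennreal"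
  assumes [measurable]: "g \<in> borel_measurable borel"
  shows "(\<integral>\<^sup>+x. g x \<partial>lborel) = (\<integral>\<^sup>+f. g (0 + (\<Sum>b\<in>Basis. f b *\<^sub>R b)) \<partial>(\<Pi>\<^sub>M b\<in>Basis. lborel))"
  unfolding lborel_eq[where 'a='a] by (subst nn_integral_distr) auto

lemma nn_integral_PiM_empty:
  fixes g :: "'a::euclidean_space \<Rightarrow> ennreal"
  shows "(\<integral>\<^sup>+f. g (a + (\<Sum>b\<in>{}. f b *\<^sub>R b)) \<partial>(\<Pi>\<^sub>M b\<in>{}. (lborel :: real measure))) = g a"
proof -
  interpret product_sigma_finite "\<lambda>_. lborel :: real measure"
    by (rule product_sigma_finite.intro) (rule lborel.sigma_finite_measure_axioms)
  show ?thesis by (subst nn_integral_empty) auto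
qed

lemma nn_integral_lborel_lines:
  fixes g :: "'a::euclidean_space \<Rightarrow> ennreal"
  assumes [measurable]: "g \<in> borel_measurable borel"
  shows "(Basis :: 'a set) = {i} \<Longrightarrow> (\<integral>\<^sup>+x. g x \<partial>lborel) = line_integral i g 0"
    and "(Basis :: 'a set) = {i, j} \<Longrightarrow> i \<noteq> j \<Longrightarrow> (\<integral>\<^sup>+x. g x \<partial>lborel) = line_integral i (line_integral j g) 0"
    and "(Basis :: 'a set) = {i, j, k} \<Longrightarrow> i \<noteq> j \<Longrightarrow> j \<noteq> k \<Longrightarrow> i \<noteq> k \<Longrightarrow>
      (\<integral>\<^sup>+x. g x \<partial>lborel) = line_integral i (line_integral j (line_integral k g)) 0"
proof -
  note step = nn_integral_PiM_line[OF assms]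
  have 1: "(\<integral>\<^sup>+f. g (a + (\<Sum>b\<in>{i}. f b *\<^sub>R b)) \<partial>(\<Pi>\<^sub>M b\<in>{i}. lborel)) = line_integral i g a" for a i
    by (subst step) (simp_all add: nn_integral_PiM_empty del: sum.empty)
  have 2: "(\<integral>\<^sup>+f. g (a + (\<Sum>b\<in>{i,j}. f b *\<^sub>R b)) \<partial>(\<Pi>\<^sub>M b\<in>{i,j}. lborel)) = line_integral i (line_integral j g) a"
    if "i \<noteq> j" for a i j
    by (subst step) (use that in \<open>simp_all only: 1, simp_all\<close>)
  have 3: "(\<integral>\<^sup>+f. g (a + (\<Sum>b\<in>{i,j,k}. f b *\<^sub>R b)) \<partial>(\<Pi>\<^sub>M b\<in>{i,j,k}. lborel)) =
     line_integral i (line_integral j (line_integral k g)) a"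
    if "i \<noteq> j" "j \<noteq> k" "i \<noteq> k" for a i j k
    by (subst step) (use that in \<open>simp_all only: 2[OF that(2)], simp_all\<close>)
  note total = nn_integral_lborel_PiM[OF assms]
  show "(Basis :: 'a set) = {i} \<Longrightarrow> (\<integral>\<^sup>+x. g x \<partial>lborel) = line_integral i g 0"
    using total 1[where a=0 and i=i] by simp
  show "(Basis :: 'a set) = {i, j} \<Longrightarrow> i \<noteq> j \<Longrightarrow> (\<integral>\<^sup>+x. g x \<partial>lborel) = line_integral i (line_integral j g) 0"
    using total 2[where a=0 and i=i and j=j] by simp
  show "(Basis :: 'a set) = {i, j, k} \<Longrightarrow> i \<noteq> j \<Longrightarrow> j \<noteq> k \<Longrightarrow> i \<noteq> k \<Longrightarrow>
      (\<integral>\<^sup>+x. g x \<partial>lborel) = line_integral i (line_integral j (line_integral k g)) 0"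
    using total 3[where a=0 and i=i and j=j and k=k] by simp
qed

lemma Cauchy_Schwarz_plane:
  fixes f g :: "'a::euclidean_space \<Rightarrow> ennreal"
  assumes [measurable]: "f \<in> borel_measurable borel" "g \<in> borel_measurable borel"
  shows "(line_integral i (line_integral j (\<lambda>x. f x * g x)) x)\<^sup>2 \<le>
    line_integral i (line_integral j (\<lambda>x. (f x)\<^sup>2)) x * line_integral i (line_integral j (\<lambda>x. (g x)\<^sup>2)) x"
proof -
  have plane: "line_integral i (line_integral j h) x =
      (\<integral>\<^sup>+p. h (x + fst p *\<^sub>R i + snd p *\<^sub>R j) \<partial>(lborel \<Otimes>\<^sub>M lborel))"
    if [measurable]: "h \<in> borel_measurable borel" for h
  proof -
    have m: "(\<lambda>p. h (x + fst p *\<^sub>R i + snd p *\<^sub>R j)) \<in> borel_measurable (lborel \<Otimes>\<^sub>M lborel)"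
      by measurable
    show ?thesis
      unfolding line_integral_def by (subst lborel.nn_integral_fst[OF m, symmetric]) simp
  qed
  show ?thesis
    by (simp add: plane) (rule Cauchy_Schwarz_nn_integral; measurable)
qed

text \<open>Bound one factor \<open>(f x)\<^sup>2\<close> by a line integral \<open>A\<close> along
  \<open>i\<close> and the other by a line integral \<open>B\<close> along \<open>j\<close>. As
  \<open>A\<close> is constant along \<open>i\<close> and \<open>B\<close> along \<open>j\<close>,
  the double integral of \<open>B * A\<close> factors into the square of the plane integral of
  \<open>2 * (f x * g x)\<close>, and Cauchy-Schwarz ends the proof; the 4 is the square of that
  2.\<close>

lemma Ladyzhenskaya_plane:
  fixes f g :: "'a::euclidean_space \<Rightarrow> ennreal"
  assumes [measurable]: "f \<in> borel_measurable borel" "g \<in> borel_measurable borel"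
    and i: "\<And>x. (f x)\<^sup>2 \<le> line_integral i (\<lambda>x. 2 * (f x * g x)) x"
    and j: "\<And>x. (f x)\<^sup>2 \<le> line_integral j (\<lambda>x. 2 * (f x * g x)) x"
  shows "line_integral i (line_integral j (\<lambda>x. (f x)^4)) x \<le>
    4 * (line_integral i (line_integral j (\<lambda>x. (f x)\<^sup>2)) x * line_integral i (line_integral j (\<lambda>x. (g x)\<^sup>2)) x)"
proof -
  define h where "h x = 2 * (f x * g x)" for x
  have [measurable]: "h \<in> borel_measurable borel" unfolding h_def by measurable
  define A where "A = line_integral i h"
  define B where "B = line_integral j h"
  have [measurable]: "A \<in> borel_measurable borel" "B \<in> borel_measurable borel"
    unfolding A_def B_def by measurable
  have A_tr: "A (x + s *\<^sub>R i) = A x" and B_tr: "B (x + s *\<^sub>R j) = B x" for x s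
    unfolding A_def B_def by (rule line_integral_translate; measurable)+
  have "(f x)^4 \<le> B x * A x" for x
  proof -
    have "(f x)^4 = (f x)\<^sup>2 * (f x)\<^sup>2" by (simp flip: power_add)
    also have "\<dots> \<le> B x * A x"
      unfolding A_def B_def h_def by (intro mult_mono i j) auto
    finally show ?thesis .
  qed
  then have "line_integral i (line_integral j (\<lambda>x. (f x)^4)) x \<le> line_integral i (line_integral j (\<lambda>x. B x * A x)) x"
    by (intro line_integral_mono)
  also have "line_integral j (\<lambda>x. B x * A x) = (\<lambda>x. line_integral j A x * B x)"
    by (intro ext, subst line_integral_mult_const) (auto simp: B_tr mult.commute)
  also have "line_integral i (\<lambda>x. line_integral j A x * B x) x = line_integral j A x * line_integral i B x"
  proof (rule line_integral_mult_const)
    show "line_integral j A (x + s *\<^sub>R i) = line_integral j A x" for s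
    proof -
      have "A (x + s *\<^sub>R i + t *\<^sub>R j) = A (x + t *\<^sub>R j)" for t
        using A_tr[of "x + t *\<^sub>R j" s] by (simp add: add_ac)
      then show ?thesis by (simp add: line_integral_def)
    qed
  qed measurable
  also have "line_integral j A x = line_integral i B x"
    unfolding A_def B_def by (rule line_integral_commute) measurable
  also have "line_integral i B x * line_integral i B x = (line_integral i (line_integral j h) x)\<^sup>2"
    by (simp add: B_def power2_eq_square)
  also have "line_integral i (line_integral j h) x = 2 * line_integral i (line_integral j (\<lambda>x. f x * g x)) x"
  proof -
    have "line_integral j h = (\<lambda>x. 2 * line_integral j (\<lambda>x. f x * g x) x)"
      unfolding h_def[abs_def] by (intro ext line_integral_mult_const) auto
    then show ?thesis
      by (simp only:) (rule line_integral_mult_const; measurable; simp)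
  qed
  also have "(2 * line_integral i (line_integral j (\<lambda>x. f x * g x)) x)\<^sup>2 =
     4 * (line_integral i (line_integral j (\<lambda>x. f x * g x)) x)\<^sup>2"
    by (simp add: power_mult_distrib)
  also have "\<dots> \<le> 4 * (line_integral i (line_integral j (\<lambda>x. (f x)\<^sup>2)) x * line_integral i (line_integral j (\<lambda>x. (g x)\<^sup>2)) x)"
    by (intro mult_left_mono Cauchy_Schwarz_plane) auto
  finally show ?thesis .
qed

lemma ennreal_two_mult_le_add_squares: "2 * (a * b) \<le> a\<^sup>2 + (b::ennreal)\<^sup>2"
proof (cases "a = top \<or> b = top")
  case True
  then show ?thesis by (auto simp: power2_eq_square ennreal_top_mult)
next
  case False
  then obtain x y where xy: "a = ennreal x" "b = ennreal y" "0 \<le> x" "0 \<le> y"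
    by (cases a; cases b) auto
  have "2 * (a * b) = ennreal (2 * (x * y))"
    using xy by (simp add: ennreal_mult flip: ennreal_numeral)
  also have "\<dots> \<le> ennreal (x\<^sup>2 + y\<^sup>2)"
    using sum_squares_bound[of x y] by (intro ennreal_leI) simp
  also have "\<dots> = a\<^sup>2 + b\<^sup>2"
    using xy by (simp add: ennreal_power)
  finally show ?thesis .
qed

text \<open>On a line \<open>f\<^sup>2\<close> is bounded pointwise by \<open>F + G\<close>; on a
  plane Ladyzhenskaya's inequality applies; in space it applies on each plane orthogonal to
  \<open>k\<close>, and the slices are then integrated along \<open>k\<close>.\<close>

lemma L4_inequality_of_line_bounds:
  fixes f g :: "'a::euclidean_space \<Rightarrow> ennreal"
  assumes dim: "DIM('a) \<le> 3"
    and [measurable]: "f \<in> borel_measurable borel" "g \<in> borel_measurable borel"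
    and line: "\<And>x i. i \<in> Basis \<Longrightarrow> (f x)\<^sup>2 \<le> line_integral i (\<lambda>x. 2 * (f x * g x)) x"
  shows "(\<integral>\<^sup>+x. (f x)^4 \<partial>lborel) \<le> 4 * (\<integral>\<^sup>+x. (f x)\<^sup>2 + (g x)\<^sup>2 \<partial>lborel)\<^sup>2"
proof -
  define F where "F = (\<integral>\<^sup>+x. (f x)\<^sup>2 \<partial>lborel)"
  define G where "G = (\<integral>\<^sup>+x. (g x)\<^sup>2 \<partial>lborel)"
  have FG: "(\<integral>\<^sup>+x. (f x)\<^sup>2 + (g x)\<^sup>2 \<partial>lborel) = F + G"
    unfolding F_def G_def by (rule nn_integral_add) auto
  have h: "(\<integral>\<^sup>+x. 2 * (f x * g x) \<partial>lborel) \<le> F + G"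
    unfolding FG[symmetric] by (intro nn_integral_mono ennreal_two_mult_le_add_squares)
  have cases: "DIM('a) = 1 \<or> DIM('a) = 2 \<or> DIM('a) = 3"
    using dim DIM_positive[where 'a='a] by linarith
  have fin: "4 * (F * (F + G)) \<le> 4 * (F + G)\<^sup>2" "4 * ((F + G) * G) \<le> 4 * (F + G)\<^sup>2" "4 * (F * G) \<le> 4 * (F + G)\<^sup>2"
    unfolding power2_eq_square by (intro mult_mono add_increasing add_increasing2 order_refl; simp)+
  from cases consider i where "(Basis :: 'a set) = {i}" | i j where "(Basis :: 'a set) = {i, j}" "i \<noteq> j"
    | i j k where "(Basis :: 'a set) = {i, j, k}" "i \<noteq> j" "j \<noteq> k" "i \<noteq> k"
    by (auto simp: card_1_singleton_iff card_2_iff card_3_iff)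
  then show ?thesis
  proof cases
    case (1 i)
    note l = nn_integral_lborel_lines(1)[OF _ 1]
    have bd: "(f x)\<^sup>2 \<le> F + G" for x
    proof -
      have "(f x)\<^sup>2 \<le> line_integral i (\<lambda>x. 2 * (f x * g x)) x" by (rule line) (simp add: 1)
      also have "\<dots> = line_integral i (\<lambda>x. 2 * (f x * g x)) (0 + (x \<bullet> i) *\<^sub>R i)"
        using euclidean_representation[of x] unfolding 1 by simp
      also have "\<dots> = line_integral i (\<lambda>x. 2 * (f x * g x)) 0"
        by (rule line_integral_translate) measurable
      also have "\<dots> \<le> F + G" using h by (subst l[symmetric]) auto
      finally show ?thesis .
    qed
    have "(\<integral>\<^sup>+x. (f x)^4 \<partial>lborel) \<le> (\<integral>\<^sup>+x. (F + G) * (f x)\<^sup>2 \<partial>lborel)"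
    proof (intro nn_integral_mono)
      fix x
      have "(f x)^4 = (f x)\<^sup>2 * (f x)\<^sup>2" by (simp flip: power_add)
      also have "\<dots> \<le> (F + G) * (f x)\<^sup>2" by (intro mult_right_mono bd) simp
      finally show "(f x)^4 \<le> (F + G) * (f x)\<^sup>2" .
    qed
    also have "\<dots> = (F + G) * F" unfolding F_def by (rule nn_integral_cmult) measurable
    also have "\<dots> \<le> 4 * (F * (F + G))" using mult_right_mono[of 1 4 "F * (F + G)"] by (simp add: mult.commute)
    finally show ?thesis using fin(1) unfolding FG by (rule order_trans)
  next
    case (2 i j)
    note l = nn_integral_lborel_lines(2)[OF _ 2]
    have "(\<integral>\<^sup>+x. (f x)^4 \<partial>lborel) \<le> 4 * (F * G)"
      unfolding F_def G_def
      by (subst (1 2 3) l; (measurable; fail)?) (rule Ladyzhenskaya_plane; (measurable; fail)?; auto intro!: line simp: 2)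
    then show ?thesis using fin(3) unfolding FG by (rule order_trans)
  next
    case (3 i j k)
    note l = nn_integral_lborel_lines(3)[OF _ 3]
    let ?P = "\<lambda>h. line_integral i (line_integral j h)"
    have l': "(\<integral>\<^sup>+x. h x \<partial>lborel) = line_integral k (?P h) 0" if [measurable]: "h \<in> borel_measurable borel" for h
    proof -
      have "line_integral k (?P h) 0 = line_integral i (line_integral k (line_integral j h)) 0"
        by (rule line_integral_commute) measurable
      also have "line_integral k (line_integral j h) = line_integral j (line_integral k h)"
        by (intro ext line_integral_commute) measurable
      finally show ?thesis by (simp add: l)
    qed
    \<comment> \<open>The line bound in the third direction controls the square integral of
      \<open>f\<close> on each slice uniformly in \<open>t\<close>, so only the integral of
      \<open>g\<^sup>2\<close> is left to integrate.\<close>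
    have slice: "?P (\<lambda>x. (f x)\<^sup>2) (t *\<^sub>R k) \<le> F + G" for t
    proof -
      have "?P (\<lambda>x. (f x)\<^sup>2) (t *\<^sub>R k) \<le> ?P (line_integral k (\<lambda>x. 2 * (f x * g x))) (t *\<^sub>R k)"
        by (intro line_integral_mono line) (simp add: 3)
      also have "\<dots> = ?P (line_integral k (\<lambda>x. 2 * (f x * g x))) 0"
      proof -
        define u where "u = line_integral k (\<lambda>x. 2 * (f x * g x))"
        have tr: "u (x + t *\<^sub>R k) = u x" for x unfolding u_def by (rule line_integral_translate) measurable
        have "u (t *\<^sub>R k + a *\<^sub>R i + b *\<^sub>R j) = u (0 + a *\<^sub>R i + b *\<^sub>R j)" for a b
          using tr[of "a *\<^sub>R i + b *\<^sub>R j"] by (simp add: add_ac)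
        then show ?thesis unfolding u_def[symmetric] by (simp add: line_integral_def)
      qed
      also have "\<dots> \<le> F + G" using h by (subst l[symmetric]) auto
      finally show ?thesis .
    qed
    have "(\<integral>\<^sup>+x. (f x)^4 \<partial>lborel) = line_integral k (?P (\<lambda>x. (f x)^4)) 0" by (rule l') measurable
    also have "\<dots> \<le> (\<integral>\<^sup>+t. 4 * (F + G) * ?P (\<lambda>x. (g x)\<^sup>2) (t *\<^sub>R k) \<partial>lborel)"
      unfolding line_integral_def[of k]
    proof (intro nn_integral_mono)
      fix t
      have "?P (\<lambda>x. (f x)^4) (0 + t *\<^sub>R k) \<le> 4 * (?P (\<lambda>x. (f x)\<^sup>2) (0 + t *\<^sub>R k) * ?P (\<lambda>x. (g x)\<^sup>2) (0 + t *\<^sub>R k))"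
        by (rule Ladyzhenskaya_plane) (auto intro!: line simp: 3)
      also have "\<dots> \<le> 4 * ((F + G) * ?P (\<lambda>x. (g x)\<^sup>2) (0 + t *\<^sub>R k))"
        using slice[of t] by (intro mult_left_mono mult_right_mono) auto
      finally show "?P (\<lambda>x. (f x)^4) (0 + t *\<^sub>R k) \<le> 4 * (F + G) * ?P (\<lambda>x. (g x)\<^sup>2) (t *\<^sub>R k)"
        unfolding mult.assoc by simp
    qed
    also have "\<dots> = 4 * (F + G) * (\<integral>\<^sup>+t. ?P (\<lambda>x. (g x)\<^sup>2) (t *\<^sub>R k) \<partial>lborel)"
      by (rule nn_integral_cmult) measurable
    also have "(\<integral>\<^sup>+t. ?P (\<lambda>x. (g x)\<^sup>2) (t *\<^sub>R k) \<partial>lborel) = G"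
      unfolding G_def by (subst l') (measurable, simp add: line_integral_def[of k])
    finally show ?thesis using fin(2) unfolding FG mult.assoc by (rule order_trans)
  qed
qed

text \<open>The fundamental theorem of calculus for \<open>\<eta>\<^sup>2\<close> on a segment that
  starts outside the support and ends at \<open>x\<close>.\<close>

lemma test_function_line_bound:
  fixes \<eta> :: "'a::euclidean_space \<Rightarrow> real"
  assumes \<eta>: "test_function UNIV \<eta>" and i: "i \<in> Basis"
  shows "(ennreal \<bar>\<eta> x\<bar>)\<^sup>2 \<le> line_integral i (\<lambda>x. 2 * (ennreal \<bar>\<eta> x\<bar> * ennreal (norm (gradient \<eta> x)))) x"
proof -
  obtain C where C: "compact C" "\<And>x. x \<notin> C \<Longrightarrow> \<eta> x = 0" using \<eta> by (metis test_functionE)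
  obtain b where b: "b > 0" "\<And>y. y \<in> C \<Longrightarrow> norm y \<le> b"
    using compact_imp_bounded[OF C(1)] by (auto simp: bounded_pos)
  \<comment> \<open>Then the starting point has norm at least \<open>R - norm x = b + 1\<close>,
    which exceeds the radius \<open>b\<close> of the support.\<close>
  define R where "R = b + norm x + 1"
  have R: "R > 0" using b(1) by (simp add: R_def add_pos_nonneg)
  have "x + (- R) *\<^sub>R i \<notin> C"
  proof
    assume "x + (- R) *\<^sub>R i \<in> C"
    then have "norm (x + (- R) *\<^sub>R i) \<le> b" by (rule b)
    moreover have "norm (R *\<^sub>R i) \<le> norm (x + (- R) *\<^sub>R i) + norm x"
      using norm_triangle_ineq4[of x "x + (- R) *\<^sub>R i"] by simp
    ultimately show False using i R by (simp add: R_def)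
  qed
  then have end0: "\<eta> (x + (- R) *\<^sub>R i) = 0" by (rule C(2))
  define h where "h t = 2 * (\<eta> (x + t *\<^sub>R i) * (gradient \<eta> (x + t *\<^sub>R i) \<bullet> i))" for t
  have cont: "continuous_on UNIV h"
    unfolding h_def
    by (intro continuous_intros continuous_on_compose2[OF continuous_on_test_function[OF \<eta>, of UNIV]]
        continuous_on_compose2[OF continuous_on_gradient[OF \<eta>, of UNIV]]) auto
  then have [measurable]: "h \<in> borel_measurable borel" by (rule borel_measurable_continuous_onI)
  have hi: "integrable lborel (\<lambda>t. indicator {- R..0} t *\<^sub>R h t)"
    using cont by (intro borel_integrable_compact) (auto intro: continuous_on_subset)
  have "(LBINT t. h t * indicator {- R..0} t) = (\<eta> (x + 0 *\<^sub>R i))\<^sup>2 - (\<eta> (x + (- R) *\<^sub>R i))\<^sup>2"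
  proof (rule integral_FTC_Icc_real)
    show "- R \<le> 0" using R by simp
    show "((\<lambda>t. (\<eta> (x + t *\<^sub>R i))\<^sup>2) has_real_derivative h t) (at t)" for t
      using DERIV_power[OF test_function_line_deriv[OF \<eta>, of x i t], of 2] by (simp add: h_def mult_ac)
    show "isCont h t" for t using cont by (simp add: continuous_on_eq_continuous_at)
  qed
  then have "(\<eta> x)\<^sup>2 = (LINT t|lborel. indicator {- R..0} t *\<^sub>R h t)"
    unfolding end0 by (simp add: mult.commute)
  then have "ennreal ((\<eta> x)\<^sup>2) \<le> ennreal (norm (LINT t|lborel. indicator {- R..0} t *\<^sub>R h t))"
    by (intro ennreal_leI) simp
  also have "\<dots> \<le> (\<integral>\<^sup>+t. norm (indicator {- R..0} t *\<^sub>R h t) \<partial>lborel)"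
    by (rule integral_norm_bound_ennreal[OF hi])
  also have "\<dots> \<le> line_integral i (\<lambda>x. 2 * (ennreal \<bar>\<eta> x\<bar> * ennreal (norm (gradient \<eta> x)))) x"
    unfolding line_integral_def
  proof (intro nn_integral_mono)
    fix t
    let ?y = "x + t *\<^sub>R i"
    have "\<bar>gradient \<eta> ?y \<bullet> i\<bar> \<le> norm (gradient \<eta> ?y)"
      using Basis_le_norm[OF i] by simp
    then have "\<bar>h t\<bar> \<le> 2 * (\<bar>\<eta> ?y\<bar> * norm (gradient \<eta> ?y))"
      by (simp add: h_def abs_mult mult_left_mono)
    then have "norm (indicator {- R..0} t *\<^sub>R h t) \<le> 2 * (\<bar>\<eta> ?y\<bar> * norm (gradient \<eta> ?y))"
      by (auto simp: indicator_def)
    then have "ennreal (norm (indicator {- R..0} t *\<^sub>R h t)) \<le> ennreal (2 * (\<bar>\<eta> ?y\<bar> * norm (gradient \<eta> ?y)))"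
      by (rule ennreal_leI)
    also have "\<dots> = 2 * (ennreal \<bar>\<eta> ?y\<bar> * ennreal (norm (gradient \<eta> ?y)))"
      by (simp add: ennreal_mult)
    finally show "ennreal (norm (indicator {- R..0} t *\<^sub>R h t)) \<le> 2 * (ennreal \<bar>\<eta> ?y\<bar> * ennreal (norm (gradient \<eta> ?y)))" .
  qed
  finally show ?thesis by (simp add: ennreal_power)
qed

lemma test_function_L4_inequality:
  fixes \<eta> :: "'a::euclidean_space \<Rightarrow> real"
  assumes dim: "DIM('a) \<le> 3" and \<eta>: "test_function UNIV \<eta>"
  shows "(\<integral>\<^sup>+x. ennreal ((\<eta> x)^4) \<partial>lborel) \<le> 4 * (\<integral>\<^sup>+x. ennreal ((\<eta> x)\<^sup>2 + (norm (gradient \<eta> x))\<^sup>2) \<partial>lborel)\<^sup>2"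
proof -
  have [measurable]: "\<eta> \<in> borel_measurable borel" "gradient \<eta> \<in> borel_measurable borel"
    using continuous_on_test_function[OF \<eta>] continuous_on_gradient[OF \<eta>] by (auto intro: borel_measurable_continuous_onI)
  have "(\<integral>\<^sup>+x. (ennreal \<bar>\<eta> x\<bar>)^4 \<partial>lborel) \<le>
    4 * (\<integral>\<^sup>+x. (ennreal \<bar>\<eta> x\<bar>)\<^sup>2 + (ennreal (norm (gradient \<eta> x)))\<^sup>2 \<partial>lborel)\<^sup>2"
    by (rule L4_inequality_of_line_bounds[OF dim _ _ test_function_line_bound[OF \<eta>]]) auto
  then show ?thesis
    by (simp add: ennreal_power power_even_abs)
qed

section \<open>The embedding in terms of the form \<open>P\<close>\<close>

context sobolev
begin

lemma P_minus: "u \<in> H1 \<Omega> \<Longrightarrow> P (- u) (- u) = P u u"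
  using H1.ip_scale[of u "(-1) *\<^sub>R u" "-1"] H1.ip_scale_right[of u u "-1"] H1.V_closed(2)[of u "-1"] by simp

lemma test_function_L4_bound:
  assumes dim: "DIM('a) \<le> 3"
  obtains C where "C \<ge> 0" "\<And>\<eta>. test_function \<Omega> \<eta> \<Longrightarrow>
    (\<integral>\<^sup>+x. ennreal ((\<eta> x)^4) \<partial>M) \<le> ennreal (C * (P (abs_ae_fun \<eta>) (abs_ae_fun \<eta>))\<^sup>2)"
proof
  \<comment> \<open>\<open>P\<close> dominates \<open>m\<close> times the unweighted Sobolev norm;
    squaring this produces the constant \<open>4 / m\<^sup>2\<close>.\<close>
  define m where "m = min 1 lam"
  have m: "m > 0" "m \<le> 1" "m \<le> lam" using lam_pos by (auto simp: m_def)
  show "0 \<le> 4 / m\<^sup>2" by simp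
  fix \<eta> assume \<eta>: "test_function \<Omega> \<eta>"
  let ?p = "P (abs_ae_fun \<eta>) (abs_ae_fun \<eta>)"
  note t = test_function_H1(1)[OF open_domain \<eta>]
  have \<eta>U: "test_function UNIV \<eta>" using \<eta> by (rule test_function_mono) simp
  have UNIV_sets: "UNIV \<in> sets lebesgue" by simp
  have [measurable]: "\<eta> \<in> borel_measurable borel" "gradient \<eta> \<in> borel_measurable borel"
    using continuous_on_test_function[OF \<eta>] continuous_on_gradient[OF \<eta>] by (auto intro: borel_measurable_continuous_onI)
  obtain K where K: "compact K" "K \<subseteq> \<Omega>" "\<And>x. x \<notin> K \<Longrightarrow> \<eta> x = 0" using \<eta> by (metis test_functionE)
  have int: "integrable lborel (\<lambda>x. (\<eta> x)\<^sup>2 + (norm (gradient \<eta> x))\<^sup>2)"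
    by (rule integrable_compact_support[OF _ K(1)])
       (use K(3) gradient_support[OF \<eta> K(1,3)] in
         \<open>auto intro!: continuous_intros continuous_on_test_function[OF \<eta>] continuous_on_gradient[OF \<eta>]\<close>)
  have p_eq: "?p = (LINT x|lborel. lam * (\<eta> x)\<^sup>2 + (norm (gradient \<eta> x))\<^sup>2)"
  proof -
    have "?p = P (0 - abs_ae_fun \<eta>) (0 - abs_ae_fun \<eta>)"
      using P_minus[OF t] by simp
    also have "\<dots> = (LINT x|M. (norm (J 0 x - J (abs_ae_fun \<eta>) x))\<^sup>2)"
      by (rule P_diff_eq[OF H1_zero t])
    also have "\<dots> = (LINT x|M. lam * (\<eta> x)\<^sup>2 + (norm (gradient \<eta> x))\<^sup>2)"
    proof (rule integral_cong_AE)
      have z: "AE x in M. J 0 x = Jt (\<lambda>x. 0) x"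
        using J_test_function[OF test_function_zero] by (simp add: zero_ae_fun_def)
      have g0: "gradient (\<lambda>x. 0) x = 0" for x :: 'a
        by (rule gradient_eqI') simp
      show "AE x in M. (norm (J 0 x - J (abs_ae_fun \<eta>) x))\<^sup>2 = lam * (\<eta> x)\<^sup>2 + (norm (gradient \<eta> x))\<^sup>2"
        using z J_test_function[OF \<eta>]
        by eventually_elim (use lam_pos in \<open>simp add: Jt_def g0 norm_Pair power_mult_distrib\<close>)
      note [measurable] = square_integrable_measurable[OF J_square_integrable[OF t]]
        square_integrable_measurable[OF J_square_integrable[OF H1_zero]]
        square_integrable_measurable[OF test_function_square_integrable(1)[OF \<eta> \<Omega>_sets]]
        square_integrable_measurable[OF test_function_square_integrable(2)[OF \<eta> \<Omega>_sets]]
      show "(\<lambda>x. (norm (J 0 x - J (abs_ae_fun \<eta>) x))\<^sup>2) \<in> borel_measurable M"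
        "(\<lambda>x. lam * (\<eta> x)\<^sup>2 + (norm (gradient \<eta> x))\<^sup>2) \<in> borel_measurable M" by measurable
    qed
    also have "\<dots> = (LINT x|lborel. lam * (\<eta> x)\<^sup>2 + (norm (gradient \<eta> x))\<^sup>2)"
    proof (rule integral_lebesgue_on_eq_lborel[OF _ \<Omega>_sets])
      show "(\<lambda>x. lam * (\<eta> x)\<^sup>2 + (norm (gradient \<eta> x))\<^sup>2) \<in> borel_measurable borel" by measurable
      show "lam * (\<eta> x)\<^sup>2 + (norm (gradient \<eta> x))\<^sup>2 = 0" if "x \<notin> \<Omega>" for x
      proof -
        have "x \<notin> K" using K(2) that by blast
        then show ?thesis
          using K(3)[of x] gradient_support[OF \<eta> K(1), of x] K(3) by simp
      qed
    qed
    finally show ?thesis .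
  qed
  have sq: "integrable lborel (\<lambda>x. (\<eta> x)\<^sup>2)" "integrable lborel (\<lambda>x. (norm (gradient \<eta> x))\<^sup>2)"
    by (rule Bochner_Integration.integrable_bound[OF int]; auto intro!: AE_I2)+
  have "m * (LINT x|lborel. (\<eta> x)\<^sup>2 + (norm (gradient \<eta> x))\<^sup>2) \<le> ?p"
    unfolding p_eq integral_mult_right_zero[symmetric]
  proof (intro integral_mono)
    show "integrable lborel (\<lambda>x. m * ((\<eta> x)\<^sup>2 + (norm (gradient \<eta> x))\<^sup>2))" using int by simp
    show "integrable lborel (\<lambda>x. lam * (\<eta> x)\<^sup>2 + (norm (gradient \<eta> x))\<^sup>2)" using sq by simp
    show "m * ((\<eta> x)\<^sup>2 + (norm (gradient \<eta> x))\<^sup>2) \<le> lam * (\<eta> x)\<^sup>2 + (norm (gradient \<eta> x))\<^sup>2" for x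
      unfolding distrib_left using m by (intro add_mono mult_right_mono mult_left_le_one_le) auto
  qed
  then have le: "(LINT x|lborel. (\<eta> x)\<^sup>2 + (norm (gradient \<eta> x))\<^sup>2) \<le> ?p / m"
    using m(1) by (simp add: field_simps)
  have "(\<integral>\<^sup>+x. ennreal ((\<eta> x)^4) \<partial>M) \<le> (\<integral>\<^sup>+x. ennreal ((\<eta> x)^4) \<partial>lebesgue)"
    using \<Omega>_sets by (subst nn_integral_restrict_space) (auto intro!: nn_integral_mono simp: indicator_def)
  also have "\<dots> = (\<integral>\<^sup>+x. ennreal ((\<eta> x)^4) \<partial>lborel)" by (rule nn_integral_completion)
  also have "\<dots> \<le> 4 * (\<integral>\<^sup>+x. ennreal ((\<eta> x)\<^sup>2 + (norm (gradient \<eta> x))\<^sup>2) \<partial>lborel)\<^sup>2"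
    by (rule test_function_L4_inequality[OF dim \<eta>U])
  also have "(\<integral>\<^sup>+x. ennreal ((\<eta> x)\<^sup>2 + (norm (gradient \<eta> x))\<^sup>2) \<partial>lborel) =
      ennreal (LINT x|lborel. (\<eta> x)\<^sup>2 + (norm (gradient \<eta> x))\<^sup>2)"
    by (rule nn_integral_eq_integral[OF int]) simp
  also have "4 * (ennreal (LINT x|lborel. (\<eta> x)\<^sup>2 + (norm (gradient \<eta> x))\<^sup>2))\<^sup>2 \<le> 4 * (ennreal (?p / m))\<^sup>2"
    by (intro mult_left_mono power_mono ennreal_leI le) auto
  also have "\<dots> = ennreal (4 / m\<^sup>2 * ?p\<^sup>2)"
    using m(1) H1.ip_nonneg[OF t]
    by (simp add: ennreal_power ennreal_mult'[symmetric] power_divide flip: ennreal_numeral)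
  finally show "(\<integral>\<^sup>+x. ennreal ((\<eta> x)^4) \<partial>M) \<le> ennreal (4 / m\<^sup>2 * ?p\<^sup>2)" .
qed

lemma L2_limit_AE_subseq:
  assumes u: "u \<in> H1 \<Omega>" and \<eta>: "\<And>k::nat. test_function \<Omega> (\<eta> k)"
    and lim: "(\<lambda>k. P (u - abs_ae_fun (\<eta> k)) (u - abs_ae_fun (\<eta> k))) \<longlonglongrightarrow> 0"
  obtains r where "strict_mono r" "AE x in M. (\<lambda>k. \<eta> (r k) x) \<longlonglongrightarrow> rep_ae_fun u x"
proof -
  let ?a = "\<lambda>k x. (rep_ae_fun u x - \<eta> k x)\<^sup>2" and ?b = "\<lambda>k x. (norm (weak_gradient \<Omega> u x - gradient (\<eta> k) x))\<^sup>2"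
  have "square_integrable M (\<lambda>x. rep_ae_fun u x - \<eta> k x)"
    "square_integrable M (\<lambda>x. weak_gradient \<Omega> u x - gradient (\<eta> k) x)" for k
    by (intro square_integrable_diff H1_D u test_function_square_integrable[OF \<eta> \<Omega>_sets])+
  then have i: "integrable M (?a k)" "integrable M (?b k)" for k
    by (auto simp: square_integrable_def)
  have "(\<lambda>k. (LINT x|M. ?a k x)) \<longlonglongrightarrow> 0"
  proof (rule tendsto_sandwich[OF _ _ tendsto_const])
    show "(\<lambda>k. P (u - abs_ae_fun (\<eta> k)) (u - abs_ae_fun (\<eta> k)) / lam) \<longlonglongrightarrow> 0"
      using tendsto_divide[OF lim tendsto_const, of lam] lam_pos by simp
    show "\<forall>\<^sub>F k in sequentially. (LINT x|M. ?a k x) \<le> P (u - abs_ae_fun (\<eta> k)) (u - abs_ae_fun (\<eta> k)) / lam"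
      using lam_pos i by (simp add: P_diff_test_function[OF u \<eta>] field_simps)
  qed simp
  then have "(\<lambda>k. (LINT x|M. norm (?a k x))) \<longlonglongrightarrow> 0" by simp
  from tendsto_L1_AE_subseq[OF i(1) this] obtain r where r: "strict_mono r" "AE x in M. (\<lambda>n. ?a (r n) x) \<longlonglongrightarrow> 0"
    by auto
  have "AE x in M. (\<lambda>k. \<eta> (r k) x) \<longlonglongrightarrow> rep_ae_fun u x"
    using r(2)
  proof eventually_elim
    case (elim x)
    then have "(\<lambda>n. \<bar>rep_ae_fun u x - \<eta> (r n) x\<bar>) \<longlonglongrightarrow> 0"
      using tendsto_real_sqrt[OF elim] by simp
    then have "(\<lambda>n. rep_ae_fun u x - \<eta> (r n) x) \<longlonglongrightarrow> 0" by (simp add: tendsto_rabs_zero_iff)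
    from tendsto_diff[OF tendsto_const[of "rep_ae_fun u x"] this] show ?case by simp
  qed
  with r(1) show thesis by (rule that)
qed

text \<open>Fatou's lemma along an almost everywhere convergent subsequence of test functions. The
  new factor 4 comes from estimating the form at the approximations by
  \<open>2 * P u u + 2 * p k\<close> and squaring.\<close>

lemma H10_L4:
  assumes dim: "DIM('a) \<le> 3"
  obtains C where "C \<ge> 0" "\<And>u. u \<in> H10 \<Omega> \<Longrightarrow> integrable M (\<lambda>x. (rep_ae_fun u x)^4)"
    "\<And>u. u \<in> H10 \<Omega> \<Longrightarrow> (LINT x|M. (rep_ae_fun u x)^4) \<le> C * (P u u)\<^sup>2"
proof -
  obtain C where C: "C \<ge> 0" "\<And>\<eta>. test_function \<Omega> \<eta> \<Longrightarrow>
    (\<integral>\<^sup>+x. ennreal ((\<eta> x)^4) \<partial>M) \<le> ennreal (C * (P (abs_ae_fun \<eta>) (abs_ae_fun \<eta>))\<^sup>2)"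
    using test_function_L4_bound[OF dim] by blast
  have main: "(\<integral>\<^sup>+x. ennreal ((rep_ae_fun u x)^4) \<partial>M) \<le> ennreal (4 * C * (P u u)\<^sup>2)" if u: "u \<in> H10 \<Omega>" for u
  proof -
    obtain \<eta> where u1: "u \<in> H1 \<Omega>" and \<eta>: "\<And>k. test_function \<Omega> (\<eta> k)"
      and lim: "(\<lambda>k::nat. P (u - abs_ae_fun (\<eta> k)) (u - abs_ae_fun (\<eta> k))) \<longlonglongrightarrow> 0"
      using u by (auto simp: H10_iff)
    obtain r where r: "strict_mono r" "AE x in M. (\<lambda>k. \<eta> (r k) x) \<longlonglongrightarrow> rep_ae_fun u x"
      using L2_limit_AE_subseq[OF u1 \<eta> lim] by blast
    define p where "p k = P (u - abs_ae_fun (\<eta> (r k))) (u - abs_ae_fun (\<eta> (r k)))" for k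
    have p: "p \<longlonglongrightarrow> 0"
      using LIMSEQ_subseq_LIMSEQ[OF lim r(1)] by (simp add: p_def[abs_def] o_def)
    note [measurable] = test_function_square_integrable(1)[OF \<eta> \<Omega>_sets, THEN square_integrable_measurable]
    have "(\<integral>\<^sup>+x. ennreal ((rep_ae_fun u x)^4) \<partial>M) = (\<integral>\<^sup>+x. liminf (\<lambda>k. ennreal ((\<eta> (r k) x)^4)) \<partial>M)"
    proof (rule nn_integral_cong_AE, use r(2) in eventually_elim)
      case (elim x)
      then have "(\<lambda>k. ennreal ((\<eta> (r k) x)^4)) \<longlonglongrightarrow> ennreal ((rep_ae_fun u x)^4)"
        by (intro tendsto_ennrealI tendsto_intros)
      then show ?case by (rule lim_imp_Liminf[OF trivial_limit_sequentially, symmetric])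
    qed
    also have "\<dots> \<le> liminf (\<lambda>k. \<integral>\<^sup>+x. ennreal ((\<eta> (r k) x)^4) \<partial>M)"
      by (rule nn_integral_liminf) measurable
    also have "\<dots> \<le> liminf (\<lambda>k. ennreal (C * (2 * P u u + 2 * p k)\<^sup>2))"
    proof (intro Liminf_mono always_eventually allI)
      fix k
      note t = test_function_H1(1)[OF open_domain \<eta>[of "r k"]]
      let ?t = "abs_ae_fun (\<eta> (r k))"
      have "P ?t ?t = P (u + (-1) *\<^sub>R (u - ?t)) (u + (-1) *\<^sub>R (u - ?t))" by simp
      also have "\<dots> \<le> 2 * P u u + 2 * P ((-1) *\<^sub>R (u - ?t)) ((-1) *\<^sub>R (u - ?t))"
        by (intro P_add_le H1.V_closed u1 t)
      also have "P ((-1) *\<^sub>R (u - ?t)) ((-1) *\<^sub>R (u - ?t)) = p k"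
        using P_minus[OF H1.V_closed(3)[OF u1 t]] by (simp add: p_def)
      finally have "P ?t ?t \<le> 2 * P u u + 2 * p k" .
      then have "C * (P ?t ?t)\<^sup>2 \<le> C * (2 * P u u + 2 * p k)\<^sup>2"
        using C(1) H1.ip_nonneg[OF t] by (intro mult_left_mono power_mono) auto
      with C(2)[OF \<eta>[of "r k"]]
      show "(\<integral>\<^sup>+x. ennreal ((\<eta> (r k) x)^4) \<partial>M) \<le> ennreal (C * (2 * P u u + 2 * p k)\<^sup>2)"
        by (meson ennreal_leI order_trans)
    qed
    also have "\<dots> = ennreal (C * (2 * P u u + 2 * 0)\<^sup>2)"
      by (intro lim_imp_Liminf trivial_limit_sequentially tendsto_ennrealI tendsto_intros p)
    finally show ?thesis by (simp add: power_mult_distrib mult_ac)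
  qed
  show thesis
  proof (rule that[of "4 * C"])
    fix u assume u: "u \<in> H10 \<Omega>"
    show i: "integrable M (\<lambda>x. (rep_ae_fun u x)^4)"
      by (rule integrableI_bounded)
         (use main[OF u] in \<open>auto intro: le_less_trans\<close>)
    have "ennreal (LINT x|M. (rep_ae_fun u x)^4) \<le> ennreal (4 * C * (P u u)\<^sup>2)"
      using main[OF u] nn_integral_eq_integral[OF i] by simp
    then show "(LINT x|M. (rep_ae_fun u x)^4) \<le> 4 * C * (P u u)\<^sup>2"
      using C(1) by (simp add: ennreal_le_iff)
  qed (use C(1) in simp)
qed

end

section \<open>Density of test functions in \<open>H\<^sup>1(\<real>\<^sup>N)\<close>\<close>

text \<open>Otherwise \<open>g'\<close> vanishes at 0 and is positive just to the right, so
  \<open>g\<close> would rise above its maximum.\<close>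

lemma second_derivative_at_max_nonpos:
  fixes g g' :: "real \<Rightarrow> real"
  assumes "\<And>t. (g has_real_derivative g' t) (at t)" "(g' has_real_derivative l) (at 0)" "\<And>t. g t \<le> g 0"
  shows "l \<le> 0"
proof (rule ccontr)
  assume "\<not> l \<le> 0"
  then have "0 < l" by simp
  have "g' 0 = 0"
    by (rule DERIV_local_max[OF assms(1)[of 0], of 1]) (use assms(3) in auto)
  obtain d where d: "d > 0" "\<And>h. 0 < h \<Longrightarrow> h < d \<Longrightarrow> g' 0 < g' (0 + h)"
    using DERIV_pos_inc_right[OF assms(2) \<open>0 < l\<close>] by auto
  obtain z where z: "0 < z" "z < d / 2" "g (d/2) - g 0 = (d/2 - 0) * g' z"
    using MVT2[of 0 "d/2" g g'] d(1) assms(1) by auto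
  have "0 < g' z" using d(2)[of z] z \<open>g' 0 = 0\<close> d(1) by simp
  then have "0 < (d / 2 - 0) * g' z" using d(1) by simp
  then have "g 0 < g (d/2)" using z(3) by linarith
  then show False using assms(3)[of "d/2"] by simp
qed

lemma indicator_compact_square_integrable:
  fixes C :: "'a::euclidean_space set"
  assumes "compact C" "\<Omega> \<in> sets lebesgue"
  shows "square_integrable (lebesgue_on \<Omega>) (\<lambda>x. indicator C x :: real)"
  unfolding square_integrable_def
proof
  have C: "C \<in> sets borel" using assms(1) by (simp add: borel_compact)
  show "(\<lambda>x. indicator C x :: real) \<in> borel_measurable (lebesgue_on \<Omega>)"
    using C by (intro measurable_restrict_space1 measurable_completion) auto
  have "integrable lborel (\<lambda>x. indicator C x :: real)"
    using C emeasure_compact_finite[OF assms(1)] by (intro integrable_real_indicator) auto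
  then have "integrable (lebesgue_on \<Omega>) (\<lambda>x. indicator C x :: real)"
    by (rule integrable_lebesgue_on_of_lborel[OF _ assms(2)])
  moreover have "(\<lambda>x. (norm (indicator C x :: real))\<^sup>2) = indicator C"
    by (auto simp: indicator_def)
  ultimately show "integrable (lebesgue_on \<Omega>) (\<lambda>x. (norm (indicator C x :: real))\<^sup>2)"
    by simp
qed

lemma test_function_translate:
  assumes "test_function UNIV \<rho>"
  shows "test_function UNIV (\<lambda>y. \<rho> (y + x))" "gradient (\<lambda>y. \<rho> (y + x)) y = gradient \<rho> (y + x)"
proof -
  have "linear (\<lambda>x::'a. x)" "inj (\<lambda>x::'a. x)" by (auto simp: linear_iff)
  note aff = test_function_affine[OF assms this, of x]
  show "test_function UNIV (\<lambda>y. \<rho> (y + x))" using aff(1) by (simp add: add.commute)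
  have "gradient (\<lambda>y. \<rho> (y + x)) y \<bullet> v = gradient \<rho> (y + x) \<bullet> v" for v
    using aff(2)[of y v] by (simp add: add.commute)
  then show "gradient (\<lambda>y. \<rho> (y + x)) y = gradient \<rho> (y + x)"
    by (metis vector_eq_rdot)
qed

text \<open>Convolution with a reflected test function.\<close>

definition conv :: "('a::euclidean_space \<Rightarrow> real) \<Rightarrow> ('a \<Rightarrow> real) \<Rightarrow> 'a \<Rightarrow> real" where
  "conv w \<rho> x = (LINT y|lebesgue_on UNIV. \<rho> (y + x) * w y)"

context
  fixes w :: "'a::euclidean_space \<Rightarrow> real"
  assumes w: "square_integrable (lebesgue_on UNIV) w"
begin

lemma w_measurable[measurable]: "w \<in> borel_measurable (lebesgue_on UNIV)"
  using w by (rule square_integrable_measurable)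

lemma w_locally_integrable: "compact C \<Longrightarrow> integrable (lebesgue_on UNIV) (\<lambda>y. indicator C y * w y)"
  using square_integrable_inner[OF indicator_compact_square_integrable w] by simp

text \<open>All derivatives fall on \<open>\<rho>\<close>, which is how \<open>w\<close>, a mere
  element of \<open>L\<^sup>2\<close>, becomes accessible to the classical maximum
  principle.\<close>

lemma conv_has_derivative:
  assumes \<rho>: "test_function UNIV \<rho>"
  shows "((\<lambda>t. conv w \<rho> (x + t *\<^sub>R v)) has_real_derivative conv w (\<lambda>y. gradient \<rho> y \<bullet> v) (x + t *\<^sub>R v)) (at t)"
proof -
  let ?z = "x + t *\<^sub>R v"
  note tr = test_function_translate[OF \<rho>, of ?z]
  have int: "integrable (lebesgue_on UNIV) (\<lambda>y. \<rho> (y + z) * w y)" for z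
    using square_integrable_inner[OF test_function_square_integrable(1)[OF test_function_translate(1)[OF \<rho>, of z]] w]
    by simp
  show ?thesis
    unfolding DERIV_def tendsto_at_iff_sequentially
  proof (intro allI impI)
    fix h :: "nat \<Rightarrow> real"
    assume h: "\<forall>i. h i \<in> UNIV - {0}" "h \<longlonglongrightarrow> 0"
    have "(\<lambda>n. LINT y|lebesgue_on UNIV. (\<rho> (y + h n *\<^sub>R v + ?z) - \<rho> (y + ?z)) / h n * w y) \<longlonglongrightarrow>
      (LINT y|lebesgue_on UNIV. (gradient (\<lambda>y. \<rho> (y + ?z)) y \<bullet> v) * w y)"
      by (rule difference_quotient_integral_tendsto[OF tr(1) w_measurable _ w_locally_integrable h(2)])
         (use h(1) in auto)
    moreover have "(LINT y|lebesgue_on UNIV. (\<rho> (y + h n *\<^sub>R v + ?z) - \<rho> (y + ?z)) / h n * w y) =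
      (conv w \<rho> (x + (t + h n) *\<^sub>R v) - conv w \<rho> ?z) / h n" for n
    proof -
      have "(\<rho> (y + h n *\<^sub>R v + ?z) - \<rho> (y + ?z)) / h n * w y =
        (\<rho> (y + (x + (t + h n) *\<^sub>R v)) * w y - \<rho> (y + ?z) * w y) / h n" for y
        by (simp add: algebra_simps diff_divide_distrib)
      then have "(LINT y|lebesgue_on UNIV. (\<rho> (y + h n *\<^sub>R v + ?z) - \<rho> (y + ?z)) / h n * w y) =
        (LINT y|lebesgue_on UNIV. (\<rho> (y + (x + (t + h n) *\<^sub>R v)) * w y - \<rho> (y + ?z) * w y) / h n)"
        by presburger
      also have "\<dots> = (conv w \<rho> (x + (t + h n) *\<^sub>R v) - conv w \<rho> ?z) / h n"
        using int by (simp add: conv_def)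
      finally show ?thesis .
    qed
    ultimately have "(\<lambda>n. (conv w \<rho> (x + (t + h n) *\<^sub>R v) - conv w \<rho> ?z) / h n)
      \<longlonglongrightarrow> (LINT y|lebesgue_on UNIV. (gradient (\<lambda>y. \<rho> (y + ?z)) y \<bullet> v) * w y)"
      by (simp only:)
    then show "((\<lambda>h. (conv w \<rho> (x + (t + h) *\<^sub>R v) - conv w \<rho> ?z) / h) \<circ> h)
      \<longlonglongrightarrow> conv w (\<lambda>y. gradient \<rho> y \<bullet> v) ?z"
      by (simp add: o_def tr(2) conv_def)
  qed
qed

lemma conv_continuous:
  assumes \<rho>: "test_function UNIV \<rho>"
  shows "continuous_on UNIV (conv w \<rho>)"
proof (rule continuous_at_imp_continuous_on, rule ballI, rule continuous_at_sequentiallyI)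
  fix x u assume u: "u \<longlonglongrightarrow> (x::'a)"
  obtain B C where BC: "B > 0" "compact C" "\<And>y. \<bar>\<rho> y\<bar> \<le> B * indicator C y"
    using test_function_bounded[OF \<rho>] by metis
  obtain b where b: "b > 0" "\<And>y. y \<in> C \<Longrightarrow> norm y \<le> b"
    using compact_imp_bounded[OF BC(2)] by (auto simp: bounded_pos)
  obtain N where N: "\<And>n. n \<ge> N \<Longrightarrow> dist (u n) x < 1"
    using u unfolding LIMSEQ_def by (meson zero_less_one)
  \<comment> \<open>Late terms satisfy \<open>norm (u n) \<le> norm x + 1\<close>, so this ball
    contains the supports of all the translates.\<close>
  let ?D = "cball (0::'a) (b + norm x + 1)"
  have "(\<lambda>n. LINT y|lebesgue_on UNIV. \<rho> (y + u (n + N)) * w y) \<longlonglongrightarrow> (LINT y|lebesgue_on UNIV. \<rho> (y + x) * w y)"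
  proof (rule integral_dominated_convergence[where w="\<lambda>y. B * \<bar>indicator ?D y * w y\<bar>"])
    show "integrable (lebesgue_on UNIV) (\<lambda>y. B * \<bar>indicator ?D y * w y\<bar>)"
      using w_locally_integrable[of ?D] by simp
    have m[measurable]: "(\<lambda>y. \<rho> (y + z)) \<in> borel_measurable (lebesgue_on UNIV)" for z
      by (intro borel_measurable_continuous_lebesgue_on continuous_on_test_function[OF test_function_translate(1)] \<rho>)
    show "(\<lambda>y. \<rho> (y + x) * w y) \<in> borel_measurable (lebesgue_on UNIV)"
      "(\<lambda>y. \<rho> (y + u (n + N)) * w y) \<in> borel_measurable (lebesgue_on UNIV)" for n by measurable
    have c: "isCont \<rho> y" for y
      using continuous_on_test_function[OF \<rho>, of UNIV] by (simp add: continuous_on_eq_continuous_at)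
    show "AE y in lebesgue_on UNIV. (\<lambda>n. \<rho> (y + u (n + N)) * w y) \<longlonglongrightarrow> \<rho> (y + x) * w y"
      using LIMSEQ_ignore_initial_segment[OF u, of N]
      by (intro AE_I2 tendsto_mult tendsto_const isCont_tendsto_compose[OF c] tendsto_add)
    show "AE y in lebesgue_on UNIV. norm (\<rho> (y + u (n + N)) * w y) \<le> B * \<bar>indicator ?D y * w y\<bar>" for n
    proof (rule AE_I2)
      fix y
      have "\<bar>\<rho> (y + u (n + N))\<bar> \<le> B * indicator ?D y"
      proof (cases "y + u (n + N) \<in> C")
        case True
        have "norm y \<le> norm (y + u (n + N)) + norm (u (n + N))"
          using norm_triangle_ineq4[of "y + u (n + N)" "u (n + N)"] by simp
        also have "norm (u (n + N)) \<le> norm x + 1"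
          using N[of "n + N"] norm_triangle_ineq2[of "u (n + N)" x] by (simp add: dist_norm)
        finally have "y \<in> ?D" using b(2)[OF True] by simp
        then show ?thesis using BC(3)[of "y + u (n + N)"] True by simp
      next
        case False
        then show ?thesis using BC(3)[of "y + u (n + N)"] BC(1) by simp
      qed
      from mult_right_mono[OF this abs_ge_zero[of "w y"]]
      show "norm (\<rho> (y + u (n + N)) * w y) \<le> B * \<bar>indicator ?D y * w y\<bar>"
        by (simp add: abs_mult mult.assoc)
    qed
  qed
  then show "(\<lambda>n. conv w \<rho> (u n)) \<longlonglongrightarrow> conv w \<rho> x"
    unfolding conv_def by (rule LIMSEQ_offset)
qed

text \<open>If \<open>norm x \<ge> b + n\<close>, the translate of \<open>\<rho>\<close> meets only
  the part of \<open>w\<close> outside the ball of radius \<open>n\<close>; Cauchy-Schwarz bounds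
  the convolution by that tail of the integral of \<open>w\<^sup>2\<close>.\<close>

lemma conv_vanishes_at_infinity:
  assumes \<rho>: "test_function UNIV \<rho>" and e: "e > 0"
  obtains R where "\<And>x. norm x \<ge> R \<Longrightarrow> \<bar>conv w \<rho> x\<bar> < e"
proof -
  let ?M = "lebesgue_on (UNIV :: 'a set)"
  obtain B C where BC: "B > 0" "compact C" "\<And>y. \<bar>\<rho> y\<bar> \<le> B * indicator C y"
    using test_function_bounded[OF \<rho>] by metis
  obtain b where b: "b > 0" "\<And>y. y \<in> C \<Longrightarrow> norm y \<le> b"
    using compact_imp_bounded[OF BC(2)] by (auto simp: bounded_pos)
  define K where "K = (LINT x|lborel. (\<rho> x)\<^sup>2)"
  have \<rho>m[measurable]: "\<rho> \<in> borel_measurable borel"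
    using continuous_on_test_function[OF \<rho>] by (auto intro: borel_measurable_continuous_onI)
  define tail where "tail n y = indicator {y. real n \<le> norm y} y * w y" for n y
  have tail_sq: "square_integrable ?M (tail n)" for n
  proof -
    have [measurable]: "(\<lambda>y. indicator {y. real n \<le> norm y} y :: real) \<in> borel_measurable ?M"
      by (intro measurable_restrict_space1 measurable_completion) measurable
    have i: "integrable ?M (\<lambda>y. (norm (w y))\<^sup>2)" using w by (simp add: square_integrable_def)
    have [measurable]: "tail n \<in> borel_measurable ?M" unfolding tail_def[abs_def] by measurable
    have "integrable ?M (\<lambda>y. (norm (tail n y))\<^sup>2)"
    proof (rule Bochner_Integration.integrable_bound[OF i])
      show "(\<lambda>y. (norm (tail n y))\<^sup>2) \<in> borel_measurable ?M" by measurable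
    qed (auto simp: tail_def indicator_def intro!: AE_I2)
    then show ?thesis by (simp add: square_integrable_def tail_def[abs_def])
  qed
  have "(\<lambda>n. LINT y|?M. (norm (tail n y))\<^sup>2) \<longlonglongrightarrow> (LINT y|?M. 0)"
  proof (rule integral_dominated_convergence[where w="\<lambda>y. (norm (w y))\<^sup>2"])
    show "integrable ?M (\<lambda>y. (norm (w y))\<^sup>2)" using w by (simp add: square_integrable_def)
    show "(\<lambda>y. (norm (tail n y))\<^sup>2) \<in> borel_measurable ?M" for n
      using square_integrable_measurable[OF tail_sq[of n]] by measurable
    show "AE y in ?M. norm ((norm (tail n y))\<^sup>2) \<le> (norm (w y))\<^sup>2" for n
      by (intro AE_I2) (auto simp: tail_def indicator_def)
    show "AE y in ?M. (\<lambda>n. (norm (tail n y))\<^sup>2) \<longlonglongrightarrow> 0"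
    proof (rule AE_I2)
      fix y :: 'a
      obtain m where m: "norm y < real m" using reals_Archimedean2 by blast
      have "\<forall>\<^sub>F n in sequentially. (norm (tail n y))\<^sup>2 = 0"
        using m by (intro eventually_sequentiallyI[of m]) (auto simp: tail_def indicator_def)
      then show "(\<lambda>n. (norm (tail n y))\<^sup>2) \<longlonglongrightarrow> 0" by (rule tendsto_eventually)
    qed
  qed simp
  then have "(\<lambda>n. K * (LINT y|?M. (norm (tail n y))\<^sup>2)) \<longlonglongrightarrow> 0"
    by (intro tendsto_mult_right_zero) simp
  then have "\<forall>\<^sub>F n in sequentially. K * (LINT y|?M. (norm (tail n y))\<^sup>2) < e\<^sup>2"
    by (rule order_tendstoD) (use e in simp)
  then obtain n where n: "K * (LINT y|?M. (norm (tail n y))\<^sup>2) < e\<^sup>2"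
    unfolding eventually_sequentially by blast
  show thesis
  proof (rule that[of "b + real n"])
    fix x :: 'a assume x: "b + real n \<le> norm x"
    note sq = test_function_square_integrable(1)[OF test_function_translate(1)[OF \<rho>, of x], of UNIV]
    have "\<rho> (y + x) * w y = \<rho> (y + x) * tail n y" for y
    proof (cases "y + x \<in> C")
      case True
      then have "norm (y + x) \<le> b" by (rule b)
      then have "real n \<le> norm y" using x norm_triangle_ineq4[of "y + x" y] by simp
      then show ?thesis by (simp add: tail_def)
    next
      case False
      then show ?thesis using BC(3)[of "y + x"] by simp
    qed
    then have "(conv w \<rho> x)\<^sup>2 = (LINT y|?M. \<rho> (y + x) \<bullet> tail n y)\<^sup>2"
      unfolding conv_def inner_real_def by presburger
    also have "\<dots> \<le> (LINT y|?M. (norm (\<rho> (y + x)))\<^sup>2) * (LINT y|?M. (norm (tail n y))\<^sup>2)"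
      by (intro Cauchy_Schwarz_integral sq tail_sq) auto
    also have "(LINT y|?M. (norm (\<rho> (y + x)))\<^sup>2) = (LINT y|lborel. (norm (\<rho> (y + x)))\<^sup>2)"
      by (rule integral_lebesgue_on_eq_lborel) auto
    also have "\<dots> = K"
      using lborel_integral_translate[of "\<lambda>y. (\<rho> y)\<^sup>2" x] by (simp add: K_def)
    finally have "(conv w \<rho> x)\<^sup>2 < e\<^sup>2" using n by simp
    then show "\<bar>conv w \<rho> x\<bar> < e"
      using e power2_less_imp_less[of "\<bar>conv w \<rho> x\<bar>" e] by simp
  qed
qed

text \<open>Maximum principle: a positive maximum of \<open>v = conv w \<rho>\<close> is incompatible with \<open>\<Delta>v = lam v\<close>.\<close>

lemma conv_nonpos:
  assumes lam: "lam > 0"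
    and eq: "\<And>\<eta>. test_function UNIV \<eta> \<Longrightarrow>
      (\<Sum>i\<in>Basis. conv w (\<lambda>y. gradient (\<lambda>y. gradient \<eta> y \<bullet> i) y \<bullet> i) 0) = lam * conv w \<eta> 0"
    and \<rho>: "test_function UNIV \<rho>"
  shows "conv w \<rho> x \<le> 0"
proof (rule ccontr)
  assume "\<not> conv w \<rho> x \<le> 0"
  then have pos: "conv w \<rho> x > 0" by simp
  obtain R where R: "\<And>y. norm y \<ge> R \<Longrightarrow> \<bar>conv w \<rho> y\<bar> < conv w \<rho> x"
    using conv_vanishes_at_infinity[OF \<rho> pos] by metis
  have "\<exists>z\<in>cball 0 (max R (norm x)). \<forall>y\<in>cball 0 (max R (norm x)). conv w \<rho> y \<le> conv w \<rho> z"
    by (rule continuous_attains_sup)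
       (use continuous_on_subset[OF conv_continuous[OF \<rho>]] in \<open>auto simp: le_max_iff_disj intro!: exI[of _ 0]\<close>)
  then obtain z where z: "\<And>y. y \<in> cball 0 (max R (norm x)) \<Longrightarrow> conv w \<rho> y \<le> conv w \<rho> z" by blast
  have zx: "conv w \<rho> x \<le> conv w \<rho> z" by (rule z) simp
  have max: "conv w \<rho> y \<le> conv w \<rho> z" for y
  proof (cases "norm y \<le> max R (norm x)")
    case False
    then have "\<bar>conv w \<rho> y\<bar> < conv w \<rho> x" by (intro R) simp
    then show ?thesis using zx by simp
  qed (use z in simp)
  have "conv w (\<lambda>y. gradient (\<lambda>y. gradient \<rho> y \<bullet> i) y \<bullet> i) z \<le> 0" for i
  proof (rule second_derivative_at_max_nonpos)
    show "((\<lambda>t. conv w \<rho> (z + t *\<^sub>R i)) has_real_derivative conv w (\<lambda>y. gradient \<rho> y \<bullet> i) (z + t *\<^sub>R i)) (at t)" for t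
      by (rule conv_has_derivative[OF \<rho>])
    show "((\<lambda>t. conv w (\<lambda>y. gradient \<rho> y \<bullet> i) (z + t *\<^sub>R i)) has_real_derivative
       conv w (\<lambda>y. gradient (\<lambda>y. gradient \<rho> y \<bullet> i) y \<bullet> i) z) (at 0)"
      using conv_has_derivative[OF test_function_inner_gradient[OF \<rho>, of i], of z i 0] by simp
  qed (simp add: max)
  then have "(\<Sum>i\<in>Basis. conv w (\<lambda>y. gradient (\<lambda>y. gradient \<rho> y \<bullet> i) y \<bullet> i) z) \<le> 0"
    by (intro sum_nonpos) simp
  also have "(\<Sum>i\<in>Basis. conv w (\<lambda>y. gradient (\<lambda>y. gradient \<rho> y \<bullet> i) y \<bullet> i) z) = lam * conv w \<rho> z"
  proof -
    \<comment> \<open>The hypothesis is an identity at 0 for every test function; inserting the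
      translate of \<open>\<rho>\<close> by \<open>z\<close> moves it to \<open>z\<close>.\<close>
    note tr = test_function_translate[OF \<rho>, of z]
    have "gradient (\<lambda>y. gradient (\<lambda>y. \<rho> (y + z)) y \<bullet> i) y = gradient (\<lambda>y. gradient \<rho> y \<bullet> i) (y + z)" for i y
      using test_function_translate(2)[OF test_function_inner_gradient[OF \<rho>, of i], of z y] by (simp add: tr(2))
    then show ?thesis using eq[OF tr(1)] by (simp add: conv_def)
  qed
  finally show False using lam pos zx by (simp add: mult_le_0_iff)
qed

end

text \<open>Let \<open>z\<close> be the \<open>P\<close>-projection of \<open>u\<close> to
  \<open>H10\<close> and \<open>w = u - z\<close>. Orthogonality to test functions means that
  \<open>w\<close> solves \<open>\<Delta>w = lam w\<close> weakly, so by the maximum principle its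
  convolutions vanish.\<close>

lemma (in sobolev) H1_eq_H10_UNIV:
  assumes UNIV: "\<Omega> = UNIV"
  shows "H1 \<Omega> = H10 \<Omega>"
proof
  show "H10 \<Omega> \<subseteq> H1 \<Omega>" using H10_H1 by blast
  show "H1 \<Omega> \<subseteq> H10 \<Omega>"
  proof
    fix u assume u: "u \<in> H1 \<Omega>"
    have CS: "(P u v)\<^sup>2 \<le> P u u * P v v" if "v \<in> H1 \<Omega>" for v
      using Cauchy_Schwarz_integral[OF J_square_integrable[OF u] J_square_integrable[OF that]]
      by (simp add: P_def power2_norm_eq_inner)
    obtain z where z: "z \<in> H10 \<Omega>" "\<And>v. v \<in> H10 \<Omega> \<Longrightarrow> P z v = P u v"
    proof (rule H10_Riesz[of "P u" "P u u"])
      show "P u (v + v') = P u v + P u v'" if "v \<in> H10 \<Omega>" "v' \<in> H10 \<Omega>" for v v'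
        by (intro H1.ip_add_right u H10_H1 that)
      show "P u (r *\<^sub>R v) = r * P u v" if "v \<in> H10 \<Omega>" for v r
        by (intro H1.ip_scale_right u H10_H1 that)
      show "(P u v)\<^sup>2 \<le> P u u * P v v" if "v \<in> H10 \<Omega>" for v
        by (intro CS H10_H1 that)
    qed blast
    define w where "w = u - z"
    have w: "w \<in> H1 \<Omega>" unfolding w_def by (intro H1.V_closed u H10_H1 z)
    have orth: "P w (abs_ae_fun \<eta>) = 0" if "test_function UNIV \<eta>" for \<eta>
    proof -
      have t: "abs_ae_fun \<eta> \<in> H10 \<Omega>" using that by (intro test_function_H10) (simp add: UNIV)
      show ?thesis
        using P_lincomb[OF u H10_H1[OF z(1)] H10_H1[OF t], of "-1"] z(2)[OF t] by (simp add: w_def)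
    qed
    let ?r = "rep_ae_fun w" and ?g = "weak_gradient \<Omega> w"
    have sq: "square_integrable M ?r" "square_integrable M ?g" using H1_D[OF w] by auto
    have eq: "(\<Sum>i\<in>Basis. conv ?r (\<lambda>y. gradient (\<lambda>y. gradient \<eta> y \<bullet> i) y \<bullet> i) 0) = lam * conv ?r \<eta> 0"
      if \<eta>: "test_function UNIV \<eta>" for \<eta>
    proof -
      have \<eta>': "test_function \<Omega> \<eta>" using \<eta> by (simp add: UNIV)
      note t = test_function_H1(1)[OF open_domain \<eta>']
      note sqe = test_function_square_integrable[OF \<eta> \<Omega>_sets]
      have i1: "integrable M (\<lambda>x. \<eta> x * ?r x)"
        using square_integrable_inner[OF sqe(1) sq(1)] by simp
      have i2: "integrable M (\<lambda>x. ?g x \<bullet> gradient \<eta> x)" by (rule square_integrable_inner[OF sq(2) sqe(2)])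
      have i3: "integrable M (\<lambda>x. (gradient \<eta> x \<bullet> i) * (?g x \<bullet> i))" if "i \<in> Basis" for i
      proof -
        have "integrable M (\<lambda>x. ((gradient \<eta> x \<bullet> i) *\<^sub>R ?g x) \<bullet> i)"
          by (intro integrable_inner_left square_integrable_mult_scaleR sq
              test_function_square_integrable(1)[OF test_function_inner_gradient[OF \<eta>] \<Omega>_sets])
        then show ?thesis by simp
      qed
      have "0 = P w (abs_ae_fun \<eta>)" using orth[OF \<eta>] by simp
      also have "\<dots> = (LINT x|M. Jt \<eta> x \<bullet> J w x)"
        unfolding P_commute[of w] using J_test_function[OF \<eta>'] t w Jt_square_integrable[OF \<eta>']
        by (intro P_eqI square_integrable_measurable)
      also have "\<dots> = (LINT x|M. lam * (\<eta> x * ?r x) + ?g x \<bullet> gradient \<eta> x)"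
        using lam_pos by (intro Bochner_Integration.integral_cong refl) (simp add: J_def Jt_def inner_commute)
      also have "\<dots> = lam * (LINT x|M. \<eta> x * ?r x) + (LINT x|M. ?g x \<bullet> gradient \<eta> x)"
        using i1 i2 by simp
      also have "(LINT x|M. \<eta> x * ?r x) = conv ?r \<eta> 0" by (simp add: conv_def UNIV)
      also have "(LINT x|M. ?g x \<bullet> gradient \<eta> x) = (\<Sum>i\<in>Basis. LINT x|M. (gradient \<eta> x \<bullet> i) * (?g x \<bullet> i))"
      proof -
        have "?g x \<bullet> gradient \<eta> x = (\<Sum>i\<in>Basis. (gradient \<eta> x \<bullet> i) * (?g x \<bullet> i))" for x
          by (subst euclidean_inner) (simp add: mult.commute)
        then have "(LINT x|M. ?g x \<bullet> gradient \<eta> x) = (LINT x|M. (\<Sum>i\<in>Basis. (gradient \<eta> x \<bullet> i) * (?g x \<bullet> i)))"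
          by presburger
        also have "\<dots> = (\<Sum>i\<in>Basis. LINT x|M. (gradient \<eta> x \<bullet> i) * (?g x \<bullet> i))"
          using i3 by (rule Bochner_Integration.integral_sum)
        finally show ?thesis .
      qed
      also have "\<dots> = (\<Sum>i\<in>Basis. - conv ?r (\<lambda>y. gradient (\<lambda>y. gradient \<eta> y \<bullet> i) y \<bullet> i) 0)"
      proof (intro sum.cong refl)
        \<comment> \<open>The second integration by parts: the weak derivative of \<open>w\<close>
          is tested with the test function \<open>gradient \<eta> y \<bullet> i\<close>, so two
          derivatives end up on \<open>\<eta>\<close>.\<close>
        fix i :: 'a assume "i \<in> Basis"
        let ?\<zeta> = "\<lambda>y. gradient \<eta> y \<bullet> i"
        have \<zeta>: "test_function \<Omega> ?\<zeta>" by (rule test_function_inner_gradient[OF \<eta>'])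
        note sqz = test_function_square_integrable[OF \<zeta> \<Omega>_sets]
        have "(LINT x|M. ?r x *\<^sub>R gradient ?\<zeta> x) = - (LINT x|M. ?\<zeta> x *\<^sub>R ?g x)"
          using weak_gradient_is_weak_gradient[OF w] \<zeta> by (simp add: is_weak_gradient_def)
        then have "(LINT x|M. ?r x *\<^sub>R gradient ?\<zeta> x) \<bullet> i = - ((LINT x|M. ?\<zeta> x *\<^sub>R ?g x) \<bullet> i)"
          by simp
        then show "(LINT x|M. ?\<zeta> x * (?g x \<bullet> i)) = - conv ?r (\<lambda>y. gradient ?\<zeta> y \<bullet> i) 0"
          using square_integrable_mult_scaleR[OF sq(1) sqz(2)] square_integrable_mult_scaleR[OF sqz(1) sq(2)]
          by (simp add: conv_def UNIV integral_inner_left[symmetric] mult.commute del: integral_inner_left)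
      qed
      finally show ?thesis by (simp add: sum_negf)
    qed
    have sqU: "square_integrable (lebesgue_on UNIV) ?r" using sq(1) by (simp add: UNIV)
    \<comment> \<open>The maximum principle gives one inequality; applying it to the negative of
      \<open>\<eta>\<close> gives the other.\<close>
    have "conv ?r \<eta> 0 = 0" if \<eta>: "test_function UNIV \<eta>" for \<eta>
    proof (rule antisym)
      show "conv ?r \<eta> 0 \<le> 0" by (rule conv_nonpos[OF sqU lam_pos eq \<eta>])
      have "conv ?r (\<lambda>x. -1 * \<eta> x) 0 \<le> 0"
        by (rule conv_nonpos[OF sqU lam_pos eq test_function_cmult[OF \<eta>]])
      then show "0 \<le> conv ?r \<eta> 0" by (simp add: conv_def)
    qed
    then have "AE x in M. ?r x = 0"
      by (intro fundamental_lemma[OF open_domain sq(1)]) (simp add: UNIV conv_def)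
    then have "AE x in lebesgue. ?r x = rep_ae_fun 0 x"
      using rep_ae_fun_zero \<Omega>_sets by (subst (asm) AE_lebesgue_on) (auto simp: UNIV elim: AE_mp)
    then have "w = 0" by (rule ae_fun_eqI)
    then show "u \<in> H10 \<Omega>" using z(1) by (simp add: w_def)
  qed
qed

section \<open>Invariance under orthogonal transformations\<close>

lemma nn_integral_lborel_translate:
  fixes f :: "'a::euclidean_space \<Rightarrow> ennreal"
  assumes "f \<in> borel_measurable borel"
  shows "(\<integral>\<^sup>+x. f (x + v) \<partial>lborel) = (\<integral>\<^sup>+x. f x \<partial>lborel)"
proof -
  have "(\<integral>\<^sup>+x. f x \<partial>lborel) = (\<integral>\<^sup>+x. f x \<partial>distr lborel borel ((+) v))"
    by (simp add: lborel_distr_plus)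
  also have "\<dots> = (\<integral>\<^sup>+x. f (v + x) \<partial>lborel)"
    using assms by (intro nn_integral_distr) auto
  finally show ?thesis by (simp add: add.commute)
qed

text \<open>Uniqueness of translation invariant measures, tested on the unit ball.\<close>

lemma nn_integral_lborel_orthogonal:
  fixes f :: "'a::euclidean_space \<Rightarrow> ennreal" and T :: "'a \<Rightarrow> 'a"
  assumes [measurable]: "f \<in> borel_measurable borel" and T: "orthogonal_transformation T"
  shows "(\<integral>\<^sup>+x. f (T x) \<partial>lborel) = (\<integral>\<^sup>+x. f x \<partial>lborel)"
proof -
  have lin: "linear T" using T by (rule orthogonal_transformation_linear)
  then have [measurable]: "T \<in> borel_measurable borel"
    by (intro borel_measurable_continuous_onI linear_continuous_on) (simp add: linear_linear)
  obtain T' where T': "\<And>x. T (T' x) = x"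
    using orthogonal_transformation_surj[OF T] by (metis surj_def)
  define g where "g x = (indicator (ball (0::'a) 1) x :: ennreal)" for x
  have [measurable]: "g \<in> borel_measurable borel"
    unfolding g_def[abs_def] by (intro borel_measurable_indicator) simp
  \<comment> \<open>The unit ball is invariant under \<open>T\<close>, so \<open>y - T x\<close> may
    be pulled back by \<open>T\<close>. This makes the integral over \<open>x\<close> one over a
    translate of the ball.\<close>
  have gT: "g (y - T x) = g (x - T' y)" for x y
  proof -
    have "norm (y - T x) = norm (T (T' y - x))" using T' lin by (simp add: linear_diff)
    also have "\<dots> = norm (x - T' y)" using orthogonal_transformation_norm[OF T] by (metis norm_minus_commute)
    finally show ?thesis by (simp add: g_def indicator_def)
  qed
  have gl: "(\<integral>\<^sup>+y. g y \<partial>lborel) = emeasure lborel (ball (0::'a) 1)"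
    unfolding g_def by simp
  have "(\<integral>\<^sup>+x. f (T x) \<partial>lborel) * (\<integral>\<^sup>+y. g y \<partial>lborel) = (\<integral>\<^sup>+y. (\<integral>\<^sup>+x. f (T x) \<partial>lborel) * g y \<partial>lborel)"
    by (rule nn_integral_cmult[symmetric]) measurable
  also have "\<dots> = (\<integral>\<^sup>+y. (\<integral>\<^sup>+x. g y * f (T x + y) \<partial>lborel) \<partial>lborel)"
  proof (rule nn_integral_cong)
    fix y
    have "(\<integral>\<^sup>+x. f (T x) \<partial>lborel) = (\<integral>\<^sup>+x. f (T (x + T' y)) \<partial>lborel)"
      by (rule nn_integral_lborel_translate[symmetric]) measurable
    also have "\<dots> = (\<integral>\<^sup>+x. f (T x + y) \<partial>lborel)" using lin T' by (simp add: linear_add)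
    finally show "(\<integral>\<^sup>+x. f (T x) \<partial>lborel) * g y = (\<integral>\<^sup>+x. g y * f (T x + y) \<partial>lborel)"
      by (subst nn_integral_cmult) (measurable, simp add: mult.commute)
  qed
  also have "\<dots> = (\<integral>\<^sup>+x. (\<integral>\<^sup>+y. g y * f (T x + y) \<partial>lborel) \<partial>lborel)"
    by (rule lborel_pair.Fubini') measurable
  also have "\<dots> = (\<integral>\<^sup>+x. (\<integral>\<^sup>+y. g (y - T x) * f y \<partial>lborel) \<partial>lborel)"
  proof (rule nn_integral_cong)
    fix x
    have "(\<integral>\<^sup>+y. g (y - T x) * f y \<partial>lborel) = (\<integral>\<^sup>+y. g ((y + T x) - T x) * f (y + T x) \<partial>lborel)"
      by (rule nn_integral_lborel_translate[symmetric]) measurable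
    then show "(\<integral>\<^sup>+y. g y * f (T x + y) \<partial>lborel) = (\<integral>\<^sup>+y. g (y - T x) * f y \<partial>lborel)"
      by (simp add: add.commute)
  qed
  also have "\<dots> = (\<integral>\<^sup>+y. (\<integral>\<^sup>+x. g (y - T x) * f y \<partial>lborel) \<partial>lborel)"
    by (rule lborel_pair.Fubini') measurable
  also have "\<dots> = (\<integral>\<^sup>+y. f y * (\<integral>\<^sup>+x. g x \<partial>lborel) \<partial>lborel)"
  proof (rule nn_integral_cong)
    fix y
    have "(\<integral>\<^sup>+x. g (x + (- T' y)) \<partial>lborel) = (\<integral>\<^sup>+x. g x \<partial>lborel)"
      by (rule nn_integral_lborel_translate) measurable
    then show "(\<integral>\<^sup>+x. g (y - T x) * f y \<partial>lborel) = f y * (\<integral>\<^sup>+x. g x \<partial>lborel)"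
      unfolding gT by (subst nn_integral_multc) (measurable, simp add: mult.commute)
  qed
  also have "\<dots> = (\<integral>\<^sup>+x. f x \<partial>lborel) * (\<integral>\<^sup>+y. g y \<partial>lborel)"
    by (rule nn_integral_multc) measurable
  finally have "(\<integral>\<^sup>+x. f (T x) \<partial>lborel) * emeasure lborel (ball (0::'a) 1) = (\<integral>\<^sup>+x. f x \<partial>lborel) * emeasure lborel (ball (0::'a) 1)"
    by (simp add: gl)
  moreover have "emeasure lborel (ball (0::'a) 1) \<noteq> 0"
  proof
    assume "emeasure lborel (ball (0::'a) 1) = 0"
    then have "ball (0::'a) 1 \<in> null_sets lebesgue" by (auto intro!: null_sets_completionI)
    then have "negligible (ball (0::'a) 1)" by (simp add: negligible_iff_null_sets)
    then show False using open_not_negligible[of "ball (0::'a) 1"] by simp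
  qed
  moreover have "emeasure lborel (ball (0::'a) 1) \<noteq> top"
    using emeasure_lborel_ball_finite[of "0::'a" 1] by simp
  ultimately show ?thesis
    by (metis ennreal_mult_divide_eq)
qed

text \<open>Borel measurability of \<open>T\<close> is not enough for the completed sigma algebra;
  preimages of null sets must be null, and this follows because \<open>T\<close> preserves
  \<open>lborel\<close>.\<close>

lemma orthogonal_measurable_lebesgue:
  fixes T :: "'a::euclidean_space \<Rightarrow> 'a"
  assumes T: "orthogonal_transformation T"
  shows "T \<in> borel_measurable borel" "distr lborel borel T = lborel" "T \<in> lebesgue \<rightarrow>\<^sub>M lebesgue" "distr lebesgue lebesgue T = lebesgue"
proof -
  have lin: "linear T" using T by (rule orthogonal_transformation_linear)
  then show m[measurable]: "T \<in> borel_measurable borel"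
    by (intro borel_measurable_continuous_onI linear_continuous_on) (simp add: linear_linear)
  show d: "distr lborel borel T = lborel"
  proof (rule measure_eqI)
    fix A assume "A \<in> sets (distr lborel borel T)"
    then have [measurable]: "A \<in> sets borel" by simp
    have "emeasure (distr lborel borel T) A = (\<integral>\<^sup>+x. indicator A x \<partial>distr lborel borel T)" by simp
    also have "\<dots> = (\<integral>\<^sup>+x. indicator A (T x) \<partial>lborel)" by (rule nn_integral_distr) measurable
    also have "\<dots> = (\<integral>\<^sup>+x. indicator A x \<partial>lborel)" by (rule nn_integral_lborel_orthogonal[OF _ T]) measurable
    finally show "emeasure (distr lborel borel T) A = emeasure lborel A" by simp
  qed simp
  have d': "distr lebesgue lborel T = lborel"
    using d by (simp add: distr_completion cong: distr_cong)
  show "T \<in> lebesgue \<rightarrow>\<^sub>M lebesgue"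
    by (simp add: completion.measurable_completion2 d' measurable_completion)
  have "completion (distr lebesgue lborel T) = distr lebesgue lebesgue T"
    by (rule completion.completion_distr_eq) (auto simp: d' measurable_completion)
  then show "distr lebesgue lebesgue T = lebesgue" by (simp add: d')
qed

lemma integral_lebesgue_orthogonal:
  fixes f :: "'a::euclidean_space \<Rightarrow> 'b::euclidean_space" and T :: "'a \<Rightarrow> 'a"
  assumes "orthogonal_transformation T" "f \<in> borel_measurable lebesgue"
  shows "(LINT x|lebesgue. f (T x)) = (LINT x|lebesgue. f x)"
  using integral_distr[OF orthogonal_measurable_lebesgue(3)[OF assms(1)] assms(2)]
  by (simp add: orthogonal_measurable_lebesgue(4)[OF assms(1)])

lemma integrable_lebesgue_orthogonal:
  fixes f :: "'a::euclidean_space \<Rightarrow> 'b::euclidean_space" and T :: "'a \<Rightarrow> 'a"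
  assumes "orthogonal_transformation T" "integrable lebesgue f"
  shows "integrable lebesgue (\<lambda>x. f (T x))"
  using integrable_distr[of T lebesgue lebesgue f] orthogonal_measurable_lebesgue[OF assms(1)] assms(2)
  by simp

lemma AE_lebesgue_orthogonal:
  fixes T :: "'a::euclidean_space \<Rightarrow> 'a"
  assumes "orthogonal_transformation T" "AE x in lebesgue. Q x"
  shows "AE x in lebesgue. Q (T x)"
proof -
  have "AE x in distr lebesgue lebesgue T. Q x"
    unfolding orthogonal_measurable_lebesgue(4)[OF assms(1)] by (rule assms(2))
  then show ?thesis
    by (rule AE_distrD[OF orthogonal_measurable_lebesgue(3)[OF assms(1)]])
qed

text \<open>For orthogonal \<open>T\<close> the representative of the result is known up to a null
  set, because such \<open>T\<close> preserve Lebesgue measure.\<close>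

definition compose_ae :: "'a::euclidean_space ae_fun \<Rightarrow> ('a \<Rightarrow> 'a) \<Rightarrow> 'a ae_fun" where
  "compose_ae u T = abs_ae_fun (\<lambda>x. rep_ae_fun u (T x))"

lemma rep_compose_ae:
  assumes "orthogonal_transformation T"
  shows "AE x in lebesgue. rep_ae_fun (compose_ae u T) x = rep_ae_fun u (T x)"
  unfolding compose_ae_def
  by (intro rep_abs_ae_fun measurable_compose[OF orthogonal_measurable_lebesgue(3)[OF assms]] rep_ae_fun_measurable)

text \<open>Symmetry as a fixed-point equation between classes, which uniqueness of a Riesz
  representative can verify.\<close>

lemma radially_symmetric_iff:
  "radially_symmetric u \<longleftrightarrow> (\<forall>T. orthogonal_transformation T \<longrightarrow> compose_ae u T = u)"
proof -
  have "(AE x in lebesgue. rep_ae_fun u (T x) = rep_ae_fun u x) \<longleftrightarrow> compose_ae u T = u"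
    if T: "orthogonal_transformation T" for T
  proof
    assume inv: "AE x in lebesgue. rep_ae_fun u (T x) = rep_ae_fun u x"
    show "compose_ae u T = u"
      by (intro ae_fun_eqI) (use rep_compose_ae[OF T, of u] inv in eventually_elim, simp)
  next
    assume "compose_ae u T = u"
    then show "AE x in lebesgue. rep_ae_fun u (T x) = rep_ae_fun u x"
      using rep_compose_ae[OF T, of u] by (simp add: eq_commute)
  qed
  then show ?thesis unfolding radially_symmetric_def by blast
qed

lemma orthogonal_transformation_inverse:
  assumes T: "orthogonal_transformation (T :: 'a::euclidean_space \<Rightarrow> 'a)"
  obtains T' where "orthogonal_transformation T'" "\<And>x. T (T' x) = x" "\<And>x. T' (T x) = x" "\<And>x y. T' x \<bullet> y = x \<bullet> T y"
proof (rule that[of "inv T"])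
  have b: "bij T" using T by (rule orthogonal_transformation_bij)
  show "orthogonal_transformation (inv T)" using T by (rule orthogonal_transformation_inv)
  show 1: "T (inv T x) = x" for x using b by (simp add: bij_is_surj surj_f_inv_f)
  show "inv T (T x) = x" for x using b by (simp add: bij_is_inj)
  show "inv T x \<bullet> y = x \<bullet> T y" for x y
    using T 1 unfolding orthogonal_transformation_def by metis
qed

lemma compose_ae_inverse:
  assumes T: "orthogonal_transformation T" and T': "orthogonal_transformation T'" and inv: "\<And>x. T' (T x) = x"
  shows "compose_ae (compose_ae v T') T = v"
proof (rule ae_fun_eqI)
  show "AE x in lebesgue. rep_ae_fun (compose_ae (compose_ae v T') T) x = rep_ae_fun v x"
    using rep_compose_ae[OF T, of "compose_ae v T'"] AE_lebesgue_orthogonal[OF T rep_compose_ae[OF T', of v]]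
    by eventually_elim (simp add: inv)
qed

lemma compose_ae_lincomb:
  assumes T: "orthogonal_transformation T"
  shows "compose_ae (u + r *\<^sub>R v) T = compose_ae u T + r *\<^sub>R compose_ae v T"
proof (rule ae_fun_eqI)
  have "AE x in lebesgue. rep_ae_fun (u + r *\<^sub>R v) x = rep_ae_fun u x + r * rep_ae_fun v x"
    using rep_ae_fun_add[of u "r *\<^sub>R v"] rep_ae_fun_scaleR[of r v] by eventually_elim simp
  from AE_lebesgue_orthogonal[OF T this] rep_compose_ae[OF T, of "u + r *\<^sub>R v"]
    rep_compose_ae[OF T, of u] rep_compose_ae[OF T, of v]
    rep_ae_fun_add[of "compose_ae u T" "r *\<^sub>R compose_ae v T"] rep_ae_fun_scaleR[of r "compose_ae v T"]
  show "AE x in lebesgue. rep_ae_fun (compose_ae (u + r *\<^sub>R v) T) x = rep_ae_fun (compose_ae u T + r *\<^sub>R compose_ae v T) x"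
    by eventually_elim simp
qed

lemma square_integrable_lebesgue_orthogonal:
  fixes T :: "'a::euclidean_space \<Rightarrow> 'a"
  assumes "orthogonal_transformation T" "square_integrable lebesgue f"
  shows "square_integrable lebesgue (\<lambda>x. f (T x))"
  using assms measurable_compose[OF orthogonal_measurable_lebesgue(3)[OF assms(1)]]
    integrable_lebesgue_orthogonal[OF assms(1), of "\<lambda>x. (norm (f x))\<^sup>2"]
  by (auto simp: square_integrable_def)

lemma square_integrable_scaleR_vector:
  fixes f :: "'x \<Rightarrow> real" and v :: "'b::euclidean_space"
  assumes "square_integrable M f"
  shows "square_integrable M (\<lambda>x. f x *\<^sub>R v)"
proof -
  note [measurable] = square_integrable_measurable[OF assms]
  have "integrable M (\<lambda>x. (norm (f x))\<^sup>2 * (norm v)\<^sup>2)"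
    using assms unfolding square_integrable_def by (intro integrable_mult_left) blast
  then have "integrable M (\<lambda>x. (norm (f x *\<^sub>R v))\<^sup>2)"
    unfolding norm_scaleR power_mult_distrib real_norm_def .
  moreover have "(\<lambda>x. f x *\<^sub>R v) \<in> borel_measurable M" by measurable
  ultimately show ?thesis unfolding square_integrable_def by blast
qed

lemma test_function_pair_square_integrable:
  assumes "test_function \<Omega>' \<eta>" "\<Omega> \<in> sets lebesgue"
  shows "square_integrable (lebesgue_on \<Omega>) (\<lambda>x. (gradient \<eta> x \<bullet> v, \<eta> x *\<^sub>R w))"
  by (intro square_integrable_Pair square_integrable_scaleR_vector
      test_function_square_integrable(1)[OF test_function_inner_gradient[OF assms(1)] assms(2)]
      test_function_square_integrable(1)[OF assms])

text \<open>The chain rule in weak form; \<open>T'\<close> is both inverse and adjoint of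
  \<open>T\<close>, hence the gradient appears rotated back.\<close>

lemma H1_compose_orthogonal:
  fixes u :: "'a::euclidean_space ae_fun"
  assumes u: "u \<in> H1 UNIV" and T: "orthogonal_transformation T" and T': "orthogonal_transformation T'"
    and inv: "\<And>x. T (T' x) = x" "\<And>x. T' (T x) = x" and adj: "\<And>x y. T' x \<bullet> y = x \<bullet> T y"
  shows "compose_ae u T \<in> H1 UNIV"
    and "AE x in lebesgue. weak_gradient UNIV (compose_ae u T) x = T' (weak_gradient UNIV u (T x))"
proof -
  have L: "lebesgue_on (UNIV :: 'a set) = lebesgue" by (rule lebesgue_on_UNIV_eq)
  have U: "(UNIV :: 'a set) \<in> sets lebesgue" by simp
  let ?g = "weak_gradient UNIV u"
  note D = H1_D[OF u, unfolded L]
  have lin: "linear T'" "linear T" using T T' by (auto intro: orthogonal_transformation_linear)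
  have sqr: "square_integrable lebesgue (rep_ae_fun (compose_ae u T))"
    by (rule square_integrable_cong_AE[OF square_integrable_lebesgue_orthogonal[OF T D(2)]])
       (use rep_compose_ae[OF T, of u] in \<open>auto elim: AE_mp\<close>)
  have "T' \<in> borel_measurable borel" by (rule orthogonal_measurable_lebesgue[OF T'])
  then have sqg: "square_integrable lebesgue (\<lambda>x. T' (?g (T x)))"
    using square_integrable_lebesgue_orthogonal[OF T D(3)]
    by (auto simp: square_integrable_def orthogonal_transformation_norm[OF T'] intro: measurable_compose)
  have sqL: "square_integrable (lebesgue_on UNIV) (rep_ae_fun (compose_ae u T))"
    "square_integrable (lebesgue_on UNIV) (\<lambda>x. T' (?g (T x)))"
    unfolding L by (rule sqr, rule sqg)
  have wg: "is_weak_gradient UNIV (compose_ae u T) (\<lambda>x. T' (?g (T x)))"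
    unfolding is_weak_gradient_iff[OF U sqL] L
  proof (intro allI impI)
    fix \<eta> :: "'a \<Rightarrow> real" and v assume \<eta>: "test_function UNIV \<eta>"
    have inj: "inj T'" "inj T" using T T' by (auto intro: orthogonal_transformation_inj)
    note t = test_function_affine[OF \<eta> lin(1) inj(1), of 0, simplified]
    \<comment> \<open>The change of variables moves the rotation from \<open>u\<close> to the test
      function and to the direction \<open>v\<close>.\<close>
    let ?\<zeta> = "\<lambda>x. \<eta> (T' x)"
    let ?F = "\<lambda>x. (rep_ae_fun u x, ?g x) \<bullet> (gradient ?\<zeta> x \<bullet> T v, ?\<zeta> x *\<^sub>R T v)"
    have sqt: "square_integrable lebesgue (\<lambda>x. (gradient ?\<zeta> x \<bullet> T v, ?\<zeta> x *\<^sub>R T v))"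
      using test_function_pair_square_integrable[OF t(1) U, of "T v" "T v"] unfolding L .
    have Fm: "?F \<in> borel_measurable lebesgue"
      using square_integrable_inner[OF square_integrable_Pair[OF D(2,3)] sqt] by (rule borel_measurable_integrable)
    have sqt0: "square_integrable lebesgue (\<lambda>x. (gradient \<eta> x \<bullet> v, \<eta> x *\<^sub>R v))"
      using test_function_pair_square_integrable[OF \<eta> U, of v v] unfolding L .
    have "(LINT x|lebesgue. (rep_ae_fun (compose_ae u T) x, T' (?g (T x))) \<bullet> (gradient \<eta> x \<bullet> v, \<eta> x *\<^sub>R v))
      = (LINT x|lebesgue. ?F (T x))"
    proof (rule integral_cong_AE)
      show "(\<lambda>x. ?F (T x)) \<in> borel_measurable lebesgue"
        by (rule measurable_compose[OF orthogonal_measurable_lebesgue(3)[OF T] Fm])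
      show "(\<lambda>x. (rep_ae_fun (compose_ae u T) x, T' (?g (T x))) \<bullet> (gradient \<eta> x \<bullet> v, \<eta> x *\<^sub>R v)) \<in> borel_measurable lebesgue"
        using square_integrable_inner[OF square_integrable_Pair[OF sqr sqg] sqt0] by (rule borel_measurable_integrable)
      have gr: "gradient ?\<zeta> (T x) \<bullet> T v = gradient \<eta> x \<bullet> v" for x
        using t(2)[of "T x" "T v"] by (simp add: inv)
      show "AE x in lebesgue. (rep_ae_fun (compose_ae u T) x, T' (?g (T x))) \<bullet> (gradient \<eta> x \<bullet> v, \<eta> x *\<^sub>R v) = ?F (T x)"
        using rep_compose_ae[OF T, of u] by eventually_elim (simp add: gr inv adj)
    qed
    also have "\<dots> = (LINT x|lebesgue. ?F x)" by (rule integral_lebesgue_orthogonal[OF T Fm])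
    also have "\<dots> = 0"
      using weak_gradient_is_weak_gradient[OF u] t(1)
        is_weak_gradient_iff[OF U H1_D(2,3)[OF u]] unfolding L by blast
    finally show "(LINT x|lebesgue. (rep_ae_fun (compose_ae u T) x, T' (?g (T x))) \<bullet> (gradient \<eta> x \<bullet> v, \<eta> x *\<^sub>R v)) = 0" .
  qed
  show 1: "compose_ae u T \<in> H1 UNIV" by (rule H1_I[OF _ sqL(1) wg]) simp
  show "AE x in lebesgue. weak_gradient UNIV (compose_ae u T) x = T' (?g (T x))"
    using H1_weak_gradient_AE[OF open_UNIV 1 wg] unfolding L .
qed

section \<open>The quartic form\<close>

locale sobolev4 = sobolev \<Omega> lam for \<Omega> :: "'a::euclidean_space set" and lam +
  assumes dim_le_3: "DIM('a) \<le> 3"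
begin

text \<open>The product is grouped in pairs because \<open>H10_product_square_integrable\<close>
  places each pair in \<open>L\<^sup>2\<close>.\<close>

definition T4 :: "'a ae_fun \<Rightarrow> 'a ae_fun \<Rightarrow> 'a ae_fun \<Rightarrow> 'a ae_fun \<Rightarrow> real" where
  "T4 a b c d = (LINT x|M. (rep_ae_fun a x * rep_ae_fun b x) * (rep_ae_fun c x * rep_ae_fun d x))"

lemma rep_product_measurable:
  "(\<lambda>x. rep_ae_fun a x * rep_ae_fun b x) \<in> borel_measurable M"
  "(\<lambda>x. (rep_ae_fun a x * rep_ae_fun b x) * (rep_ae_fun c x * rep_ae_fun d x)) \<in> borel_measurable M"
  by (intro borel_measurable_times rep_measurable)+

text \<open>By \<open>2 * a\<^sup>2 * b\<^sup>2 \<le> a ^ 4 + b ^ 4\<close> and the embedding into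
  \<open>L\<^sup>4\<close>.\<close>

lemma H10_product_square_integrable:
  assumes "a \<in> H10 \<Omega>" "b \<in> H10 \<Omega>"
  shows "square_integrable M (\<lambda>x. rep_ae_fun a x * rep_ae_fun b x)"
proof -
  obtain C where C: "\<And>u. u \<in> H10 \<Omega> \<Longrightarrow> integrable M (\<lambda>x. (rep_ae_fun u x)^4)"
    using H10_L4[OF dim_le_3] by metis
  have i: "integrable M (\<lambda>x. (rep_ae_fun a x)^4 + (rep_ae_fun b x)^4)" using C assms by simp
  have "integrable M (\<lambda>x. (norm (rep_ae_fun a x * rep_ae_fun b x))\<^sup>2)"
  proof (rule Bochner_Integration.integrable_bound[OF i])
    show "AE x in M. norm ((norm (rep_ae_fun a x * rep_ae_fun b x))\<^sup>2) \<le> norm ((rep_ae_fun a x)^4 + (rep_ae_fun b x)^4)"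
    proof (rule AE_I2)
      fix x
      have "2 * ((rep_ae_fun a x)\<^sup>2 * (rep_ae_fun b x)\<^sup>2) \<le> (rep_ae_fun a x)^4 + (rep_ae_fun b x)^4"
        using sum_squares_bound[of "(rep_ae_fun a x)\<^sup>2" "(rep_ae_fun b x)\<^sup>2"] by (simp flip: power_mult)
      moreover have "0 \<le> (rep_ae_fun a x)\<^sup>2 * (rep_ae_fun b x)\<^sup>2" by simp
      ultimately have "(rep_ae_fun a x)\<^sup>2 * (rep_ae_fun b x)\<^sup>2 \<le> (rep_ae_fun a x)^4 + (rep_ae_fun b x)^4" by linarith
      then show "norm ((norm (rep_ae_fun a x * rep_ae_fun b x))\<^sup>2) \<le> norm ((rep_ae_fun a x)^4 + (rep_ae_fun b x)^4)"
        by (simp add: power_mult_distrib)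
    qed
  qed (intro borel_measurable_power borel_measurable_norm[THEN measurable_compose[rotated]] rep_product_measurable)
  then show ?thesis unfolding square_integrable_def using rep_product_measurable(1) by blast
qed

lemma T4_integrable:
  assumes "a \<in> H10 \<Omega>" "b \<in> H10 \<Omega>" "c \<in> H10 \<Omega>" "d \<in> H10 \<Omega>"
  shows "integrable M (\<lambda>x. (rep_ae_fun a x * rep_ae_fun b x) * (rep_ae_fun c x * rep_ae_fun d x))"
  using square_integrable_inner[OF H10_product_square_integrable[OF assms(1,2)] H10_product_square_integrable[OF assms(3,4)]]
  by simp

lemma T4_swap: "T4 a b c d = T4 b a c d" "T4 a b c d = T4 a b d c" "T4 a b c d = T4 c d a b" "T4 a b c d = T4 a c b d"
  by (simp_all add: T4_def mult_ac)

lemma T4_lincomb: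
  assumes "a \<in> H10 \<Omega>" "a' \<in> H10 \<Omega>" "b \<in> H10 \<Omega>" "c \<in> H10 \<Omega>" "d \<in> H10 \<Omega>"
  shows "T4 (a + r *\<^sub>R a') b c d = T4 a b c d + r * T4 a' b c d"
proof -
  have "T4 (a + r *\<^sub>R a') b c d = (LINT x|M. (rep_ae_fun a x * rep_ae_fun b x) * (rep_ae_fun c x * rep_ae_fun d x)
      + r * ((rep_ae_fun a' x * rep_ae_fun b x) * (rep_ae_fun c x * rep_ae_fun d x)))"
    unfolding T4_def
  proof (rule integral_cong_AE)
    show "AE x in M. rep_ae_fun (a + r *\<^sub>R a') x * rep_ae_fun b x * (rep_ae_fun c x * rep_ae_fun d x) =
      rep_ae_fun a x * rep_ae_fun b x * (rep_ae_fun c x * rep_ae_fun d x) +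
      r * (rep_ae_fun a' x * rep_ae_fun b x * (rep_ae_fun c x * rep_ae_fun d x))"
      using AE_lebesgue_onI[OF rep_ae_fun_add[of a "r *\<^sub>R a'"] \<Omega>_sets] AE_lebesgue_onI[OF rep_ae_fun_scaleR[of r a'] \<Omega>_sets]
      by eventually_elim (simp add: algebra_simps)
  qed (intro borel_measurable_add borel_measurable_times borel_measurable_const rep_measurable)+
  also have "\<dots> = T4 a b c d + r * T4 a' b c d"
    unfolding T4_def using T4_integrable assms by simp
  finally show ?thesis .
qed

lemma T4_lincomb2:
  assumes "a \<in> H10 \<Omega>" "a' \<in> H10 \<Omega>" "b \<in> H10 \<Omega>" "c \<in> H10 \<Omega>" "d \<in> H10 \<Omega>"
  shows "T4 b (a + r *\<^sub>R a') c d = T4 b a c d + r * T4 b a' c d"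
    and "T4 b c (a + r *\<^sub>R a') d = T4 b c a d + r * T4 b c a' d"
    and "T4 b c d (a + r *\<^sub>R a') = T4 b c d a + r * T4 b c d a'"
proof -
  show "T4 b (a + r *\<^sub>R a') c d = T4 b a c d + r * T4 b a' c d"
    using T4_lincomb[OF assms, of r] by (simp add: T4_swap(1)[of b])
  show "T4 b c (a + r *\<^sub>R a') d = T4 b c a d + r * T4 b c a' d"
    using T4_lincomb[OF assms(1,2,5,3,4), of r] by (simp add: T4_swap(3)[of b])
  show "T4 b c d (a + r *\<^sub>R a') = T4 b c d a + r * T4 b c d a'"
    using T4_lincomb[OF assms(1,2,5,3,4), of r] by (simp add: T4_swap(3)[of b] T4_swap(1)[of d])
qed

lemma T4_nonneg: "0 \<le> T4 a a b b"
  unfolding T4_def by (intro Bochner_Integration.integral_nonneg) (simp add: zero_le_mult_iff)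

lemma T4_Cauchy_Schwarz:
  assumes "a \<in> H10 \<Omega>" "b \<in> H10 \<Omega>" "c \<in> H10 \<Omega>" "d \<in> H10 \<Omega>"
  shows "(T4 a b c d)\<^sup>2 \<le> T4 a a b b * T4 c c d d"
  using Cauchy_Schwarz_integral[OF H10_product_square_integrable[OF assms(1,2)] H10_product_square_integrable[OF assms(3,4)]]
  by (simp add: T4_def power2_eq_square mult_ac)

text \<open>Cauchy-Schwarz twice isolates \<open>T4 w w w w\<close>, which the embedding bounds by
  the square of \<open>P w w\<close>.\<close>

lemma T4_bounded:
  assumes a: "a \<in> H10 \<Omega>" and b: "b \<in> H10 \<Omega>" and c: "c \<in> H10 \<Omega>"
  obtains K where "K \<ge> 0" "\<And>w. w \<in> H10 \<Omega> \<Longrightarrow> (T4 a b c w)\<^sup>2 \<le> K * P w w"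
proof -
  obtain C where C: "C \<ge> 0" "\<And>u. u \<in> H10 \<Omega> \<Longrightarrow> (LINT x|M. (rep_ae_fun u x)^4) \<le> C * (P u u)\<^sup>2"
    using H10_L4[OF dim_le_3] by metis
  have quart: "T4 u u u u = (LINT x|M. (rep_ae_fun u x)^4)" for u
    by (simp add: T4_def power4_eq_xxxx mult.assoc)
  define K where "K = T4 a a b b * sqrt (T4 c c c c * C)"
  have "(T4 a b c w)\<^sup>2 \<le> K * P w w" if w: "w \<in> H10 \<Omega>" for w
  proof -
    have pw: "0 \<le> P w w" by (rule H1.ip_nonneg[OF H10_H1[OF w]])
    have "(T4 c c w w)\<^sup>2 \<le> T4 c c c c * T4 w w w w" by (rule T4_Cauchy_Schwarz[OF c c w w])
    also have "\<dots> \<le> T4 c c c c * (C * (P w w)\<^sup>2)"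
      by (intro mult_left_mono T4_nonneg) (use C(2)[OF w] in \<open>simp add: quart\<close>)
    finally have "T4 c c w w \<le> sqrt (T4 c c c c * (C * (P w w)\<^sup>2))" by (rule real_le_rsqrt)
    also have "\<dots> = sqrt (T4 c c c c * C) * P w w"
      using pw by (simp add: real_sqrt_mult)
    finally have 1: "T4 c c w w \<le> sqrt (T4 c c c c * C) * P w w" .
    have "(T4 a b c w)\<^sup>2 \<le> T4 a a b b * T4 c c w w" by (rule T4_Cauchy_Schwarz[OF a b c w])
    also have "\<dots> \<le> T4 a a b b * (sqrt (T4 c c c c * C) * P w w)" by (intro mult_left_mono 1 T4_nonneg)
    finally show ?thesis by (simp add: K_def mult.assoc)
  qed
  moreover have "K \<ge> 0" unfolding K_def using C(1) T4_nonneg by (intro mult_nonneg_nonneg real_sqrt_ge_zero) auto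
  ultimately show thesis using that by blast
qed

lemma H_space_H10: "u \<in> H_space \<Omega> \<Longrightarrow> u \<in> H10 \<Omega>"
  using H1_eq_H10_UNIV by (cases "\<Omega> = UNIV") (auto simp: H_space_def)

lemma H_space_subspace: "subspace (H_space \<Omega>)"
proof (cases "\<Omega> = UNIV")
  case True
  have c0: "compose_ae 0 T = 0" if "orthogonal_transformation T" for T :: "'a \<Rightarrow> 'a"
    using compose_ae_lincomb[OF that, of 0 "-1" 0] by simp
  have "u + r *\<^sub>R v \<in> H_space \<Omega>" if "u \<in> H_space \<Omega>" "v \<in> H_space \<Omega>" for u v r
    using that H1.V_closed(1,2) True
    by (auto simp: H_space_def radially_symmetric_iff compose_ae_lincomb)
  moreover have "0 \<in> H_space \<Omega>"
    using H1_zero True c0 by (auto simp: H_space_def radially_symmetric_iff)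
  ultimately show ?thesis
    unfolding subspace_def by (metis add_0 scaleR_one)
next
  case False
  then show ?thesis using H10_subspace by (simp add: H_space_def)
qed

section \<open>The forms \<open>Q U s\<close>, weak solutions and symmetric criticality\<close>

definition Q :: "'a ae_fun \<Rightarrow> real \<Rightarrow> 'a ae_fun \<Rightarrow> 'a ae_fun \<Rightarrow> real" where
  "Q U s f w = P f w - s * T4 U U f w"

lemma Q_test_function:
  assumes U: "U \<in> H10 \<Omega>" and f: "f \<in> H10 \<Omega>"
  shows "weakly_solves \<Omega> lam f (\<lambda>x. s * (rep_ae_fun U x)\<^sup>2 * rep_ae_fun f x) \<longleftrightarrow>
    (\<forall>\<eta>. test_function \<Omega> \<eta> \<longrightarrow> Q U s f (abs_ae_fun \<eta>) = 0)"
proof -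
  have "((LINT x|M. weak_gradient \<Omega> f x \<bullet> gradient \<eta> x + lam * rep_ae_fun f x * \<eta> x)
     = (LINT x|M. s * (rep_ae_fun U x)\<^sup>2 * rep_ae_fun f x * \<eta> x)) \<longleftrightarrow> Q U s f (abs_ae_fun \<eta>) = 0"
    if \<eta>: "test_function \<Omega> \<eta>" for \<eta>
  proof -
    note t = test_function_H1(1)[OF open_domain \<eta>]
    have "P f (abs_ae_fun \<eta>) = (LINT x|M. Jt \<eta> x \<bullet> J f x)"
      unfolding P_commute[of f] using J_test_function[OF \<eta>] t H10_H1[OF f] Jt_square_integrable[OF \<eta>]
      by (intro P_eqI square_integrable_measurable)
    also have "\<dots> = (LINT x|M. weak_gradient \<Omega> f x \<bullet> gradient \<eta> x + lam * rep_ae_fun f x * \<eta> x)"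
      using lam_pos by (intro Bochner_Integration.integral_cong refl) (simp add: J_def Jt_def inner_commute)
    finally have 1: "P f (abs_ae_fun \<eta>) = (LINT x|M. weak_gradient \<Omega> f x \<bullet> gradient \<eta> x + lam * rep_ae_fun f x * \<eta> x)" .
    have "s * T4 U U f (abs_ae_fun \<eta>) = (LINT x|M. s * ((rep_ae_fun U x * rep_ae_fun U x) * (rep_ae_fun f x * rep_ae_fun (abs_ae_fun \<eta>) x)))"
      unfolding T4_def by (rule integral_mult_right_zero[symmetric])
    also have "\<dots> = (LINT x|M. s * (rep_ae_fun U x)\<^sup>2 * rep_ae_fun f x * \<eta> x)"
    proof (rule integral_cong_AE)
      show "AE x in M. s * ((rep_ae_fun U x * rep_ae_fun U x) * (rep_ae_fun f x * rep_ae_fun (abs_ae_fun \<eta>) x))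
         = s * (rep_ae_fun U x)\<^sup>2 * rep_ae_fun f x * \<eta> x"
        using AE_lebesgue_onI[OF rep_abs_test_function[OF \<eta>] \<Omega>_sets]
        by eventually_elim (simp add: power2_eq_square)
    qed (intro borel_measurable_times borel_measurable_power borel_measurable_const rep_measurable
        square_integrable_measurable[OF test_function_square_integrable(1)[OF \<eta> \<Omega>_sets]])+
    finally show ?thesis using 1 by (simp add: Q_def)
  qed
  then show ?thesis unfolding weakly_solves_def by blast
qed

lemma Q_lincomb_right:
  assumes "U \<in> H10 \<Omega>" "f \<in> H10 \<Omega>" "v \<in> H10 \<Omega>" "w \<in> H10 \<Omega>"
  shows "Q U s f (v + r *\<^sub>R w) = Q U s f v + r * Q U s f w"
  using assms H1.V_closed(2)[OF H10_H1[OF assms(4)], of r]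
  by (simp add: Q_def T4_lincomb2 H1.ip_add_right H1.ip_scale_right H10_H1 algebra_simps)

lemma Q_bounded:
  assumes U: "U \<in> H10 \<Omega>" and f: "f \<in> H10 \<Omega>"
  obtains K where "K \<ge> 0" "\<And>w. w \<in> H10 \<Omega> \<Longrightarrow> (Q U s f w)\<^sup>2 \<le> K * P w w"
proof -
  obtain K where K: "K \<ge> 0" "\<And>w. w \<in> H10 \<Omega> \<Longrightarrow> (T4 U U f w)\<^sup>2 \<le> K * P w w"
    using T4_bounded[OF U U f] by metis
  have "(Q U s f w)\<^sup>2 \<le> (2 * P f f + 2 * s\<^sup>2 * K) * P w w" if w: "w \<in> H10 \<Omega>" for w
  proof -
    have "(P f w)\<^sup>2 \<le> P f f * P w w"
      using Cauchy_Schwarz_integral[OF J_square_integrable[OF H10_H1[OF f]] J_square_integrable[OF H10_H1[OF w]]]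
      by (simp add: P_def power2_norm_eq_inner)
    moreover have "s\<^sup>2 * (T4 U U f w)\<^sup>2 \<le> s\<^sup>2 * (K * P w w)" by (intro mult_left_mono K w) simp
    moreover have "(Q U s f w)\<^sup>2 \<le> 2 * (P f w)\<^sup>2 + 2 * (s\<^sup>2 * (T4 U U f w)\<^sup>2)"
      using norm_add_square_le[of "P f w" "- (s * T4 U U f w)"] by (simp add: Q_def power_mult_distrib)
    ultimately have "(Q U s f w)\<^sup>2 \<le> 2 * (P f f * P w w) + 2 * (s\<^sup>2 * (K * P w w))" by linarith
    then show ?thesis by (simp add: algebra_simps)
  qed
  moreover have "2 * P f f + 2 * s\<^sup>2 * K \<ge> 0" using K(1) H1.ip_nonneg[OF H10_H1[OF f]] by simp
  ultimately show thesis using that by blast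
qed

text \<open>\<open>Q U s f\<close> is continuous for the form \<open>P\<close>, and test functions
  are dense in \<open>H10\<close>.\<close>

lemma Q_zero_on_test_functions_iff:
  assumes U: "U \<in> H10 \<Omega>" and f: "f \<in> H10 \<Omega>"
  shows "(\<forall>\<eta>. test_function \<Omega> \<eta> \<longrightarrow> Q U s f (abs_ae_fun \<eta>) = 0) \<longleftrightarrow> (\<forall>w\<in>H10 \<Omega>. Q U s f w = 0)"
proof
  assume "\<forall>w\<in>H10 \<Omega>. Q U s f w = 0"
  then show "\<forall>\<eta>. test_function \<Omega> \<eta> \<longrightarrow> Q U s f (abs_ae_fun \<eta>) = 0" using test_function_H10 by blast
next
  assume zero: "\<forall>\<eta>. test_function \<Omega> \<eta> \<longrightarrow> Q U s f (abs_ae_fun \<eta>) = 0"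
  obtain K where K: "K \<ge> 0" "\<And>w. w \<in> H10 \<Omega> \<Longrightarrow> (Q U s f w)\<^sup>2 \<le> K * P w w"
    using Q_bounded[OF U f, of s] by metis
  show "\<forall>w\<in>H10 \<Omega>. Q U s f w = 0"
  proof
    fix w assume w: "w \<in> H10 \<Omega>"
    have "(Q U s f w)\<^sup>2 \<le> 0 + e" if "e > 0" for e
    proof -
      \<comment> \<open>The 1 avoids a division by zero, as \<open>K\<close> may vanish.\<close>
      have "e / (K + 1) > 0" using K(1) that by simp
      then obtain \<eta> where \<eta>: "test_function \<Omega> \<eta>" "P (w - abs_ae_fun \<eta>) (w - abs_ae_fun \<eta>) < e / (K + 1)"
        using w unfolding H10_approx_iff by blast
      note t = test_function_H10[OF \<eta>(1)]
      have "Q U s f (w + (-1) *\<^sub>R abs_ae_fun \<eta>) = Q U s f w"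
        using Q_lincomb_right[OF U f w t, of s "-1"] zero \<eta>(1) by simp
      then have "(Q U s f w)\<^sup>2 \<le> K * P (w - abs_ae_fun \<eta>) (w - abs_ae_fun \<eta>)"
        using K(2)[OF H10.V_closed(3)[OF w t]] by simp
      also have "\<dots> \<le> K * (e / (K + 1))" using \<eta>(2) K(1) by (intro mult_left_mono) auto
      also have "\<dots> \<le> e" using K(1) that by (simp add: field_simps)
      finally show ?thesis by simp
    qed
    then have "(Q U s f w)\<^sup>2 \<le> 0" by (rule field_le_epsilon)
    then show "Q U s f w = 0" by simp
  qed
qed

lemma P_compose:
  assumes UNIV: "\<Omega> = UNIV" and T: "orthogonal_transformation T" and uv: "u \<in> H1 \<Omega>" "v \<in> H1 \<Omega>"
  shows "P (compose_ae u T) (compose_ae v T) = P u v"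
proof -
  obtain T' where T': "orthogonal_transformation T'" "\<And>x. T (T' x) = x" "\<And>x. T' (T x) = x" "\<And>x y. T' x \<bullet> y = x \<bullet> T y"
    using orthogonal_transformation_inverse[OF T] by metis
  have M: "M = lebesgue" using UNIV by (simp add: lebesgue_on_UNIV_eq)
  note comp = H1_compose_orthogonal[OF _ T T'(1,2,3,4)]
  have uv': "u \<in> H1 UNIV" "v \<in> H1 UNIV" using uv UNIV by auto
  have Jm: "(\<lambda>x. J u x \<bullet> J v x) \<in> borel_measurable lebesgue"
    using square_integrable_inner[OF uv[THEN J_square_integrable]] M by (simp add: borel_measurable_integrable)
  have c: "compose_ae u T \<in> H1 \<Omega>" "compose_ae v T \<in> H1 \<Omega>" using comp(1) uv' UNIV by auto
  have TT: "T' a \<bullet> T' b = a \<bullet> b" for a b using T'(4)[of a "T' b"] T'(2) by simp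
  have "P (compose_ae u T) (compose_ae v T) = (LINT x|lebesgue. J u (T x) \<bullet> J v (T x))"
    unfolding P_def M
  proof (rule integral_cong_AE)
    show "(\<lambda>x. J (compose_ae u T) x \<bullet> J (compose_ae v T) x) \<in> borel_measurable lebesgue"
      using square_integrable_inner[OF c[THEN J_square_integrable]] M by (simp add: borel_measurable_integrable)
    show "(\<lambda>x. J u (T x) \<bullet> J v (T x)) \<in> borel_measurable lebesgue"
      by (rule measurable_compose[OF orthogonal_measurable_lebesgue(3)[OF T] Jm])
    show "AE x in lebesgue. J (compose_ae u T) x \<bullet> J (compose_ae v T) x = J u (T x) \<bullet> J v (T x)"
    proof -
      have Je: "J w x = (sqrt lam * rep_ae_fun w x, weak_gradient UNIV w x)" for w x
        unfolding J_def using UNIV by simp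
      show ?thesis
        using comp(2)[OF uv'(1)] comp(2)[OF uv'(2)] rep_compose_ae[OF T, of u] rep_compose_ae[OF T, of v]
        unfolding Je by eventually_elim (simp add: TT)
    qed
  qed
  also have "\<dots> = (LINT x|lebesgue. J u x \<bullet> J v x)"
    by (rule integral_lebesgue_orthogonal[OF T Jm])
  finally show ?thesis by (simp add: P_def M)
qed

lemma T4_compose:
  assumes UNIV: "\<Omega> = UNIV" and T: "orthogonal_transformation T"
  shows "T4 (compose_ae a T) (compose_ae b T) (compose_ae c T) (compose_ae d T) = T4 a b c d"
proof -
  have M: "M = lebesgue" using UNIV by (simp add: lebesgue_on_UNIV_eq)
  let ?F = "\<lambda>x. (rep_ae_fun a x * rep_ae_fun b x) * (rep_ae_fun c x * rep_ae_fun d x)"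
  have "T4 (compose_ae a T) (compose_ae b T) (compose_ae c T) (compose_ae d T) = (LINT x|lebesgue. ?F (T x))"
    unfolding T4_def M
  proof (rule integral_cong_AE)
    show "(\<lambda>x. ?F (T x)) \<in> borel_measurable lebesgue"
      by (rule measurable_compose[OF orthogonal_measurable_lebesgue(3)[OF T]]) measurable
    show "AE x in lebesgue. rep_ae_fun (compose_ae a T) x * rep_ae_fun (compose_ae b T) x *
        (rep_ae_fun (compose_ae c T) x * rep_ae_fun (compose_ae d T) x) = ?F (T x)"
      using rep_compose_ae[OF T, of a] rep_compose_ae[OF T, of b] rep_compose_ae[OF T, of c] rep_compose_ae[OF T, of d]
      by eventually_elim simp
  qed measurable
  also have "\<dots> = (LINT x|lebesgue. ?F x)"
    by (rule integral_lebesgue_orthogonal[OF T]) measurable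
  finally show ?thesis by (simp add: T4_def M)
qed

text \<open>Palais' principle of symmetric criticality: the Riesz representative of \<open>Q U s f\<close> is itself
  radially symmetric.\<close>

lemma symmetric_criticality:
  assumes U: "U \<in> H_space \<Omega>" and f: "f \<in> H_space \<Omega>" and zero: "\<forall>w\<in>H_space \<Omega>. Q U s f w = 0"
  shows "\<forall>w\<in>H10 \<Omega>. Q U s f w = 0"
proof (cases "\<Omega> = UNIV")
  case False
  then show ?thesis using zero by (simp add: H_space_def)
next
  case UNIV: True
  note H = H1_eq_H10_UNIV[OF UNIV]
  have U': "U \<in> H10 \<Omega>" and f': "f \<in> H10 \<Omega>" using U f H_space_H10 by auto
  let ?G = "Q U s f"
  obtain K where K: "\<And>w. w \<in> H10 \<Omega> \<Longrightarrow> (?G w)\<^sup>2 \<le> K * P w w"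
    using Q_bounded[OF U' f', of s] by metis
  have G0: "?G 0 = 0"
    using Q_lincomb_right[OF U' f' H10_zero H10_zero, of s 1] by simp
  obtain z where z: "z \<in> H10 \<Omega>" "\<And>v. v \<in> H10 \<Omega> \<Longrightarrow> P z v = ?G v"
  proof (rule H10_Riesz[of ?G K])
    show "?G (u + v) = ?G u + ?G v" if "u \<in> H10 \<Omega>" "v \<in> H10 \<Omega>" for u v
      using Q_lincomb_right[OF U' f' that, of s 1] by simp
    show "?G (r *\<^sub>R u) = r * ?G u" if "u \<in> H10 \<Omega>" for u r
      using Q_lincomb_right[OF U' f' H10_zero that, of s r] G0 by simp
  qed (use K in blast)+
  have "compose_ae z T = z" if T: "orthogonal_transformation T" for T
  proof -
    obtain T' where T': "orthogonal_transformation T'" "\<And>x. T (T' x) = x" "\<And>x. T' (T x) = x" "\<And>x y. T' x \<bullet> y = x \<bullet> T y"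
      using orthogonal_transformation_inverse[OF T] by metis
    have inT: "compose_ae v T \<in> H1 \<Omega>" "compose_ae v T' \<in> H1 \<Omega>" if "v \<in> H1 \<Omega>" for v
    proof -
      have 1: "T' x \<bullet> y = x \<bullet> T y" and 2: "T x \<bullet> y = x \<bullet> T' y" for x y
        using T'(4) by (auto simp: inner_commute)
      show "compose_ae v T \<in> H1 \<Omega>" "compose_ae v T' \<in> H1 \<Omega>"
        using H1_compose_orthogonal(1)[OF _ T T'(1,2,3) 1] H1_compose_orthogonal(1)[OF _ T'(1) T T'(3,2) 2] that UNIV by auto
    qed
    have rad: "compose_ae U T = U" "compose_ae f T = f"
      using U f T UNIV by (auto simp: H_space_def radially_symmetric_iff)
    have "P (compose_ae z T) v = P z v" if v: "v \<in> H1 \<Omega>" for v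
    proof -
      define v' where "v' = compose_ae v T'"
      have v': "v' \<in> H1 \<Omega>" unfolding v'_def by (rule inT[OF v])
      have vv: "compose_ae v' T = v" unfolding v'_def by (rule compose_ae_inverse[OF T T'(1,3)])
      have "P (compose_ae z T) v = P (compose_ae z T) (compose_ae v' T)" by (simp add: vv)
      also have "\<dots> = P z v'" by (rule P_compose[OF UNIV T H10_H1[OF z(1)] v'])
      also have "\<dots> = ?G v'" using z(2) v' H by simp
      also have "\<dots> = ?G (compose_ae v' T)"
        unfolding Q_def using P_compose[OF UNIV T H10_H1[OF f'] v'] T4_compose[OF UNIV T, of U U f v'] by (simp add: rad)
      also have "\<dots> = P z v" using z(2) v H by (simp add: vv)
      finally show ?thesis .
    qed
    moreover have zT: "compose_ae z T \<in> H1 \<Omega>" by (rule inT[OF H10_H1[OF z(1)]])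
    moreover have d: "compose_ae z T - z \<in> H1 \<Omega>" using zT H10_H1[OF z(1)] by (rule H1.V_closed(3))
    ultimately have "P (compose_ae z T - z) (compose_ae z T - z) = 0"
      using P_lincomb[OF zT H10_H1[OF z(1)] d, of "-1"] by simp
    then show ?thesis using P_eq_0[OF d] by simp
  qed
  then have zH: "z \<in> H_space \<Omega>"
    using H10_H1[OF z(1)] UNIV by (simp add: H_space_def radially_symmetric_iff)
  \<comment> \<open>Being radial, the representative \<open>z\<close> may itself be inserted into
    the hypothesis.\<close>
  have "P z z = 0" using z(2)[OF z(1)] zero zH by simp
  then have "z = 0" using P_eq_0 z(1) H10_H1 by blast
  then show ?thesis using z(2) H1.ip_scale[OF H1_zero, of _ 0] H10_H1 by (metis mult_zero_left scaleR_zero_right)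
qed

text \<open>Three classes of test elements impose the same condition: test functions, all of
  \<open>H10\<close> by density, and \<open>H_space\<close> by symmetric criticality.\<close>

lemma weakly_solves_iff:
  assumes U: "U \<in> H_space \<Omega>" and f: "f \<in> H_space \<Omega>"
  shows "weakly_solves \<Omega> lam f (\<lambda>x. s * (rep_ae_fun U x)\<^sup>2 * rep_ae_fun f x) \<longleftrightarrow> (\<forall>w\<in>H_space \<Omega>. Q U s f w = 0)"
  using Q_test_function[OF U[THEN H_space_H10] f[THEN H_space_H10], of s]
    Q_zero_on_test_functions_iff[OF U[THEN H_space_H10] f[THEN H_space_H10], of s]
    symmetric_criticality[OF U f, of s] H_space_H10 by blast

end

section \<open>The second variation\<close>

context sobolev4
begin

lemma P_lincomb_right:
  "u \<in> H1 \<Omega> \<Longrightarrow> v \<in> H1 \<Omega> \<Longrightarrow> w \<in> H1 \<Omega> \<Longrightarrow> P w (u + r *\<^sub>R v) = P w u + r * P w v"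
  using P_lincomb[of u v w r] by (simp add: P_commute[of w])

lemma P_has_derivative:
  assumes "a \<in> H10 \<Omega>" "b \<in> H10 \<Omega>" "a' \<in> H10 \<Omega>" "b' \<in> H10 \<Omega>"
  shows "((\<lambda>t. P (a + t *\<^sub>R a') (b + t *\<^sub>R b')) has_real_derivative P a' b + P a b') (at 0)"
proof -
  have eq: "P (a + t *\<^sub>R a') (b + t *\<^sub>R b') = P a b + t * P a b' + t * P a' b + t * t * P a' b'" for t
    using assms by (simp add: P_lincomb P_lincomb_right H10_H1 H1.V_closed algebra_simps)
  show ?thesis
    unfolding eq by (auto intro!: derivative_eq_intros)
qed

lemma T4_has_derivative:
  assumes [simp]: "a \<in> H10 \<Omega>" "b \<in> H10 \<Omega>" "c \<in> H10 \<Omega>" "d \<in> H10 \<Omega>"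
    "a' \<in> H10 \<Omega>" "b' \<in> H10 \<Omega>" "c' \<in> H10 \<Omega>" "d' \<in> H10 \<Omega>"
  shows "((\<lambda>t. T4 (a + t *\<^sub>R a') (b + t *\<^sub>R b') (c + t *\<^sub>R c') (d + t *\<^sub>R d')) has_real_derivative
    T4 a' b c d + T4 a b' c d + T4 a b c' d + T4 a b c d') (at 0)"
proof -
  have [simp]: "x + t *\<^sub>R y \<in> H10 \<Omega>" if "x \<in> H10 \<Omega>" "y \<in> H10 \<Omega>" for x y t
    using that by (rule H10_lincomb)
  show ?thesis
    by (simp only: T4_lincomb T4_lincomb2 assms \<open>\<And>x y t. x \<in> H10 \<Omega> \<Longrightarrow> y \<in> H10 \<Omega> \<Longrightarrow> x + t *\<^sub>R y \<in> H10 \<Omega>\<close>)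
       (auto intro!: derivative_eq_intros)
qed

lemma T4_zero: "b \<in> H10 \<Omega> \<Longrightarrow> c \<in> H10 \<Omega> \<Longrightarrow> d \<in> H10 \<Omega> \<Longrightarrow> T4 0 b c d = 0"
  using T4_lincomb[OF H10_zero H10_zero, of b c d 1] by simp

lemma P_eq_integral: "P u u = (LINT x|M. (norm (weak_gradient \<Omega> u x))\<^sup>2 + lam * (rep_ae_fun u x)\<^sup>2)"
  unfolding P_def
  by (intro Bochner_Integration.integral_cong refl)
     (use lam_pos in \<open>simp add: J_def power2_norm_eq_inner[symmetric] norm_Pair power_mult_distrib\<close>)

lemma energy_eq:
  assumes u: "\<And>i. u $ i \<in> H10 \<Omega>"
  shows "energy \<Omega> lam A u = 1/2 * (\<Sum>i\<in>UNIV. P (u $ i) (u $ i))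
    - 1/4 * (\<Sum>i\<in>UNIV. \<Sum>j\<in>UNIV. A $ i $ j * T4 (u $ i) (u $ i) (u $ j) (u $ j))"
proof -
  have int: "integrable M (\<lambda>x. A $ i $ j * (rep_ae_fun (u $ i) x)\<^sup>2 * (rep_ae_fun (u $ j) x)\<^sup>2)" for i j
    using integrable_mult_right[OF T4_integrable[OF u u u u, of i i j j], of "A $ i $ j"]
    by (simp add: power2_eq_square mult.assoc)
  have "(LINT x|M. A $ i $ j * (rep_ae_fun (u $ i) x)\<^sup>2 * (rep_ae_fun (u $ j) x)\<^sup>2)
    = A $ i $ j * T4 (u $ i) (u $ i) (u $ j) (u $ j)" for i j
    unfolding T4_def integral_mult_right_zero[symmetric] by (simp add: power2_eq_square mult.assoc)
  then have "(LINT x|M. (\<Sum>i\<in>UNIV. \<Sum>j\<in>UNIV. A $ i $ j * (rep_ae_fun (u $ i) x)\<^sup>2 * (rep_ae_fun (u $ j) x)\<^sup>2))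
    = (\<Sum>i\<in>UNIV. \<Sum>j\<in>UNIV. A $ i $ j * T4 (u $ i) (u $ i) (u $ j) (u $ j))"
    using int by (simp add: Bochner_Integration.integral_sum)
  then show ?thesis
    unfolding energy_def P_eq_integral by simp
qed

lemma scalar_energy_eq:
  assumes "u \<in> H10 \<Omega>"
  shows "scalar_energy \<Omega> lam u = 1/2 * P u u - 1/4 * T4 u u u u"
  unfolding scalar_energy_def P_eq_integral T4_def by (simp add: power4_eq_xxxx mult.assoc)

lemma energy_has_derivative:
  assumes v: "\<And>i. v $ i \<in> H10 \<Omega>" and \<psi>: "\<And>i. \<psi> $ i \<in> H10 \<Omega>"
  shows "((\<lambda>t. energy \<Omega> lam A (v + t *\<^sub>R \<psi>)) has_real_derivative
    (\<Sum>i\<in>UNIV. P (v $ i) (\<psi> $ i)) - 1/2 * (\<Sum>i\<in>UNIV. \<Sum>j\<in>UNIV. A $ i $ j *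
      (T4 (\<psi> $ i) (v $ i) (v $ j) (v $ j) + T4 (v $ i) (v $ i) (\<psi> $ j) (v $ j)))) (at 0)"
proof -
  have c: "(v + t *\<^sub>R \<psi>) $ i \<in> H10 \<Omega>" for t i
    using H10_lincomb[OF v \<psi>] by simp
  have "((\<lambda>t. 1/2 * (\<Sum>i\<in>UNIV. P (v $ i + t *\<^sub>R \<psi> $ i) (v $ i + t *\<^sub>R \<psi> $ i))
    - 1/4 * (\<Sum>i\<in>UNIV. \<Sum>j\<in>UNIV. A $ i $ j * T4 (v $ i + t *\<^sub>R \<psi> $ i) (v $ i + t *\<^sub>R \<psi> $ i) (v $ j + t *\<^sub>R \<psi> $ j) (v $ j + t *\<^sub>R \<psi> $ j)))
    has_real_derivative 1/2 * (\<Sum>i\<in>UNIV. P (\<psi> $ i) (v $ i) + P (v $ i) (\<psi> $ i)) - 1/4 * (\<Sum>i\<in>UNIV. \<Sum>j\<in>UNIV. A $ i $ j *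
     (T4 (\<psi> $ i) (v $ i) (v $ j) (v $ j) + T4 (v $ i) (\<psi> $ i) (v $ j) (v $ j) +
      T4 (v $ i) (v $ i) (\<psi> $ j) (v $ j) + T4 (v $ i) (v $ i) (v $ j) (\<psi> $ j)))) (at 0)"
    by (intro DERIV_diff DERIV_cmult DERIV_sum P_has_derivative T4_has_derivative v \<psi>)
  moreover have "1/2 * (\<Sum>i\<in>UNIV. P (\<psi> $ i) (v $ i) + P (v $ i) (\<psi> $ i)) = (\<Sum>i\<in>UNIV. P (v $ i) (\<psi> $ i))"
    by (simp add: P_commute[of "\<psi> $ _"] sum_divide_distrib)
  moreover have "1/4 * (\<Sum>i\<in>UNIV. \<Sum>j\<in>UNIV. A $ i $ j *
     (T4 (\<psi> $ i) (v $ i) (v $ j) (v $ j) + T4 (v $ i) (\<psi> $ i) (v $ j) (v $ j) +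
      T4 (v $ i) (v $ i) (\<psi> $ j) (v $ j) + T4 (v $ i) (v $ i) (v $ j) (\<psi> $ j))) =
    1/2 * (\<Sum>i\<in>UNIV. \<Sum>j\<in>UNIV. A $ i $ j *
      (T4 (\<psi> $ i) (v $ i) (v $ j) (v $ j) + T4 (v $ i) (v $ i) (\<psi> $ j) (v $ j)))"
    unfolding sum_distrib_left T4_swap(1)[of "v $ _" "\<psi> $ _"] T4_swap(2)[of "v $ _" "v $ _" "v $ _" "\<psi> $ _"]
    by (intro sum.cong refl) (simp add: algebra_simps)
  ultimately show ?thesis
    unfolding energy_eq[OF c] by (simp only: vector_add_component vector_scaleR_component)
qed

lemma second_variation_energy:
  assumes u: "\<And>i. u $ i \<in> H10 \<Omega>" and \<phi>: "\<And>i. \<phi> $ i \<in> H10 \<Omega>" and \<psi>: "\<And>i. \<psi> $ i \<in> H10 \<Omega>"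
  shows "second_variation (energy \<Omega> lam A) u \<phi> \<psi> = (\<Sum>i\<in>UNIV. P (\<phi> $ i) (\<psi> $ i)) -
    1/2 * (\<Sum>i\<in>UNIV. \<Sum>j\<in>UNIV. A $ i $ j * (T4 (\<psi> $ i) (\<phi> $ i) (u $ j) (u $ j) + 2 * T4 (\<psi> $ i) (u $ i) (\<phi> $ j) (u $ j)
      + 2 * T4 (\<phi> $ i) (u $ i) (\<psi> $ j) (u $ j) + T4 (u $ i) (u $ i) (\<psi> $ j) (\<phi> $ j)))"
proof -
  let ?v = "\<lambda>s. u + s *\<^sub>R \<phi>"
  have v: "?v s $ i \<in> H10 \<Omega>" for s i using H10_lincomb[OF u \<phi>] by simp
  \<comment> \<open>Arguments independent of \<open>s\<close> are written with an added
    \<open>s *\<^sub>R 0\<close>, so that the product rules for \<open>P\<close> and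
    \<open>T4\<close> match literally.\<close>
  have inner: "(\<lambda>s. deriv (\<lambda>t. energy \<Omega> lam A (u + s *\<^sub>R \<phi> + t *\<^sub>R \<psi>)) 0) =
    (\<lambda>s. (\<Sum>i\<in>UNIV. P (u $ i + s *\<^sub>R \<phi> $ i) (\<psi> $ i + s *\<^sub>R 0)) - 1/2 * (\<Sum>i\<in>UNIV. \<Sum>j\<in>UNIV. A $ i $ j *
      (T4 (\<psi> $ i + s *\<^sub>R 0) (u $ i + s *\<^sub>R \<phi> $ i) (u $ j + s *\<^sub>R \<phi> $ j) (u $ j + s *\<^sub>R \<phi> $ j)
       + T4 (u $ i + s *\<^sub>R \<phi> $ i) (u $ i + s *\<^sub>R \<phi> $ i) (\<psi> $ j + s *\<^sub>R 0) (u $ j + s *\<^sub>R \<phi> $ j))))"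
    by (intro ext, subst DERIV_imp_deriv[OF energy_has_derivative[OF v \<psi>]]) simp
  have "((\<lambda>s. (\<Sum>i\<in>UNIV. P (u $ i + s *\<^sub>R \<phi> $ i) (\<psi> $ i + s *\<^sub>R 0)) - 1/2 * (\<Sum>i\<in>UNIV. \<Sum>j\<in>UNIV. A $ i $ j *
      (T4 (\<psi> $ i + s *\<^sub>R 0) (u $ i + s *\<^sub>R \<phi> $ i) (u $ j + s *\<^sub>R \<phi> $ j) (u $ j + s *\<^sub>R \<phi> $ j)
       + T4 (u $ i + s *\<^sub>R \<phi> $ i) (u $ i + s *\<^sub>R \<phi> $ i) (\<psi> $ j + s *\<^sub>R 0) (u $ j + s *\<^sub>R \<phi> $ j))))
    has_real_derivative (\<Sum>i\<in>UNIV. P (\<phi> $ i) (\<psi> $ i) + P (u $ i) 0) - 1/2 * (\<Sum>i\<in>UNIV. \<Sum>j\<in>UNIV. A $ i $ j *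
      ((T4 0 (u $ i) (u $ j) (u $ j) + T4 (\<psi> $ i) (\<phi> $ i) (u $ j) (u $ j) + T4 (\<psi> $ i) (u $ i) (\<phi> $ j) (u $ j) + T4 (\<psi> $ i) (u $ i) (u $ j) (\<phi> $ j))
     + (T4 (\<phi> $ i) (u $ i) (\<psi> $ j) (u $ j) + T4 (u $ i) (\<phi> $ i) (\<psi> $ j) (u $ j) + T4 (u $ i) (u $ i) 0 (u $ j) + T4 (u $ i) (u $ i) (\<psi> $ j) (\<phi> $ j))))) (at 0)"
    by (intro DERIV_diff DERIV_cmult DERIV_sum DERIV_add P_has_derivative T4_has_derivative u \<phi> \<psi> H10_zero)
  then have "second_variation (energy \<Omega> lam A) u \<phi> \<psi> = (\<Sum>i\<in>UNIV. P (\<phi> $ i) (\<psi> $ i) + P (u $ i) 0) - 1/2 * (\<Sum>i\<in>UNIV. \<Sum>j\<in>UNIV. A $ i $ j *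
      ((T4 0 (u $ i) (u $ j) (u $ j) + T4 (\<psi> $ i) (\<phi> $ i) (u $ j) (u $ j) + T4 (\<psi> $ i) (u $ i) (\<phi> $ j) (u $ j) + T4 (\<psi> $ i) (u $ i) (u $ j) (\<phi> $ j))
     + (T4 (\<phi> $ i) (u $ i) (\<psi> $ j) (u $ j) + T4 (u $ i) (\<phi> $ i) (\<psi> $ j) (u $ j) + T4 (u $ i) (u $ i) 0 (u $ j) + T4 (u $ i) (u $ i) (\<psi> $ j) (\<phi> $ j))))"
    unfolding second_variation_def inner by (rule DERIV_imp_deriv)
  moreover have "P (u $ i) 0 = 0" for i
    using H1.ip_scale_right[OF H1_zero H10_H1[OF u[of i]], of 0] by simp
  moreover have "T4 0 (u $ i) (u $ j) (u $ j) = 0" "T4 (u $ i) (u $ i) 0 (u $ j) = 0" for i j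
    using T4_zero u T4_swap(3)[of "u $ i" "u $ i" 0 "u $ j"] by auto
  moreover have "T4 (\<psi> $ i) (u $ i) (u $ j) (\<phi> $ j) = T4 (\<psi> $ i) (u $ i) (\<phi> $ j) (u $ j)"
    "T4 (u $ i) (\<phi> $ i) (\<psi> $ j) (u $ j) = T4 (\<phi> $ i) (u $ i) (\<psi> $ j) (u $ j)" for i j
    by (rule T4_swap)+
  ultimately show ?thesis by (simp add: algebra_simps)
qed

text \<open>Translates the Morse index of \<open>U\<close> into a statement about the form
  \<open>Q U 3\<close>.\<close>

lemma second_variation_scalar_energy:
  assumes u: "u \<in> H10 \<Omega>" and \<phi>: "\<phi> \<in> H10 \<Omega>" and \<psi>: "\<psi> \<in> H10 \<Omega>"
  shows "second_variation (scalar_energy \<Omega> lam) u \<phi> \<psi> = Q u 3 \<phi> \<psi>"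
proof -
  have D: "((\<lambda>t. scalar_energy \<Omega> lam (v + t *\<^sub>R \<psi>)) has_real_derivative P v \<psi> - T4 v v v \<psi>) (at 0)"
    if v: "v \<in> H10 \<Omega>" for v
  proof -
    have "((\<lambda>t. 1/2 * P (v + t *\<^sub>R \<psi>) (v + t *\<^sub>R \<psi>) - 1/4 * T4 (v + t *\<^sub>R \<psi>) (v + t *\<^sub>R \<psi>) (v + t *\<^sub>R \<psi>) (v + t *\<^sub>R \<psi>))
      has_real_derivative 1/2 * (P \<psi> v + P v \<psi>) - 1/4 * (T4 \<psi> v v v + T4 v \<psi> v v + T4 v v \<psi> v + T4 v v v \<psi>)) (at 0)"
      by (intro DERIV_diff DERIV_cmult P_has_derivative T4_has_derivative v \<psi>)
    moreover have "T4 \<psi> v v v = T4 v v v \<psi>" "T4 v \<psi> v v = T4 v v v \<psi>" "T4 v v \<psi> v = T4 v v v \<psi>"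
      by (simp_all add: T4_def mult_ac)
    ultimately show ?thesis
      using P_commute[of \<psi> v] by (simp add: scalar_energy_eq H10_lincomb v \<psi>)
  qed
  have inner: "(\<lambda>s. deriv (\<lambda>t. scalar_energy \<Omega> lam (u + s *\<^sub>R \<phi> + t *\<^sub>R \<psi>)) 0) =
    (\<lambda>s. P (u + s *\<^sub>R \<phi>) (\<psi> + s *\<^sub>R 0) - T4 (u + s *\<^sub>R \<phi>) (u + s *\<^sub>R \<phi>) (u + s *\<^sub>R \<phi>) (\<psi> + s *\<^sub>R 0))"
    by (intro ext, subst DERIV_imp_deriv[OF D[OF H10_lincomb[OF u \<phi>]]]) simp
  have "((\<lambda>s. P (u + s *\<^sub>R \<phi>) (\<psi> + s *\<^sub>R 0) - T4 (u + s *\<^sub>R \<phi>) (u + s *\<^sub>R \<phi>) (u + s *\<^sub>R \<phi>) (\<psi> + s *\<^sub>R 0)) has_real_derivative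
    (P \<phi> \<psi> + P u 0) - (T4 \<phi> u u \<psi> + T4 u \<phi> u \<psi> + T4 u u \<phi> \<psi> + T4 u u u 0)) (at 0)"
    by (intro DERIV_diff P_has_derivative T4_has_derivative u \<phi> \<psi> H10_zero)
  then have "second_variation (scalar_energy \<Omega> lam) u \<phi> \<psi> = (P \<phi> \<psi> + P u 0) - (T4 \<phi> u u \<psi> + T4 u \<phi> u \<psi> + T4 u u \<phi> \<psi> + T4 u u u 0)"
    unfolding second_variation_def inner by (rule DERIV_imp_deriv)
  moreover have "P u 0 = 0" using H1.ip_scale_right[OF H1_zero H10_H1[OF u], of 0] by simp
  moreover have "T4 u u u 0 = 0" using T4_zero[OF u u u] by (simp add: T4_def mult_ac)
  moreover have "T4 \<phi> u u \<psi> = T4 u u \<phi> \<psi>" "T4 u \<phi> u \<psi> = T4 u u \<phi> \<psi>"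
    by (simp_all add: T4_def mult_ac)
  ultimately show ?thesis by (simp add: Q_def)
qed

end

section \<open>Forms of index one\<close>

lemma diff_double_neg: "0 < (x::real) \<Longrightarrow> y \<le> 0 \<Longrightarrow> y - 2 * x < 0"
  by linarith

text \<open>In the application \<open>q\<close> is the quadratic form of \<open>- \<Delta> + lam - U\<^sup>2\<close>, which annihilates \<open>U\<close>, \<open>R\<close> is
  multiplication by \<open>U\<^sup>2\<close>, and \<open>q - 2 R\<close> is the linearization of the cubic equation.\<close>

locale index_one =
  fixes V :: "'v::real_vector set" and q R :: "'v \<Rightarrow> 'v \<Rightarrow> real" and U :: 'v
  assumes V: "subspace V" and U: "U \<in> V" "U \<noteq> 0"
    and q_lin: "\<And>u v w r. u \<in> V \<Longrightarrow> v \<in> V \<Longrightarrow> w \<in> V \<Longrightarrow> q (u + r *\<^sub>R v) w = q u w + r * q v w"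
    and q_sym: "\<And>u v. u \<in> V \<Longrightarrow> v \<in> V \<Longrightarrow> q u v = q v u"
    and R_lin: "\<And>u v w r. u \<in> V \<Longrightarrow> v \<in> V \<Longrightarrow> w \<in> V \<Longrightarrow> R (u + r *\<^sub>R v) w = R u w + r * R v w"
    and R_sym: "\<And>u v. u \<in> V \<Longrightarrow> v \<in> V \<Longrightarrow> R u v = R v u"
    and R_pos: "\<And>f. f \<in> V \<Longrightarrow> f \<noteq> 0 \<Longrightarrow> R f f > 0"
    and qU: "\<And>w. w \<in> V \<Longrightarrow> q U w = 0"
    and index: "\<And>B. finite B \<Longrightarrow> independent B \<Longrightarrow> span B \<subseteq> V \<Longrightarrow>
      (\<And>f. f \<in> span B \<Longrightarrow> f \<noteq> 0 \<Longrightarrow> q f f - 2 * R f f < 0) \<Longrightarrow> card B \<le> 1"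
begin

lemma V_lincomb: "u \<in> V \<Longrightarrow> v \<in> V \<Longrightarrow> u + r *\<^sub>R v \<in> V" and V_zero: "0 \<in> V"
  and V_scale: "u \<in> V \<Longrightarrow> r *\<^sub>R u \<in> V"
  using V by (auto simp: subspace_def)

lemma zero_left: "w \<in> V \<Longrightarrow> q 0 w = 0" "w \<in> V \<Longrightarrow> R 0 w = 0"
  using q_lin[OF V_zero V_zero, of w 1] R_lin[OF V_zero V_zero, of w 1] by auto

lemma lin_right:
  assumes "u \<in> V" "v \<in> V" "w \<in> V"
  shows "q w (u + r *\<^sub>R v) = q w u + r * q w v" "R w (u + r *\<^sub>R v) = R w u + r * R w v"
proof -
  note c = V_lincomb[OF assms(1,2), of r]
  show "q w (u + r *\<^sub>R v) = q w u + r * q w v"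
    using q_lin[OF assms, of r] q_sym[OF assms(3) c] q_sym[OF assms(3,1)] q_sym[OF assms(3,2)] by simp
  show "R w (u + r *\<^sub>R v) = R w u + r * R w v"
    using R_lin[OF assms, of r] R_sym[OF assms(3) c] R_sym[OF assms(3,1)] R_sym[OF assms(3,2)] by simp
qed

lemma R_nonneg: "f \<in> V \<Longrightarrow> 0 \<le> R f f"
  using R_pos[of f] zero_left(2)[OF V_zero] by (cases "f = 0") auto

text \<open>\<open>U\<close> lies in the kernel of \<open>q\<close>, so only the \<open>f\<close>
  direction of the plane contributes to \<open>q\<close>, whereas \<open>R\<close> sees
  both.\<close>

lemma plane_forms:
  assumes f: "f \<in> V"
  shows "q (a *\<^sub>R U + b *\<^sub>R f) (a *\<^sub>R U + b *\<^sub>R f) = b\<^sup>2 * q f f"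
    "R (a *\<^sub>R U + b *\<^sub>R f) (a *\<^sub>R U + b *\<^sub>R f) = a\<^sup>2 * R U U + 2 * a * b * R U f + b\<^sup>2 * R f f"
proof -
  have aU: "a *\<^sub>R U \<in> V" by (rule V_scale[OF U(1)])
  have s: "q (a *\<^sub>R U) w = a * q U w" "R (a *\<^sub>R U) w = a * R U w" if "w \<in> V" for w
    using q_lin[OF V_zero U(1) that, of a] R_lin[OF V_zero U(1) that, of a] zero_left[OF that] by auto
  have s': "q f (a *\<^sub>R U) = a * q U f" "R f (a *\<^sub>R U) = a * R U f"
    using s[OF f] q_sym[OF f aU] R_sym[OF f aU] by auto
  have RaU: "R (a *\<^sub>R U) (a *\<^sub>R U) = a * (a * R U U)"
    using s(2)[OF aU] s(2)[OF U(1)] R_sym[OF U(1) aU] by simp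
  show "q (a *\<^sub>R U + b *\<^sub>R f) (a *\<^sub>R U + b *\<^sub>R f) = b\<^sup>2 * q f f"
    using f aU V_lincomb[OF aU f, of b]
    by (simp add: q_lin lin_right s s' qU power2_eq_square)
  show "R (a *\<^sub>R U + b *\<^sub>R f) (a *\<^sub>R U + b *\<^sub>R f) = a\<^sup>2 * R U U + 2 * a * b * R U f + b\<^sup>2 * R f f"
    using f aU V_lincomb[OF aU f, of b]
    by (simp add: R_lin lin_right s(2)[OF f] s' RaU power2_eq_square algebra_simps)
qed

text \<open>The hypothesis says that \<open>q - 2 R\<close> is negative on the span of
  \<open>U\<close> and \<open>f\<close>; were the two independent, this would be a negative
  plane.\<close>

lemma multiple_of_U:
  assumes f: "f \<in> V"
    and neg: "\<And>a b. a *\<^sub>R U + b *\<^sub>R f \<noteq> 0 \<Longrightarrow>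
      b\<^sup>2 * q f f - 2 * (a\<^sup>2 * R U U + 2 * a * b * R U f + b\<^sup>2 * R f f) < 0"
  obtains t where "f = t *\<^sub>R U"
proof (cases "f \<in> span {U}")
  case True
  then show ?thesis using that by (auto simp: span_singleton)
next
  case False
  then have "f \<noteq> U" using span_base[of U "{U}"] by auto
  have ind: "independent {f, U}"
    using False U(2) by (simp add: independent_insert)
  have "card {f, U} \<le> 1"
  proof (rule index[OF _ ind])
    show "span {f, U} \<subseteq> V" using V f U(1) by (intro span_minimal) auto
    fix x assume x: "x \<in> span {f, U}" "x \<noteq> 0"
    then obtain b a where xab: "x = a *\<^sub>R U + b *\<^sub>R f"
      by (auto simp: span_breakdown_eq span_singleton) (metis add.commute diff_add_cancel)
    show "q x x - 2 * R x x < 0"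
      using neg[of a b] x(2) unfolding xab plane_forms[OF f] by simp
  qed simp
  then show ?thesis using \<open>f \<noteq> U\<close> by simp
qed

text \<open>A negative value would make the plane with \<open>U\<close> negative and force
  \<open>f\<close> to be a multiple of \<open>U\<close>, where \<open>q\<close> vanishes.\<close>

lemma q_nonneg:
  assumes f: "f \<in> V" shows "0 \<le> q f f"
proof (rule ccontr)
  assume "\<not> 0 \<le> q f f"
  then have neg: "q f f < 0" by simp
  obtain t where "f = t *\<^sub>R U"
  proof (rule multiple_of_U[OF f])
    fix a b assume nz: "a *\<^sub>R U + b *\<^sub>R f \<noteq> 0"
    have "0 < R (a *\<^sub>R U + b *\<^sub>R f) (a *\<^sub>R U + b *\<^sub>R f)"
      by (intro R_pos nz V_lincomb V_scale U(1) f)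
    moreover have "b\<^sup>2 * q f f \<le> 0" using neg by (simp add: mult_nonneg_nonpos)
    ultimately show "b\<^sup>2 * q f f - 2 * (a\<^sup>2 * R U U + 2 * a * b * R U f + b\<^sup>2 * R f f) < 0"
      unfolding plane_forms[OF f] by (rule diff_double_neg)
  qed
  then have "q f f = 0" using plane_forms(1)[OF f, of t 0] plane_forms(1)[OF U(1), of t 0] by simp
  then show False using neg by simp
qed

lemma kernel_q:
  assumes f: "f \<in> V" and z: "q f f = 0"
  obtains t where "f = t *\<^sub>R U"
proof (rule multiple_of_U[OF f])
  fix a b assume nz: "a *\<^sub>R U + b *\<^sub>R f \<noteq> 0"
  have "0 < R (a *\<^sub>R U + b *\<^sub>R f) (a *\<^sub>R U + b *\<^sub>R f)"
    by (intro R_pos nz V_lincomb V_scale U(1) f)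
  then show "b\<^sup>2 * q f f - 2 * (a\<^sup>2 * R U U + 2 * a * b * R U f + b\<^sup>2 * R f f) < 0"
    unfolding plane_forms[OF f] z by (rule diff_double_neg) simp
qed

lemma R_orth_multiple:
  assumes "f = t *\<^sub>R U" "R U f = 0" shows "f = 0"
proof -
  have "R U f = t * R U U"
    using lin_right(2)[OF V_zero U(1) U(1), of t] R_sym[OF U(1) V_zero] zero_left(2)[OF U(1)] assms(1) by simp
  then show ?thesis using assms R_pos[OF U] by simp
qed

text \<open>For \<open>\<mu> < 0\<close> insert \<open>f\<close> itself: the left side is
  nonnegative and \<open>R\<close> is positive. For \<open>0 < \<mu>\<close> inserting
  \<open>U\<close> gives \<open>R U f = 0\<close> and inserting \<open>f\<close> gives
  \<open>q f f = 2 * \<mu> * R f f\<close>, so on the plane \<open>q - 2 R\<close> equals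
  \<open>- 2 * (a\<^sup>2 * R U U + (1 - \<mu>) * b\<^sup>2 * R f f)\<close>, which is negative
  because \<open>\<mu> < 1\<close>.\<close>

lemma kernel_shifted:
  assumes f: "f \<in> V" and \<mu>: "\<mu> \<noteq> 0" "\<mu> < 1" and ker: "\<And>g. g \<in> V \<Longrightarrow> q f g - 2 * \<mu> * R f g = 0"
  shows "f = 0"
proof (cases "\<mu> < 0")
  case True
  have "2 * \<mu> * R f f \<ge> 0" using ker[OF f] q_nonneg[OF f] by simp
  then have "R f f \<le> 0" using True by (simp add: zero_le_mult_iff)
  then show ?thesis using R_pos[OF f] by force
next
  case False
  have RUf: "R U f = 0"
    using ker[OF U(1)] qU[OF f] q_sym[OF f U(1)] R_sym[OF f U(1)] \<mu>(1) by simp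
  have qff: "q f f = 2 * \<mu> * R f f" using ker[OF f] by simp
  show ?thesis
  proof (rule ccontr)
    assume "f \<noteq> 0"
    then have Rf: "R f f > 0" by (rule R_pos[OF f])
    obtain t where "f = t *\<^sub>R U"
    proof (rule multiple_of_U[OF f])
      fix a b assume nz: "a *\<^sub>R U + b *\<^sub>R f \<noteq> 0"
      have "a \<noteq> 0 \<or> b \<noteq> 0" using nz by auto
      then have "0 < a\<^sup>2 * R U U + b\<^sup>2 * ((1 - \<mu>) * R f f)"
      proof
        assume "a \<noteq> 0"
        then show ?thesis using R_pos[OF U] Rf \<mu>(2) by (intro add_pos_nonneg mult_pos_pos mult_nonneg_nonneg) auto
      next
        assume "b \<noteq> 0"
        then show ?thesis using R_pos[OF U] Rf \<mu>(2) by (intro add_nonneg_pos mult_pos_pos mult_nonneg_nonneg) auto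
      qed
      then show "b\<^sup>2 * q f f - 2 * (a\<^sup>2 * R U U + 2 * a * b * R U f + b\<^sup>2 * R f f) < 0"
        unfolding qff RUf by (simp add: algebra_simps)
    qed
    then show False using R_orth_multiple RUf \<open>f \<noteq> 0\<close> by blast
  qed
qed

text \<open>\<open>U\<close> already uses up the single negative direction of
  \<open>q - 2 R\<close>, and an \<open>R\<close>-orthogonal second one would give a negative plane.
  Smaller \<open>\<mu>\<close> follow from \<open>R \<ge> 0\<close>.\<close>

lemma nonneg_on_complement:
  assumes f: "f \<in> V" and RUf: "R U f = 0" and \<mu>: "\<mu> \<le> 1"
  shows "0 \<le> q f f - 2 * \<mu> * R f f"
proof -
  have "0 \<le> q f f - 2 * R f f"
  proof (rule ccontr)
    assume "\<not> 0 \<le> q f f - 2 * R f f"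
    then have neg: "q f f - 2 * R f f < 0" by simp
    obtain t where t: "f = t *\<^sub>R U"
    proof (rule multiple_of_U[OF f])
      fix a b assume nz: "a *\<^sub>R U + b *\<^sub>R f \<noteq> 0"
      have "b\<^sup>2 * (q f f - 2 * R f f) - 2 * (a\<^sup>2 * R U U) < 0"
      proof (cases "b = 0")
        case True
        then show ?thesis using nz R_pos[OF U] by simp
      next
        case False
        then have "b\<^sup>2 * (q f f - 2 * R f f) < 0" using neg by (simp add: mult_pos_neg)
        moreover have "0 \<le> a\<^sup>2 * R U U" using R_pos[OF U] by simp
        ultimately show ?thesis by linarith
      qed
      then show "b\<^sup>2 * q f f - 2 * (a\<^sup>2 * R U U + 2 * a * b * R U f + b\<^sup>2 * R f f) < 0"
        unfolding RUf by (simp add: algebra_simps)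
    qed
    have "f = 0" by (rule R_orth_multiple[OF t RUf])
    then show False using neg zero_left[OF V_zero] by simp
  qed
  moreover have "\<mu> * R f f \<le> 1 * R f f" by (intro mult_right_mono \<mu> R_nonneg f)
  ultimately show ?thesis by simp
qed

end

section \<open>Symmetric matrices\<close>

text \<open>Indexed by the coordinate type itself: the vectors are the rows of an orthogonal matrix,
  and multiplicities are counted by indices.\<close>

definition eigenbasis :: "real^'n^'n \<Rightarrow> ('n \<Rightarrow> real^'n) \<Rightarrow> ('n \<Rightarrow> real) \<Rightarrow> bool" where
  "eigenbasis A e \<mu> \<longleftrightarrow> (\<forall>k l. e k \<bullet> e l = (if k = l then 1 else 0)) \<and> (\<forall>k. A *v e k = \<mu> k *\<^sub>R e k)"

lemma symmetric_matrix_inner: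
  fixes A :: "real^'n^'n"
  assumes "\<forall>i j. A $ i $ j = A $ j $ i"
  shows "(A *v x) \<bullet> y = x \<bullet> (A *v y)"
proof -
  have "transpose A = A" using assms by (simp add: transpose_def vec_eq_iff)
  then have "A *v x = x v* A" by (metis transpose_matrix_vector)
  then show ?thesis by (simp add: dot_lmul_matrix)
qed

text \<open>A maximizer of the Rayleigh quotient on an invariant subspace is an eigenvector.\<close>

lemma symmetric_invariant_eigenvector:
  fixes A :: "real^'n^'n"
  assumes sym: "\<forall>i j. A $ i $ j = A $ j $ i" and S: "subspace S" and inv: "\<And>x. x \<in> S \<Longrightarrow> A *v x \<in> S"
    and nz: "S \<noteq> {0}"
  obtains e r where "e \<in> S" "norm e = 1" "A *v e = r *\<^sub>R e"
proof -
  note sa = symmetric_matrix_inner[OF sym]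
  obtain x where x: "x \<in> S" "x \<noteq> 0" using nz subspace_0[OF S] by blast
  then have ne: "(1 / norm x) *\<^sub>R x \<in> S \<inter> sphere 0 1" using S by (simp add: subspace_scale)
  have "compact (S \<inter> sphere 0 1)"
    using closed_subspace[OF S] by (intro closed_Int_compact) auto
  moreover have "continuous_on (S \<inter> sphere 0 1) (\<lambda>x. x \<bullet> (A *v x))"
    by (intro continuous_intros matrix_vector_mult_linear_continuous_on)
  moreover have "S \<inter> sphere 0 1 \<noteq> {}" using ne by blast
  ultimately have "\<exists>e\<in>S \<inter> sphere 0 1. \<forall>y\<in>S \<inter> sphere 0 1. y \<bullet> (A *v y) \<le> e \<bullet> (A *v e)"
    by (intro continuous_attains_sup)
  then obtain e where "e \<in> S \<inter> sphere 0 1" "\<forall>y\<in>S \<inter> sphere 0 1. y \<bullet> (A *v y) \<le> e \<bullet> (A *v e)" by blast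
  then have e: "e \<in> S" "norm e = 1" "\<And>y. y \<in> S \<Longrightarrow> norm y = 1 \<Longrightarrow> y \<bullet> (A *v y) \<le> e \<bullet> (A *v e)"
    by auto
  define r where "r = e \<bullet> (A *v e)"
  have le: "y \<bullet> (A *v y) \<le> r * (y \<bullet> y)" if "y \<in> S" for y
  proof (cases "y = 0")
    case False
    let ?z = "(1 / norm y) *\<^sub>R y"
    have "?z \<bullet> (A *v ?z) \<le> r"
      unfolding r_def using that S False by (intro e(3)) (auto simp: subspace_scale)
    then have "(y \<bullet> (A *v y)) / (norm y)\<^sup>2 \<le> r"
      by (simp add: matrix_vector_mult_scaleR power2_eq_square)
    then show ?thesis using False by (simp add: field_simps power2_norm_eq_inner)
  qed simp
  have "r *\<^sub>R e - A *v e = 0"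
  proof -
    define y where "y = r *\<^sub>R e - A *v e"
    have y: "y \<in> S" unfolding y_def using S e(1) inv by (simp add: subspace_diff subspace_scale)
    \<comment> \<open>The Rayleigh inequality along \<open>e + t *\<^sub>R y\<close> is a
      nonnegative quadratic in \<open>t\<close> with constant term 0; its linear coefficient is the
      squared length of the residual \<open>y\<close>.\<close>
    have "((r *\<^sub>R e - A *v e) \<bullet> y)\<^sup>2 \<le> 0 * (r * (y \<bullet> y) - y \<bullet> (A *v y))"
    proof (rule quadratic_nonneg_discriminant)
      fix t :: real
      have "e + t *\<^sub>R y \<in> S" using S e(1) y by (simp add: subspace_add subspace_scale)
      from le[OF this] have "0 \<le> r * ((e + t *\<^sub>R y) \<bullet> (e + t *\<^sub>R y)) - (e + t *\<^sub>R y) \<bullet> (A *v (e + t *\<^sub>R y))" by simp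
      moreover have "e \<bullet> e = 1" using e(2) by (simp add: norm_eq_1)
      moreover have "e \<bullet> (A *v y) = y \<bullet> (A *v e)" using sa[of e y] by (simp add: inner_commute)
      ultimately show "0 \<le> 0 + 2 * t * ((r *\<^sub>R e - A *v e) \<bullet> y) + t\<^sup>2 * (r * (y \<bullet> y) - y \<bullet> (A *v y))"
        by (simp add: matrix_vector_right_distrib matrix_vector_mult_scaleR inner_add_left inner_add_right
            inner_diff_left inner_commute r_def[symmetric] power2_eq_square algebra_simps)
    qed (use le[OF y] in simp)
    then have "y \<bullet> y = 0" by (simp add: y_def[symmetric])
    then show ?thesis by (simp add: y_def)
  qed
  then show thesis using that[of e r] e by simp
qed

text \<open>Spectral theorem by induction on the dimension: symmetry makes the orthogonal complement
  of an eigenvector inside \<open>S\<close> invariant again.\<close>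

lemma symmetric_orthonormal_eigenvectors:
  fixes A :: "real^'n^'n"
  assumes sym: "\<forall>i j. A $ i $ j = A $ j $ i"
  shows "subspace S \<Longrightarrow> (\<And>x. x \<in> S \<Longrightarrow> A *v x \<in> S) \<Longrightarrow>
    \<exists>B. finite B \<and> pairwise orthogonal B \<and> (\<forall>b\<in>B. norm b = 1 \<and> (\<exists>r. A *v b = r *\<^sub>R b)) \<and> span B = S"
proof (induction "dim S" arbitrary: S rule: less_induct)
  case less
  note sa = symmetric_matrix_inner[OF sym]
  show ?case
  proof (cases "S = {0}")
    case True
    then show ?thesis by (intro exI[of _ "{}"]) auto
  next
    case False
    obtain e r where e: "e \<in> S" "norm e = 1" "A *v e = r *\<^sub>R e"
      using symmetric_invariant_eigenvector[OF sym less.prems False] by metis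
    define S' where "S' = {x \<in> S. x \<bullet> e = 0}"
    have S': "subspace S'"
      using less.prems(1) by (auto simp: S'_def subspace_def inner_add_left)
    have inv: "A *v x \<in> S'" if "x \<in> S'" for x
      using that less.prems(2) sa[of x e] e(3) by (auto simp: S'_def)
    have "e \<notin> S'" using e(2) by (auto simp: S'_def norm_eq_1)
    moreover have "S' \<subseteq> S" by (auto simp: S'_def)
    ultimately have "S' \<subset> S" using e(1) by blast
    then have "dim S' < dim S"
      using S' less.prems(1) by (intro dim_psubset) (simp add: span_eq_iff[THEN iffD2])
    from less.hyps[OF this S' inv] obtain B where B: "finite B" "pairwise orthogonal B"
      "\<forall>b\<in>B. norm b = 1 \<and> (\<exists>r. A *v b = r *\<^sub>R b)" "span B = S'" by blast
    have orth: "b \<bullet> e = 0" if "b \<in> B" for b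
      using span_base[OF that] B(4) by (auto simp: S'_def)
    have "span (insert e B) = S"
    proof
      show "span (insert e B) \<subseteq> S"
        using e(1) span_base B(4) less.prems(1) by (intro span_minimal) (auto simp: S'_def)
      show "S \<subseteq> span (insert e B)"
      proof
        fix x assume x: "x \<in> S"
        have "e \<bullet> e = 1" using e(2) by (simp add: norm_eq_1)
        then have "x - (x \<bullet> e) *\<^sub>R e \<in> S'"
          using x e(1) less.prems(1) by (simp add: S'_def subspace_diff subspace_scale inner_diff_left)
        then show "x \<in> span (insert e B)" using B(4) by (auto simp: span_breakdown_eq)
      qed
    qed
    moreover have "pairwise orthogonal (insert e B)"
      using B(2) orth by (auto simp: pairwise_insert orthogonal_def inner_commute)
    ultimately show ?thesis
      using B e by (intro exI[of _ "insert e B"]) auto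
  qed
qed

lemma eigenbasis_exists:
  fixes A :: "real^'n^'n"
  assumes sym: "\<forall>i j. A $ i $ j = A $ j $ i"
  obtains e \<mu> where "eigenbasis A e \<mu>"
proof -
  obtain B where B: "finite B" "pairwise orthogonal B" "\<forall>b\<in>B. norm b = 1 \<and> (\<exists>r. A *v b = r *\<^sub>R b)" "span B = UNIV"
    using symmetric_orthonormal_eigenvectors[OF sym, of UNIV] by auto
  have "independent B" using B by (intro pairwise_orthogonal_independent) auto
  then have "card B = CARD('n)" using dim_span_eq_card_independent[of B] B(4) by simp
  then obtain e where e: "bij_betw e (UNIV :: 'n set) B"
    using finite_same_card_bij[of "UNIV :: 'n set" B] B(1) by auto
  have eB: "e k \<in> B" for k using e by (auto simp: bij_betw_def)
  have "\<forall>k. \<exists>r. A *v e k = r *\<^sub>R e k" using B(3) eB by blast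
  then obtain \<mu> where \<mu>: "\<And>k. A *v e k = \<mu> k *\<^sub>R e k" by metis
  have "e k \<bullet> e l = (if k = l then 1 else 0)" for k l
  proof (cases "k = l")
    case True
    then show ?thesis using B(3) eB by (simp add: norm_eq_1[symmetric])
  next
    case False
    then have "e k \<noteq> e l" using e by (auto simp: bij_betw_def inj_on_def)
    then show ?thesis using B(2) eB False by (auto simp: pairwise_def orthogonal_def)
  qed
  then have "eigenbasis A e \<mu>" using \<mu> by (simp add: eigenbasis_def)
  then show thesis by (rule that)
qed

section \<open>Expansion in an eigenbasis and counting of eigenvalues\<close>

context
  fixes A :: "real^'n^'n" and e :: "'n \<Rightarrow> real^'n" and \<mu> :: "'n \<Rightarrow> real"
  assumes eb: "eigenbasis A e \<mu>"
begin

lemma eigenbasis_eq: "A *v e k = \<mu> k *\<^sub>R e k"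
  using eb by (simp add: eigenbasis_def)

lemma eigenbasis_inner: "e k \<bullet> e l = (if k = l then 1 else 0)"
  using eb by (simp add: eigenbasis_def)

text \<open>A square matrix with orthonormal rows also has orthonormal columns.\<close>

lemma eigenbasis_complete: "(\<Sum>k\<in>UNIV. e k $ i * e k $ j) = (if i = j then 1 else 0)"
proof -
  define E where "E = (\<chi> k. e k)"
  have "E ** transpose E = mat 1"
    using eigenbasis_inner by (simp add: E_def matrix_matrix_mult_def transpose_def mat_def vec_eq_iff inner_vec_def)
  then have "transpose E ** E = mat 1" by (simp add: matrix_left_right_inverse)
  then have "(transpose E ** E) $ i $ j = (mat 1 :: real^'n^'n) $ i $ j" by simp
  then show ?thesis by (simp add: E_def matrix_matrix_mult_def transpose_def mat_def)
qed

lemma eigenbasis_expand: "x = (\<Sum>k\<in>UNIV. (e k \<bullet> x) *\<^sub>R e k)"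
proof (rule vec_eq_iff[THEN iffD2], rule allI)
  fix i
  have "(\<Sum>k\<in>UNIV. (e k \<bullet> x) *\<^sub>R e k) $ i = (\<Sum>k\<in>UNIV. \<Sum>j\<in>UNIV. (e k $ i * e k $ j) * x $ j)"
    by (simp add: sum_component inner_vec_def sum_distrib_right sum_distrib_left mult_ac)
  also have "\<dots> = (\<Sum>j\<in>UNIV. (\<Sum>k\<in>UNIV. e k $ i * e k $ j) * x $ j)"
    by (subst sum.swap) (simp add: sum_distrib_right)
  also have "\<dots> = x $ i" by (simp add: eigenbasis_complete if_distrib[of "\<lambda>z. z * _"] cong: if_cong)
  finally show "x $ i = (\<Sum>k\<in>UNIV. (e k \<bullet> x) *\<^sub>R e k) $ i" by simp
qed

lemma eigenbasis_entry: "A $ i $ j = (\<Sum>k\<in>UNIV. \<mu> k * (e k $ i * e k $ j))"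
proof -
  have "(\<Sum>k\<in>UNIV. \<mu> k * (e k $ i * e k $ j)) = (\<Sum>k\<in>UNIV. (A *v e k) $ i * e k $ j)"
    by (simp add: eigenbasis_eq mult.assoc)
  also have "\<dots> = (\<Sum>k\<in>UNIV. \<Sum>l\<in>UNIV. A $ i $ l * (e k $ l * e k $ j))"
    by (simp add: matrix_vector_mult_def sum_distrib_right mult.assoc)
  also have "\<dots> = (\<Sum>l\<in>UNIV. A $ i $ l * (\<Sum>k\<in>UNIV. e k $ l * e k $ j))"
    by (subst sum.swap) (simp add: sum_distrib_left)
  also have "\<dots> = A $ i $ j" by (simp add: eigenbasis_complete if_distrib cong: if_cong)
  finally show ?thesis by simp
qed

lemma eigenbasis_apply: "A *v x = (\<Sum>k\<in>UNIV. (\<mu> k * (e k \<bullet> x)) *\<^sub>R e k)"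
proof -
  have "A *v x = A *v (\<Sum>k\<in>UNIV. (e k \<bullet> x) *\<^sub>R e k)" using eigenbasis_expand[of x] by simp
  also have "\<dots> = (\<Sum>k\<in>UNIV. A *v ((e k \<bullet> x) *\<^sub>R e k))"
    by (rule linear_sum[OF matrix_vector_mul_linear])
  finally show ?thesis by (simp add: matrix_vector_mult_scaleR eigenbasis_eq mult.commute)
qed

lemma eigenbasis_quadratic: "x \<bullet> (A *v x) = (\<Sum>k\<in>UNIV. \<mu> k * (e k \<bullet> x)\<^sup>2)"
  unfolding eigenbasis_apply by (simp add: inner_sum_right inner_commute power2_eq_square mult.assoc)

lemma eigenbasis_inj: "inj e"
  using eigenbasis_inner by (metis injI zero_neq_one)

lemma eigenbasis_independent: "independent (e ` K)"
proof (rule pairwise_orthogonal_independent)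
  show "pairwise orthogonal (e ` K)" using eigenbasis_inner by (auto simp: pairwise_def orthogonal_def)
  show "0 \<notin> e ` K"
    using eigenbasis_inner by (metis imageE inner_zero_left zero_neq_one)
qed

lemma eigenvector_coefficient: "A *v v = r *\<^sub>R v \<Longrightarrow> e k \<bullet> v \<noteq> 0 \<Longrightarrow> \<mu> k = r"
proof -
  assume v: "A *v v = r *\<^sub>R v" and nz: "e k \<bullet> v \<noteq> 0"
  have "e k \<bullet> (A *v v) = \<mu> k * (e k \<bullet> v)"
    unfolding eigenbasis_apply by (simp add: inner_sum_right eigenbasis_inner if_distrib cong: if_cong)
  then show "\<mu> k = r" using v nz by simp
qed

lemma eigenspace_eq: "{v. A *v v = r *\<^sub>R v} = span (e ` {k. \<mu> k = r})"
proof
  have "subspace {v. A *v v = r *\<^sub>R v}"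
    by (auto simp: subspace_def matrix_vector_right_distrib matrix_vector_mult_scaleR scaleR_add_right)
  then show "span (e ` {k. \<mu> k = r}) \<subseteq> {v. A *v v = r *\<^sub>R v}"
    by (intro span_minimal) (auto simp: eigenbasis_eq)
  show "{v. A *v v = r *\<^sub>R v} \<subseteq> span (e ` {k. \<mu> k = r})"
  proof
    fix v assume "v \<in> {v. A *v v = r *\<^sub>R v}"
    then have v: "A *v v = r *\<^sub>R v" by simp
    have "(\<Sum>k\<in>UNIV. (e k \<bullet> v) *\<^sub>R e k) \<in> span (e ` {k. \<mu> k = r})"
    proof (intro span_sum)
      fix k show "(e k \<bullet> v) *\<^sub>R e k \<in> span (e ` {k. \<mu> k = r})"
        using eigenvector_coefficient[OF v, of k]
        by (cases "e k \<bullet> v = 0") (simp add: span_zero, intro span_scale span_base, auto)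
    qed
    then show "v \<in> span (e ` {k. \<mu> k = r})" using eigenbasis_expand[of v] by simp
  qed
qed

text \<open>The dimension of an eigenspace is the number of indices carrying that eigenvalue, so
  summing over distinct eigenvalues counts indices fibre by fibre.\<close>

lemma num_pos_eigenvalues_eq: "num_pos_eigenvalues A = card {k. \<mu> k > 0}"
proof -
  have set: "{r. r > 0 \<and> (\<exists>v. v \<noteq> 0 \<and> A *v v = r *\<^sub>R v)} = \<mu> ` {k. \<mu> k > 0}"
  proof safe
    fix r :: real and v assume "0 < r" "v \<noteq> 0" "A *v v = r *\<^sub>R v"
    moreover obtain k where "e k \<bullet> v \<noteq> 0"
      using eigenbasis_expand[of v] \<open>v \<noteq> 0\<close> by (metis (no_types, lifting) scaleR_zero_left sum.neutral)
    ultimately show "r \<in> \<mu> ` {k. \<mu> k > 0}" using eigenvector_coefficient by blast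
  next
    fix k assume "\<mu> k > 0"
    have "e k \<noteq> 0" using eigenbasis_inner[of k k] by auto
    then show "\<exists>v. v \<noteq> 0 \<and> A *v v = \<mu> k *\<^sub>R v" using eigenbasis_eq by blast
  qed
  have "num_pos_eigenvalues A = (\<Sum>r\<in>\<mu> ` {k. \<mu> k > 0}. card {k. \<mu> k = r})"
    unfolding num_pos_eigenvalues_def set eigenspace_eq
    by (intro sum.cong refl)
       (simp add: dim_eq_card_independent[OF eigenbasis_independent] card_image inj_on_subset[OF eigenbasis_inj])
  also have "\<dots> = (\<Sum>r\<in>\<mu> ` {k. \<mu> k > 0}. \<Sum>k\<in>{k \<in> {k. \<mu> k > 0}. \<mu> k = r}. 1)"
    by (intro sum.cong refl) (auto intro!: arg_cong[where f=card])
  also have "\<dots> = (\<Sum>k\<in>{k. \<mu> k > 0}. 1)"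
    by (rule sum.image_gen[symmetric]) simp
  finally show ?thesis by simp
qed

end

text \<open>\<open>L\<close> maps \<open>span B\<close> injectively into the coordinate subspace
  belonging to \<open>K\<close>. Linearity is asked on \<open>span B\<close> only, because the
  functionals used later are linear only on the function space.\<close>

lemma independent_card_le_of_functionals:
  fixes L :: "'v::real_vector \<Rightarrow> real^'n"
  assumes B: "finite B" "independent B"
    and lin: "\<And>x y r. x \<in> span B \<Longrightarrow> y \<in> span B \<Longrightarrow> L (x + r *\<^sub>R y) = L x + r *\<^sub>R L y"
    and inj: "\<And>x. x \<in> span B \<Longrightarrow> L x = 0 \<Longrightarrow> x = 0"
    and supp: "\<And>x k. k \<notin> K \<Longrightarrow> L x $ k = 0"
  shows "card B \<le> card K"
proof -
  \<comment> \<open>A globally linear map that agrees with \<open>L\<close> on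
    \<open>span B\<close>, as the theorems on linear images require one.\<close>
  obtain g where g: "linear g" "\<forall>x\<in>B. g x = L x" using linear_independent_extend[OF B(2), of L] by blast
  have L0: "L 0 = 0" using lin[OF span_zero span_zero, of 1] by simp
  have "x \<in> span B \<and> g x = L x" if "x \<in> span B" for x
    using that
  proof (induction rule: span_induct_alt)
    case base
    then show ?case using L0 g(1) by (simp add: linear_0 span_zero)
  next
    case (step c x y)
    then have y: "y \<in> span B" and x: "x \<in> span B" by (auto intro: span_base)
    have "L (y + c *\<^sub>R x) = L y + c *\<^sub>R L x" by (rule lin[OF y x])
    then show ?case using step g span_add[OF span_scale[OF x, of c] y]
      by (simp add: linear_add linear_scale add.commute)
  qed
  then have gL: "g x = L x" if "x \<in> span B" for x using that by blast
  have "inj_on g (span B)"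
  proof (rule inj_onI)
    fix x y assume xy: "x \<in> span B" "y \<in> span B" "g x = g y"
    then have "g (x - y) = 0" using g(1) by (simp add: linear_diff)
    then have "x - y = 0" using xy inj[of "x - y"] gL[of "x - y"] by (simp add: span_diff)
    then show "x = y" by simp
  qed
  then have ind: "independent (g ` B)" and card: "card (g ` B) = card B"
    using linear_independent_injective_image[OF g(1) B(2)] card_image inj_on_subset[OF _ span_superset] by auto
  have "g ` B \<subseteq> span ((\<lambda>k. axis k 1) ` K)"
  proof
    fix y assume "y \<in> g ` B"
    then obtain x where x: "x \<in> B" "y = g x" by blast
    have "g x = (\<Sum>k\<in>K. (L x $ k) *\<^sub>R axis k 1)"
      using g(2) x(1) supp by (auto simp: vec_eq_iff axis_def if_distrib cong: if_cong)
    also have "\<dots> \<in> span ((\<lambda>k. axis k 1) ` K)" by (intro span_sum span_scale span_base) auto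
    finally show "y \<in> span ((\<lambda>k. axis k 1) ` K)" using x by simp
  qed
  from independent_span_bound[OF finite_imageI[OF finite] ind this]
  have "card (g ` B) \<le> card ((\<lambda>k. axis k (1::real)) ` K)" by simp
  also have "\<dots> \<le> card K" by (rule card_image_le) simp
  finally show ?thesis by (simp add: card)
qed

text \<open>One half of Sylvester's law: a vector without coordinates along the positive
  eigenvectors has a nonpositive quadratic form.\<close>

lemma positive_subspace_card_le:
  fixes A :: "real^'n^'n"
  assumes eb: "eigenbasis A e \<mu>" and B: "finite B" "independent B"
    and pos: "\<And>x. x \<in> span B \<Longrightarrow> x \<noteq> 0 \<Longrightarrow> x \<bullet> (A *v x) > 0"
  shows "card B \<le> card {k. \<mu> k > 0}"
proof (rule independent_card_le_of_functionals[OF B, where L="\<lambda>x. \<chi> k. if \<mu> k > 0 then e k \<bullet> x else 0"])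
  fix x assume x: "x \<in> span B" "(\<chi> k. if \<mu> k > 0 then e k \<bullet> x else 0) = 0"
  have "\<mu> k * (e k \<bullet> x)\<^sup>2 \<le> 0" for k
    using x(2) by (cases "\<mu> k > 0") (auto simp: vec_eq_iff mult_nonpos_nonneg split: if_splits)
  then have "x \<bullet> (A *v x) \<le> 0" unfolding eigenbasis_quadratic[OF eb] by (intro sum_nonpos) auto
  then show "x = 0" using pos[OF x(1)] by force
qed (auto simp: vec_eq_iff inner_add_right)

section \<open>The linearized system\<close>

locale linearized_system = index_one V q R U
  for V :: "'v::real_vector set" and q R U +
  fixes A :: "real^'n^'n" and c :: "real^'n"
  assumes A_sym: "\<forall>i j. A $ i $ j = A $ j $ i" and A_nonneg: "\<forall>i j. A $ i $ j \<ge> 0"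
    and c_pos: "\<And>i. c $ i > 0" and Ac: "\<And>i. (\<Sum>j\<in>UNIV. A $ i $ j * (c $ j)\<^sup>2) = 1"
begin

definition VV :: "('v^'n) set" where "VV = {\<phi>. \<forall>i. \<phi> $ i \<in> V}"

text \<open>The abstract second variation of the energy at \<open>c \<odot> U\<close>; the
  identification is \<open>second_variation_eq\<close>.\<close>

definition B :: "'v^'n \<Rightarrow> 'v^'n \<Rightarrow> real" where
  "B \<phi> \<psi> = (\<Sum>i\<in>UNIV. q (\<phi> $ i) (\<psi> $ i)) - 2 * (\<Sum>i\<in>UNIV. \<Sum>j\<in>UNIV. A $ i $ j * c $ i * c $ j * R (\<phi> $ i) (\<psi> $ j))"

definition kernel :: "('v^'n) set" where
  "kernel = {\<phi> \<in> VV. \<forall>\<psi>\<in>VV. B \<phi> \<psi> = 0}"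

text \<open>The kernel of the form with \<open>s = 3\<close>, in the application the solutions of
  the linearized scalar equation (\<open>N_eq\<close>).\<close>

definition N :: "'v set" where "N = {\<psi> \<in> V. \<forall>g\<in>V. q \<psi> g - 2 * R \<psi> g = 0}"

definition Mat :: "real^'n^'n" where "Mat = (\<chi> i j. A $ i $ j * c $ i * c $ j)"

lemma sum_mem: "(\<And>i. i \<in> I \<Longrightarrow> x i \<in> V) \<Longrightarrow> (\<Sum>i\<in>I. a i *\<^sub>R x i) \<in> V"
  using V by (intro subspace_sum V_scale) auto

lemma sum_left:
  assumes "finite I" "\<And>i. i \<in> I \<Longrightarrow> x i \<in> V" "w \<in> V"
  shows "q (\<Sum>i\<in>I. a i *\<^sub>R x i) w = (\<Sum>i\<in>I. a i * q (x i) w)"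
    "R (\<Sum>i\<in>I. a i *\<^sub>R x i) w = (\<Sum>i\<in>I. a i * R (x i) w)"
proof -
  have "q (\<Sum>i\<in>I. a i *\<^sub>R x i) w = (\<Sum>i\<in>I. a i * q (x i) w) \<and> R (\<Sum>i\<in>I. a i *\<^sub>R x i) w = (\<Sum>i\<in>I. a i * R (x i) w)"
    using assms(1,2)
  proof (induction I rule: finite_induct)
    case empty
    then show ?case using zero_left[OF assms(3)] by simp
  next
    case (insert i I)
    have s: "(\<Sum>i\<in>I. a i *\<^sub>R x i) \<in> V" using insert.prems by (intro sum_mem) auto
    show ?case
      using insert q_lin[OF s _ assms(3), of "x i" "a i"] R_lin[OF s _ assms(3), of "x i" "a i"]
      by (simp add: add.commute)
  qed
  then show "q (\<Sum>i\<in>I. a i *\<^sub>R x i) w = (\<Sum>i\<in>I. a i * q (x i) w)"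
    "R (\<Sum>i\<in>I. a i *\<^sub>R x i) w = (\<Sum>i\<in>I. a i * R (x i) w)" by auto
qed

lemma sum_right:
  assumes "finite I" "\<And>i. i \<in> I \<Longrightarrow> x i \<in> V" "w \<in> V"
  shows "q w (\<Sum>i\<in>I. a i *\<^sub>R x i) = (\<Sum>i\<in>I. a i * q w (x i))"
    "R w (\<Sum>i\<in>I. a i *\<^sub>R x i) = (\<Sum>i\<in>I. a i * R w (x i))"
proof -
  have s: "(\<Sum>i\<in>I. a i *\<^sub>R x i) \<in> V" using assms by (intro sum_mem) auto
  show "q w (\<Sum>i\<in>I. a i *\<^sub>R x i) = (\<Sum>i\<in>I. a i * q w (x i))"
    using sum_left(1)[OF assms, where a=a] q_sym[OF assms(3) s] q_sym[OF assms(3,2)] by simp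
  show "R w (\<Sum>i\<in>I. a i *\<^sub>R x i) = (\<Sum>i\<in>I. a i * R w (x i))"
    using sum_left(2)[OF assms, where a=a] R_sym[OF assms(3) s] R_sym[OF assms(3,2)] by simp
qed

lemma scale_left: "x \<in> V \<Longrightarrow> w \<in> V \<Longrightarrow> q (a *\<^sub>R x) w = a * q x w" "x \<in> V \<Longrightarrow> w \<in> V \<Longrightarrow> R (a *\<^sub>R x) w = a * R x w"
  using sum_left[of "{()}" "\<lambda>_. x" w "\<lambda>_. a"] by auto

lemma scale_right: "x \<in> V \<Longrightarrow> w \<in> V \<Longrightarrow> q w (a *\<^sub>R x) = a * q w x" "x \<in> V \<Longrightarrow> w \<in> V \<Longrightarrow> R w (a *\<^sub>R x) = a * R w x"
  using sum_right[of "{()}" "\<lambda>_. x" w "\<lambda>_. a"] by auto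

lemma Mat_sym: "\<forall>i j. Mat $ i $ j = Mat $ j $ i"
  using A_sym by (simp add: Mat_def mult_ac)

lemma Mat_apply: "(Mat *v x) $ i = c $ i * (A *v (\<chi> j. c $ j * x $ j)) $ i"
  by (simp add: Mat_def matrix_vector_mult_def sum_distrib_left mult_ac)

lemma Mat_zero_iff: "Mat *v x = 0 \<longleftrightarrow> A *v (\<chi> j. c $ j * x $ j) = 0"
  using c_pos by (simp add: vec_eq_iff Mat_apply less_imp_neq[symmetric])

lemma Mat_c: "Mat *v c = c"
proof (rule vec_eq_iff[THEN iffD2], rule allI)
  show "(Mat *v c) $ i = c $ i" for i
    unfolding Mat_apply using Ac[of i] by (simp add: matrix_vector_mult_def power2_eq_square)
qed

lemma Mat_quadratic_A: "x \<bullet> (Mat *v x) = (\<chi> j. c $ j * x $ j) \<bullet> (A *v (\<chi> j. c $ j * x $ j))"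
  by (simp add: inner_vec_def Mat_apply mult_ac)

text \<open>Perron--Frobenius for the positive eigenvector \<open>c\<close>, by completing squares.\<close>

lemma Mat_quadratic:
  "(\<Sum>i\<in>UNIV. \<Sum>j\<in>UNIV. Mat $ i $ j * c $ i * c $ j * (x $ i / c $ i - x $ j / c $ j)\<^sup>2) = 2 * (x \<bullet> x - x \<bullet> (Mat *v x))"
proof -
  have c: "c $ i \<noteq> 0" for i using c_pos[of i] by simp
  \<comment> \<open>This identity turns each of the two square terms of the expansion into
    \<open>x \<bullet> x\<close>.\<close>
  have row: "(\<Sum>j\<in>UNIV. Mat $ i $ j * c $ j) = c $ i" for i
    using arg_cong[OF Mat_c, of "\<lambda>v. v $ i"] by (simp add: matrix_vector_mult_def)
  have "Mat $ i $ j * c $ i * c $ j * (x $ i / c $ i - x $ j / c $ j)\<^sup>2 =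
    (x $ i)\<^sup>2 / c $ i * (Mat $ i $ j * c $ j) + (x $ j)\<^sup>2 / c $ j * (Mat $ j $ i * c $ i) - 2 * (x $ i * (Mat $ i $ j * x $ j))" for i j
    using c[of i] c[of j] Mat_sym by (simp add: field_simps power2_eq_square)
  then have "(\<Sum>i\<in>UNIV. \<Sum>j\<in>UNIV. Mat $ i $ j * c $ i * c $ j * (x $ i / c $ i - x $ j / c $ j)\<^sup>2) =
    (\<Sum>i\<in>UNIV. \<Sum>j\<in>UNIV. (x $ i)\<^sup>2 / c $ i * (Mat $ i $ j * c $ j)) +
    (\<Sum>i\<in>UNIV. \<Sum>j\<in>UNIV. (x $ j)\<^sup>2 / c $ j * (Mat $ j $ i * c $ i)) - 2 * (\<Sum>i\<in>UNIV. \<Sum>j\<in>UNIV. x $ i * (Mat $ i $ j * x $ j))"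
    by (simp add: sum.distrib sum_subtractf sum_distrib_left)
  also have "(\<Sum>i\<in>UNIV. \<Sum>j\<in>UNIV. (x $ i)\<^sup>2 / c $ i * (Mat $ i $ j * c $ j)) = x \<bullet> x"
    unfolding sum_distrib_left[symmetric] row using c by (simp add: inner_vec_def power2_eq_square)
  also have "(\<Sum>i\<in>UNIV. \<Sum>j\<in>UNIV. (x $ j)\<^sup>2 / c $ j * (Mat $ j $ i * c $ i)) = x \<bullet> x"
    by (subst sum.swap) (unfold sum_distrib_left[symmetric] row, use c in \<open>simp add: inner_vec_def power2_eq_square\<close>)
  also have "(\<Sum>i\<in>UNIV. \<Sum>j\<in>UNIV. x $ i * (Mat $ i $ j * x $ j)) = x \<bullet> (Mat *v x)"
    by (simp add: inner_vec_def matrix_vector_mult_def sum_distrib_left)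
  finally show ?thesis by simp
qed

lemma Mat_nonneg: "0 \<le> Mat $ i $ j * c $ i * c $ j"
  using A_nonneg c_pos[THEN less_imp_le] by (auto simp: Mat_def intro!: mult_nonneg_nonneg)

lemma eigenvalue_le_1:
  assumes "Mat *v x = r *\<^sub>R x" "x \<noteq> 0" shows "r \<le> 1"
proof -
  have "0 \<le> 2 * (x \<bullet> x - x \<bullet> (Mat *v x))"
    unfolding Mat_quadratic[symmetric]
    by (intro sum_nonneg mult_nonneg_nonneg[OF Mat_nonneg zero_le_power2])
  then have "r * (x \<bullet> x) \<le> 1 * (x \<bullet> x)" using assms(1) by simp
  then show ?thesis using assms(2) by (simp add: mult_le_cancel_right)
qed

text \<open>For the eigenvalue 1 the sum of squares is zero and its weights are positive, so all
  ratios \<open>x $ i / c $ i\<close> coincide.\<close>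

lemma eigenvalue_1_multiple:
  assumes "Mat *v x = x" and pos: "\<forall>i j. A $ i $ j > 0"
  obtains s where "x = s *\<^sub>R c"
proof -
  have "(\<Sum>i\<in>UNIV. \<Sum>j\<in>UNIV. Mat $ i $ j * c $ i * c $ j * (x $ i / c $ i - x $ j / c $ j)\<^sup>2) = 0"
    unfolding Mat_quadratic using assms(1) by simp
  then have "Mat $ i $ j * c $ i * c $ j * (x $ i / c $ i - x $ j / c $ j)\<^sup>2 = 0" for i j
    using Mat_nonneg by (simp add: sum_nonneg_eq_0_iff sum_nonneg)
  moreover have "Mat $ i $ j * c $ i * c $ j > 0" for i j
    using pos c_pos by (simp add: Mat_def)
  ultimately have eq: "x $ i / c $ i = x $ j / c $ j" for i j
    by (metis less_irrefl mult_eq_0_iff power2_eq_square eq_iff_diff_eq_0)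
  \<comment> \<open>\<open>undefined\<close> is just a fixed reference index.\<close>
  have "x = (x $ undefined / c $ undefined) *\<^sub>R c"
  proof (rule vec_eq_iff[THEN iffD2], rule allI)
    fix i
    have "x $ i = (x $ i / c $ i) * c $ i" using c_pos[of i] by simp
    then show "x $ i = ((x $ undefined / c $ undefined) *\<^sub>R c) $ i" using eq[of i undefined] by simp
  qed
  then show thesis by (rule that)
qed

section \<open>Diagonalization of the linearized system\<close>

context
  fixes e :: "'n \<Rightarrow> real^'n" and \<mu> :: "'n \<Rightarrow> real"
  assumes eb: "eigenbasis Mat e \<mu>"
begin

text \<open>The orthogonal change of unknowns that decouples the system.\<close>

definition comp :: "'n \<Rightarrow> 'v^'n \<Rightarrow> 'v" where "comp k \<phi> = (\<Sum>i\<in>UNIV. (e k $ i) *\<^sub>R (\<phi> $ i))"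

lemma comp_V: "\<phi> \<in> VV \<Longrightarrow> comp k \<phi> \<in> V"
  unfolding comp_def by (intro sum_mem) (simp add: VV_def)

lemma \<mu>_le_1: "\<mu> k \<le> 1"
proof -
  have "e k \<noteq> 0" using eigenbasis_inner[OF eb, of k k] by (cases "e k = 0") simp_all
  then show ?thesis by (rule eigenvalue_le_1[OF eigenbasis_eq[OF eb]])
qed

lemma comp_expand: "\<phi> $ i = (\<Sum>k\<in>UNIV. (e k $ i) *\<^sub>R comp k \<phi>)"
proof -
  have "(\<Sum>k\<in>UNIV. (e k $ i) *\<^sub>R comp k \<phi>) = (\<Sum>j\<in>UNIV. (\<Sum>k\<in>UNIV. e k $ i * e k $ j) *\<^sub>R (\<phi> $ j))"
    unfolding comp_def scaleR_sum_right scaleR_sum_left scaleR_scaleR by (rule sum.swap)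
  also have "\<dots> = \<phi> $ i"
    by (simp add: eigenbasis_complete[OF eb] if_distrib[of "\<lambda>z. z *\<^sub>R _"] cong: if_cong)
  finally show ?thesis by simp
qed

text \<open>Orthogonality of \<open>e\<close> leaves the diagonal \<open>q\<close> part unchanged,
  while the spectral decomposition of \<open>Mat\<close> turns the coupling into the eigenvalues
  \<open>\<mu> k\<close>.\<close>

lemma B_diagonal:
  assumes \<phi>: "\<phi> \<in> VV" and \<psi>: "\<psi> \<in> VV"
  shows "B \<phi> \<psi> = (\<Sum>k\<in>UNIV. q (comp k \<phi>) (comp k \<psi>) - 2 * \<mu> k * R (comp k \<phi>) (comp k \<psi>))"
proof -
  have m: "\<phi> $ i \<in> V" "\<psi> $ i \<in> V" for i using assms by (auto simp: VV_def)
  have qk: "q (comp k \<phi>) (comp k \<psi>) = (\<Sum>i\<in>UNIV. \<Sum>j\<in>UNIV. (e k $ i * e k $ j) * q (\<phi> $ i) (\<psi> $ j))" for k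
    unfolding comp_def using m
    by (subst sum_left(1)) (auto simp: sum_right(1) sum_mem sum_distrib_left mult.assoc)
  have Rk: "R (comp k \<phi>) (comp k \<psi>) = (\<Sum>i\<in>UNIV. \<Sum>j\<in>UNIV. (e k $ i * e k $ j) * R (\<phi> $ i) (\<psi> $ j))" for k
    unfolding comp_def using m
    by (subst sum_left(2)) (auto simp: sum_right(2) sum_mem sum_distrib_left mult.assoc)
  have swap: "(\<Sum>k\<in>UNIV. \<Sum>i\<in>UNIV. \<Sum>j\<in>UNIV. h k i j * g i j) = (\<Sum>i\<in>UNIV. \<Sum>j\<in>UNIV. (\<Sum>k\<in>UNIV. h k i j) * g i j)"
    for h :: "'n \<Rightarrow> 'n \<Rightarrow> 'n \<Rightarrow> real" and g
  proof -
    have "(\<Sum>k\<in>UNIV. \<Sum>i\<in>UNIV. \<Sum>j\<in>UNIV. h k i j * g i j) = (\<Sum>i\<in>UNIV. \<Sum>k\<in>UNIV. \<Sum>j\<in>UNIV. h k i j * g i j)"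
      by (rule sum.swap)
    also have "\<dots> = (\<Sum>i\<in>UNIV. \<Sum>j\<in>UNIV. \<Sum>k\<in>UNIV. h k i j * g i j)"
      by (intro sum.cong refl sum.swap)
    finally show ?thesis by (simp add: sum_distrib_right)
  qed
  have "(\<Sum>k\<in>UNIV. q (comp k \<phi>) (comp k \<psi>)) = (\<Sum>i\<in>UNIV. \<Sum>j\<in>UNIV. (if i = j then 1 else 0) * q (\<phi> $ i) (\<psi> $ j))"
    unfolding qk swap eigenbasis_complete[OF eb] ..
  also have "\<dots> = (\<Sum>i\<in>UNIV. q (\<phi> $ i) (\<psi> $ i))"
    by (simp add: if_distrib[of "\<lambda>z. z * _"] cong: if_cong)
  finally have 1: "(\<Sum>k\<in>UNIV. q (comp k \<phi>) (comp k \<psi>)) = (\<Sum>i\<in>UNIV. q (\<phi> $ i) (\<psi> $ i))" .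
  have "(\<Sum>k\<in>UNIV. \<mu> k * R (comp k \<phi>) (comp k \<psi>)) =
      (\<Sum>k\<in>UNIV. \<Sum>i\<in>UNIV. \<Sum>j\<in>UNIV. (\<mu> k * (e k $ i * e k $ j)) * R (\<phi> $ i) (\<psi> $ j))"
    unfolding Rk sum_distrib_left by (simp add: mult.assoc)
  also have "\<dots> = (\<Sum>i\<in>UNIV. \<Sum>j\<in>UNIV. Mat $ i $ j * R (\<phi> $ i) (\<psi> $ j))"
    unfolding swap eigenbasis_entry[OF eb, symmetric] ..
  finally have 2: "(\<Sum>k\<in>UNIV. \<mu> k * R (comp k \<phi>) (comp k \<psi>)) = (\<Sum>i\<in>UNIV. \<Sum>j\<in>UNIV. Mat $ i $ j * R (\<phi> $ i) (\<psi> $ j))" .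
  show ?thesis
    unfolding B_def sum_subtractf mult.assoc[of 2] sum_distrib_left[symmetric] 1 2 by (simp add: Mat_def)
qed

text \<open>Test elements supported in the single component \<open>k\<close> decouple the kernel
  condition.\<close>

lemma kernel_comp:
  assumes \<phi>: "\<phi> \<in> kernel" and g: "g \<in> V"
  shows "q (comp k \<phi>) g - 2 * \<mu> k * R (comp k \<phi>) g = 0"
proof -
  have \<phi>V: "\<phi> \<in> VV" using \<phi> by (simp add: kernel_def)
  \<comment> \<open>By orthonormality its component is \<open>g\<close> for the index
    \<open>k\<close> and 0 for all others.\<close>
  define \<psi> where "\<psi> = (\<chi> i. (e k $ i) *\<^sub>R g)"
  have \<psi>: "\<psi> \<in> VV" using V_scale[OF g] by (simp add: VV_def \<psi>_def)
  have cl: "comp l \<psi> = (if l = k then g else 0)" for l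
  proof -
    have "comp l \<psi> = (e l \<bullet> e k) *\<^sub>R g"
      by (simp add: comp_def \<psi>_def inner_vec_def scaleR_sum_left)
    then show ?thesis using eigenbasis_inner[OF eb, of l k] by simp
  qed
  have z: "q w 0 = 0" "R w 0 = 0" if "w \<in> V" for w
    using zero_left[OF that] q_sym[OF that V_zero] R_sym[OF that V_zero] by auto
  have "0 = B \<phi> \<psi>" using \<phi> \<psi> by (simp add: kernel_def)
  also have "\<dots> = (\<Sum>l\<in>UNIV. if l = k then q (comp k \<phi>) g - 2 * \<mu> k * R (comp k \<phi>) g else 0)"
    unfolding B_diagonal[OF \<phi>V \<psi>] cl by (intro sum.cong refl) (simp add: z comp_V[OF \<phi>V])
  finally show ?thesis by simp
qed

text \<open>Each component solves a scalar problem with \<open>s = 1 + 2 * \<mu> k\<close>; since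
  \<open>\<mu> k \<le> 1\<close>, the abstract kernel lemmas cover every case except
  \<open>s = 3\<close>, which is \<open>N\<close>.\<close>

lemma kernel_comp_cases:
  assumes \<phi>: "\<phi> \<in> kernel"
  shows "\<mu> k \<noteq> 0 \<Longrightarrow> \<mu> k \<noteq> 1 \<Longrightarrow> comp k \<phi> = 0"
    and "\<mu> k = 1 \<Longrightarrow> comp k \<phi> \<in> N"
    and "\<mu> k = 0 \<Longrightarrow> \<exists>t. comp k \<phi> = t *\<^sub>R U"
proof -
  have cV: "comp k \<phi> \<in> V" using \<phi> by (intro comp_V) (simp add: kernel_def)
  note ker = kernel_comp[OF \<phi>, of _ k]
  show "comp k \<phi> = 0" if "\<mu> k \<noteq> 0" "\<mu> k \<noteq> 1"
    using that \<mu>_le_1[of k] ker by (intro kernel_shifted[OF cV, of "\<mu> k"]) auto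
  show "comp k \<phi> \<in> N" if "\<mu> k = 1" using ker that cV by (simp add: N_def)
  show "\<exists>t. comp k \<phi> = t *\<^sub>R U" if "\<mu> k = 0"
    using kernel_q[OF cV] ker[OF cV] that by auto
qed

text \<open>The functionals are the \<open>R\<close>-products of \<open>U\<close> with the
  components of positive \<open>\<mu> k\<close>. Where they all vanish, every summand of the
  diagonal form is nonnegative, so they separate points of a negative space.\<close>

lemma negative_space_card_le_comp:
  assumes S: "finite S" "independent S" "span S \<subseteq> VV" and neg: "\<And>x. x \<in> span S \<Longrightarrow> x \<noteq> 0 \<Longrightarrow> B x x < 0"
  shows "card S \<le> card {k. \<mu> k > 0}"
proof (rule independent_card_le_of_functionals[OF S(1,2), where L="\<lambda>x. \<chi> k. if \<mu> k > 0 then R (comp k x) U else 0"])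
  have compl: "comp k (x + r *\<^sub>R y) = comp k x + r *\<^sub>R comp k y" for k x y r
    by (simp add: comp_def scaleR_add_right sum.distrib scaleR_sum_right mult.commute)
  fix x y and r :: real assume xy: "x \<in> span S" "y \<in> span S"
  have cV: "comp k x \<in> V" "comp k y \<in> V" for k using xy S(3) comp_V by auto
  show "(\<chi> k. if \<mu> k > 0 then R (comp k (x + r *\<^sub>R y)) U else 0) =
    (\<chi> k. if \<mu> k > 0 then R (comp k x) U else 0) + r *\<^sub>R (\<chi> k. if \<mu> k > 0 then R (comp k y) U else 0)"
    using cV U(1) by (simp add: vec_eq_iff compl R_lin)
next
  fix x assume x: "x \<in> span S" "(\<chi> k. if \<mu> k > 0 then R (comp k x) U else 0) = 0"
  have xV: "x \<in> VV" using x(1) S(3) by blast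
  have "0 \<le> q (comp k x) (comp k x) - 2 * \<mu> k * R (comp k x) (comp k x)" for k
  proof (cases "\<mu> k > 0")
    case True
    then have "R U (comp k x) = 0"
      using x(2) R_sym[OF U(1) comp_V[OF xV]] by (auto simp: vec_eq_iff split: if_splits)
    then show ?thesis by (intro nonneg_on_complement comp_V xV \<mu>_le_1)
  next
    case False
    then have "\<mu> k * R (comp k x) (comp k x) \<le> 0"
      using R_nonneg[OF comp_V[OF xV]] by (intro mult_nonpos_nonneg) auto
    then show ?thesis using q_nonneg[OF comp_V[OF xV], of k] by simp
  qed
  then have "0 \<le> B x x" unfolding B_diagonal[OF xV xV] by (intro sum_nonneg) auto
  then show "x = 0" using neg[OF x(1)] by force
qed (auto simp: vec_eq_iff)

end

end

lemma eigenbasis_positive_on_span: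
  fixes A :: "real^'n^'n"
  assumes eb: "eigenbasis A e \<mu>" and x: "x \<in> span (e ` {k. \<mu> k > 0})" "x \<noteq> 0"
  shows "x \<bullet> (A *v x) > 0"
proof -
  have orth: "e l \<bullet> x = 0" if l: "\<not> \<mu> l > 0" for l
    using x(1)
  proof (induction rule: span_induct)
    case base
    show ?case by (simp add: subspace_def inner_add_right)
  next
    case (step x)
    then show ?case using l eigenbasis_inner[OF eb] by auto
  qed
  have nonneg: "0 \<le> \<mu> k * (e k \<bullet> x)\<^sup>2" for k using orth[of k] by (cases "\<mu> k > 0") auto
  obtain k where k: "e k \<bullet> x \<noteq> 0"
    using eigenbasis_expand[OF eb, of x] x(2) by (metis (no_types, lifting) scaleR_zero_left sum.neutral)
  then have "0 < \<mu> k * (e k \<bullet> x)\<^sup>2" using orth[of k] by (cases "\<mu> k > 0") auto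
  then show ?thesis
    unfolding eigenbasis_quadratic[OF eb] using nonneg by (intro sum_pos2[of UNIV k]) auto
qed

lemma linear_times_fun: "linear (\<lambda>\<psi>. c \<odot> \<psi>)"
  by (rule linearI) (simp_all add: times_fun_def vec_eq_iff scaleR_add_right mult.commute)

section \<open>Kernel and negative spaces at the solution\<close>

context linearized_system
begin

lemma times_fun_VV: "f \<in> V \<Longrightarrow> x \<odot> f \<in> VV"
  by (simp add: VV_def times_fun_def V_scale)

lemma B_times_fun:
  assumes f: "f \<in> V" and \<psi>: "\<psi> \<in> VV"
  shows "B (x \<odot> f) \<psi> = (\<Sum>i\<in>UNIV. x $ i * q f (\<psi> $ i)) - 2 * (\<Sum>j\<in>UNIV. (Mat *v x) $ j * R f (\<psi> $ j))"
proof -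
  have m: "\<psi> $ i \<in> V" for i using \<psi> by (simp add: VV_def)
  have "(\<Sum>i\<in>UNIV. \<Sum>j\<in>UNIV. A $ i $ j * c $ i * c $ j * R ((x \<odot> f) $ i) (\<psi> $ j))
    = (\<Sum>i\<in>UNIV. \<Sum>j\<in>UNIV. Mat $ j $ i * x $ i * R f (\<psi> $ j))"
    using m f A_sym by (simp add: times_fun_def scale_left Mat_def mult_ac)
  also have "\<dots> = (\<Sum>j\<in>UNIV. (Mat *v x) $ j * R f (\<psi> $ j))"
    by (subst sum.swap) (simp add: matrix_vector_mult_def sum_distrib_right)
  finally show ?thesis
    using m f by (simp add: B_def times_fun_def scale_left)
qed

lemma c_nonzero: "c $ i \<noteq> 0"
  using c_pos[of i] by simp

text \<open>Multiplication by \<open>c\<close> turns the form of \<open>Mat\<close> into that of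
  \<open>A\<close>; this is the origin of the Hadamard division in the theorem.\<close>

lemma hadamard_inverse: "(\<chi> j. c $ j * (\<gamma> \<oslash> c) $ j) = \<gamma>" "(\<chi> j. c $ j * x $ j) \<oslash> c = x"
  by (simp_all add: hadamard_div_def vec_eq_iff c_nonzero)

lemma Mat_hadamard_zero_iff: "Mat *v (\<gamma> \<oslash> c) = 0 \<longleftrightarrow> A *v \<gamma> = 0"
  by (simp add: Mat_zero_iff hadamard_inverse)

lemma kernel_of_A:
  assumes "A *v \<gamma> = 0" shows "(\<gamma> \<oslash> c) \<odot> U \<in> kernel"
proof -
  have "Mat *v (\<gamma> \<oslash> c) = 0" using assms by (simp add: Mat_hadamard_zero_iff)
  then show ?thesis
    using times_fun_VV[OF U(1)] by (auto simp: kernel_def B_times_fun[OF U(1)] qU VV_def)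
qed

text \<open>\<open>c\<close> is an eigenvector of \<open>Mat\<close> with eigenvalue 1, so along it
  the system reduces to the scalar form with \<open>s = 3\<close>.\<close>

lemma kernel_of_N:
  assumes \<psi>: "\<psi> \<in> N" shows "c \<odot> \<psi> \<in> kernel"
proof -
  have V: "\<psi> \<in> V" using \<psi> by (simp add: N_def)
  have "B (c \<odot> \<psi>) \<phi> = (\<Sum>i\<in>UNIV. c $ i * (q \<psi> (\<phi> $ i) - 2 * R \<psi> (\<phi> $ i)))" if "\<phi> \<in> VV" for \<phi>
    unfolding B_times_fun[OF V that] Mat_c by (simp add: right_diff_distrib sum_subtractf sum_distrib_left mult_ac)
  then show ?thesis
    using \<psi> times_fun_VV[OF V] by (simp add: kernel_def N_def VV_def)
qed

lemma N_subspace: "subspace N"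
  unfolding subspace_def N_def
  using V_zero zero_left q_lin[of _ _ _ 1] R_lin[of _ _ _ 1] scale_left V_lincomb[of _ _ 1] V_scale
  by (auto simp: algebra_simps)

text \<open>Only components with \<open>\<mu> k = 0\<close> survive, and these are multiples of
  \<open>U\<close>.\<close>

lemma kernel_subset_if_N_trivial:
  assumes N: "N = {0}" and \<phi>: "\<phi> \<in> kernel"
  obtains \<gamma> where "A *v \<gamma> = 0" "\<phi> = (\<gamma> \<oslash> c) \<odot> U"
proof -
  obtain e \<mu> where eb: "eigenbasis Mat e \<mu>" using eigenbasis_exists[OF Mat_sym] by metis
  note cases = kernel_comp_cases[OF eb \<phi>]
  have "\<exists>t. comp e k \<phi> = t *\<^sub>R U \<and> (\<mu> k = 0 \<or> t = 0)" for k
  proof (cases "\<mu> k = 0")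
    case False
    then have "comp e k \<phi> = 0" using cases(1,2)[of k] N by (cases "\<mu> k = 1") auto
    then show ?thesis by (intro exI[of _ 0]) simp
  qed (use cases(3) in blast)
  then obtain t where t: "\<And>k. comp e k \<phi> = t k *\<^sub>R U" "\<And>k. \<mu> k = 0 \<or> t k = 0" by metis
  \<comment> \<open>Collects the surviving eigenvectors with their coefficients: a null vector of
    \<open>Mat\<close>, which multiplication by \<open>c\<close> turns into the desired
    \<open>\<gamma>\<close>.\<close>
  define x where "x = (\<Sum>k\<in>UNIV. t k *\<^sub>R e k)"
  have "Mat *v x = (\<Sum>k\<in>UNIV. Mat *v (t k *\<^sub>R e k))"
    unfolding x_def by (rule linear_sum[OF matrix_vector_mul_linear])
  also have "\<dots> = 0"
    using t(2) by (intro sum.neutral) (auto simp: matrix_vector_mult_scaleR eigenbasis_eq[OF eb])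
  finally have "Mat *v x = 0" .
  moreover have "\<phi> = x \<odot> U"
  proof (rule vec_eq_iff[THEN iffD2], rule allI)
    fix i
    have "\<phi> $ i = (\<Sum>k\<in>UNIV. (e k $ i) *\<^sub>R (t k *\<^sub>R U))" using comp_expand[OF eb, of \<phi> i] t(1) by simp
    then show "\<phi> $ i = (x \<odot> U) $ i"
      by (simp add: x_def times_fun_def scaleR_sum_left mult.commute)
  qed
  ultimately show thesis
    using that[of "\<chi> j. c $ j * x $ j"] by (simp add: Mat_zero_iff hadamard_inverse)
qed

text \<open>Injectivity of \<open>A\<close> excludes \<open>\<mu> k = 0\<close>. For
  \<open>\<mu> k = 1\<close> positivity of the entries makes \<open>e k\<close> a multiple of
  \<open>c\<close>, so the whole expansion collapses to one multiple of \<open>c\<close>.\<close>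

lemma kernel_subset_if_A_positive:
  assumes inj: "\<And>\<gamma>. A *v \<gamma> = 0 \<Longrightarrow> \<gamma> = 0" and pos: "\<forall>i j. A $ i $ j > 0" and \<phi>: "\<phi> \<in> kernel"
  obtains \<psi> where "\<psi> \<in> N" "\<phi> = c \<odot> \<psi>"
proof -
  obtain e \<mu> where eb: "eigenbasis Mat e \<mu>" using eigenbasis_exists[OF Mat_sym] by metis
  note cases = kernel_comp_cases[OF eb \<phi>]
  have nz: "\<mu> k \<noteq> 0" for k
  proof
    assume "\<mu> k = 0"
    then have "A *v (\<chi> j. c $ j * e k $ j) = 0"
      using eigenbasis_eq[OF eb, of k] by (simp add: Mat_zero_iff)
    then have "(\<chi> j. c $ j * e k $ j) = 0" by (rule inj)
    then have "e k = 0" by (simp add: vec_eq_iff c_nonzero)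
    then show False using eigenbasis_inner[OF eb, of k k] by simp
  qed
  have "\<exists>s. comp e k \<phi> \<in> N \<and> (comp e k \<phi> = 0 \<or> e k = s *\<^sub>R c)" for k
  proof (cases "\<mu> k = 1")
    case True
    then have "Mat *v e k = e k" using eigenbasis_eq[OF eb, of k] by simp
    then obtain s where "e k = s *\<^sub>R c" using eigenvalue_1_multiple pos by metis
    then show ?thesis using cases(2)[OF True] by blast
  next
    case False
    then show ?thesis using cases(1)[OF nz False] subspace_0[OF N_subspace] by simp
  qed
  then obtain s where s: "\<And>k. comp e k \<phi> \<in> N" "\<And>k. comp e k \<phi> = 0 \<or> e k = s k *\<^sub>R c" by metis
  define \<psi> where "\<psi> = (\<Sum>k\<in>UNIV. s k *\<^sub>R comp e k \<phi>)"
  have "\<psi> \<in> N"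
    unfolding \<psi>_def using N_subspace s(1) by (intro subspace_sum subspace_scale)
  moreover have "\<phi> = c \<odot> \<psi>"
  proof (rule vec_eq_iff[THEN iffD2], rule allI)
    fix i
    have "(e k $ i) *\<^sub>R comp e k \<phi> = c $ i *\<^sub>R (s k *\<^sub>R comp e k \<phi>)" for k
      using s(2)[of k] by (auto simp: mult.commute)
    then have "(\<Sum>k\<in>UNIV. (e k $ i) *\<^sub>R comp e k \<phi>) = (\<Sum>k\<in>UNIV. c $ i *\<^sub>R (s k *\<^sub>R comp e k \<phi>))"
      by (intro sum.cong refl)
    then show "\<phi> $ i = (c \<odot> \<psi>) $ i"
      unfolding comp_expand[OF eb, of \<phi> i] by (simp add: \<psi>_def times_fun_def scaleR_sum_right)
  qed
  ultimately show thesis by (rule that)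
qed

lemma kernel_trivial_iff:
  "kernel = {0} \<longleftrightarrow> N = {0} \<and> (\<forall>\<gamma>. A *v \<gamma> = 0 \<longrightarrow> \<gamma> = 0)"
proof
  assume k: "kernel = {0}"
  have "\<psi> = 0" if "\<psi> \<in> N" for \<psi>
  proof -
    have "c \<odot> \<psi> = 0" using kernel_of_N[OF that] k by simp
    then show ?thesis by (simp add: times_fun_def vec_eq_iff c_nonzero)
  qed
  then have "N = {0}" using subspace_0[OF N_subspace] by blast
  moreover have "\<gamma> = 0" if "A *v \<gamma> = 0" for \<gamma>
  proof -
    have "(\<gamma> \<oslash> c) \<odot> U = 0" using kernel_of_A[OF that] k by simp
    then have "\<gamma> \<oslash> c = 0" using U(2) by (simp add: times_fun_def vec_eq_iff)
    then show ?thesis using hadamard_inverse(1)[of \<gamma>] by (simp add: vec_eq_iff)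
  qed
  ultimately show "N = {0} \<and> (\<forall>\<gamma>. A *v \<gamma> = 0 \<longrightarrow> \<gamma> = 0)" by blast
next
  assume *: "N = {0} \<and> (\<forall>\<gamma>. A *v \<gamma> = 0 \<longrightarrow> \<gamma> = 0)"
  have "\<phi> = 0" if \<phi>: "\<phi> \<in> kernel" for \<phi>
  proof -
    obtain \<gamma> where "A *v \<gamma> = 0" "\<phi> = (\<gamma> \<oslash> c) \<odot> U" using kernel_subset_if_N_trivial[OF _ \<phi>] * by metis
    moreover from this have "\<gamma> = 0" using * by blast
    ultimately show ?thesis by (simp add: times_fun_def hadamard_div_def vec_eq_iff)
  qed
  moreover have "0 \<in> kernel"
  proof -
    have "(0 \<oslash> c) \<odot> U = 0" by (simp add: times_fun_def hadamard_div_def vec_eq_iff)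
    then show ?thesis using kernel_of_A[of 0] by (simp add: matrix_vector_mult_0_right)
  qed
  ultimately show "kernel = {0}" by blast
qed

text \<open>The bound by positive eigenvalues of \<open>Mat\<close> passes to \<open>A\<close>: the
  diagonal map by \<open>c\<close> is injective and sends the positive eigenspaces of
  \<open>Mat\<close> to a subspace on which \<open>A\<close> is positive.\<close>

lemma negative_space_card_le:
  assumes S: "finite S" "independent S" "span S \<subseteq> VV" and neg: "\<And>x. x \<in> span S \<Longrightarrow> x \<noteq> 0 \<Longrightarrow> B x x < 0"
  shows "card S \<le> num_pos_eigenvalues A"
proof -
  obtain e \<mu> where eb: "eigenbasis Mat e \<mu>" using eigenbasis_exists[OF Mat_sym] by metis
  obtain e' \<mu>' where eb': "eigenbasis A e' \<mu>'" using eigenbasis_exists[OF A_sym] by metis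
  let ?K = "{k. \<mu> k > 0}" and ?D = "\<lambda>x. \<chi> j. c $ j * x $ j"
  have D: "linear ?D" by (rule linearI) (simp_all add: vec_eq_iff algebra_simps)
  have D_inj: "inj ?D"
    using c_pos by (intro injI) (simp add: vec_eq_iff less_imp_neq[symmetric])
  have "card S \<le> card ?K" by (rule negative_space_card_le_comp[OF eb S neg])
  also have "\<dots> = card (?D ` e ` ?K)"
    using eigenbasis_inj[OF eb] D_inj by (simp add: card_image inj_on_subset)
  also have "\<dots> \<le> card {k. \<mu>' k > 0}"
  proof (rule positive_subspace_card_le[OF eb'])
    show "independent (?D ` e ` ?K)"
      using linear_independent_injective_image[OF D eigenbasis_independent[OF eb]] D_inj inj_on_subset by blast
    fix y assume y: "y \<in> span (?D ` e ` ?K)" "y \<noteq> 0"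
    then obtain x where x: "x \<in> span (e ` ?K)" "y = ?D x"
      unfolding linear_span_image[OF D] by blast
    moreover have "x \<noteq> 0" using y(2) x(2) by (auto simp: vec_eq_iff)
    ultimately show "y \<bullet> (A *v y) > 0"
      using eigenbasis_positive_on_span[OF eb, of x] by (simp add: Mat_quadratic_A)
  qed simp
  finally show ?thesis by (simp add: num_pos_eigenvalues_eq[OF eb'])
qed

definition W :: "('v^'n) set" where
  "W = span {(\<gamma> \<oslash> c) \<odot> U | \<gamma>. \<exists>r>0. A *v \<gamma> = r *\<^sub>R \<gamma>}"

text \<open>At \<open>(\<gamma> \<oslash> c) \<odot> U\<close> the form \<open>B\<close> has the
  value \<open>- 2 * (\<gamma> \<bullet> (A *v \<gamma>)) * R U U\<close>, since \<open>q\<close>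
  annihilates \<open>U\<close>.\<close>

lemma W_basis:
  obtains S where "finite S" "independent S" "span S = W" "card S = num_pos_eigenvalues A"
    and "W \<subseteq> VV" "\<And>x. x \<in> W \<Longrightarrow> x \<noteq> 0 \<Longrightarrow> B x x < 0"
proof -
  obtain e \<mu> where eb: "eigenbasis A e \<mu>" using eigenbasis_exists[OF A_sym] by metis
  let ?K = "{k. \<mu> k > 0}" and ?T = "\<lambda>\<gamma>. (\<gamma> \<oslash> c) \<odot> U"
  have T: "linear ?T"
    by (rule linearI) (simp_all add: times_fun_def hadamard_div_def vec_eq_iff add_divide_distrib scaleR_add_left)
  have T_inj: "inj ?T"
    using c_pos U(2) by (intro injI) (simp add: times_fun_def hadamard_div_def vec_eq_iff less_imp_neq[symmetric])
  let ?G = "{\<gamma>. \<exists>r>0. A *v \<gamma> = r *\<^sub>R \<gamma>}"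
  have "span ?G = span (e ` ?K)"
  proof
    show "span ?G \<subseteq> span (e ` ?K)"
    proof (intro span_minimal subspace_span subsetI)
      fix \<gamma> assume "\<gamma> \<in> ?G"
      then obtain r where r: "r > 0" "A *v \<gamma> = r *\<^sub>R \<gamma>" by blast
      then have "\<gamma> \<in> span (e ` {k. \<mu> k = r})" using eigenspace_eq[OF eb, of r] by blast
      moreover have "e ` {k. \<mu> k = r} \<subseteq> e ` ?K" using r(1) by auto
      ultimately show "\<gamma> \<in> span (e ` ?K)" using span_mono by blast
    qed
    show "span (e ` ?K) \<subseteq> span ?G"
      using eigenbasis_eq[OF eb] by (intro span_mono) auto
  qed
  then have W: "W = ?T ` span (e ` ?K)"
    unfolding W_def by (simp add: setcompr_eq_image linear_span_image[OF T])
  show thesis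
  proof (rule that[of "?T ` e ` ?K"])
    show "independent (?T ` e ` ?K)"
      using linear_independent_injective_image[OF T eigenbasis_independent[OF eb]] T_inj inj_on_subset by blast
    show "span (?T ` e ` ?K) = W" by (simp add: W linear_span_image[OF T])
    show "card (?T ` e ` ?K) = num_pos_eigenvalues A"
      using eigenbasis_inj[OF eb] T_inj by (simp add: card_image inj_on_subset num_pos_eigenvalues_eq[OF eb])
    show "W \<subseteq> VV" unfolding W using times_fun_VV[OF U(1)] by blast
    fix x assume x: "x \<in> W" "x \<noteq> 0"
    then obtain \<gamma> where \<gamma>: "\<gamma> \<in> span (e ` ?K)" "x = ?T \<gamma>" unfolding W by blast
    have "\<gamma> \<noteq> 0" using x(2) \<gamma>(2) T linear_0 by blast
    then have pos: "\<gamma> \<bullet> (A *v \<gamma>) > 0" using eigenbasis_positive_on_span[OF eb \<gamma>(1)] by blast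
    let ?x = "\<gamma> \<oslash> c"
    have xi: "x $ i = ?x $ i *\<^sub>R U" for i using \<gamma>(2) by (simp add: times_fun_def)
    have "B x x = (\<Sum>i\<in>UNIV. ?x $ i * q U (x $ i)) - 2 * (\<Sum>j\<in>UNIV. (Mat *v ?x) $ j * R U (x $ j))"
      using B_times_fun[OF U(1) times_fun_VV[OF U(1)], of ?x ?x] \<gamma>(2) by simp
    also have "\<dots> = - 2 * (?x \<bullet> (Mat *v ?x) * R U U)"
      unfolding xi using U(1) by (simp add: scale_right qU inner_vec_def sum_distrib_left sum_negf mult_ac)
    also have "?x \<bullet> (Mat *v ?x) = \<gamma> \<bullet> (A *v \<gamma>)" by (simp add: Mat_quadratic_A hadamard_inverse)
    finally show "B x x < 0" using pos R_pos[OF U] by simp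
  qed simp
qed

end

section \<open>The manifold of amplitudes\<close>

lemma vec_eq_sum_axis: "(\<chi> i. f i) = (\<Sum>i\<in>UNIV. f i *\<^sub>R axis i (1::real))"
  by (simp add: vec_eq_iff axis_def if_distrib cong: if_cong)

text \<open>The intervals depend on the coordinate because the square root of
  \<open>x $ i + a $ i\<close> has its own domain for each \<open>i\<close>.\<close>

lemma k_smooth_on_componentwise:
  fixes D :: "nat \<Rightarrow> 'n::finite \<Rightarrow> real \<Rightarrow> real"
  assumes "open T" "\<And>x i. x \<in> T \<Longrightarrow> x $ i \<in> I i"
    and "\<And>k i t. t \<in> I i \<Longrightarrow> (D k i has_field_derivative D (Suc k) i t) (at t)"
  shows "k_smooth_on m T (\<lambda>x :: real^'n. \<chi> i. D 0 i (x $ i))"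
proof -
  have "k_smooth_on m T (\<lambda>x. D 0 i (x \<bullet> axis i 1))" for i
    by (rule k_smooth_on_inner_comp[where D="\<lambda>k. D k i" and k=0 and I="I i"])
       (use assms in \<open>auto simp: inner_axis\<close>)
  then have "k_smooth_on m T (\<lambda>x. \<Sum>i\<in>UNIV. D 0 i (x \<bullet> axis i 1) *\<^sub>R axis i (1::real))"
    using assms(1) by (intro k_smooth_on_sum k_smooth_on_bounded_linear[OF bounded_linear_scaleR_left]) auto
  then show ?thesis by (simp add: vec_eq_sum_axis inner_axis)
qed

lemma smooth_on_squares: "open T \<Longrightarrow> smooth_on T (\<lambda>x :: real^'n. \<chi> i. (x $ i)\<^sup>2 - a $ i)"
proof -
  assume T: "open T"
  define D where "D k i t = (if k = 0 then t\<^sup>2 - a $ i else if k = 1 then 2 * t else if k = 2 then 2 else 0)"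
    for k :: nat and i :: 'n and t :: real
  have "k_smooth_on m T (\<lambda>x. \<chi> i. D 0 i (x $ i))" for m
    by (rule k_smooth_on_componentwise[where I="\<lambda>_. UNIV"])
       (auto simp: T D_def[abs_def] intro!: derivative_eq_intros)
  then show ?thesis by (simp add: smooth_on_def D_def)
qed

text \<open>Falling factorials of 1/2, the constants in the higher derivatives of the square
  root.\<close>

primrec sqrt_coeff :: "nat \<Rightarrow> real" where
  "sqrt_coeff 0 = 1"
| "sqrt_coeff (Suc k) = sqrt_coeff k * (1/2 - real k)"

lemma smooth_on_sqrt:
  assumes T: "open T" and pos: "\<And>x i. x \<in> T \<Longrightarrow> x $ i + a $ i > 0"
  shows "smooth_on T (\<lambda>x :: real^'n. \<chi> i. sqrt (x $ i + a $ i))"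
proof -
  define D where "D k i t = sqrt_coeff k * (t + a $ i) powr (1/2 - real k)" for k :: nat and i :: 'n and t :: real
  have "k_smooth_on m T (\<lambda>x. \<chi> i. D 0 i (x $ i))" for m
  proof (rule k_smooth_on_componentwise[where I="\<lambda>i. {t. t + a $ i > 0}"])
    fix k i t assume "t \<in> {t. t + a $ i > 0}"
    then show "(D k i has_field_derivative D (Suc k) i t) (at t)"
      unfolding D_def[abs_def]
      by (auto intro!: derivative_eq_intros simp: algebra_simps)
  qed (use T pos in auto)
  moreover have "(\<chi> i. D 0 i (x $ i)) = (\<chi> i. sqrt (x $ i + a $ i))" if "x \<in> T" for x
    by (simp add: D_def powr_half_sqrt pos[OF that, THEN less_imp_le])
  ultimately have "k_smooth_on m T (\<lambda>x. \<chi> i. sqrt (x $ i + a $ i))" for m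
    by (rule k_smooth_on_cong[OF T, rotated])
  then show ?thesis unfolding smooth_on_def by blast
qed

lemma open_positive: "open {x :: real^'n. \<forall>i. x $ i + a $ i > 0}"
proof -
  have "{x :: real^'n. \<forall>i. x $ i + a $ i > 0} = (\<Inter>i\<in>UNIV. {x. x $ i + a $ i > 0})" by auto
  also have "open \<dots>" by (intro open_INT finite ballI open_Collect_less continuous_intros)
  finally show ?thesis .
qed

text \<open>A single chart suffices: squaring and subtracting \<open>a\<close> is a diffeomorphism
  of the positive orthant onto an open set \<open>W\<close>, and it straightens the manifold to
  \<open>K \<inter> W\<close>.\<close>

lemma smooth_submanifold_squares:
  fixes K :: "(real^'n) set" and a :: "real^'n"
  assumes K: "subspace K"
  shows "smooth_submanifold (dim K) {(\<chi> i. sqrt (a $ i + \<gamma> $ i)) | \<gamma>. \<gamma> \<in> K \<and> (\<forall>i. a $ i + \<gamma> $ i > 0)}" (is "smooth_submanifold _ ?L")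
proof -
  define V where "V = {x :: real^'n. \<forall>i. x $ i > 0}"
  define W where "W = {y :: real^'n. \<forall>i. y $ i + a $ i > 0}"
  define \<Phi> where "\<Phi> x = (\<chi> i. (x $ i)\<^sup>2 - a $ i)" for x
  define \<Psi> where "\<Psi> y = (\<chi> i. sqrt (y $ i + a $ i))" for y
  have V: "open V" using open_positive[of 0] by (simp add: V_def)
  have W: "open W" unfolding W_def by (rule open_positive)
  have s\<Phi>: "smooth_on V \<Phi>" unfolding \<Phi>_def[abs_def] by (rule smooth_on_squares[OF V])
  have s\<Psi>: "smooth_on W \<Psi>" unfolding \<Psi>_def[abs_def] by (rule smooth_on_sqrt[OF W]) (simp add: W_def)
  have inv1: "\<Phi> x \<in> W \<and> \<Psi> (\<Phi> x) = x" if "x \<in> V" for x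
  proof -
    have "0 < x $ i" for i using that by (simp add: V_def)
    then have "x $ i \<noteq> 0" "\<bar>x $ i\<bar> = x $ i" for i by (metis less_irrefl, metis abs_of_pos)
    then show ?thesis by (simp add: W_def \<Phi>_def \<Psi>_def vec_eq_iff)
  qed
  have inv2: "\<Psi> y \<in> V \<and> \<Phi> (\<Psi> y) = y" if "y \<in> W" for y
  proof -
    have p: "0 < y $ i + a $ i" for i using that by (simp add: W_def)
    then show ?thesis by (simp add: V_def \<Phi>_def \<Psi>_def vec_eq_iff real_sqrt_pow2[OF less_imp_le])
  qed
  have hom: "homeomorphism V W \<Phi> \<Psi>"
    using s\<Phi> s\<Psi> inv1 inv2
    by (intro homeomorphismI) (auto simp: smooth_on_def intro: k_smooth_on_imp_continuous_on)
  have L: "?L = \<Psi> ` (K \<inter> W)"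
    by (auto simp: \<Psi>_def W_def add.commute)
  have "\<Phi> ` (?L \<inter> V) = K \<inter> W"
  proof
    show "\<Phi> ` (?L \<inter> V) \<subseteq> K \<inter> W" unfolding L using inv2 by auto
    show "K \<inter> W \<subseteq> \<Phi> ` (?L \<inter> V)"
    proof
      fix y assume y: "y \<in> K \<inter> W"
      then have "\<Psi> y \<in> ?L \<inter> V" "y = \<Phi> (\<Psi> y)" unfolding L using inv2 by auto
      then show "y \<in> \<Phi> ` (?L \<inter> V)" by blast
    qed
  qed
  note image = this
  have LV: "p \<in> V" if "p \<in> ?L" for p using that inv2 unfolding L by auto
  show ?thesis
    unfolding smooth_submanifold_def
  proof (rule ballI)
    fix p assume "p \<in> ?L"
    then have "p \<in> V" by (rule LV)
    with V W hom s\<Phi> s\<Psi> K image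
    have "p \<in> V \<and> open V \<and> open W \<and> homeomorphism V W \<Phi> \<Psi> \<and> smooth_on V \<Phi> \<and> smooth_on W \<Psi>
        \<and> subspace K \<and> dim K = dim K \<and> \<Phi> ` (?L \<inter> V) = K \<inter> W" by blast
    then show "\<exists>V W \<Phi> \<Psi> E. p \<in> V \<and> open V \<and> open (W :: (real^'n) set) \<and> homeomorphism V W \<Phi> \<Psi> \<and> smooth_on V \<Phi> \<and> smooth_on W \<Psi>
        \<and> subspace E \<and> dim E = dim K \<and> \<Phi> ` (?L \<inter> V) = E \<inter> W" by (intro exI)
  qed
qed

text \<open>It is the continuous image of the intersection of a subspace with a shifted open
  orthant, which is convex.\<close>

lemma connected_squares:
  fixes K :: "(real^'n) set" and a :: "real^'n"
  assumes K: "subspace K"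
  shows "connected {(\<chi> i. sqrt (a $ i + \<gamma> $ i)) | \<gamma>. \<gamma> \<in> K \<and> (\<forall>i. a $ i + \<gamma> $ i > 0)}"
proof -
  have "convex {y :: real^'n. \<forall>i. a $ i + y $ i > 0}"
  proof (rule convexI, clarsimp)
    fix x y :: "real^'n" and u v :: real and i
    assume *: "\<forall>i. 0 < a $ i + x $ i" "\<forall>i. 0 < a $ i + y $ i" "0 \<le> u" "0 \<le> v" "u + v = 1"
    have "0 < u * (a $ i + x $ i) + v * (a $ i + y $ i)"
    proof (cases "u = 0")
      case False
      then show ?thesis
        using *(1)[rule_format, of i] *(2)[rule_format, of i] *(3,4)
        by (intro add_pos_nonneg[OF mult_pos_pos mult_nonneg_nonneg]) auto
    qed (use * in auto)
    also have "\<dots> = (u + v) * a $ i + u * x $ i + v * y $ i" by (simp add: algebra_simps)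
    finally show "0 < a $ i + (u * x $ i + v * y $ i)" using *(5) by simp
  qed
  then have "connected (K \<inter> {y. \<forall>i. a $ i + y $ i > 0})"
    by (intro convex_connected convex_Int[OF subspace_imp_convex[OF K]])
  then have "connected ((\<lambda>\<gamma>. \<chi> i. sqrt (a $ i + \<gamma> $ i)) ` (K \<inter> {y. \<forall>i. a $ i + y $ i > 0}))"
    by (rule connected_continuous_image[rotated]) (intro continuous_intros)
  moreover have "(\<lambda>\<gamma>. \<chi> i. sqrt (a $ i + \<gamma> $ i)) ` (K \<inter> {y. \<forall>i. a $ i + y $ i > 0}) =
     {(\<chi> i. sqrt (a $ i + \<gamma> $ i)) | \<gamma>. \<gamma> \<in> K \<and> (\<forall>i. a $ i + \<gamma> $ i > 0)}" by auto
  ultimately show ?thesis by simp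
qed

context sobolev4
begin

lemma T4_scale:
  assumes "a \<in> H10 \<Omega>" "b \<in> H10 \<Omega>" "c \<in> H10 \<Omega>" "d \<in> H10 \<Omega>"
  shows "T4 (r *\<^sub>R a) b c d = r * T4 a b c d" "T4 b (r *\<^sub>R a) c d = r * T4 b a c d"
    "T4 b c (r *\<^sub>R a) d = r * T4 b c a d" "T4 b c d (r *\<^sub>R a) = r * T4 b c d a"
proof -
  have *: "T4 (r *\<^sub>R a) b c d = r * T4 a b c d" if "b \<in> H10 \<Omega>" "c \<in> H10 \<Omega>" "d \<in> H10 \<Omega>" for b c d
    using T4_lincomb[OF H10_zero assms(1) that, of r] T4_zero[OF that] by simp
  show "T4 (r *\<^sub>R a) b c d = r * T4 a b c d" by (rule *[OF assms(2,3,4)])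
  show "T4 b (r *\<^sub>R a) c d = r * T4 b a c d"
    using *[OF assms(2,3,4)] by (simp add: T4_swap(1)[of b])
  show "T4 b c (r *\<^sub>R a) d = r * T4 b c a d"
    using *[OF assms(4,2,3)] by (simp add: T4_swap(3)[of b])
  show "T4 b c d (r *\<^sub>R a) = r * T4 b c d a"
    using *[OF assms(4,2,3)] by (simp add: T4_swap(3)[of b] T4_swap(1)[of d])
qed

text \<open>A nonempty open set is not null, so positivity almost everywhere on it is not
  vacuous.\<close>

lemma positive_on_nonzero:
  assumes "\<Omega> \<noteq> {}" "positive_on \<Omega> U" shows "U \<noteq> 0"
proof
  assume "U = 0"
  then have "AE x in M. False"
    using assms(2) AE_lebesgue_onI[OF rep_ae_fun_zero \<Omega>_sets] unfolding positive_on_def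
    by (auto elim: AE_mp)
  then have "AE x in lebesgue. x \<in> - \<Omega>"
    by (subst (asm) AE_lebesgue_on[OF \<Omega>_sets]) simp
  \<comment> \<open>A closed set of full measure is the whole space.\<close>
  then have "x \<in> - \<Omega>" for x
    using open_domain by (intro mem_closed_if_AE_lebesgue) auto
  then show False using assms(1) by blast
qed

text \<open>If the integral of \<open>(U f)\<^sup>2\<close> vanishes, then \<open>f\<close> vanishes
  almost everywhere on \<open>\<Omega>\<close>, because \<open>U\<close> is positive there.\<close>

lemma T4_pos:
  assumes U: "U \<in> H10 \<Omega>" "positive_on \<Omega> U" and f: "f \<in> H10 \<Omega>" "f \<noteq> 0"
  shows "T4 U U f f > 0"
proof (rule ccontr)
  assume "\<not> T4 U U f f > 0"
  then have "T4 U U f f = 0" using T4_nonneg[of U f] by simp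
  then have "(LINT x|M. (rep_ae_fun U x * rep_ae_fun f x)\<^sup>2) = 0"
    by (simp add: T4_def power2_eq_square mult_ac)
  moreover have "integrable M (\<lambda>x. (rep_ae_fun U x * rep_ae_fun f x)\<^sup>2)"
    using H10_product_square_integrable[OF U(1) f(1)] unfolding square_integrable_def real_norm_def power2_abs by (rule conjunct2)
  ultimately have "AE x in M. (rep_ae_fun U x * rep_ae_fun f x)\<^sup>2 = 0"
    by (subst (asm) integral_nonneg_eq_0_iff_AE) auto
  then have "AE x in M. rep_ae_fun f x = 0"
    using U(2) unfolding positive_on_def by eventually_elim auto
  then have "AE x in lebesgue. x \<in> \<Omega> \<longrightarrow> rep_ae_fun f x = 0"
    by (subst (asm) AE_lebesgue_on[OF \<Omega>_sets])
  then have "AE x in lebesgue. rep_ae_fun f x = rep_ae_fun 0 x"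
    using H1_D(1)[OF H10_H1[OF f(1)]] rep_ae_fun_zero by eventually_elim auto
  then show False using f(2) ae_fun_eqI by blast
qed

lemma weakly_solves_cong:
  assumes "AE x in M. g x = h x" "g \<in> borel_measurable M" "h \<in> borel_measurable M"
  shows "weakly_solves \<Omega> lam u g \<longleftrightarrow> weakly_solves \<Omega> lam u h"
proof -
  have "(LINT x|M. g x * \<eta> x) = (LINT x|M. h x * \<eta> x)" if \<eta>: "test_function \<Omega> \<eta>" for \<eta>
  proof (rule integral_cong_AE)
    note m = square_integrable_measurable[OF test_function_square_integrable(1)[OF \<eta> \<Omega>_sets]]
    show "(\<lambda>x. g x * \<eta> x) \<in> borel_measurable M" "(\<lambda>x. h x * \<eta> x) \<in> borel_measurable M"
      by (intro borel_measurable_times assms m)+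
    show "AE x in M. g x * \<eta> x = h x * \<eta> x" using assms(1) by eventually_elim simp
  qed
  then show ?thesis unfolding weakly_solves_def by simp
qed

lemma positive_on_scaleR:
  assumes ne: "\<Omega> \<noteq> {}" and U: "positive_on \<Omega> U"
  shows "positive_on \<Omega> (d *\<^sub>R U) \<longleftrightarrow> d > 0"
proof
  assume "d > 0"
  show "positive_on \<Omega> (d *\<^sub>R U)"
    using U AE_lebesgue_onI[OF rep_ae_fun_scaleR[of d U] \<Omega>_sets] unfolding positive_on_def
    by eventually_elim (use \<open>d > 0\<close> in simp)
next
  assume dU: "positive_on \<Omega> (d *\<^sub>R U)"
  show "d > 0"
  proof (rule ccontr)
    assume "\<not> d > 0"
    have "positive_on \<Omega> 0"
      using U dU AE_lebesgue_onI[OF rep_ae_fun_scaleR[of d U] \<Omega>_sets] unfolding positive_on_def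
      by eventually_elim (use \<open>\<not> d > 0\<close> in \<open>auto simp: zero_less_mult_iff\<close>)
    then show False using positive_on_nonzero[OF ne] by blast
  qed
qed

end

lemma hadamard_square_sum:
  fixes A :: "real^'n^'n"
  shows "(\<Sum>j\<in>UNIV. A $ i $ j * (d $ j)\<^sup>2) = (A *v (\<chi> j. (d $ j)\<^sup>2)) $ i"
  by (simp add: matrix_vector_mult_def)

section \<open>The system at a scalar solution of index one\<close>

locale index_one_solution = sobolev4 \<Omega> lam for \<Omega> :: "'a::euclidean_space set" and lam +
  fixes U :: "'a ae_fun"
  assumes nonempty: "\<Omega> \<noteq> {}"
    and U_solution: "positive_scalar_solution \<Omega> lam U"
    and U_index: "morse_index (scalar_energy \<Omega> lam) (H_space \<Omega>) U = 1"
begin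

lemma U_H: "U \<in> H_space \<Omega>" "U \<in> H10 \<Omega>" and U_positive: "positive_on \<Omega> U"
  using U_solution H_space_H10 by (auto simp: positive_scalar_solution_def)

lemma U_nonzero: "U \<noteq> 0"
  by (rule positive_on_nonzero[OF nonempty U_positive])

lemma Q_lincomb_left:
  assumes "u \<in> H10 \<Omega>" "v \<in> H10 \<Omega>" "w \<in> H10 \<Omega>"
  shows "Q U s (u + r *\<^sub>R v) w = Q U s u w + r * Q U s v w"
  using assms U_H by (simp add: Q_def T4_lincomb2 P_lincomb H10_H1 algebra_simps)

lemma Q_U: "w \<in> H_space \<Omega> \<Longrightarrow> Q U 1 U w = 0"
proof -
  have "weakly_solves \<Omega> lam U (\<lambda>x. (rep_ae_fun U x)^3)"
    using U_solution by (simp add: positive_scalar_solution_def)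
  then have "weakly_solves \<Omega> lam U (\<lambda>x. 1 * (rep_ae_fun U x)\<^sup>2 * rep_ae_fun U x)"
    by (simp add: power2_eq_square power3_eq_cube mult.assoc)
  then show "w \<in> H_space \<Omega> \<Longrightarrow> Q U 1 U w = 0"
    using weakly_solves_iff[OF U_H(1) U_H(1), of 1] by blast
qed

text \<open>The assumption on the Morse index enters here: it becomes the axiom \<open>index\<close>
  of the abstract locale.\<close>

sublocale index_one "H_space \<Omega>" "Q U 1" "T4 U U" U
proof
  show "subspace (H_space \<Omega>)" by (rule H_space_subspace)
  show "U \<in> H_space \<Omega>" "U \<noteq> 0" by (rule U_H, rule U_nonzero)
  fix u v w and r :: real
  assume u: "u \<in> H_space \<Omega>" and v: "v \<in> H_space \<Omega>"
  note uv = u[THEN H_space_H10] v[THEN H_space_H10]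
  show "Q U 1 u v = Q U 1 v u" by (simp add: Q_def P_commute T4_swap(2)[of U U u v])
  show "T4 U U u v = T4 U U v u" by (rule T4_swap)
  show "Q U 1 (u + r *\<^sub>R v) w = Q U 1 u w + r * Q U 1 v w" if "w \<in> H_space \<Omega>"
    by (intro Q_lincomb_left uv H_space_H10 that)
  show "T4 U U (u + r *\<^sub>R v) w = T4 U U u w + r * T4 U U v w" if "w \<in> H_space \<Omega>"
    by (intro T4_lincomb2 uv U_H H_space_H10 that)
next
  show "T4 U U f f > 0" if "f \<in> H_space \<Omega>" "f \<noteq> 0" for f
    using that by (intro T4_pos U_H U_positive H_space_H10)
  show "Q U 1 U w = 0" if "w \<in> H_space \<Omega>" for w by (rule Q_U[OF that])
next
  fix B :: "'a ae_fun set"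
  assume B: "finite B" "independent B" "span B \<subseteq> H_space \<Omega>"
    and neg: "\<And>f. f \<in> span B \<Longrightarrow> f \<noteq> 0 \<Longrightarrow> Q U 1 f f - 2 * T4 U U f f < 0"
  have "second_variation (scalar_energy \<Omega> lam) U f f = Q U 1 f f - 2 * T4 U U f f" if "f \<in> span B" for f
    using second_variation_scalar_energy[OF U_H(2), of f f] that B(3) H_space_H10
    by (auto simp: Q_def)
  then have "negative_space (scalar_energy \<Omega> lam) (H_space \<Omega>) U (span B)"
    using neg B(3) by (auto simp: negative_space_def)
  then have "enat (card B) \<le> morse_index (scalar_energy \<Omega> lam) (H_space \<Omega>) U"
    unfolding morse_index_def using B by (intro Sup_upper) blast
  then show "card B \<le> 1" unfolding U_index by (simp add: one_enat_def)
qed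

text \<open>Inserting \<open>d \<odot> U\<close> leaves
  \<open>d\<^sub>i (1 - \<kappa>\<^sub>i) U\<^sup>3 = 0\<close> in the \<open>i\<close>-th equation,
  as \<open>U\<close> solves the scalar one.\<close>

lemma vector_solution_times_fun:
  "positive_vector_solution \<Omega> lam A (d \<odot> U) \<longleftrightarrow> (\<forall>i. d $ i > 0) \<and> (\<forall>i. (\<Sum>j\<in>UNIV. A $ i $ j * (d $ j)\<^sup>2) = 1)"
proof -
  let ?\<kappa> = "\<lambda>i. \<Sum>j\<in>UNIV. A $ i $ j * (d $ j)\<^sup>2"
  have dU: "d $ i *\<^sub>R U \<in> H_space \<Omega>" for i by (rule V_scale[OF U_H(1)])
  have "weakly_solves \<Omega> lam ((d \<odot> U) $ i)
      (\<lambda>x. \<Sum>j\<in>UNIV. A $ i $ j * rep_ae_fun ((d \<odot> U) $ i) x * (rep_ae_fun ((d \<odot> U) $ j) x)\<^sup>2) \<longleftrightarrow> ?\<kappa> i = 1"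
    if di: "d $ i > 0" for i
  proof -
    have "weakly_solves \<Omega> lam ((d \<odot> U) $ i)
      (\<lambda>x. \<Sum>j\<in>UNIV. A $ i $ j * rep_ae_fun ((d \<odot> U) $ i) x * (rep_ae_fun ((d \<odot> U) $ j) x)\<^sup>2) \<longleftrightarrow>
      weakly_solves \<Omega> lam (d $ i *\<^sub>R U) (\<lambda>x. ?\<kappa> i * (rep_ae_fun U x)\<^sup>2 * rep_ae_fun (d $ i *\<^sub>R U) x)"
      unfolding times_fun_def vec_lambda_beta
    proof (rule weakly_solves_cong)
      have "AE x in M. \<forall>j\<in>UNIV. rep_ae_fun (d $ j *\<^sub>R U) x = d $ j * rep_ae_fun U x"
        using AE_lebesgue_onI[OF rep_ae_fun_scaleR \<Omega>_sets] by (intro AE_finite_allI) auto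
      then show "AE x in M. (\<Sum>j\<in>UNIV. A $ i $ j * rep_ae_fun (d $ i *\<^sub>R U) x * (rep_ae_fun (d $ j *\<^sub>R U) x)\<^sup>2)
         = ?\<kappa> i * (rep_ae_fun U x)\<^sup>2 * rep_ae_fun (d $ i *\<^sub>R U) x"
        by eventually_elim (simp add: sum_distrib_left sum_distrib_right power_mult_distrib mult_ac)
    qed (intro borel_measurable_sum borel_measurable_times borel_measurable_power borel_measurable_const rep_measurable)+
    also have "\<dots> \<longleftrightarrow> (\<forall>w\<in>H_space \<Omega>. Q U (?\<kappa> i) (d $ i *\<^sub>R U) w = 0)"
      by (rule weakly_solves_iff[OF U_H(1) dU])
    also have "\<dots> \<longleftrightarrow> (\<forall>w\<in>H_space \<Omega>. d $ i * ((1 - ?\<kappa> i) * T4 U U U w) = 0)"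
    proof (intro ball_cong refl)
      fix w assume w: "w \<in> H_space \<Omega>"
      have "Q U (?\<kappa> i) (d $ i *\<^sub>R U) w = d $ i * Q U (?\<kappa> i) U w"
        using Q_lincomb_left[OF H10_zero U_H(2) H_space_H10[OF w], of "?\<kappa> i" "d $ i"]
          Q_lincomb_left[OF H10_zero H10_zero H_space_H10[OF w], of "?\<kappa> i" 1] by simp
      also have "Q U (?\<kappa> i) U w = (1 - ?\<kappa> i) * T4 U U U w"
        using Q_U[OF w] by (simp add: Q_def left_diff_distrib)
      finally show "(Q U (?\<kappa> i) (d $ i *\<^sub>R U) w = 0) = (d $ i * ((1 - ?\<kappa> i) * T4 U U U w) = 0)" by simp
    qed
    \<comment> \<open>Test with \<open>w = U\<close>, for which the quartic integral is
      positive.\<close>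
    also have "\<dots> \<longleftrightarrow> ?\<kappa> i = 1"
      using di R_pos[OF U_H(1) U_nonzero] U_H(1) by (auto dest!: bspec[OF _ U_H(1)])
    finally show ?thesis .
  qed
  moreover have "(d \<odot> U) \<in> H_vec \<Omega>" using dU by (simp add: H_vec_def times_fun_def)
  moreover have "positive_on \<Omega> ((d \<odot> U) $ i) \<longleftrightarrow> d $ i > 0" for i
    using positive_on_scaleR[OF nonempty U_positive] by (simp add: times_fun_def)
  ultimately show ?thesis
    unfolding positive_vector_solution_def vector_solution_def by auto
qed

text \<open>The terms with \<open>(c $ j)\<^sup>2\<close> sum to \<open>T4 U U\<close> by
  \<open>Ac\<close> and change \<open>P\<close> into \<open>Q U 1\<close>; the mixed terms remain as
  the coupling.\<close>

lemma second_variation_at_solution: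
  assumes A_sym: "\<forall>i j. A $ i $ j = A $ j $ i" and Ac: "\<And>i. (\<Sum>j\<in>UNIV. A $ i $ j * (c $ j)\<^sup>2) = 1"
    and \<phi>: "\<And>i. \<phi> $ i \<in> H10 \<Omega>" and \<psi>: "\<And>i. \<psi> $ i \<in> H10 \<Omega>"
  shows "second_variation (energy \<Omega> lam A) (c \<odot> U) \<phi> \<psi> = (\<Sum>i\<in>UNIV. Q U 1 (\<phi> $ i) (\<psi> $ i))
    - 2 * (\<Sum>i\<in>UNIV. \<Sum>j\<in>UNIV. A $ i $ j * c $ i * c $ j * T4 U U (\<phi> $ i) (\<psi> $ j))"
proof -
  have u: "(c \<odot> U) $ i \<in> H10 \<Omega>" for i using H10.V_closed(2)[OF U_H(2)] by (simp add: times_fun_def)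
  let ?R = "T4 U U"
  have T: "T4 (\<psi> $ i) (\<phi> $ i) ((c \<odot> U) $ j) ((c \<odot> U) $ j) = (c $ j)\<^sup>2 * ?R (\<phi> $ i) (\<psi> $ i)"
    "T4 (\<psi> $ i) ((c \<odot> U) $ i) (\<phi> $ j) ((c \<odot> U) $ j) = c $ i * c $ j * ?R (\<phi> $ j) (\<psi> $ i)"
    "T4 (\<phi> $ i) ((c \<odot> U) $ i) (\<psi> $ j) ((c \<odot> U) $ j) = c $ i * c $ j * ?R (\<phi> $ i) (\<psi> $ j)"
    "T4 ((c \<odot> U) $ i) ((c \<odot> U) $ i) (\<psi> $ j) (\<phi> $ j) = (c $ i)\<^sup>2 * ?R (\<phi> $ j) (\<psi> $ j)" for i j
    using U_H(2) \<phi> \<psi> H10.V_closed(2)[OF U_H(2)]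
    by (simp_all add: times_fun_def T4_scale power2_eq_square) (simp_all add: T4_def mult_ac)
  define X where "X = (\<Sum>i\<in>UNIV. ?R (\<phi> $ i) (\<psi> $ i))"
  define Y where "Y = (\<Sum>i\<in>UNIV. \<Sum>j\<in>UNIV. A $ i $ j * c $ i * c $ j * ?R (\<phi> $ i) (\<psi> $ j))"
  have 1: "(\<Sum>i\<in>UNIV. \<Sum>j\<in>UNIV. A $ i $ j * ((c $ j)\<^sup>2 * ?R (\<phi> $ i) (\<psi> $ i))) = X"
    unfolding X_def mult.assoc[symmetric] sum_distrib_right[symmetric] Ac by simp
  have 4: "(\<Sum>i\<in>UNIV. \<Sum>j\<in>UNIV. A $ i $ j * ((c $ i)\<^sup>2 * ?R (\<phi> $ j) (\<psi> $ j))) = X"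
    using 1 A_sym by (subst sum.swap) simp
  have 3: "(\<Sum>i\<in>UNIV. \<Sum>j\<in>UNIV. A $ i $ j * (c $ i * c $ j * ?R (\<phi> $ i) (\<psi> $ j))) = Y"
    by (simp add: Y_def mult.assoc)
  have "(\<Sum>i\<in>UNIV. \<Sum>j\<in>UNIV. A $ i $ j * (c $ i * c $ j * ?R (\<phi> $ j) (\<psi> $ i)))
    = (\<Sum>i\<in>UNIV. \<Sum>j\<in>UNIV. A $ j $ i * (c $ j * c $ i * ?R (\<phi> $ i) (\<psi> $ j)))"
    by (rule sum.swap)
  also have "\<dots> = Y" unfolding 3[symmetric] using A_sym by (simp add: mult_ac)
  finally have 2: "(\<Sum>i\<in>UNIV. \<Sum>j\<in>UNIV. A $ i $ j * (c $ i * c $ j * ?R (\<phi> $ j) (\<psi> $ i))) = Y" .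
  have "(\<Sum>i\<in>UNIV. \<Sum>j\<in>UNIV. A $ i $ j * ((c $ j)\<^sup>2 * ?R (\<phi> $ i) (\<psi> $ i) + 2 * (c $ i * c $ j * ?R (\<phi> $ j) (\<psi> $ i))
      + 2 * (c $ i * c $ j * ?R (\<phi> $ i) (\<psi> $ j)) + (c $ i)\<^sup>2 * ?R (\<phi> $ j) (\<psi> $ j))) =
    (\<Sum>i\<in>UNIV. \<Sum>j\<in>UNIV. A $ i $ j * ((c $ j)\<^sup>2 * ?R (\<phi> $ i) (\<psi> $ i))) +
    2 * (\<Sum>i\<in>UNIV. \<Sum>j\<in>UNIV. A $ i $ j * (c $ i * c $ j * ?R (\<phi> $ j) (\<psi> $ i))) +
    2 * (\<Sum>i\<in>UNIV. \<Sum>j\<in>UNIV. A $ i $ j * (c $ i * c $ j * ?R (\<phi> $ i) (\<psi> $ j))) +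
    (\<Sum>i\<in>UNIV. \<Sum>j\<in>UNIV. A $ i $ j * ((c $ i)\<^sup>2 * ?R (\<phi> $ j) (\<psi> $ j)))"
    unfolding sum_distrib_left sum.distrib[symmetric] by (intro sum.cong refl) (simp add: algebra_simps)
  \<comment> \<open>By symmetry of \<open>A\<close> the two pure sums coincide, and so do the two
    mixed ones, each of which carries a factor 2.\<close>
  also have "\<dots> = 2 * X + 4 * Y" unfolding 1 2 3 4 by simp
  finally have "second_variation (energy \<Omega> lam A) (c \<odot> U) \<phi> \<psi> = (\<Sum>i\<in>UNIV. P (\<phi> $ i) (\<psi> $ i)) - 1/2 * (2 * X + 4 * Y)"
    unfolding second_variation_energy[OF u \<phi> \<psi>] T by simp
  also have "\<dots> = (\<Sum>i\<in>UNIV. P (\<phi> $ i) (\<psi> $ i)) - X - 2 * Y" by (simp add: algebra_simps)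
  also have "(\<Sum>i\<in>UNIV. P (\<phi> $ i) (\<psi> $ i)) - X = (\<Sum>i\<in>UNIV. Q U 1 (\<phi> $ i) (\<psi> $ i))"
    by (simp add: Q_def X_def sum_subtractf)
  finally show ?thesis by (simp add: Y_def)
qed

text \<open>For a solution the quartic double sum also collapses to the sum of squares, so the
  energy depends on \<open>d\<close> only through it.\<close>

lemma energy_times_fun:
  assumes "\<And>i. (\<Sum>j\<in>UNIV. A $ i $ j * (d $ j)\<^sup>2) = 1"
  shows "energy \<Omega> lam A (d \<odot> U) = (\<Sum>i\<in>UNIV. (d $ i)\<^sup>2) * (1/2 * P U U - 1/4 * T4 U U U U)"
proof -
  have u: "(d \<odot> U) $ i \<in> H10 \<Omega>" for i using H10.V_closed(2)[OF U_H(2)] by (simp add: times_fun_def)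
  have 1: "P ((d \<odot> U) $ i) ((d \<odot> U) $ i) = (d $ i)\<^sup>2 * P U U" for i
    using H10_H1[OF U_H(2)] H1.V_closed(2)[OF H10_H1[OF U_H(2)]]
    by (simp add: times_fun_def H1.ip_scale H1.ip_scale_right power2_eq_square)
  have 2: "T4 ((d \<odot> U) $ i) ((d \<odot> U) $ i) ((d \<odot> U) $ j) ((d \<odot> U) $ j) = (d $ i)\<^sup>2 * ((d $ j)\<^sup>2 * T4 U U U U)" for i j
    using U_H(2) H10.V_closed(2)[OF U_H(2)] by (simp add: times_fun_def T4_scale power2_eq_square)
  have "(\<Sum>i\<in>UNIV. \<Sum>j\<in>UNIV. A $ i $ j * ((d $ i)\<^sup>2 * ((d $ j)\<^sup>2 * T4 U U U U))) =
    (\<Sum>i\<in>UNIV. (d $ i)\<^sup>2 * T4 U U U U * (\<Sum>j\<in>UNIV. A $ i $ j * (d $ j)\<^sup>2))"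
    by (simp add: sum_distrib_left mult_ac)
  also have "\<dots> = (\<Sum>i\<in>UNIV. (d $ i)\<^sup>2) * T4 U U U U" by (simp add: assms sum_distrib_right)
  finally show ?thesis
    unfolding energy_eq[OF u] 1 2 sum_distrib_right[symmetric] by (simp only:) (simp add: algebra_simps)
qed

end

section \<open>The conclusions of the theorem\<close>

locale solution_system = index_one_solution \<Omega> lam U for \<Omega> :: "'a::euclidean_space set" and lam U +
  fixes A :: "real^'n^'n" and c :: "real^'n"
  assumes A_sym: "\<forall>i j. A $ i $ j = A $ j $ i" and A_nonneg: "\<forall>i j. A $ i $ j \<ge> 0"
    and c_solution: "positive_vector_solution \<Omega> lam A (c \<odot> U)"
begin

sublocale linearized_system "H_space \<Omega>" "Q U 1" "T4 U U" U A c
  using A_sym A_nonneg c_solution vector_solution_times_fun[of A c] by unfold_locales auto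

abbreviation "I \<equiv> energy \<Omega> lam A"

lemma H_vec_eq: "H_vec \<Omega> = VV"
  by (simp add: H_vec_def VV_def)

lemma second_variation_eq: "\<phi> \<in> VV \<Longrightarrow> \<psi> \<in> VV \<Longrightarrow> second_variation I (c \<odot> U) \<phi> \<psi> = B \<phi> \<psi>"
  unfolding B_def using H_space_H10 by (intro second_variation_at_solution A_sym Ac) (auto simp: VV_def)

lemma linearized_kernel_eq: "linearized_kernel I (H_vec \<Omega>) (c \<odot> U) = kernel"
  unfolding linearized_kernel_def kernel_def H_vec_eq using second_variation_eq by auto

lemma negative_space_iff:
  "negative_space I (H_vec \<Omega>) (c \<odot> U) S \<longleftrightarrow> subspace S \<and> S \<subseteq> VV \<and> (\<forall>x\<in>S. x \<noteq> 0 \<longrightarrow> B x x < 0)"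
  unfolding negative_space_def H_vec_eq using second_variation_eq by (auto simp: subset_iff)

lemma N_eq: "N = scalar_linearized_solutions \<Omega> lam U"
  unfolding N_def scalar_linearized_solutions_def
  using weakly_solves_iff[OF U_H(1), of _ 3] by (auto simp: Q_def)

lemma scalar_nondegenerate_iff: "scalar_nondegenerate \<Omega> lam U \<longleftrightarrow> N = {0}"
  unfolding scalar_nondegenerate_def N_eq[symmetric] using subspace_0[OF N_subspace] by blast

lemma det_iff: "det A \<noteq> 0 \<longleftrightarrow> (\<forall>\<gamma>. A *v \<gamma> = 0 \<longrightarrow> \<gamma> = 0)"
  by (metis invertible_det_nz invertible_left_inverse matrix_left_invertible_ker)

lemma nondegenerate_iff: "nondegenerate \<Omega> lam A (c \<odot> U) \<longleftrightarrow> scalar_nondegenerate \<Omega> lam U \<and> det A \<noteq> 0"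
  unfolding nondegenerate_def linearized_kernel_eq scalar_nondegenerate_iff det_iff by (rule kernel_trivial_iff)

lemma negative_space_W: "negative_space I (H_vec \<Omega>) (c \<odot> U) W"
  unfolding negative_space_iff using W_basis subspace_span unfolding W_def by (metis (no_types, lifting))

lemma morse_index_eq: "morse_index I (H_vec \<Omega>) (c \<odot> U) = enat (num_pos_eigenvalues A)"
proof (rule antisym)
  show "morse_index I (H_vec \<Omega>) (c \<odot> U) \<le> enat (num_pos_eigenvalues A)"
    unfolding morse_index_def
  proof (rule Sup_least)
    fix k assume "k \<in> {enat (card S) |S. finite S \<and> independent S \<and> negative_space I (H_vec \<Omega>) (c \<odot> U) (span S)}"
    then obtain S where "k = enat (card S)" "finite S" "independent S" "negative_space I (H_vec \<Omega>) (c \<odot> U) (span S)" by blast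
    then show "k \<le> enat (num_pos_eigenvalues A)"
      using negative_space_card_le[of S] by (simp add: negative_space_iff)
  qed
  obtain S where S: "finite S" "independent S" "span S = W" "card S = num_pos_eigenvalues A"
    using W_basis by metis
  have "enat (card S) \<le> morse_index I (H_vec \<Omega>) (c \<odot> U)"
    unfolding morse_index_def using S(1,2) negative_space_W[folded S(3)] by (intro Sup_upper) blast
  then show "enat (num_pos_eigenvalues A) \<le> morse_index I (H_vec \<Omega>) (c \<odot> U)" by (simp add: S(4))
qed

lemma dim_W: "dim W = num_pos_eigenvalues A"
proof -
  obtain S where "finite S" "independent S" "span S = W" "card S = num_pos_eigenvalues A"
    using W_basis by metis
  then show ?thesis using dim_span_eq_card_independent by metis
qed

text \<open>A basis of \<open>W\<close> together with one more vector would exceed the bound on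
  independent sets spanning negative spaces.\<close>

lemma maximal_negative_space_W: "maximal_negative_space I (H_vec \<Omega>) (c \<odot> U) W"
  unfolding maximal_negative_space_def
proof (intro conjI allI impI negative_space_W)
  fix W' assume W': "negative_space I (H_vec \<Omega>) (c \<odot> U) W' \<and> W \<subseteq> W'"
  obtain S where S: "finite S" "independent S" "span S = W" "card S = num_pos_eigenvalues A"
    using W_basis by metis
  have "x \<in> W" if x: "x \<in> W'" for x
  proof (rule ccontr)
    assume xW: "x \<notin> W"
    have "S \<subseteq> W'" using W' span_superset[of S] unfolding S(3) by blast
    then have sub: "span (insert x S) \<subseteq> W'"
      using W' x by (intro span_minimal) (auto simp: negative_space_iff)
    have "card (insert x S) \<le> num_pos_eigenvalues A"
    proof (rule negative_space_card_le)
      show "finite (insert x S)" using S(1) by simp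
      show "independent (insert x S)" using S(2,3) xW by (auto simp: independent_insert)
    qed (use sub W' in \<open>auto simp: negative_space_iff\<close>)
    moreover have "x \<notin> S" using xW span_superset[of S] unfolding S(3) by blast
    ultimately show False using S(1,4) by simp
  qed
  then show "W' = W" using W' by blast
qed

lemma kernel_nondegenerate:
  assumes "scalar_nondegenerate \<Omega> lam U"
  shows "kernel = {(\<gamma> \<oslash> c) \<odot> U | \<gamma>. A *v \<gamma> = 0}"
  using kernel_subset_if_N_trivial kernel_of_A assms unfolding scalar_nondegenerate_iff by blast

lemma kernel_positive:
  assumes "det A \<noteq> 0" "\<forall>i j. A $ i $ j > 0"
  shows "kernel = span {c \<odot> \<psi> | \<psi>. \<psi> \<in> N}"
proof -
  have "subspace ((\<lambda>\<psi>. c \<odot> \<psi>) ` N)"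
    by (rule linear_subspace_image[OF linear_times_fun N_subspace])
  moreover have "{c \<odot> \<psi> | \<psi>. \<psi> \<in> N} = (\<lambda>\<psi>. c \<odot> \<psi>) ` N" by auto
  ultimately have "span {c \<odot> \<psi> | \<psi>. \<psi> \<in> N} = {c \<odot> \<psi> | \<psi>. \<psi> \<in> N}" by (simp only: span_eq_iff)
  moreover have "kernel = {c \<odot> \<psi> | \<psi>. \<psi> \<in> N}"
    using kernel_subset_if_A_positive[OF _ assms(2)] kernel_of_N assms(1) unfolding det_iff by blast
  ultimately show ?thesis by (simp only:)
qed

definition L :: "(real^'n) set" where
  "L = {(\<chi> i. sqrt ((c $ i)\<^sup>2 + \<gamma> $ i)) | \<gamma>. A *v \<gamma> = 0 \<and> (\<forall>i. (c $ i)\<^sup>2 + \<gamma> $ i > 0)}"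

lemma solution_amplitudes_iff:
  "d \<in> solution_amplitudes \<Omega> lam A U \<longleftrightarrow> (\<forall>i. d $ i > 0) \<and> (\<forall>i. (\<Sum>j\<in>UNIV. A $ i $ j * (d $ j)\<^sup>2) = 1)"
  by (simp add: solution_amplitudes_def vector_solution_times_fun)

text \<open>In the squares of the amplitudes the condition is an inhomogeneous linear equation: a
  particular solution plus the kernel of \<open>A\<close>.\<close>

lemma solution_amplitudes_eq: "solution_amplitudes \<Omega> lam A U = L"
proof
  let ?sq = "\<lambda>d. \<chi> j. (d $ j)\<^sup>2"
  show "solution_amplitudes \<Omega> lam A U \<subseteq> L"
  proof
    fix d assume "d \<in> solution_amplitudes \<Omega> lam A U"
    then have d: "\<And>i. d $ i > 0" "\<And>i. (\<Sum>j\<in>UNIV. A $ i $ j * (d $ j)\<^sup>2) = 1"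
      by (auto simp: solution_amplitudes_iff)
    have "A *v (?sq d - ?sq c) = 0"
      using d(2) Ac by (simp add: vec_eq_iff matrix_vector_mult_diff_distrib hadamard_square_sum)
    moreover have "d = (\<chi> i. sqrt ((c $ i)\<^sup>2 + (?sq d - ?sq c) $ i))"
      using d(1)[THEN less_imp_le] by (simp add: vec_eq_iff)
    moreover have "\<forall>i. (c $ i)\<^sup>2 + (?sq d - ?sq c) $ i > 0" using d(1) by (simp add: less_imp_neq[symmetric])
    ultimately show "d \<in> L" unfolding L_def by blast
  qed
  show "L \<subseteq> solution_amplitudes \<Omega> lam A U"
  proof
    fix d assume "d \<in> L"
    then obtain \<gamma> where \<gamma>: "A *v \<gamma> = 0" "\<And>i. (c $ i)\<^sup>2 + \<gamma> $ i > 0" "d = (\<chi> i. sqrt ((c $ i)\<^sup>2 + \<gamma> $ i))"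
      unfolding L_def by blast
    have "(d $ j)\<^sup>2 = (c $ j)\<^sup>2 + \<gamma> $ j" for j using \<gamma>(2)[of j] by (simp add: \<gamma>(3))
    then have "(\<Sum>j\<in>UNIV. A $ i $ j * (d $ j)\<^sup>2) = (\<Sum>j\<in>UNIV. A $ i $ j * (c $ j)\<^sup>2) + (A *v \<gamma>) $ i" for i
      by (simp add: matrix_vector_mult_def distrib_left sum.distrib)
    then show "d \<in> solution_amplitudes \<Omega> lam A U"
      using \<gamma> Ac by (simp add: solution_amplitudes_iff)
  qed
qed

text \<open>Pairing \<open>A d\<^sup>2 = 1\<close> with \<open>c\<^sup>2\<close> and \<open>A c\<^sup>2 = 1\<close> with \<open>d\<^sup>2\<close>.\<close>

lemma sum_squares_eq:
  assumes "\<And>i. (\<Sum>j\<in>UNIV. A $ i $ j * (d $ j)\<^sup>2) = 1"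
  shows "(\<Sum>i\<in>UNIV. (d $ i)\<^sup>2) = (\<Sum>i\<in>UNIV. (c $ i)\<^sup>2)"
proof -
  have "(\<Sum>i\<in>UNIV. (d $ i)\<^sup>2) = (\<Sum>i\<in>UNIV. \<Sum>j\<in>UNIV. (d $ i)\<^sup>2 * (A $ i $ j * (c $ j)\<^sup>2))"
    unfolding sum_distrib_left[symmetric] Ac by simp
  also have "\<dots> = (\<Sum>j\<in>UNIV. \<Sum>i\<in>UNIV. (c $ j)\<^sup>2 * (A $ j $ i * (d $ i)\<^sup>2))"
    using A_sym by (subst sum.swap) (simp add: mult_ac)
  also have "\<dots> = (\<Sum>j\<in>UNIV. (c $ j)\<^sup>2)"
    unfolding sum_distrib_left[symmetric] assms by simp
  finally show ?thesis .
qed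

lemma amplitudes_properties:
  "connected L" "smooth_submanifold (dim {\<gamma>. A *v \<gamma> = 0}) L" "L \<subseteq> S_plus (\<Sum>i\<in>UNIV. (c $ i)\<^sup>2)"
  "d \<in> L \<Longrightarrow> I (c \<odot> U) = I (d \<odot> U)" "bdry L \<subseteq> bdry (S_plus (\<Sum>i\<in>UNIV. (c $ i)\<^sup>2))"
proof -
  have K: "subspace {\<gamma>. A *v \<gamma> = 0}"
    by (auto simp: subspace_def matrix_vector_right_distrib matrix_vector_mult_scaleR)
  show "connected L" "smooth_submanifold (dim {\<gamma>. A *v \<gamma> = 0}) L"
    using connected_squares[OF K, of "\<chi> i. (c $ i)\<^sup>2"] smooth_submanifold_squares[OF K, of "\<chi> i. (c $ i)\<^sup>2"]
    by (simp_all add: L_def)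
  let ?S = "S_plus (\<Sum>i\<in>UNIV. (c $ i)\<^sup>2)"
  have iff: "d \<in> L \<longleftrightarrow> (\<forall>i. d $ i > 0) \<and> (\<forall>i. (\<Sum>j\<in>UNIV. A $ i $ j * (d $ j)\<^sup>2) = 1)" for d
    using solution_amplitudes_eq solution_amplitudes_iff by blast
  show LS: "L \<subseteq> ?S" using sum_squares_eq by (auto simp: iff S_plus_def)
  show "I (c \<odot> U) = I (d \<odot> U)" if "d \<in> L"
    using energy_times_fun[OF Ac] energy_times_fun[of A d] sum_squares_eq[of d] that by (simp add: iff)
  show "bdry L \<subseteq> bdry ?S"
  proof
    fix x assume x: "x \<in> bdry L"
    then have xc: "x \<in> closure L" "x \<notin> L" by (auto simp: bdry_def)
    \<comment> \<open>The equations are closed conditions, so a limit point outside \<open>L\<close>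
      can fail only positivity and hence also lies outside the open piece of the sphere.\<close>
    have "closure L \<subseteq> {x. \<forall>i. (\<Sum>j\<in>UNIV. A $ i $ j * (x $ j)\<^sup>2) = 1}"
    proof (rule closure_minimal)
      show "L \<subseteq> {x. \<forall>i. (\<Sum>j\<in>UNIV. A $ i $ j * (x $ j)\<^sup>2) = 1}" by (auto simp: iff)
      show "closed {x :: real^'n. \<forall>i. (\<Sum>j\<in>UNIV. A $ i $ j * (x $ j)\<^sup>2) = 1}"
        by (intro closed_Collect_all closed_Collect_eq continuous_intros)
    qed
    then have "x \<notin> ?S" using xc by (auto simp: iff S_plus_def)
    moreover have "x \<in> closure ?S" using xc(1) closure_mono[OF LS] by blast
    ultimately show "x \<in> bdry ?S" by (simp add: bdry_def)
  qed
qed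

end

theorem theorem2p3:
  fixes \<Omega> :: "'a::euclidean_space set"
    and lam :: real
    and U :: "'a ae_fun"
    and A :: "real^'n^'n"
    and c :: "real^'n"
  assumes dim_le: "DIM('a) \<le> 3"
    and dom: "domain \<Omega>"
    and lam_pos: "lam > 0"
    and U_least: "least_energy_positive_solution \<Omega> lam U"
    and U_index: "morse_index (scalar_energy \<Omega> lam) (H_space \<Omega>) U = 1"
    and A_sym: "\<forall>i j. A $ i $ j = A $ j $ i"
    and A_nonneg: "\<forall>i j. A $ i $ j \<ge> 0"
    and sol: "positive_vector_solution \<Omega> lam A (c \<odot> U)"
  shows
    "(morse_index (energy \<Omega> lam A) (H_vec \<Omega>) (c \<odot> U) = enat (num_pos_eigenvalues A) \<and>
      (let W = span {(\<gamma> \<oslash> c) \<odot> U | \<gamma>. \<exists>\<mu>>0. A *v \<gamma> = \<mu> *\<^sub>R \<gamma>} in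
         maximal_negative_space (energy \<Omega> lam A) (H_vec \<Omega>) (c \<odot> U) W \<and>
         enat (dim W) = morse_index (energy \<Omega> lam A) (H_vec \<Omega>) (c \<odot> U)))
     \<and>
     (scalar_nondegenerate \<Omega> lam U \<and> det A = 0 \<longrightarrow>
      linearized_kernel (energy \<Omega> lam A) (H_vec \<Omega>) (c \<odot> U)
        = {(\<gamma> \<oslash> c) \<odot> U | \<gamma>. A *v \<gamma> = 0} \<and>
      (let K = {\<gamma>. A *v \<gamma> = 0};
           L = solution_amplitudes \<Omega> lam A U;
           S = S_plus (\<Sum>i\<in>UNIV. (c $ i)\<^sup>2) in
         L = {(\<chi> i. sqrt ((c $ i)\<^sup>2 + \<gamma> $ i)) | \<gamma>. \<gamma> \<in> K \<and> (\<forall>i. (c $ i)\<^sup>2 + \<gamma> $ i > 0)} \<and>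
         connected L \<and> smooth_submanifold (dim K) L \<and> L \<subseteq> S \<and>
         (\<forall>d\<in>L. energy \<Omega> lam A (c \<odot> U) = energy \<Omega> lam A (d \<odot> U)) \<and>
         bdry L \<subseteq> bdry S))
     \<and>
     (\<not> scalar_nondegenerate \<Omega> lam U \<and> det A \<noteq> 0 \<longrightarrow>
      {c \<odot> \<psi> | \<psi>. \<psi> \<in> scalar_linearized_solutions \<Omega> lam U}
        \<subseteq> linearized_kernel (energy \<Omega> lam A) (H_vec \<Omega>) (c \<odot> U))
     \<and>
     (\<not> scalar_nondegenerate \<Omega> lam U \<and> det A \<noteq> 0 \<and> (\<forall>i j. A $ i $ j > 0) \<longrightarrow>
      linearized_kernel (energy \<Omega> lam A) (H_vec \<Omega>) (c \<odot> U)
        = span {c \<odot> \<psi> | \<psi>. \<psi> \<in> scalar_linearized_solutions \<Omega> lam U})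
     \<and>
     (nondegenerate \<Omega> lam A (c \<odot> U) \<longleftrightarrow> scalar_nondegenerate \<Omega> lam U \<and> det A \<noteq> 0)"
proof -
  interpret solution_system \<Omega> lam U A c
    using assms by unfold_locales (auto simp: domain_def least_energy_positive_solution_def)
  show ?thesis
    unfolding Let_def W_def[symmetric] linearized_kernel_eq N_eq[symmetric] mem_Collect_eq
      solution_amplitudes_eq
    using morse_index_eq maximal_negative_space_W dim_W kernel_nondegenerate L_def amplitudes_properties
      kernel_of_N kernel_positive nondegenerate_iff
    by auto
qed

end
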